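(* Let $-\infty<a<b<\infty$ and let $X=(X_t:t\in\mathbb R)$ be a real-valued centered Gaussian process with continuous sample paths and covariance function $R(s,t)=\mathrm E(X_sX_t)$. Assume that at least one of the following holds. (a) (i) There are real numbers $(r_{mn}:m,n\ge 0)$ with $R(s,t)=\sum_{m=0}^\infty\sum_{n=0}^\infty r_{mn}s^mt^n$ for all $s,t\in\mathbb R$; (ii) for every compact interval $[c,d]$ and every Borel probability measure $\nu$ on $[c,d]$, $\int_c^d\int_c^dR(s,t)\,\nu(ds)\,\nu(dt)>0$; (iii) the sample paths of $X$ are infinitely differentiable, and for any finitely many distinct pairs $(s_1,n_1),\ldots,(s_p,n_p)\in\mathbb R\times\{0,1,2,\ldots\}$ the covariance matrix of $(X^{(n_1)}_{s_1},\ldots,X^{(n_p)}_{s_p})$ is non-singular; (iv) $\limsup_{t\to\infty}R(s,t)\le 0$ for every $s\in[a,b]$. (b) $X$ is stationary, and its spectral measure $F_X$ satisfies $\int_{-\infty}^\infty e^{tx}F_X(dx)<\infty$ for all $t\in\mathbb R$, and the support of $F_X$ has at least one accumulation point. Let $S$, $\mu$, $Z$ and $W$ be as defined in the context, and assume also that $\mu^{(2)}(t)>0$ for all $t\in S\cap(a,b)$. Then, as $u\to\infty$, $$\mathrm P\left((X_t-u\mu(t):a\le t\le b)\in\cdot\,\Big|\,\min_{t\in[a,b]}X_t>u\right)\Rightarrow Q_W(\cdot)$$ weakly on $C[a,b]$, where $Q_W$ is the probability measure on $C[a,b]$ defined by $$Q_W(B)=\frac{1}{\mathrm E W}\,\mathrm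 E\left[\mathbf 1\big((Z_t:a\le t\le b)\in B\big)\,W\right],\qquad B\subset C[a,b]\text{ Borel}.$$
   Context: Notation: $f^{(n)}$ is the $n$-th derivative, $f^{(0)}=f$. $C[a,b]$ carries the supremum norm. The spectral measure of a stationary process $X$ is the finite symmetric Borel measure $F_X$ on $\mathbb R$ with $R(s,t)=\int_{-\infty}^\infty e^{i(t-s)x}F_X(dx)$. In case (b), a version of $X$ with infinitely differentiable sample paths is used. $M_1[a,b]$ is the set of Borel probability measures on $[a,b]$. Under (a) or (b) the problem $\min_{\nu\in M_1[a,b]}\int_a^b\int_a^bR(s,t)\,\nu(ds)\,\nu(dt)$ has a unique minimizer $\nu_*$, and its support $S$ is finite. Write $S=\{t_1,\ldots,t_k\}$ with $a\le t_1<\cdots<t_k\le b$. $\Sigma$ is the (invertible) covariance matrix of $(X_{t_1},\ldots,X_{t_k})$, and $\theta=(\theta_1,\ldots,\theta_k)=\Sigma^{-1}\mathbf 1$, where $\mathbf 1$ is the vector of ones (all $\theta_j$ are positive). For $t\in\mathbb R$, $\mu(t)=\mathrm E(X_t\mid X_s=1\text{ for all }s\in S)$; that is, if $\mathrm E(X_t\mid X_{t_1},\ldots,X_{t_k})=\sum_{j=1}^k a_j(t)X_{t_j}$ then $\mu(t)=\sum_{j=1}^k a_j(t)$. Set $Y_t=\mathrm E(X_t\mid X_s,\,s\in S)$ and $Z_t=X_t-Y_t$ (smooth centered Gaussian processes). The set $E=\{t\in[a,b]:\mu(t)=1\}$ is a finite superset of $S$; write $E\setminus S=\{t_{k+1},\ldots,t_l\}$.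 Define $$W_{(a,b)}=\exp\Big\{-\tfrac12\sum_{1\le j\le k,\ t_j\in(a,b)}\frac{\theta_j}{\mu^{(2)}(t_j)}\big(Z^{(1)}_{t_j}\big)^2\Big\}.$$ If $t_1=a$ and $\mu^{(1)}(t_1)=0$, let $$W_a=\mathbf 1(Z^{(1)}_{t_1}>0)+\exp\Big\{-\frac{\theta_1}{2\mu^{(2)}(t_1)}\big(Z^{(1)}_{t_1}\big)^2\Big\}\mathbf 1(Z^{(1)}_{t_1}<0),$$ and $W_a=1$ otherwise. If $t_k=b$ and $\mu^{(1)}(t_k)=0$, let $$W_b=\mathbf 1(Z^{(1)}_{t_k}<0)+\exp\Big\{-\frac{\theta_k}{2\mu^{(2)}(t_k)}\big(Z^{(1)}_{t_k}\big)^2\Big\}\mathbf 1(Z^{(1)}_{t_k}>0),$$ and $W_b=1$ otherwise. The conventions are that a positive number divided by zero is $+\infty$ and $e^{-\infty}=0$. Finally $$W=W_{(a,b)}W_aW_b\prod_{j=k+1}^l\mathbf 1(Z_{t_j}>0).$$ Under the assumption $\mu^{(2)}(t)>0$ for all $t\in S\cap(a,b)$ one has $\mathrm E(W)>0$. *)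

theory Defs
  imports
    "HOL-Analysis.Urysohn"
    "HOL-Probability.Probability"
    "Jordan_Normal_Form.Gauss_Jordan_Elimination"
begin

section \<open>Processes on the real line\<close>

definition mean_zero_normal :: "real measure \<Rightarrow> bool" where
  "mean_zero_normal N \<longleftrightarrow>
     N = return borel 0 \<or> (\<exists>\<sigma>>0. N = density lborel (\<lambda>x. ennreal (normal_density 0 \<sigma> x)))"

definition centered_gaussian_process :: "'a measure \<Rightarrow> (real \<Rightarrow> 'a \<Rightarrow> real) \<Rightarrow> bool" where
  "centered_gaussian_process M X \<longleftrightarrow>
     (\<forall>t. X t \<in> borel_measurable M) \<and>
     (\<forall>I c. finite I \<longrightarrow> mean_zero_normal (distr M borel (\<lambda>\<omega>. \<Sum>t\<in>I. c t * X t \<omega>)))"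

definition covfun :: "'a measure \<Rightarrow> (real \<Rightarrow> 'a \<Rightarrow> real) \<Rightarrow> real \<Rightarrow> real \<Rightarrow> real" where
  "covfun M X s t = (\<integral>\<omega>. X s \<omega> * X t \<omega> \<partial>M)"

definition covariance :: "'a measure \<Rightarrow> ('a \<Rightarrow> real) \<Rightarrow> ('a \<Rightarrow> real) \<Rightarrow> real" where
  "covariance M U V =
     (\<integral>\<omega>. (U \<omega> - (\<integral>\<omega>'. U \<omega>' \<partial>M)) * (V \<omega> - (\<integral>\<omega>'. V \<omega>' \<partial>M)) \<partial>M)"

definition path_deriv :: "(real \<Rightarrow> 'a \<Rightarrow> real) \<Rightarrow> nat \<Rightarrow> real \<Rightarrow> 'a \<Rightarrow> real" where
  "path_deriv X n t \<omega> = (deriv ^^ n) (\<lambda>s. X s \<omega>) t"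

definition infinitely_differentiable :: "(real \<Rightarrow> real) \<Rightarrow> bool" where
  "infinitely_differentiable f \<longleftrightarrow> (\<forall>n x. (deriv ^^ n) f field_differentiable at x)"

definition stationary_process :: "'a measure \<Rightarrow> (real \<Rightarrow> 'a \<Rightarrow> real) \<Rightarrow> bool" where
  "stationary_process M X \<longleftrightarrow>
     (\<forall>I h. finite I \<longrightarrow>
        distr M (Pi\<^sub>M I (\<lambda>_. borel)) (\<lambda>\<omega>. \<lambda>t\<in>I. X (t + h) \<omega>) =
        distr M (Pi\<^sub>M I (\<lambda>_. borel)) (\<lambda>\<omega>. \<lambda>t\<in>I. X t \<omega>))"

text \<open>\<^const>\<open>char\<close> \<open>F u\<close> is the integral of \<open>exp (i u x)\<close> with respect to \<open>F\<close>.\<close>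

definition spectral_measure :: "'a measure \<Rightarrow> (real \<Rightarrow> 'a \<Rightarrow> real) \<Rightarrow> real measure \<Rightarrow> bool" where
  "spectral_measure M X F \<longleftrightarrow>
     finite_measure F \<and> sets F = sets borel \<and> distr F borel uminus = F \<and>
     (\<forall>s t. complex_of_real (covfun M X s t) = char F (t - s))"

definition measure_support :: "real measure \<Rightarrow> real set" where
  "measure_support \<nu> =
     {x \<in> space \<nu>. \<forall>U. open U \<longrightarrow> x \<in> U \<longrightarrow> emeasure \<nu> (U \<inter> space \<nu>) > 0}"

text \<open>The Borel probability measures on \<open>A\<close>, as measures whose underlying space is \<open>A\<close>.\<close>

definition borel_prob_measures :: "real set \<Rightarrow> real measure set" where
  "borel_prob_measures A = {\<nu>. prob_space \<nu> \<and> sets \<nu> = sets (restrict_space borel A)}"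

definition energy :: "(real \<Rightarrow> real \<Rightarrow> real) \<Rightarrow> real measure \<Rightarrow> real" where
  "energy R \<nu> = (\<integral>s. (\<integral>t. R s t \<partial>\<nu>) \<partial>\<nu>)"

section \<open>The two alternative assumptions\<close>

text \<open>The double power series is the iterated series: the inner sums over \<open>n\<close> converge, and their
  values are summed over \<open>m\<close>.\<close>

definition assumption_a :: "'a measure \<Rightarrow> (real \<Rightarrow> 'a \<Rightarrow> real) \<Rightarrow> real \<Rightarrow> real \<Rightarrow> bool" where
  "assumption_a M X a b \<longleftrightarrow>
     (\<exists>r :: nat \<Rightarrow> nat \<Rightarrow> real. \<forall>s t.
        (\<forall>m. summable (\<lambda>n. r m n * s ^ m * t ^ n)) \<and>
        (\<lambda>m. \<Sum>n. r m n * s ^ m * t ^ n) sums covfun M X s t) \<and>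
     (\<forall>c d \<nu>. c \<le> d \<longrightarrow> \<nu> \<in> borel_prob_measures {c..d} \<longrightarrow> energy (covfun M X) \<nu> > 0) \<and>
     (\<forall>\<omega>\<in>space M. infinitely_differentiable (\<lambda>t. X t \<omega>)) \<and>
     (\<forall>ps :: (real \<times> nat) list. distinct ps \<longrightarrow>
        invertible_mat (mat (length ps) (length ps) (\<lambda>(i, j).
          covariance M (path_deriv X (snd (ps ! i)) (fst (ps ! i)))
                       (path_deriv X (snd (ps ! j)) (fst (ps ! j)))))) \<and>
     (\<forall>s\<in>{a..b}. Limsup at_top (\<lambda>t. ereal (covfun M X s t)) \<le> 0)"

definition assumption_b :: "'a measure \<Rightarrow> (real \<Rightarrow> 'a \<Rightarrow> real) \<Rightarrow> bool" where
  "assumption_b M X \<longleftrightarrow>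
     stationary_process M X \<and>
     (\<exists>F. spectral_measure M X F \<and>
          (\<forall>t. integrable F (\<lambda>x. exp (t * x))) \<and>
          (\<exists>x. x islimpt measure_support F))"

section \<open>Conditioning on the process being one on a finite set\<close>

text \<open>In this section \<open>S\<close> is a finite set of times at which the covariance matrix is invertible.\<close>

definition generated_sigma :: "'a measure \<Rightarrow> (real \<Rightarrow> 'a \<Rightarrow> real) \<Rightarrow> real set \<Rightarrow> 'a measure" where
  "generated_sigma M X S =
     vimage_algebra (space M) (\<lambda>\<omega>. \<lambda>s\<in>S. X s \<omega>) (Pi\<^sub>M S (\<lambda>_. borel))"

text \<open>The coefficients of \<open>E(X t | X s, s \<in> S)\<close> as a linear combination of the \<open>X s\<close>.
  On \<open>S\<close> they are unique because the covariance matrix is invertible; the values outside \<open>S\<close>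
  are never used.\<close>

definition cond_coeff :: "'a measure \<Rightarrow> (real \<Rightarrow> 'a \<Rightarrow> real) \<Rightarrow> real set \<Rightarrow> real \<Rightarrow> real \<Rightarrow> real" where
  "cond_coeff M X S t =
     (SOME c. AE \<omega> in M.
        real_cond_exp M (generated_sigma M X S) (X t) \<omega> = (\<Sum>s\<in>S. c s * X s \<omega>))"

definition cond_mean :: "'a measure \<Rightarrow> (real \<Rightarrow> 'a \<Rightarrow> real) \<Rightarrow> real set \<Rightarrow> real \<Rightarrow> real" where
  "cond_mean M X S t = (\<Sum>s\<in>S. cond_coeff M X S t s)"

text \<open>The linear combination is the version of the conditional expectation used throughout; unlike
  an arbitrary version it is as smooth in \<open>t\<close> as \<open>X\<close>.\<close>

definition cond_proc :: "'a measure \<Rightarrow> (real \<Rightarrow> 'a \<Rightarrow> real) \<Rightarrow> real set \<Rightarrow> real \<Rightarrow> 'a \<Rightarrow> real" where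
  "cond_proc M X S t \<omega> = (\<Sum>s\<in>S. cond_coeff M X S t s * X s \<omega>)"

definition resid :: "'a measure \<Rightarrow> (real \<Rightarrow> 'a \<Rightarrow> real) \<Rightarrow> real set \<Rightarrow> real \<Rightarrow> 'a \<Rightarrow> real" where
  "resid M X S t \<omega> = X t \<omega> - cond_proc M X S t \<omega>"

text \<open>The points of \<open>S\<close> in increasing order are \<open>pts S ! 0, \<dots>, pts S ! (card S - 1)\<close>, and
  \<open>theta M X S\<close> is indexed in the same way.\<close>

abbreviation pts :: "real set \<Rightarrow> real list" where
  "pts S \<equiv> sorted_list_of_set S"

definition cov_mat :: "'a measure \<Rightarrow> (real \<Rightarrow> 'a \<Rightarrow> real) \<Rightarrow> real set \<Rightarrow> real mat" where
  "cov_mat M X S = mat (card S) (card S) (\<lambda>(i, j). covfun M X (pts S ! i) (pts S ! j))"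

definition theta :: "'a measure \<Rightarrow> (real \<Rightarrow> 'a \<Rightarrow> real) \<Rightarrow> real set \<Rightarrow> nat \<Rightarrow> real" where
  "theta M X S = vec_index (the (mat_inverse (cov_mat M X S)) *\<^sub>v vec (card S) (\<lambda>_. 1))"

section \<open>The weight\<close>

text \<open>\<open>exp (- q * z\<^sup>2 / (2 * d))\<close> for \<open>q > 0\<close>, where \<open>q / 0\<close> is infinite and \<open>exp\<close> vanishes at
  minus infinity; it is only used with \<open>z \<noteq> 0\<close>.\<close>

definition exp_ratio :: "real \<Rightarrow> real \<Rightarrow> real \<Rightarrow> real" where
  "exp_ratio q d z = (if d = 0 then 0 else exp (- (q / (2 * d)) * z\<^sup>2))"

text \<open>The derivatives of \<open>resid\<close> are taken along sample paths. They exist almost surely also in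
  case (b) for \<open>X\<close> merely continuous, since a continuous process with an infinitely differentiable
  version agrees with it on all of the real line outside a null set.\<close>

definition W_interior ::
    "'a measure \<Rightarrow> (real \<Rightarrow> 'a \<Rightarrow> real) \<Rightarrow> real set \<Rightarrow> real \<Rightarrow> real \<Rightarrow> 'a \<Rightarrow> real" where
  "W_interior M X S a b \<omega> =
     exp (- (1/2) * (\<Sum>j | j < card S \<and> pts S ! j \<in> {a<..<b}.
        theta M X S j / (deriv ^^ 2) (cond_mean M X S) (pts S ! j) *
        (path_deriv (resid M X S) 1 (pts S ! j) \<omega>)\<^sup>2))"

definition W_left ::
    "'a measure \<Rightarrow> (real \<Rightarrow> 'a \<Rightarrow> real) \<Rightarrow> real set \<Rightarrow> real \<Rightarrow> 'a \<Rightarrow> real" where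
  "W_left M X S a \<omega> =
     (let t = pts S ! 0; z = path_deriv (resid M X S) 1 t \<omega> in
      if t = a \<and> deriv (cond_mean M X S) t = 0
      then of_bool (z > 0) +
           exp_ratio (theta M X S 0) ((deriv ^^ 2) (cond_mean M X S) t) z * of_bool (z < 0)
      else 1)"

definition W_right ::
    "'a measure \<Rightarrow> (real \<Rightarrow> 'a \<Rightarrow> real) \<Rightarrow> real set \<Rightarrow> real \<Rightarrow> 'a \<Rightarrow> real" where
  "W_right M X S b \<omega> =
     (let k = card S - 1; t = pts S ! k; z = path_deriv (resid M X S) 1 t \<omega> in
      if t = b \<and> deriv (cond_mean M X S) t = 0
      then of_bool (z < 0) +
           exp_ratio (theta M X S k) ((deriv ^^ 2) (cond_mean M X S) t) z * of_bool (z > 0)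
      else 1)"

definition W ::
    "'a measure \<Rightarrow> (real \<Rightarrow> 'a \<Rightarrow> real) \<Rightarrow> real set \<Rightarrow> real \<Rightarrow> real \<Rightarrow> 'a \<Rightarrow> real" where
  "W M X S a b \<omega> =
     W_interior M X S a b \<omega> * W_left M X S a \<omega> * W_right M X S b \<omega> *
     (\<Prod>t\<in>{t \<in> {a..b}. cond_mean M X S t = 1} - S. of_bool (resid M X S t \<omega> > 0))"

section \<open>Weak convergence on the space of continuous functions\<close>

text \<open>\<open>C_space a b\<close> consists of the continuous functions on \<open>{a..b}\<close>, extended by \<^const>\<open>undefined\<close>,
  with the supremum metric.\<close>

definition C_space :: "real \<Rightarrow> real \<Rightarrow> (real \<Rightarrow> real) metric" where
  "C_space a b = cfunspace (top_of_set {a..b}) euclidean_metric"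

definition metric_borel :: "'b metric \<Rightarrow> 'b measure" where
  "metric_borel m = sigma (mspace m) {U. openin (mtopology_of m) U}"

definition weakly_converges :: "'b metric \<Rightarrow> ('i \<Rightarrow> 'b measure) \<Rightarrow> 'b measure \<Rightarrow> 'i filter \<Rightarrow> bool" where
  "weakly_converges m P Q G \<longleftrightarrow>
     prob_space Q \<and> sets Q = sets (metric_borel m) \<and>
     (\<forall>\<^sub>F u in G. prob_space (P u) \<and> sets (P u) = sets (metric_borel m)) \<and>
     (\<forall>f :: 'b \<Rightarrow> real. continuous_map (mtopology_of m) euclideanreal f \<longrightarrow>
          bounded (f ` mspace m) \<longrightarrow>
          ((\<lambda>u. \<integral>x. f x \<partial>P u) \<longlongrightarrow> (\<integral>x. f x \<partial>Q)) G)"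

text \<open>The law of \<open>X t - u \<mu> t\<close>, \<open>a \<le> t \<le> b\<close>, given that the minimum of \<open>X\<close> on \<open>{a..b}\<close> exceeds
  \<open>u\<close>; the minimum is the infimum of a continuous function on a compact set.\<close>

definition cond_law ::
    "'a measure \<Rightarrow> (real \<Rightarrow> 'a \<Rightarrow> real) \<Rightarrow> (real \<Rightarrow> real) \<Rightarrow> real \<Rightarrow> real \<Rightarrow> real \<Rightarrow> (real \<Rightarrow> real) measure" where
  "cond_law M X \<mu> a b u =
     distr (uniform_measure M {\<omega> \<in> space M. (INF t\<in>{a..b}. X t \<omega>) > u})
       (metric_borel (C_space a b)) (\<lambda>\<omega>. \<lambda>t\<in>{a..b}. X t \<omega> - u * \<mu> t)"

definition tilted_law ::
    "'a measure \<Rightarrow> (real \<Rightarrow> 'a \<Rightarrow> real) \<Rightarrow> ('a \<Rightarrow> real) \<Rightarrow> real \<Rightarrow> real \<Rightarrow> (real \<Rightarrow> real) measure" where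
  "tilted_law M Z V a b =
     distr (density M (\<lambda>\<omega>. ennreal (V \<omega> / (\<integral>\<omega>'. V \<omega>' \<partial>M))))
       (metric_borel (C_space a b)) (\<lambda>\<omega>. \<lambda>t\<in>{a..b}. Z t \<omega>)"

end

theory Submission
  imports
    Defs
    "HOL-Complex_Analysis.Complex_Analysis"
    "HOL-Real_Asymp.Real_Asymp"
    "Jordan_Normal_Form.Determinant"
begin

text \<open>
  Let \<open>\<Theta>\<close> be the sum of the \<open>\<theta> s * X s\<close> over \<open>s \<in> S\<close>. Minimality of the energy says that
  \<open>\<mu> t = E (X t * \<Theta>)\<close> is at least \<open>1\<close> on \<open>{a..b}\<close> and equal to \<open>1\<close> on \<open>S\<close>. The Cameron--Martin shift by
  \<open>u * \<mu>\<close> turns \<open>X - u * \<mu>\<close> into \<open>X\<close> and the excursion event into \<open>X t + u * \<mu> t > u\<close>, at the price of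
  a factor \<open>exp (- u * \<Theta>)\<close>. Conditionally on \<open>X s = w s / u\<close> for \<open>s \<in> S\<close>, this factor is the exponential
  of \<open>- (\<Sum>s\<in>S. \<theta> s * w s)\<close>, and the path is \<open>Z\<close> plus a smooth function of size \<open>1 / u\<close>. For large \<open>u\<close>
  the event only depends on the points where \<open>\<mu> = 1\<close>: outside \<open>S\<close> it requires \<open>Z t > 0\<close>, and at an
  interior point \<open>s\<close> of \<open>S\<close> it requires \<open>\<mu>'' s / 2 * h\<^sup>2 + Z' s * h + w s\<close> to be positive for all \<open>h\<close>, that
  is, \<open>w s > (Z' s)\<^sup>2 / (2 * \<mu>'' s)\<close>. Integrating the exponential over these \<open>w\<close> produces \<open>W\<close> up to a
  constant factor.

  Finiteness of the set where \<open>\<mu> = 1\<close> holds because the covariance function is entire in each argument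
  and \<open>\<mu>\<close> is not constant. In case (b) the sample paths are differentiable at a given point almost surely
  because the second differences of \<open>X\<close> have variance of fourth order in the step.
\<close>

section \<open>Gaussian families\<close>

text \<open>Joint laws are compared on the product sigma-algebra over all real times, where
  continuity of a path or the size of its minimum is not an event. Hence each continuous functional
  of the path, and the minimum itself, is first replaced by a measurable function of the coordinates
  that agrees with it at continuous paths. All Gaussian identities come from a single one, the
  splitting of one coordinate from its independent residual: used once it gives the Cameron--Martin
  shift, iterated it gives the disintegration. The limit is taken twice under an integral, first
  over the values \<open>w\<close> and then over the residual path. The domination comes from the
  points of \<open>S\<close> themselves: staying above the level there forces every
  \<open>w s\<close> to be positive, where the tilt is integrable. Both alternatives are used
  through the same fact, that values and first derivatives at distinct points are jointly
  nondegenerate. It excludes ties in the sign conditions at contact points and end points, and it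
  makes the expectation of \<open>W\<close> positive. The remaining constants are the same for every
  test functional and cancel in the quotient.\<close>

definition centered_normal :: "'a measure \<Rightarrow> ('a \<Rightarrow> real) \<Rightarrow> bool" where
  "centered_normal M U \<longleftrightarrow> U \<in> borel_measurable M \<and> mean_zero_normal (distr M borel U)"

lemma char_normal_density:
  assumes "\<sigma> > 0"
  shows "char (density lborel (normal_density 0 \<sigma>)) t = of_real (exp (- (\<sigma>\<^sup>2 * t\<^sup>2) / 2))"
proof -
  interpret S: prob_space std_normal_distribution by (rule prob_space_normal_density) simp
  have "distributed std_normal_distribution lborel (\<lambda>x. x) (normal_density 0 1)"
    unfolding distributed_def by (auto simp: distr_id2)
  from S.normal_density_affine[OF this, of \<sigma> 0] assms
  have "distributed std_normal_distribution lborel (\<lambda>x. \<sigma> * x) (normal_density 0 \<sigma>)" by simp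
  then have eq: "distr std_normal_distribution lborel (\<lambda>x. \<sigma> * x) = density lborel (normal_density 0 \<sigma>)"
    unfolding distributed_def by simp
  have "char (density lborel (normal_density 0 \<sigma>)) t = char std_normal_distribution (t * \<sigma>)"
    unfolding eq[symmetric] char_def by (subst integral_distr) (auto simp: mult_ac)
  then show ?thesis by (simp add: char_std_normal_distribution power_mult_distrib mult_ac)
qed

lemma (in prob_space) centered_normal_moments:
  assumes "centered_normal M U"
  shows "integrable M U" "integrable M (\<lambda>x. (U x)\<^sup>2)" "expectation U = 0"
    "char (distr M borel U) t = of_real (exp (- (expectation (\<lambda>x. (U x)\<^sup>2) * t\<^sup>2) / 2))"
proof -
  have U[measurable]: "U \<in> borel_measurable M" and N: "mean_zero_normal (distr M borel U)"
    using assms by (auto simp: centered_normal_def)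
  have "integrable M U \<and> integrable M (\<lambda>x. (U x)\<^sup>2) \<and> expectation U = 0 \<and>
    char (distr M borel U) t = of_real (exp (- (expectation (\<lambda>x. (U x)\<^sup>2) * t\<^sup>2) / 2))"
  proof (cases "distr M borel U = return borel 0")
    case True
    have "AE x in distr M borel U. x = 0" unfolding True by (subst AE_return) auto
    then have ae: "AE x in M. U x = 0" by (subst (asm) AE_distr_iff) auto
    have 1: "integrable M U" using ae by (subst integrable_cong_AE[where g="\<lambda>_. 0"]) auto
    have 2: "integrable M (\<lambda>x. (U x)\<^sup>2)" using ae by (subst integrable_cong_AE[where g="\<lambda>_. 0"]) auto
    have 3: "expectation U = 0" using ae by (subst integral_cong_AE[where g="\<lambda>_. 0"]) auto
    have 4: "expectation (\<lambda>x. (U x)\<^sup>2) = 0" using ae by (subst integral_cong_AE[where g="\<lambda>_. 0"]) auto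
    have "char (distr M borel U) t = 1" unfolding True char_def by (subst integral_return) auto
    with 1 2 3 4 show ?thesis by simp
  next
    case False
    then obtain \<sigma> where \<sigma>: "\<sigma> > 0" and eq: "distr M borel U = density lborel (normal_density 0 \<sigma>)"
      using N by (auto simp: mean_zero_normal_def)
    have "distr M lborel U = distr M borel U" by (rule distr_cong) auto
    then have D: "distributed M lborel U (normal_density 0 \<sigma>)"
      unfolding distributed_def using eq by auto
    have "integrable M (\<lambda>x. U x ^ k)" for k
      using distributed_integrable[OF D, of "\<lambda>x. x ^ k"] integrable_normal_moment[OF \<sigma>, of 0 k] by simp
    from this[of 1] this[of 2] have "integrable M U" "integrable M (\<lambda>x. (U x)\<^sup>2)" by auto
    moreover have "expectation U = 0" using normal_distributed_expectation[OF \<sigma> D] .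
    moreover have "expectation (\<lambda>x. (U x)\<^sup>2) = \<sigma>\<^sup>2"
      using normal_distributed_variance[OF \<sigma> D] calculation(3) by simp
    ultimately show ?thesis using char_normal_density[OF \<sigma>, of t] eq by simp
  qed
  then show "integrable M U" "integrable M (\<lambda>x. (U x)\<^sup>2)" "expectation U = 0"
    "char (distr M borel U) t = of_real (exp (- (expectation (\<lambda>x. (U x)\<^sup>2) * t\<^sup>2) / 2))" by auto
qed

lemma (in prob_space) centered_normal_iexp:
  assumes "centered_normal M U"
  shows "(\<integral>x. iexp (U x) \<partial>M) = of_real (exp (- expectation (\<lambda>x. (U x)\<^sup>2) / 2))"
proof -
  have [measurable]: "U \<in> borel_measurable M" using assms by (auto simp: centered_normal_def)
  have "char (distr M borel U) 1 = (\<integral>x. iexp (U x) \<partial>M)"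
    unfolding char_def by (subst integral_distr) auto
  with centered_normal_moments(4)[OF assms, of 1] show ?thesis by simp
qed

text \<open>Levy's uniqueness theorem: the characteristic function fixes the law. The value
  \<open>v = 0\<close> belongs to the point mass, which has no density and is treated apart.\<close>

lemma (in prob_space) centered_normalI:
  assumes U[measurable]: "U \<in> borel_measurable M" and "v \<ge> 0"
    and ch: "\<And>t. (\<integral>x. iexp (t * U x) \<partial>M) = of_real (exp (- (v * t\<^sup>2) / 2))"
  shows "centered_normal M U" "expectation (\<lambda>x. (U x)\<^sup>2) = v"
proof -
  have chU: "char (distr M borel U) t = of_real (exp (- (v * t\<^sup>2) / 2))" for t
    unfolding char_def by (subst integral_distr) (use ch in auto)
  have rd: "real_distribution (distr M borel U)"
    by (simp add: real_distribution_distr)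
  show *: "centered_normal M U"
  proof (cases "v = 0")
    case True
    have r: "real_distribution (return borel (0::real))"
      by (simp add: real_distribution_def real_distribution_axioms_def prob_space_return)
    have "char (distr M borel U) = char (return borel 0)"
    proof
      fix t show "char (distr M borel U) t = char (return borel 0) t"
        unfolding chU by (simp add: True char_def integral_return)
    qed
    then have "distr M borel U = return borel 0" by (rule Levy_uniqueness[OF rd r])
    then show ?thesis by (simp add: centered_normal_def mean_zero_normal_def)
  next
    case False
    then have s: "sqrt v > 0" using \<open>v \<ge> 0\<close> by simp
    have "real_distribution (density lborel (normal_density 0 (sqrt v)))"
      using prob_space_normal_density[OF s] by (auto simp: real_distribution_def real_distribution_axioms_def)
    moreover have "char (distr M borel U) = char (density lborel (normal_density 0 (sqrt v)))"
      using char_normal_density[OF s] \<open>v \<ge> 0\<close> by (auto simp: chU)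
    ultimately have "distr M borel U = density lborel (normal_density 0 (sqrt v))"
      using Levy_uniqueness[OF rd] by blast
    then show ?thesis unfolding centered_normal_def mean_zero_normal_def using s
      by (intro conjI U disjI2 exI[of _ "sqrt v"])
  qed
  have "of_real (exp (- expectation (\<lambda>x. (U x)\<^sup>2) / 2)) = (of_real (exp (- v / 2)) :: complex)"
    using centered_normal_iexp[OF *] ch[of 1] by simp
  then have "exp (- expectation (\<lambda>x. (U x)\<^sup>2) / 2) = exp (- v / 2)"
    by (rule of_real_eq_iff[THEN iffD1])
  then show "expectation (\<lambda>x. (U x)\<^sup>2) = v" by simp
qed

lemma centered_normal_measurable: "centered_normal M U \<Longrightarrow> U \<in> borel_measurable M"
  by (simp add: centered_normal_def)

text \<open>Almost sure convergence gives convergence of the characteristic functions, and for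
  centred normal laws these determine the variances through a logarithm, so the second moments
  converge as well. It serves to pass from difference quotients to derivatives.\<close>

lemma (in prob_space) centered_normal_limit:
  assumes U: "\<And>n::nat. centered_normal M (U n)" and V[measurable]: "V \<in> borel_measurable M"
    and lim: "AE x in M. (\<lambda>n. U n x) \<longlonglongrightarrow> V x"
  shows "centered_normal M V"
    "(\<lambda>n. expectation (\<lambda>x. (U n x)\<^sup>2)) \<longlonglongrightarrow> expectation (\<lambda>x. (V x)\<^sup>2)"
proof -
  have [measurable]: "U n \<in> borel_measurable M" for n by (rule centered_normal_measurable[OF U])
  define s where "s n = expectation (\<lambda>x. (U n x)\<^sup>2)" for n
  have s0: "s n \<ge> 0" for n unfolding s_def by simp
  have chn: "(\<integral>x. iexp (t * U n x) \<partial>M) = of_real (exp (- (s n * t\<^sup>2) / 2))" for t n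
  proof -
    have "(\<integral>x. iexp (t * U n x) \<partial>M) = char (distr M borel (U n)) t"
      unfolding char_def by (subst integral_distr) auto
    then show ?thesis using centered_normal_moments(4)[OF U] by (simp add: s_def)
  qed
  have conv: "(\<lambda>n. \<integral>x. iexp (t * U n x) \<partial>M) \<longlonglongrightarrow> (\<integral>x. iexp (t * V x) \<partial>M)" for t
  proof (rule integral_dominated_convergence[where w="\<lambda>_. 1"])
    show "AE x in M. (\<lambda>n. iexp (t * U n x)) \<longlonglongrightarrow> iexp (t * V x)"
      using lim by eventually_elim (intro tendsto_intros)
  qed auto
  define \<phi> where "\<phi> t = Re (\<integral>x. iexp (t * V x) \<partial>M)" for t
  have c\<phi>: "(\<lambda>n. exp (- (s n * t\<^sup>2) / 2)) \<longlonglongrightarrow> \<phi> t" for t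
    using tendsto_Re[OF conv[of t]] unfolding chn \<phi>_def by simp
  have im: "(\<integral>x. iexp (t * V x) \<partial>M) = of_real (\<phi> t)" for t
    using LIMSEQ_unique[OF conv[of t, unfolded chn] tendsto_of_real[OF c\<phi>[of t]]] .
  \<comment> \<open>The limit \<open>\<phi>\<close> is continuous at 0 with value 1. Positivity at
    one nonzero point prevents the variances from escaping to infinity and lets \<open>ln\<close>
    recover their limit.\<close>
  have "\<exists>t. t \<noteq> 0 \<and> \<phi> t > 0"
  proof -
    have "(\<lambda>n. \<integral>x. iexp ((1 / real (Suc n)) * V x) \<partial>M) \<longlonglongrightarrow> (\<integral>x. iexp (0 * V x) \<partial>M)"
    proof (rule integral_dominated_convergence[where w="\<lambda>_. 1"])
      have "(\<lambda>n. 1 / real (Suc n)) \<longlonglongrightarrow> 0" by (rule LIMSEQ_Suc[OF lim_1_over_n])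
      then show "AE x in M. (\<lambda>n. iexp ((1 / real (Suc n)) * V x)) \<longlonglongrightarrow> iexp (0 * V x)"
        by (intro AE_I2 tendsto_intros)
    qed auto
    then have "(\<lambda>n. \<phi> (1 / real (Suc n))) \<longlonglongrightarrow> 1"
      unfolding \<phi>_def by (auto dest!: tendsto_Re simp: prob_space)
    then have "\<forall>\<^sub>F n in sequentially. \<phi> (1 / real (Suc n)) > 0"
      by (rule order_tendstoD) simp
    then obtain n where "\<phi> (1 / real (Suc n)) > 0" by (auto simp: eventually_sequentially)
    then show ?thesis by (intro exI[of _ "1 / real (Suc n)"]) auto
  qed
  then obtain t0 where t0: "t0 \<noteq> 0" "\<phi> t0 > 0" by auto
  define v where "v = - 2 * ln (\<phi> t0) / t0\<^sup>2"
  have sv: "s \<longlonglongrightarrow> v"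
  proof -
    have "(\<lambda>n. - 2 * ln (exp (- (s n * t0\<^sup>2) / 2)) / t0\<^sup>2) \<longlonglongrightarrow> v"
      unfolding v_def using t0 by (intro tendsto_intros c\<phi>) auto
    then show ?thesis using t0 by simp
  qed
  have v0: "v \<ge> 0" using LIMSEQ_le_const[OF sv] s0 by auto
  have "(\<integral>x. iexp (t * V x) \<partial>M) = of_real (exp (- (v * t\<^sup>2) / 2))" for t
  proof -
    have "(\<lambda>n. exp (- (s n * t\<^sup>2) / 2)) \<longlonglongrightarrow> exp (- (v * t\<^sup>2) / 2)"
      by (intro tendsto_intros sv) simp
    then show ?thesis using im LIMSEQ_unique[OF c\<phi>[of t]] by simp
  qed
  from centered_normalI[OF V v0 this] sv
  show "centered_normal M V" "(\<lambda>n. expectation (\<lambda>x. (U n x)\<^sup>2)) \<longlonglongrightarrow> expectation (\<lambda>x. (V x)\<^sup>2)"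
    unfolding s_def by auto
qed

section \<open>Uniqueness of joint laws from characteristic functions\<close>

lemma iexp_weighted_unique_nonneg:
  fixes g1 :: "'a \<Rightarrow> real" and g2 :: "'b \<Rightarrow> real"
  assumes "prob_space M1" "prob_space M2"
    and [measurable]: "V1 \<in> borel_measurable M1" "V2 \<in> borel_measurable M2"
      "g1 \<in> borel_measurable M1" "g2 \<in> borel_measurable M2"
    and g1: "\<And>x. 0 \<le> g1 x" "\<And>x. g1 x \<le> K" and g2: "\<And>x. 0 \<le> g2 x" "\<And>x. g2 x \<le> K"
    and eq: "\<And>t. (\<integral>x. g1 x * iexp (t * V1 x) \<partial>M1) = (\<integral>x. g2 x * iexp (t * V2 x) \<partial>M2)"
    and [measurable]: "B \<in> sets borel"
  shows "(\<integral>x. g1 x * indicator B (V1 x) \<partial>M1) = (\<integral>x. g2 x * indicator B (V2 x) \<partial>M2)"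
proof -
  interpret M1: prob_space M1 by fact
  interpret M2: prob_space M2 by fact
  have i1: "integrable M1 g1" by (rule M1.integrable_const_bound[where B=K]) (use g1 in auto)
  have i2: "integrable M2 g2" by (rule M2.integrable_const_bound[where B=K]) (use g2 in auto)
  define c where "c = (\<integral>x. g1 x \<partial>M1)"
  have "of_real c = (of_real (\<integral>x. g2 x \<partial>M2) :: complex)" using eq[of 0] by (simp add: c_def)
  then have c2: "c = (\<integral>x. g2 x \<partial>M2)" by (rule of_real_eq_iff[THEN iffD1])
  have c0: "c \<ge> 0" unfolding c_def using g1 by simp
  show ?thesis
  proof (cases "c = 0")
    case True
    have "AE x in M1. g1 x = 0"
      using integral_nonneg_eq_0_iff_AE[OF i1] g1 True by (simp add: c_def)
    then have "(\<integral>x. g1 x * indicator B (V1 x) \<partial>M1) = 0"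
      by (intro integral_eq_zero_AE) auto
    moreover have "AE x in M2. g2 x = 0"
      using integral_nonneg_eq_0_iff_AE[OF i2] g2 True c2 by simp
    then have "(\<integral>x. g2 x * indicator B (V2 x) \<partial>M2) = 0"
      by (intro integral_eq_zero_AE) auto
    ultimately show ?thesis by simp
  next
    case False
    with c0 have cp: "c > 0" by simp
    \<comment> \<open>Divided by its total mass \<open>c\<close>, which \<open>eq\<close> at
      \<open>t = 0\<close> shows to be common to both sides, the weight becomes a probability
      density, and Levy's theorem applies to the image law.\<close>
    have *: "real_distribution (distr (density N (\<lambda>x. ennreal (g x / c))) borel V) \<and>
        char (distr (density N (\<lambda>x. ennreal (g x / c))) borel V) t = (\<integral>x. g x * iexp (t * V x) \<partial>N) / c \<and>
        measure (distr (density N (\<lambda>x. ennreal (g x / c))) borel V) B = (\<integral>x. g x * indicator B (V x) \<partial>N) / c"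
      if [measurable]: "g \<in> borel_measurable N" "V \<in> borel_measurable N" and g0: "\<And>x. g x \<ge> 0"
        and ig: "integrable N g" "(\<integral>x. g x \<partial>N) = c" for N and g V :: "'z \<Rightarrow> real" and t
    proof -
      let ?D = "density N (\<lambda>x. ennreal (g x / c))"
      have "emeasure ?D (space ?D) = (\<integral>\<^sup>+x. ennreal (g x / c) \<partial>N)"
        by (subst emeasure_density) (auto intro!: nn_integral_cong)
      also have "\<dots> = ennreal (\<integral>x. g x / c \<partial>N)"
        by (rule nn_integral_eq_integral) (use ig g0 cp in auto)
      also have "\<dots> = 1" using ig cp by simp
      finally interpret D: prob_space ?D by (intro prob_spaceI)
      have rd: "real_distribution (distr ?D borel V)" by (rule D.real_distribution_distr) simp
      have "char (distr ?D borel V) t = (\<integral>x. (g x / c) *\<^sub>R iexp (t * V x) \<partial>N)"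
        unfolding char_def using g0 cp by (subst integral_distr) (auto simp: integral_density)
      also have "\<dots> = (\<integral>x. g x * iexp (t * V x) / c \<partial>N)"
        by (intro Bochner_Integration.integral_cong) (auto simp: scaleR_conv_of_real)
      also have "\<dots> = (\<integral>x. g x * iexp (t * V x) \<partial>N) / c" by simp
      finally have ch: "char (distr ?D borel V) t = (\<integral>x. g x * iexp (t * V x) \<partial>N) / c" .
      have "measure (distr ?D borel V) B = (\<integral>x. indicator B x \<partial>distr ?D borel V)"
        by simp
      also have "\<dots> = (\<integral>x. (g x / c) *\<^sub>R indicator B (V x) \<partial>N)"
        using g0 cp by (subst integral_distr) (auto simp: integral_density)
      also have "\<dots> = (\<integral>x. g x * indicator B (V x) / c \<partial>N)"
        by (intro Bochner_Integration.integral_cong) auto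
      finally have "measure (distr ?D borel V) B = (\<integral>x. g x * indicator B (V x) \<partial>N) / c"
        by simp
      with rd ch show ?thesis by blast
    qed
    note D1 = *[of g1 M1 V1, OF _ _ g1(1) i1 c_def[symmetric]]
    note D2 = *[of g2 M2 V2, OF _ _ g2(1) i2 c2[symmetric]]
    have "distr (density M1 (\<lambda>x. ennreal (g1 x / c))) borel V1 = distr (density M2 (\<lambda>x. ennreal (g2 x / c))) borel V2"
      using D1 D2 eq by (intro Levy_uniqueness ext) auto
    then show ?thesis using D1 D2 cp by auto
  qed
qed

text \<open>A real weight bounded by 1 becomes nonnegative after adding 1, which is what the
  hypothesis \<open>base\<close> pays for; the imaginary part of \<open>g\<close> is the real part
  of \<open>- \<i> * g\<close>.\<close>

lemma iexp_weighted_unique: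
  fixes g1 :: "'a \<Rightarrow> complex" and g2 :: "'b \<Rightarrow> complex"
  assumes P: "prob_space M1" "prob_space M2"
    and V[measurable]: "V1 \<in> borel_measurable M1" "V2 \<in> borel_measurable M2"
    and g[measurable]: "g1 \<in> borel_measurable M1" "g2 \<in> borel_measurable M2"
    and g1: "\<And>x. norm (g1 x) \<le> 1" and g2: "\<And>x. norm (g2 x) \<le> 1"
    and base: "\<And>t. (\<integral>x. iexp (t * V1 x) \<partial>M1) = (\<integral>x. iexp (t * V2 x) \<partial>M2)"
    and eq: "\<And>t. (\<integral>x. g1 x * iexp (t * V1 x) \<partial>M1) = (\<integral>x. g2 x * iexp (t * V2 x) \<partial>M2)"
    and B[measurable]: "B \<in> sets borel"
  shows "(\<integral>x. g1 x * of_real (indicator B (V1 x)) \<partial>M1) = (\<integral>x. g2 x * of_real (indicator B (V2 x)) \<partial>M2)"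
proof -
  interpret M1: prob_space M1 by fact
  interpret M2: prob_space M2 by fact
  have int1: "integrable M1 f" if "f \<in> borel_measurable M1" "\<And>x. norm (f x) \<le> 4"
    for f :: "'a \<Rightarrow> 'c::{banach,second_countable_topology}"
    by (rule M1.integrable_const_bound[where B=4]) (use that in auto)
  have int2: "integrable M2 f" if "f \<in> borel_measurable M2" "\<And>x. norm (f x) \<le> 4"
    for f :: "'b \<Rightarrow> 'c::{banach,second_countable_topology}"
    by (rule M2.integrable_const_bound[where B=4]) (use that in auto)
  have ind: "(\<integral>x. indicator B (V1 x) \<partial>M1) = ((\<integral>x. indicator B (V2 x) \<partial>M2) :: real)"
  proof -
    have "(\<integral>x. 1 * indicator B (V1 x) \<partial>M1) = ((\<integral>x. 1 * indicator B (V2 x) \<partial>M2) :: real)"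
      by (rule iexp_weighted_unique_nonneg[OF P V, where K=1]) (simp_all only: of_real_1 mult_1 base, simp_all)
    then show ?thesis by simp
  qed
  have re: "(\<integral>x. Re (h1 x) * indicator B (V1 x) \<partial>M1) = (\<integral>x. Re (h2 x) * indicator B (V2 x) \<partial>M2)"
    if h[measurable]: "h1 \<in> borel_measurable M1" "h2 \<in> borel_measurable M2"
      and h1: "\<And>x. norm (h1 x) \<le> 1" and h2: "\<And>x. norm (h2 x) \<le> 1"
      and heq: "\<And>t. (\<integral>x. h1 x * iexp (t * V1 x) \<partial>M1) = (\<integral>x. h2 x * iexp (t * V2 x) \<partial>M2)"
    for h1 h2
  proof -
    have [measurable]: "cnj \<in> borel_measurable borel"
      by (intro borel_measurable_continuous_onI continuous_intros)
    have b: "norm (w * iexp s) \<le> 4" if "norm w \<le> 1" for w and s :: real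
      using that by (simp add: norm_mult)
    have b': "norm (w * of_real (indicator B s) :: complex) \<le> 4" if "norm w \<le> 1" for w and s :: real
      using that by (auto simp: norm_mult indicator_def)
    have r: "of_real (1 + Re w) * z = z + (w * z + cnj w * z) / 2" for w z :: complex
      by (simp add: complex_add_cnj algebra_simps)
        (simp add: complex_eq_iff)
    have cj: "(\<integral>x. cnj (h1 x) * iexp (t * V1 x) \<partial>M1) = (\<integral>x. cnj (h2 x) * iexp (t * V2 x) \<partial>M2)" for t
    proof -
      have e: "cnj w * iexp (t * s) = cnj (w * iexp (- t * s))" for w and s :: real
        by (simp add: exp_cnj)
      have "(\<integral>x. cnj (h1 x) * iexp (t * V1 x) \<partial>M1) = cnj (\<integral>x. h1 x * iexp (- t * V1 x) \<partial>M1)"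
        unfolding e by (rule Bochner_Integration.integral_cnj)
      also have "\<dots> = cnj (\<integral>x. h2 x * iexp (- t * V2 x) \<partial>M2)" by (simp only: heq)
      also have "\<dots> = (\<integral>x. cnj (h2 x) * iexp (t * V2 x) \<partial>M2)"
        unfolding e by (rule Bochner_Integration.integral_cnj[symmetric])
      finally show ?thesis .
    qed
    have "(\<integral>x. of_real (1 + Re (h1 x)) * iexp (t * V1 x) \<partial>M1) =
        (\<integral>x. of_real (1 + Re (h2 x)) * iexp (t * V2 x) \<partial>M2)" for t
    proof -
      have H: "integrable N f \<Longrightarrow> integrable N g \<Longrightarrow> integrable N k \<Longrightarrow>
        (\<integral>x. f x + (g x + k x) / 2 \<partial>N) = (\<integral>x. f x \<partial>N) + ((\<integral>x. g x \<partial>N) + (\<integral>x. k x \<partial>N)) / 2"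
        for N :: "'z measure" and f g k :: "'z \<Rightarrow> complex" by simp
      have "(\<integral>x. of_real (1 + Re (h1 x)) * iexp (t * V1 x) \<partial>M1) =
        (\<integral>x. iexp (t * V1 x) \<partial>M1) + ((\<integral>x. h1 x * iexp (t * V1 x) \<partial>M1) + (\<integral>x. cnj (h1 x) * iexp (t * V1 x) \<partial>M1)) / 2"
        unfolding r by (intro H int1) (simp_all add: norm_mult h1 order.trans[OF h1])
      also have "\<dots> = (\<integral>x. iexp (t * V2 x) \<partial>M2) + ((\<integral>x. h2 x * iexp (t * V2 x) \<partial>M2) + (\<integral>x. cnj (h2 x) * iexp (t * V2 x) \<partial>M2)) / 2"
        by (simp only: base heq cj)
      also have "\<dots> = (\<integral>x. of_real (1 + Re (h2 x)) * iexp (t * V2 x) \<partial>M2)"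
        unfolding r by (intro H[symmetric] int2) (simp_all add: norm_mult h2 order.trans[OF h2])
      finally show ?thesis .
    qed
    moreover have "\<bar>Re (h1 x)\<bar> \<le> 1" "\<bar>Re (h2 y)\<bar> \<le> 1" for x y
      using h1[of x] h2[of y] abs_Re_le_cmod[of "h1 x"] abs_Re_le_cmod[of "h2 y"] by linarith+
    then have hb: "-1 \<le> Re (h1 x)" "Re (h1 x) \<le> 1" "-1 \<le> Re (h2 y)" "Re (h2 y) \<le> 1" for x y
      by (simp_all add: abs_le_iff minus_le_iff)
    have hb': "0 \<le> 1 + Re (h1 x)" "1 + Re (h1 x) \<le> 2" "0 \<le> 1 + Re (h2 y)" "1 + Re (h2 y) \<le> 2" for x y
      using hb(1,2)[of x] hb(3,4)[of y] by linarith+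
    ultimately have e: "(\<integral>x. (1 + Re (h1 x)) * indicator B (V1 x) \<partial>M1) = (\<integral>x. (1 + Re (h2 x)) * indicator B (V2 x) \<partial>M2)"
      using hb' by (intro iexp_weighted_unique_nonneg[OF P V, where K=2]) auto
    have n1: "\<bar>Re (h1 x)\<bar> \<le> 4" "\<bar>Re (h2 y)\<bar> \<le> 4" for x y using hb(1,2)[of x] hb(3,4)[of y] by (auto simp: abs_le_iff)
    have "(\<integral>x. (1 + Re (h1 x)) * indicator B (V1 x) \<partial>M1) = (\<integral>x. indicator B (V1 x) \<partial>M1) + (\<integral>x. Re (h1 x) * indicator B (V1 x) \<partial>M1)"
      unfolding distrib_right using n1
      by (subst Bochner_Integration.integral_add) (auto intro!: int1 simp: indicator_def)
    moreover have "(\<integral>x. (1 + Re (h2 x)) * indicator B (V2 x) \<partial>M2) = (\<integral>x. indicator B (V2 x) \<partial>M2) + (\<integral>x. Re (h2 x) * indicator B (V2 x) \<partial>M2)"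
      unfolding distrib_right using n1
      by (subst Bochner_Integration.integral_add) (auto intro!: int2 simp: indicator_def)
    ultimately show ?thesis using e ind by simp
  qed
  have Rg: "(\<integral>x. Re (g1 x) * indicator B (V1 x) \<partial>M1) = (\<integral>x. Re (g2 x) * indicator B (V2 x) \<partial>M2)"
    by (rule re) (use g1 g2 eq in auto)
  have "(\<integral>x. Re (- \<i> * g1 x) * indicator B (V1 x) \<partial>M1) = (\<integral>x. Re (- \<i> * g2 x) * indicator B (V2 x) \<partial>M2)"
  proof (rule re)
    fix t show "(\<integral>x. - \<i> * g1 x * iexp (t * V1 x) \<partial>M1) = (\<integral>x. - \<i> * g2 x * iexp (t * V2 x) \<partial>M2)"
      using eq[of t] by (simp add: mult.assoc)
  qed (use g1 g2 in \<open>auto simp: norm_mult\<close>)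
  then have Ig: "(\<integral>x. Im (g1 x) * indicator B (V1 x) \<partial>M1) = (\<integral>x. Im (g2 x) * indicator B (V2 x) \<partial>M2)" by simp
  have n: "norm (g1 x * of_real (indicator B s)) \<le> 4" "norm (g2 y * of_real (indicator B s)) \<le> 4" for x y and s :: real
    using g1[of x] g2[of y] by (auto simp: norm_mult indicator_def)
  have I1: "integrable M1 (\<lambda>x. g1 x * of_real (indicator B (V1 x)))" by (rule int1) (use n in auto)
  have I2: "integrable M2 (\<lambda>x. g2 x * of_real (indicator B (V2 x)))" by (rule int2) (use n in auto)
  show ?thesis
    using Rg Ig I1 I2 by (simp add: complex_eq_iff flip: integral_Re integral_Im)
qed

text \<open>Cramer--Wold: characters are exchanged for indicators one coordinate at a time, so only
  one-dimensional uniqueness is used. The resulting cylinder probabilities determine the law on the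
  infinite product.\<close>

lemma joint_iexp_unique:
  fixes V1 :: "'i \<Rightarrow> 'a \<Rightarrow> real" and V2 :: "'i \<Rightarrow> 'b \<Rightarrow> real"
  assumes P: "prob_space M1" "prob_space M2"
    and V[measurable]: "\<And>i. V1 i \<in> borel_measurable M1" "\<And>i. V2 i \<in> borel_measurable M2"
    and eq: "\<And>I c. finite I \<Longrightarrow>
      (\<integral>x. iexp (\<Sum>i\<in>I. c i * V1 i x) \<partial>M1) = (\<integral>x. iexp (\<Sum>i\<in>I. c i * V2 i x) \<partial>M2)"
  shows "distr M1 (Pi\<^sub>M UNIV (\<lambda>_. borel)) (\<lambda>x i. V1 i x) = distr M2 (Pi\<^sub>M UNIV (\<lambda>_. borel)) (\<lambda>x i. V2 i x)"
proof -
  interpret M1: prob_space M1 by fact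
  interpret M2: prob_space M2 by fact
  have pm1[measurable]: "(\<lambda>x i. V1 i x) \<in> M1 \<rightarrow>\<^sub>M Pi\<^sub>M UNIV (\<lambda>_. borel)"
    by (rule measurable_PiM_single') auto
  have pm2[measurable]: "(\<lambda>x i. V2 i x) \<in> M2 \<rightarrow>\<^sub>M Pi\<^sub>M UNIV (\<lambda>_. borel)"
    by (rule measurable_PiM_single') auto
  \<comment> \<open>The invariant is that no coordinate carries both a character and an indicator. A
    coordinate about to enter \<open>J\<close> first carries a free character with parameter
    \<open>t\<close>, so the induction hypothesis is used for \<open>insert j I\<close>.\<close>
  have claim: "(\<integral>x. iexp (\<Sum>i\<in>I. c i * V1 i x) * of_real (\<Prod>j\<in>J. indicator (B j) (V1 j x)) \<partial>M1) =
      (\<integral>x. iexp (\<Sum>i\<in>I. c i * V2 i x) * of_real (\<Prod>j\<in>J. indicator (B j) (V2 j x)) \<partial>M2)"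
    if "finite J" "\<And>j. j \<in> J \<Longrightarrow> B j \<in> sets borel" "finite I" "I \<inter> J = {}" for I J c B
    using that
  proof (induction J arbitrary: I c rule: finite_induct)
    case empty
    have "(\<Prod>j\<in>{}. indicator (B j) (f j) :: real) = 1" for f by simp
    then show ?case using eq[OF empty(2), of c] by (simp only: of_real_1 mult_1_right)
  next
    case (insert j J)
    have [measurable]: "\<And>i. i \<in> J \<Longrightarrow> B i \<in> sets borel" "B j \<in> sets borel" using insert.prems by auto
    have jI: "j \<notin> I" using insert.prems by auto
    let ?g1 = "\<lambda>x. iexp (\<Sum>i\<in>I. c i * V1 i x) * of_real (\<Prod>j\<in>J. indicator (B j) (V1 j x))"
    let ?g2 = "\<lambda>x. iexp (\<Sum>i\<in>I. c i * V2 i x) * of_real (\<Prod>j\<in>J. indicator (B j) (V2 j x))"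
    have pb: "(\<Prod>j\<in>J. indicator (B j) (f j) :: real) \<le> 1" "0 \<le> (\<Prod>j\<in>J. indicator (B j) (f j) :: real)" for f
      by (auto intro!: prod_le_1 prod_nonneg simp: indicator_def)
    have "(\<integral>x. ?g1 x * of_real (indicator (B j) (V1 j x)) \<partial>M1) = (\<integral>x. ?g2 x * of_real (indicator (B j) (V2 j x)) \<partial>M2)"
    proof (rule iexp_weighted_unique[OF P])
      fix t
      show "(\<integral>x. iexp (t * V1 j x) \<partial>M1) = (\<integral>x. iexp (t * V2 j x) \<partial>M2)"
        using eq[of "{j}" "\<lambda>_. t"] by simp
      have s: "(\<Sum>i\<in>insert j I. (c(j := t)) i * f i) = (\<Sum>i\<in>I. c i * f i) + t * f j" for f
      proof -
        have "(\<Sum>i\<in>I. (c(j := t)) i * f i) = (\<Sum>i\<in>I. c i * f i)" using jI by (intro sum.cong) auto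
        then show ?thesis using jI insert.prems by simp
      qed
      have e: "iexp (A + D) * w = iexp A * w * iexp D" for A D :: real and w :: complex
        by (simp add: exp_add distrib_left mult_ac)
      show "(\<integral>x. ?g1 x * iexp (t * V1 j x) \<partial>M1) = (\<integral>x. ?g2 x * iexp (t * V2 j x) \<partial>M2)"
        using insert.IH[of "insert j I" "c(j := t)"] insert.prems insert.hyps unfolding s e by auto
    qed (use pb in \<open>auto simp: norm_mult simp flip: of_real_prod\<close>)
    then show ?case using insert.hyps by (simp add: mult_ac)
  qed
  show ?thesis
  proof (rule measure_eqI_PiM_infinite)
    fix A J assume J: "finite J" "J \<subseteq> (UNIV::'i set)" and A: "\<And>i. i \<in> J \<Longrightarrow> A i \<in> sets (borel::real measure)"
    have A'[measurable]: "\<And>i. i \<in> J \<Longrightarrow> A i \<in> sets borel" using A by auto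
    have PE[measurable]: "prod_emb UNIV (\<lambda>_. borel) J (Pi\<^sub>E J A) \<in> sets (Pi\<^sub>M UNIV (\<lambda>_. borel :: real measure))"
      by (rule sets_PiM_I) (use J A in auto)
    have *: "emeasure (distr N (Pi\<^sub>M UNIV (\<lambda>_. borel)) (\<lambda>x i. V i x)) (prod_emb UNIV (\<lambda>_. borel) J (Pi\<^sub>E J A)) =
        ennreal (Re (\<integral>x. of_real (\<Prod>j\<in>J. indicator (A j) (V j x)) \<partial>N))"
      if "prob_space N" and [measurable]: "\<And>i. V i \<in> borel_measurable N" for N and V :: "'i \<Rightarrow> 'z \<Rightarrow> real"
    proof -
      interpret N: prob_space N by fact
      have pm[measurable]: "(\<lambda>x i. V i x) \<in> N \<rightarrow>\<^sub>M Pi\<^sub>M UNIV (\<lambda>_. borel)"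
        by (rule measurable_PiM_single') auto
      have "emeasure (distr N (Pi\<^sub>M UNIV (\<lambda>_. borel)) (\<lambda>x i. V i x)) (prod_emb UNIV (\<lambda>_. borel) J (Pi\<^sub>E J A)) =
        emeasure N {x\<in>space N. \<forall>j\<in>J. V j x \<in> A j}"
        by (subst emeasure_distr[OF pm PE]) (auto intro!: arg_cong[where f="emeasure N"] simp: prod_emb_def)
      also have "\<dots> = ennreal (N.prob {x\<in>space N. \<forall>j\<in>J. V j x \<in> A j})" by (simp add: N.emeasure_eq_measure)
      also have "N.prob {x\<in>space N. \<forall>j\<in>J. V j x \<in> A j} = (\<integral>x. indicator {x\<in>space N. \<forall>j\<in>J. V j x \<in> A j} x \<partial>N)"
        by (subst Bochner_Integration.integral_indicator) (auto intro!: arg_cong[where f=N.prob])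
      also have "\<dots> = (\<integral>x. (\<Prod>j\<in>J. indicator (A j) (V j x)) \<partial>N)"
        using J by (intro Bochner_Integration.integral_cong) (auto simp: indicator_def prod_zero_iff)
      finally show ?thesis by (simp only: integral_complex_of_real Re_complex_of_real)
    qed
    show "emeasure (distr M1 (Pi\<^sub>M UNIV (\<lambda>_. borel)) (\<lambda>x i. V1 i x)) (prod_emb UNIV (\<lambda>_. borel) J (Pi\<^sub>E J A)) =
      emeasure (distr M2 (Pi\<^sub>M UNIV (\<lambda>_. borel)) (\<lambda>x i. V2 i x)) (prod_emb UNIV (\<lambda>_. borel) J (Pi\<^sub>E J A))"
      unfolding *[OF P(1) V(1)] *[OF P(2) V(2)]
      using claim[of J A "{}" "\<lambda>_. 0"] J A by simp
  next
    show "finite_measure (distr M1 (Pi\<^sub>M UNIV (\<lambda>_. borel)) (\<lambda>x i. V1 i x))"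
      by (rule M1.finite_measure_distr) simp
  qed auto
qed

section \<open>The linear span of a Gaussian family\<close>

definition lincombs :: "('i \<Rightarrow> 'a \<Rightarrow> real) \<Rightarrow> ('a \<Rightarrow> real) set" where
  "lincombs V = {L. \<exists>I c. finite I \<and> L = (\<lambda>x. \<Sum>i\<in>I. c i * V i x)}"

definition gaussian_family :: "'a measure \<Rightarrow> ('i \<Rightarrow> 'a \<Rightarrow> real) \<Rightarrow> bool" where
  "gaussian_family M V \<longleftrightarrow> (\<forall>L\<in>lincombs V. centered_normal M L)"

lemma lincombsI: "finite I \<Longrightarrow> (\<lambda>x. \<Sum>i\<in>I. c i * V i x) \<in> lincombs V"
  by (auto simp: lincombs_def)

lemma lincombs_base: "V i \<in> lincombs V"
  using lincombsI[of "{i}" "\<lambda>_. 1" V] by simp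

lemma lincombs_zero: "(\<lambda>x. 0) \<in> lincombs V"
  using lincombsI[of "{}" _ V] by simp

lemma lincombs_cmult:
  assumes "L \<in> lincombs V" shows "(\<lambda>x. c * L x) \<in> lincombs V"
proof -
  obtain I d where I: "finite I" and L: "L = (\<lambda>x. \<Sum>i\<in>I. d i * V i x)"
    using assms by (auto simp: lincombs_def)
  have "(\<lambda>x. c * L x) = (\<lambda>x. \<Sum>i\<in>I. (c * d i) * V i x)"
    by (simp add: L sum_distrib_left mult_ac)
  then show ?thesis using lincombsI[OF I] by metis
qed

lemma lincombs_add:
  assumes "L \<in> lincombs V" "L' \<in> lincombs V" shows "(\<lambda>x. L x + L' x) \<in> lincombs V"
proof -
  obtain I c where I: "finite I" and L: "L = (\<lambda>x. \<Sum>i\<in>I. c i * V i x)"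
    using assms(1) by (auto simp: lincombs_def)
  obtain J d where J: "finite J" and L': "L' = (\<lambda>x. \<Sum>i\<in>J. d i * V i x)"
    using assms(2) by (auto simp: lincombs_def)
  let ?e = "\<lambda>i. (if i \<in> I then c i else 0) + (if i \<in> J then d i else 0)"
  have e: "(\<Sum>i\<in>I. c i * f i) + (\<Sum>i\<in>J. d i * f i) = (\<Sum>i\<in>I \<union> J. ?e i * f i)" for f
  proof -
    have "(\<Sum>i\<in>I. c i * f i) = (\<Sum>i\<in>I \<union> J. (if i \<in> I then c i else 0) * f i)"
      using I J by (intro sum.mono_neutral_cong_left) auto
    moreover have "(\<Sum>i\<in>J. d i * f i) = (\<Sum>i\<in>I \<union> J. (if i \<in> J then d i else 0) * f i)"
      using I J by (intro sum.mono_neutral_cong_left) auto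
    ultimately show ?thesis by (simp add: distrib_right sum.distrib)
  qed
  have "(\<lambda>x. L x + L' x) = (\<lambda>x. \<Sum>i\<in>I \<union> J. ?e i * V i x)"
    unfolding L L' e ..
  then show ?thesis using lincombsI[of "I \<union> J" ?e V] I J by simp
qed

lemma lincombs_diff: "L \<in> lincombs V \<Longrightarrow> L' \<in> lincombs V \<Longrightarrow> (\<lambda>x. L x - L' x) \<in> lincombs V"
  using lincombs_add[of L V "\<lambda>x. -1 * L' x"] lincombs_cmult[of L' V "-1"] by simp

lemma lincombs_sum:
  "finite I \<Longrightarrow> (\<And>i. i \<in> I \<Longrightarrow> L i \<in> lincombs V) \<Longrightarrow> (\<lambda>x. \<Sum>i\<in>I. L i x) \<in> lincombs V"
  by (induction I rule: finite_induct) (auto intro: lincombs_zero lincombs_add)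

lemma lincombs_subset:
  assumes "\<And>j. Z j \<in> lincombs V" shows "lincombs Z \<subseteq> lincombs V"
proof
  fix L assume "L \<in> lincombs Z"
  then obtain I c where "finite I" "L = (\<lambda>x. \<Sum>i\<in>I. c i * Z i x)" by (auto simp: lincombs_def)
  then show "L \<in> lincombs V" using assms by (auto intro!: lincombs_sum lincombs_cmult)
qed

lemma gaussian_family_lincombs:
  "gaussian_family M V \<Longrightarrow> (\<And>j. Z j \<in> lincombs V) \<Longrightarrow> gaussian_family M Z"
  using lincombs_subset[of Z V] by (auto simp: gaussian_family_def)

lemma integrable_mult_squares:
  fixes f g :: "'a \<Rightarrow> real"
  assumes [measurable]: "f \<in> borel_measurable M" "g \<in> borel_measurable M"
    and "integrable M (\<lambda>x. (f x)\<^sup>2)" "integrable M (\<lambda>x. (g x)\<^sup>2)"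
  shows "integrable M (\<lambda>x. f x * g x)"
proof (rule Bochner_Integration.integrable_bound)
  show "integrable M (\<lambda>x. (f x)\<^sup>2 + (g x)\<^sup>2)" using assms by auto
  have "\<bar>u * v\<bar> \<le> u\<^sup>2 + v\<^sup>2" for u v :: real
  proof -
    have "0 \<le> \<bar>u\<bar> * \<bar>v\<bar>" by simp
    moreover have "2 * (\<bar>u\<bar> * \<bar>v\<bar>) \<le> u\<^sup>2 + v\<^sup>2"
      using sum_squares_bound[of "\<bar>u\<bar>" "\<bar>v\<bar>"] by (simp add: mult.assoc)
    ultimately show ?thesis unfolding abs_mult by linarith
  qed
  then show "AE x in M. norm (f x * g x) \<le> norm ((f x)\<^sup>2 + (g x)\<^sup>2)" by auto
qed auto

context prob_space
begin

lemma lincombs_normal: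
  assumes "gaussian_family M V" "L \<in> lincombs V"
  shows "centered_normal M L" "L \<in> borel_measurable M" "integrable M L" "expectation L = 0"
  using assms centered_normal_moments[of L] by (auto simp: gaussian_family_def centered_normal_def)

lemma lincombs_integrable_mult:
  assumes "gaussian_family M V" "L \<in> lincombs V" "L' \<in> lincombs V"
  shows "integrable M (\<lambda>x. L x * L' x)"
  using lincombs_normal[OF assms(1,2)] lincombs_normal[OF assms(1,3)]
  by (intro integrable_mult_squares centered_normal_moments) auto

text \<open>The regression coefficient of a centred \<open>L\<close> on \<open>U\<close>: for
  \<open>U\<close> of positive variance, \<open>L\<close> minus this multiple of \<open>U\<close> is
  uncorrelated with \<open>U\<close>.\<close>

definition regr :: "('a \<Rightarrow> real) \<Rightarrow> ('a \<Rightarrow> real) \<Rightarrow> real" where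
  "regr L U = expectation (\<lambda>x. L x * U x) / expectation (\<lambda>x. (U x)\<^sup>2)"

text \<open>Splitting off one Gaussian coordinate \<open>U\<close>: the residual is uncorrelated with \<open>U\<close>, so it may be
  recombined with an independent copy of \<open>U\<close> without changing the law.\<close>

lemma gaussian_split_distr:
  assumes G: "gaussian_family M V" and U: "U \<in> lincombs V" and pos: "expectation (\<lambda>x. (U x)\<^sup>2) > 0"
  defines "N \<equiv> density lborel (normal_density 0 (sqrt (expectation (\<lambda>x. (U x)\<^sup>2))))"
  shows "distr M (Pi\<^sub>M UNIV (\<lambda>_. borel)) (\<lambda>x i. V i x) =
    distr (N \<Otimes>\<^sub>M M) (Pi\<^sub>M UNIV (\<lambda>_. borel)) (\<lambda>p i. regr (V i) U * fst p + (V i (snd p) - regr (V i) U * U (snd p)))"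
proof -
  let ?v = "expectation (\<lambda>x. (U x)\<^sup>2)"
  have Vm[measurable]: "V i \<in> borel_measurable M" for i
    by (rule lincombs_normal[OF G lincombs_base])
  have Um[measurable]: "U \<in> borel_measurable M" by (rule lincombs_normal[OF G U])
  interpret N: prob_space N unfolding N_def by (rule prob_space_normal_density) (use pos in simp)
  interpret NM: pair_prob_space N M ..
  have setsN[measurable_cong]: "sets N = sets borel" by (simp add: N_def)
  show ?thesis
  proof (rule joint_iexp_unique)
    show "prob_space M" by (rule prob_space_axioms)
    show "prob_space (N \<Otimes>\<^sub>M M)" by (rule NM.P.prob_space_axioms)
    fix I :: "'b set" and c assume I: "finite I"
    define k where "k = (\<Sum>i\<in>I. c i * regr (V i) U)"
    define F where "F x = (\<Sum>i\<in>I. c i * V i x)" for x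
    define L where "L x = F x - k * U x" for x
    have F: "F \<in> lincombs V" unfolding F_def[abs_def] by (rule lincombsI[OF I])
    have L: "L \<in> lincombs V" unfolding L_def[abs_def] by (intro lincombs_diff F lincombs_cmult U)
    have [measurable]: "F \<in> borel_measurable M" "L \<in> borel_measurable M"
      using lincombs_normal[OF G F] lincombs_normal[OF G L] by auto
    have FU: "expectation (\<lambda>x. F x * U x) = k * ?v"
    proof -
      have "expectation (\<lambda>x. F x * U x) = (\<Sum>i\<in>I. c i * expectation (\<lambda>x. V i x * U x))"
        unfolding F_def sum_distrib_right mult.assoc
        by (subst Bochner_Integration.integral_sum)
          (auto intro!: integrable_mult_right lincombs_integrable_mult[OF G] lincombs_base U)
      then show ?thesis using pos by (simp add: k_def regr_def sum_distrib_right)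
    qed
    have UU: "integrable M (\<lambda>x. (U x)\<^sup>2)" using centered_normal_moments(2) lincombs_normal(1)[OF G U] by blast
    have FF: "integrable M (\<lambda>x. (F x)\<^sup>2)" using centered_normal_moments(2) lincombs_normal(1)[OF G F] by blast
    have iFU: "integrable M (\<lambda>x. F x * U x)" by (rule lincombs_integrable_mult[OF G F U])
    \<comment> \<open>Pythagoras: \<open>F\<close> is the orthogonal sum of \<open>k * U\<close> and
      \<open>L\<close>, so the two Gaussian characteristic functions multiply to the one of
      \<open>F\<close>.\<close>
    have LL: "expectation (\<lambda>x. (L x)\<^sup>2) = expectation (\<lambda>x. (F x)\<^sup>2) - k\<^sup>2 * ?v"
    proof -
      have "expectation (\<lambda>x. (L x)\<^sup>2) = expectation (\<lambda>x. (F x)\<^sup>2 - 2 * k * (F x * U x) + k\<^sup>2 * (U x)\<^sup>2)"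
        by (intro Bochner_Integration.integral_cong) (auto simp: L_def power2_eq_square algebra_simps)
      also have "\<dots> = expectation (\<lambda>x. (F x)\<^sup>2) - 2 * k * (k * ?v) + k\<^sup>2 * ?v"
        using FF iFU UU FU by simp
      finally show ?thesis by (simp add: power2_eq_square algebra_simps)
    qed
    have sum_eq: "(\<Sum>i\<in>I. c i * (regr (V i) U * y + (V i x - regr (V i) U * U x))) = k * y + L x" for x y
      unfolding L_def F_def k_def by (simp add: sum.distrib sum_subtractf algebra_simps sum_distrib_left sum_distrib_right)
    have "(\<integral>p. iexp (k * fst p + L (snd p)) \<partial>(N \<Otimes>\<^sub>M M)) = (\<integral>y. (\<integral>x. iexp (k * y + L x) \<partial>M) \<partial>N)"
      by (subst NM.integral_fst'[symmetric]) (auto intro!: NM.P.integrable_const_bound[where B=1])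
    also have "\<dots> = (\<integral>y. iexp (k * y) * (\<integral>x. iexp (L x) \<partial>M) \<partial>N)"
      by (simp add: exp_add distrib_left)
    also have "\<dots> = char N k * (\<integral>x. iexp (L x) \<partial>M)" by (simp add: char_def)
    also have "char N k = of_real (exp (- (?v * k\<^sup>2) / 2))"
      unfolding N_def using char_normal_density[of "sqrt ?v" k] pos by simp
    also have "(\<integral>x. iexp (L x) \<partial>M) = of_real (exp (- (expectation (\<lambda>x. (F x)\<^sup>2) - k\<^sup>2 * ?v) / 2))"
      using centered_normal_iexp[OF lincombs_normal(1)[OF G L]] LL by simp
    also have "of_real (exp (- (?v * k\<^sup>2) / 2)) * of_real (exp (- (expectation (\<lambda>x. (F x)\<^sup>2) - k\<^sup>2 * ?v) / 2)) =
        (of_real (exp (- expectation (\<lambda>x. (F x)\<^sup>2) / 2)) :: complex)"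
      by (simp flip: of_real_mult exp_add add: field_simps)
    also have "\<dots> = (\<integral>x. iexp (F x) \<partial>M)"
      using centered_normal_iexp[OF lincombs_normal(1)[OF G F]] by simp
    finally show "(\<integral>x. iexp (\<Sum>i\<in>I. c i * V i x) \<partial>M) =
      (\<integral>p. iexp (\<Sum>i\<in>I. c i * (regr (V i) U * fst p + (V i (snd p) - regr (V i) U * U (snd p)))) \<partial>(N \<Otimes>\<^sub>M M))"
      unfolding sum_eq F_def by simp
  qed auto
qed

text \<open>With values in \<open>ennreal\<close>, Tonelli applies without integrability conditions;
  signed integrals are later treated through positive and negative parts.\<close>

lemma gaussian_split:
  assumes G: "gaussian_family M V" and U: "U \<in> lincombs V" and pos: "expectation (\<lambda>x. (U x)\<^sup>2) > 0"
    and \<Psi>[measurable]: "\<Psi> \<in> borel_measurable (Pi\<^sub>M UNIV (\<lambda>_. borel))"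
  shows "(\<integral>\<^sup>+x. \<Psi> (\<lambda>i. V i x) \<partial>M) =
    (\<integral>\<^sup>+y. ennreal (normal_density 0 (sqrt (expectation (\<lambda>x. (U x)\<^sup>2))) y) *
      (\<integral>\<^sup>+x. \<Psi> (\<lambda>i. regr (V i) U * y + (V i x - regr (V i) U * U x)) \<partial>M) \<partial>lborel)"
proof -
  let ?n = "normal_density 0 (sqrt (expectation (\<lambda>x. (U x)\<^sup>2)))"
  let ?N = "density lborel ?n"
  have Vm[measurable]: "V i \<in> borel_measurable M" for i
    by (rule lincombs_normal[OF G lincombs_base])
  have Um[measurable]: "U \<in> borel_measurable M" by (rule lincombs_normal[OF G U])
  have m1[measurable]: "(\<lambda>x i. V i x) \<in> M \<rightarrow>\<^sub>M Pi\<^sub>M UNIV (\<lambda>_. borel)"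
    by (rule measurable_PiM_single') auto
  have m2[measurable]: "(\<lambda>p i. regr (V i) U * fst p + (V i (snd p) - regr (V i) U * U (snd p))) \<in> ?N \<Otimes>\<^sub>M M \<rightarrow>\<^sub>M Pi\<^sub>M UNIV (\<lambda>_. borel)"
    by (rule measurable_PiM_single') auto
  have m3: "(\<lambda>p. (\<lambda>i. regr (V i) U * fst p + (V i (snd p) - regr (V i) U * U (snd p)))) \<in> (lborel \<Otimes>\<^sub>M M) \<rightarrow>\<^sub>M Pi\<^sub>M UNIV (\<lambda>_. borel)"
    by (rule measurable_PiM_single') auto
  have m4: "(\<lambda>p. \<Psi> (\<lambda>i. regr (V i) U * fst p + (V i (snd p) - regr (V i) U * U (snd p)))) \<in> borel_measurable (lborel \<Otimes>\<^sub>M M)"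
    using measurable_compose[OF m3 \<Psi>] .
  have m5[measurable]: "(\<lambda>y. \<integral>\<^sup>+x. \<Psi> (\<lambda>i. regr (V i) U * y + (V i x - regr (V i) U * U x)) \<partial>M) \<in> borel_measurable lborel"
    using borel_measurable_nn_integral_fst[OF m4] by simp
  have "(\<integral>\<^sup>+x. \<Psi> (\<lambda>i. V i x) \<partial>M) = (\<integral>\<^sup>+w. \<Psi> w \<partial>distr M (Pi\<^sub>M UNIV (\<lambda>_. borel)) (\<lambda>x i. V i x))"
    by (subst nn_integral_distr) auto
  also have "\<dots> = (\<integral>\<^sup>+p. \<Psi> (\<lambda>i. regr (V i) U * fst p + (V i (snd p) - regr (V i) U * U (snd p))) \<partial>(?N \<Otimes>\<^sub>M M))"
    unfolding gaussian_split_distr[OF G U pos] by (subst nn_integral_distr) auto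
  also have "\<dots> = (\<integral>\<^sup>+y. (\<integral>\<^sup>+x. \<Psi> (\<lambda>i. regr (V i) U * y + (V i x - regr (V i) U * U x)) \<partial>M) \<partial>?N)"
    by (subst nn_integral_fst[symmetric]) auto
  also have "\<dots> = (\<integral>\<^sup>+y. ?n y * (\<integral>\<^sup>+x. \<Psi> (\<lambda>i. regr (V i) U * y + (V i x - regr (V i) U * U x)) \<partial>M) \<partial>lborel)"
    by (subst nn_integral_density) auto
  finally show ?thesis .
qed

end

section \<open>Disintegration and change of measure\<close>

text \<open>The coefficients are a parameter here; \<open>cond_coeff_eq\<close> later recognises
  them as those of the conditional expectation.\<close>

definition resd :: "('i \<Rightarrow> 'a \<Rightarrow> real) \<Rightarrow> 'i set \<Rightarrow> ('i \<Rightarrow> 'i \<Rightarrow> real) \<Rightarrow> 'i \<Rightarrow> 'a \<Rightarrow> real" where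
  "resd X S a t x = X t x - (\<Sum>s\<in>S. a t s * X s x)"

lemma resd_lincombs: "finite S \<Longrightarrow> resd X S a t \<in> lincombs X"
  unfolding resd_def[abs_def] by (intro lincombs_diff lincombs_base lincombsI)

text \<open>Positive definiteness of the covariance matrix, phrased by second moments so that it
  applies to any finite index set without an enumeration, in particular to values and derivatives
  together.\<close>

definition nondegenerate_on :: "'a measure \<Rightarrow> ('i \<Rightarrow> 'a \<Rightarrow> real) \<Rightarrow> 'i set \<Rightarrow> bool" where
  "nondegenerate_on M X S \<longleftrightarrow>
     (\<forall>c. (\<integral>x. (\<Sum>s\<in>S. c s * X s x)\<^sup>2 \<partial>M) = 0 \<longrightarrow> (\<forall>s\<in>S. c s = 0))"

lemma nondegenerate_on_subset:
  assumes "nondegenerate_on M X T" "S \<subseteq> T" "finite T"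
  shows "nondegenerate_on M X S"
  unfolding nondegenerate_on_def
proof (intro allI impI)
  fix c assume c: "(\<integral>x. (\<Sum>s\<in>S. c s * X s x)\<^sup>2 \<partial>M) = 0"
  have "(\<Sum>s\<in>S. c s * X s x) = (\<Sum>s\<in>T. (if s \<in> S then c s else 0) * X s x)" for x
    using assms by (intro sum.mono_neutral_cong_left) auto
  with c have "(\<integral>x. (\<Sum>s\<in>T. (if s \<in> S then c s else 0) * X s x)\<^sup>2 \<partial>M) = 0" by simp
  then have "\<forall>s\<in>T. (if s \<in> S then c s else 0) = 0"
    using assms(1)[unfolded nondegenerate_on_def, rule_format, of "\<lambda>s. if s \<in> S then c s else 0"] by blast
  then show "\<forall>s\<in>S. c s = 0" using assms(2) by fastforce
qed

context prob_space
begin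

lemma resd_measurable:
  assumes "gaussian_family M X" "finite S"
  shows "resd X S a t \<in> borel_measurable M"
  using lincombs_normal(2)[OF assms(1) resd_lincombs[OF assms(2)]] .

lemma disintegration_measurable:
  assumes G: "gaussian_family M X" and S: "finite S"
    and \<Psi>[measurable]: "\<Psi> \<in> borel_measurable (Pi\<^sub>M UNIV (\<lambda>_. borel))"
  shows "(\<lambda>p. \<Psi> (\<lambda>t. e * (\<Sum>s\<in>S. b t s * fst p s) + resd X S a t (snd p)))
      \<in> borel_measurable (Pi\<^sub>M S (\<lambda>_. lborel) \<Otimes>\<^sub>M M)"
proof -
  have [measurable]: "resd X S a t \<in> borel_measurable M" for t by (rule resd_measurable[OF G S])
  have "(\<lambda>p. (\<lambda>t. e * (\<Sum>s\<in>S. b t s * fst p s) + resd X S a t (snd p)))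
      \<in> Pi\<^sub>M S (\<lambda>_. lborel) \<Otimes>\<^sub>M M \<rightarrow>\<^sub>M Pi\<^sub>M UNIV (\<lambda>_. borel)"
    by (rule measurable_PiM_single') auto
  from measurable_compose[OF this \<Psi>] show ?thesis .
qed

lemma regr_zero: "(\<And>x. L x = 0) \<Longrightarrow> regr L U = 0"
  by (simp add: regr_def)

lemma regr_self: "expectation (\<lambda>x. (U x)\<^sup>2) > 0 \<Longrightarrow> regr U U = 1"
  by (simp add: regr_def power2_eq_square)

text \<open>Here \<open>p\<close> is the joint density of the \<open>X s\<close>, \<open>s \<in> S\<close>, whose values are written as \<open>e * w s\<close>.\<close>

definition disintegrates :: "('i \<Rightarrow> 'a \<Rightarrow> real) \<Rightarrow> 'i set \<Rightarrow> ('i \<Rightarrow> 'i \<Rightarrow> real) \<Rightarrow> (('i \<Rightarrow> real) \<Rightarrow> real) \<Rightarrow> bool" where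
  "disintegrates X S a p \<longleftrightarrow>
    (\<forall>e>0. \<forall>\<Psi>\<in>borel_measurable (Pi\<^sub>M UNIV (\<lambda>_. borel)).
      (\<integral>\<^sup>+x. \<Psi> (\<lambda>t. X t x) \<partial>M) =
      ennreal e ^ card S * (\<integral>\<^sup>+w. ennreal (p (\<lambda>s\<in>S. e * w s)) *
        (\<integral>\<^sup>+x. \<Psi> (\<lambda>t. e * (\<Sum>s\<in>S. a t s * w s) + resd X S a t x) \<partial>M) \<partial>Pi\<^sub>M S (\<lambda>_. lborel)))"

text \<open>Gram--Schmidt: the residual of a new coordinate \<open>r\<close> given \<open>S\<close>
  has positive variance, and splitting it off adds one normal factor to the density. The bound
  \<open>p0\<close>, which is the value of the density at the origin, and the limit there are
  carried along for the later dominated convergence as the scale \<open>e\<close> tends to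
  0.\<close>

lemma gaussian_disintegration:
  fixes X :: "'i \<Rightarrow> 'a \<Rightarrow> real"
  assumes G: "gaussian_family M X" and "finite S" and "nondegenerate_on M X S"
  shows "\<exists>a p p0. (\<forall>s\<in>S. \<forall>s'\<in>S. a s s' = of_bool (s = s')) \<and>
    (\<forall>t. \<forall>s\<in>S. expectation (\<lambda>x. resd X S a t x * X s x) = 0) \<and>
    p \<in> borel_measurable (Pi\<^sub>M S (\<lambda>_. lborel)) \<and> (\<forall>w. 0 \<le> p w \<and> p w \<le> p0) \<and> p0 > 0 \<and>
    (\<forall>w. ((\<lambda>e. p (\<lambda>s\<in>S. e * w s)) \<longlongrightarrow> p0) (at_right 0)) \<and>
    disintegrates X S a p"
  using assms(2,3)
proof (induction S rule: finite_induct)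
  case empty
  interpret P: product_sigma_finite "\<lambda>_::'i. lborel :: real measure" ..
  have "disintegrates X {} (\<lambda>_ _. 0) (\<lambda>_. 1)"
    by (auto simp: disintegrates_def resd_def PiM_empty)
  then show ?case by (intro exI[of _ "\<lambda>_ _. 0"] exI[of _ "\<lambda>_. 1"] exI[of _ 1]) auto
next
  case (insert r S)
  interpret P: product_sigma_finite "\<lambda>_::'i. lborel :: real measure" ..
  have nd: "nondegenerate_on M X S" by (rule nondegenerate_on_subset[OF insert.prems]) (use insert in auto)
  from insert.IH[OF nd] obtain a p p0 where
    a: "\<And>s s'. s \<in> S \<Longrightarrow> s' \<in> S \<Longrightarrow> a s s' = of_bool (s = s')"
    and orth: "\<And>t s. s \<in> S \<Longrightarrow> expectation (\<lambda>x. resd X S a t x * X s x) = 0"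
    and p[measurable]: "p \<in> borel_measurable (Pi\<^sub>M S (\<lambda>_. lborel))"
    and pb: "\<And>w. 0 \<le> p w" "\<And>w. p w \<le> p0" "p0 > 0"
    and plim: "\<And>w. ((\<lambda>e. p (\<lambda>s\<in>S. e * w s)) \<longlongrightarrow> p0) (at_right 0)"
    and dis: "disintegrates X S a p" by blast
  define Z where "Z = resd X S a"
  define U where "U = Z r"
  have Zl: "Z t \<in> lincombs X" for t unfolding Z_def by (rule resd_lincombs) fact
  have GZ: "gaussian_family M Z" by (rule gaussian_family_lincombs[OF G Zl])
  have Zm[measurable]: "Z t \<in> borel_measurable M" for t using lincombs_normal(2)[OF G Zl] .
  have Zs: "Z s x = 0" if "s \<in> S" for s x
  proof -
    have "(\<Sum>r\<in>S. a s r * X r x) = (\<Sum>r\<in>S. if r = s then X r x else 0)"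
      using that a by (intro sum.cong) auto
    then show ?thesis using that insert.hyps unfolding Z_def resd_def by simp
  qed
  define v where "v = expectation (\<lambda>x. (U x)\<^sup>2)"
  have vpos: "v > 0"
  proof (rule ccontr)
    assume "\<not> v > 0"
    moreover have "v \<ge> 0" by (simp add: v_def)
    ultimately have "v = 0" by simp
    \<comment> \<open>With zero variance this combination would vanish almost surely although its
      coefficient at \<open>r\<close> is 1.\<close>
    let ?c = "\<lambda>s. if s = r then 1 else - a r s"
    have e: "(\<Sum>s\<in>insert r S. ?c s * X s x) = U x" for x
    proof -
      have "(\<Sum>s\<in>S. ?c s * X s x) = (\<Sum>s\<in>S. - a r s * X s x)"
        using insert.hyps by (intro sum.cong) auto
      then show ?thesis unfolding U_def Z_def resd_def using insert.hyps by (simp add: sum_negf)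
    qed
    have "(\<integral>x. (\<Sum>s\<in>insert r S. ?c s * X s x)\<^sup>2 \<partial>M) = 0"
      unfolding e using \<open>v = 0\<close> by (simp add: v_def)
    then have "\<forall>s\<in>insert r S. ?c s = 0"
      using insert.prems[unfolded nondegenerate_on_def, rule_format, of ?c] by blast
    then show False by auto
  qed
  define k where "k t = regr (Z t) U" for t
  \<comment> \<open>Regression on \<open>insert r S\<close> is regression on \<open>S\<close>
    followed by regression of the residual on the innovation \<open>U\<close>.\<close>
  define a' where "a' t s = (if s = r then k t else a t s - k t * a r s)" for t s
  let ?n = "normal_density 0 (sqrt v)"
  define p' where "p' u = p (restrict u S) * ?n (u r - (\<Sum>s\<in>S. a r s * u s))" for u
  have rS: "r \<notin> S" by fact
  have sa': "(\<Sum>s\<in>insert r S. a' t s * f s) = (\<Sum>s\<in>S. a t s * f s) + k t * (f r - (\<Sum>s\<in>S. a r s * f s))" for t and f :: "'i \<Rightarrow> real"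
  proof -
    have "(\<Sum>s\<in>S. a' t s * f s) = (\<Sum>s\<in>S. a t s * f s - k t * (a r s * f s))"
      using rS by (intro sum.cong) (auto simp: a'_def algebra_simps)
    then show ?thesis using rS insert.hyps
      by (simp add: a'_def sum_subtractf sum_distrib_left algebra_simps)
  qed
  have Z': "resd X (insert r S) a' t x = Z t x - k t * U x" for t x
    unfolding resd_def sa' Z_def U_def by (simp add: algebra_simps)
  have kr: "k r = 1" unfolding k_def U_def[symmetric] using vpos v_def by (intro regr_self) simp
  have ks: "k s = 0" if "s \<in> S" for s unfolding k_def using Zs[OF that] by (rule regr_zero)
  have 1: "a' s s' = of_bool (s = s')" if "s \<in> insert r S" "s' \<in> insert r S" for s s'
    using that a rS kr ks by (auto simp: a'_def)
  have Ul: "U \<in> lincombs X" unfolding U_def by (rule Zl)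
  have 2: "expectation (\<lambda>x. resd X (insert r S) a' t x * X s x) = 0" if "s \<in> insert r S" for s t
  proof -
    have i: "integrable M (\<lambda>x. L x * L' x)" if "L \<in> lincombs X" "L' \<in> lincombs X" for L L'
      by (rule lincombs_integrable_mult[OF G that])
    have S0: "expectation (\<lambda>x. (Z t x - k t * U x) * X s x) = 0" if "s \<in> S" for s
      using orth[OF that, folded Z_def] i[OF Zl lincombs_base, of t s] i[OF Ul lincombs_base, of s]
      by (simp add: left_diff_distrib mult.assoc U_def)
    have "expectation (\<lambda>x. (Z t x - k t * U x) * X r x) = 0"
    proof -
      have ZU: "expectation (\<lambda>x. (Z t x - k t * U x) * U x) = 0"
      proof -
        have "expectation (\<lambda>x. (Z t x - k t * U x) * U x) = expectation (\<lambda>x. Z t x * U x) - k t * expectation (\<lambda>x. (U x)\<^sup>2)"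
          using i[OF Zl Ul, of t] i[OF Ul Ul] by (simp add: left_diff_distrib mult.assoc power2_eq_square)
        then show ?thesis using vpos by (simp add: k_def regr_def v_def)
      qed
      have Xr: "X r x = U x + (\<Sum>s\<in>S. a r s * X s x)" for x by (simp add: U_def Z_def resd_def)
      have dl: "(\<lambda>x. Z t x - k t * U x) \<in> lincombs X" by (intro lincombs_diff Zl lincombs_cmult Ul)
      have "expectation (\<lambda>x. (Z t x - k t * U x) * X r x) =
        expectation (\<lambda>x. (Z t x - k t * U x) * U x + (\<Sum>s\<in>S. a r s * ((Z t x - k t * U x) * X s x)))"
        unfolding Xr by (simp add: distrib_left sum_distrib_left mult_ac)
      also have "\<dots> = expectation (\<lambda>x. (Z t x - k t * U x) * U x) + (\<Sum>s\<in>S. a r s * expectation (\<lambda>x. (Z t x - k t * U x) * X s x))"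
        using i[OF dl Ul] i[OF dl lincombs_base] by simp
      also have "\<dots> = 0" using ZU S0 by simp
      finally show ?thesis .
    qed
    then show ?thesis unfolding Z' using S0 that by auto
  qed
  have restr[measurable]: "(\<lambda>u. restrict u S) \<in> Pi\<^sub>M (insert r S) (\<lambda>_. lborel) \<rightarrow>\<^sub>M Pi\<^sub>M S (\<lambda>_. lborel :: real measure)"
    by (rule measurable_restrict_subset) auto
  have 3[measurable]: "p' \<in> borel_measurable (Pi\<^sub>M (insert r S) (\<lambda>_. lborel))"
    unfolding p'_def[abs_def] by measurable
  have nle: "0 \<le> ?n y" "?n y \<le> ?n 0" for y
    using vpos by (auto simp: normal_density_def intro!: divide_right_mono)
  have n0: "?n 0 > 0" using vpos by (intro normal_density_pos) simp
  have 4: "0 \<le> p' u" "p' u \<le> p0 * ?n 0" for u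
    unfolding p'_def using pb nle by (auto intro!: mult_mono mult_nonneg_nonneg order.strict_implies_order[OF pb(3)])
  have re: "restrict (\<lambda>s\<in>insert r S. f s) S = (\<lambda>s\<in>S. f s)" for f :: "'i \<Rightarrow> real" by (auto simp: restrict_def)
  have se: "(\<Sum>s\<in>S. a r s * (\<lambda>s\<in>insert r S. e * w s) s) = e * (\<Sum>s\<in>S. a r s * w s)" for e w
    by (simp add: sum_distrib_left mult_ac)
  have p'e: "p' (\<lambda>s\<in>insert r S. e * w s) = p (\<lambda>s\<in>S. e * w s) * ?n (e * (w r - (\<Sum>s\<in>S. a r s * w s)))" for e w
    unfolding p'_def re se by (simp add: algebra_simps)
  have 5: "((\<lambda>e. p' (\<lambda>s\<in>insert r S. e * w s)) \<longlongrightarrow> p0 * ?n 0) (at_right 0)" for w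
  proof -
    have "((\<lambda>e::real. ?n (e * (w r - (\<Sum>s\<in>S. a r s * w s)))) \<longlongrightarrow> ?n (0 * (w r - (\<Sum>s\<in>S. a r s * w s)))) (at_right 0)"
      unfolding normal_density_def using vpos by (intro tendsto_intros) auto
    then show ?thesis unfolding p'e by (intro tendsto_mult plim) simp
  qed
  have 6: "disintegrates X (insert r S) a' p'"
    unfolding disintegrates_def
  proof (intro allI impI ballI)
    fix e :: real and \<Psi> :: "('i \<Rightarrow> real) \<Rightarrow> ennreal" assume e: "e > 0"
      and \<Psi>[measurable]: "\<Psi> \<in> borel_measurable (Pi\<^sub>M UNIV (\<lambda>_. borel))"
    define J where "J w = (\<integral>\<^sup>+x. \<Psi> (\<lambda>t. e * (\<Sum>s\<in>insert r S. a' t s * w s) + resd X (insert r S) a' t x) \<partial>M)" for w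
    have finS: "finite (insert r S)" using insert.hyps by simp
    have Jm[measurable]: "J \<in> borel_measurable (Pi\<^sub>M (insert r S) (\<lambda>_. lborel))"
      unfolding J_def[abs_def]
      using borel_measurable_nn_integral_fst[OF disintegration_measurable[OF G finS \<Psi>]] by simp
    have I: "(\<integral>\<^sup>+x. \<Psi> (\<lambda>t. e * (\<Sum>s\<in>S. a t s * w s) + Z t x) \<partial>M) =
       ennreal e * (\<integral>\<^sup>+y. ennreal (?n (e * (y - (\<Sum>s\<in>S. a r s * w s)))) * J (w(r := y)) \<partial>lborel)" for w
    proof -
      let ?g = "\<lambda>t. e * (\<Sum>s\<in>S. a t s * w s)"
      have shift: "(\<lambda>z. (\<lambda>t. ?g t + z t)) \<in> Pi\<^sub>M UNIV (\<lambda>_. borel) \<rightarrow>\<^sub>M Pi\<^sub>M UNIV (\<lambda>_. borel :: real measure)"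
        by (rule measurable_PiM_single') auto
      have \<Psi>w: "(\<lambda>z. \<Psi> (\<lambda>t. ?g t + z t)) \<in> borel_measurable (Pi\<^sub>M UNIV (\<lambda>_. borel))"
        by (rule measurable_compose[OF shift \<Psi>])
      have m: "(\<lambda>q. (\<lambda>t. ?g t + (k t * fst q + (Z t (snd q) - k t * U (snd q))))) \<in> borel \<Otimes>\<^sub>M M \<rightarrow>\<^sub>M Pi\<^sub>M UNIV (\<lambda>_. borel :: real measure)"
        unfolding U_def by (rule measurable_PiM_single') auto
      have m': "(\<lambda>y. \<integral>\<^sup>+x. \<Psi> (\<lambda>t. ?g t + (k t * y + (Z t x - k t * U x))) \<partial>M) \<in> borel_measurable borel"
        using borel_measurable_nn_integral_fst[OF measurable_compose[OF m \<Psi>]] by simp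
      have "(\<integral>\<^sup>+x. \<Psi> (\<lambda>t. ?g t + Z t x) \<partial>M) =
         (\<integral>\<^sup>+y. ennreal (?n y) * (\<integral>\<^sup>+x. \<Psi> (\<lambda>t. ?g t + (k t * y + (Z t x - k t * U x))) \<partial>M) \<partial>lborel)"
        using gaussian_split[OF GZ _ _ \<Psi>w, of U] lincombs_base[of Z r] vpos unfolding U_def[symmetric] v_def k_def by simp
      \<comment> \<open>The substitution sets \<open>U\<close> to
        \<open>e * y - e * (\<Sum>s\<in>S. a r s * w s)\<close>, which makes \<open>e * y\<close>
        the value of \<open>X r\<close>; its Jacobian is the additional factor
        \<open>e\<close>.\<close>
      also have "\<dots> = ennreal \<bar>e\<bar> * (\<integral>\<^sup>+y. ennreal (?n (- ?g r + e * y)) *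
          (\<integral>\<^sup>+x. \<Psi> (\<lambda>t. ?g t + (k t * (- ?g r + e * y) + (Z t x - k t * U x))) \<partial>M) \<partial>lborel)"
        by (rule nn_integral_real_affine) (use m' e in auto)
      also have "\<dots> = ennreal e * (\<integral>\<^sup>+y. ennreal (?n (e * (y - (\<Sum>s\<in>S. a r s * w s)))) * J (w(r := y)) \<partial>lborel)"
      proof -
        have ws: "(\<Sum>s\<in>S. c s * (w(r := y)) s) = (\<Sum>s\<in>S. c s * w s)" for c :: "'i \<Rightarrow> real" and y
          using rS by (intro sum.cong) auto
        have "?g t + (k t * (- ?g r + e * y) + (Z t x - k t * U x)) =
          e * (\<Sum>s\<in>insert r S. a' t s * (w(r := y)) s) + resd X (insert r S) a' t x" for t x y
          unfolding Z' sa' ws by (simp add: algebra_simps)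
        then show ?thesis using e unfolding J_def by (simp add: algebra_simps)
      qed
      finally show ?thesis .
    qed
    have "(\<integral>\<^sup>+x. \<Psi> (\<lambda>t. X t x) \<partial>M) = ennreal e ^ card S * (\<integral>\<^sup>+w. ennreal (p (\<lambda>s\<in>S. e * w s)) *
        (\<integral>\<^sup>+x. \<Psi> (\<lambda>t. e * (\<Sum>s\<in>S. a t s * w s) + Z t x) \<partial>M) \<partial>Pi\<^sub>M S (\<lambda>_. lborel))"
      using dis e \<Psi> unfolding disintegrates_def Z_def by blast
    also have "\<dots> = ennreal e ^ card S * (\<integral>\<^sup>+w. ennreal e * (\<integral>\<^sup>+y. ennreal (p' (\<lambda>s\<in>insert r S. e * (w(r := y)) s)) * J (w(r := y)) \<partial>lborel) \<partial>Pi\<^sub>M S (\<lambda>_. lborel))"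
    proof (intro arg_cong[where f="\<lambda>z. _ * z"] nn_integral_cong)
      fix w :: "'i \<Rightarrow> real" assume w: "w \<in> space (Pi\<^sub>M S (\<lambda>_. lborel))"
      have p'w: "p' (\<lambda>s\<in>insert r S. e * (w(r := y)) s) = p (\<lambda>s\<in>S. e * w s) * ?n (e * (y - (\<Sum>s\<in>S. a r s * w s)))" for y
      proof -
        have "(\<lambda>s\<in>S. e * (w(r := y)) s) = (\<lambda>s\<in>S. e * w s)" using rS by (auto simp: restrict_def)
        moreover have "(\<Sum>s\<in>S. a r s * (w(r := y)) s) = (\<Sum>s\<in>S. a r s * w s)"
          using rS by (intro sum.cong) auto
        ultimately show ?thesis unfolding p'e by simp
      qed
      have wm: "(\<lambda>y. w(r := y)) \<in> lborel \<rightarrow>\<^sub>M Pi\<^sub>M (insert r S) (\<lambda>_. lborel)"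
        using measurable_component_update[OF w rS] by simp
      have Jw: "(\<lambda>y. J (w(r := y))) \<in> borel_measurable lborel" by (rule measurable_compose[OF wm Jm])
      show "ennreal (p (\<lambda>s\<in>S. e * w s)) * (\<integral>\<^sup>+x. \<Psi> (\<lambda>t. e * (\<Sum>s\<in>S. a t s * w s) + Z t x) \<partial>M) =
          ennreal e * (\<integral>\<^sup>+y. ennreal (p' (\<lambda>s\<in>insert r S. e * (w(r := y)) s)) * J (w(r := y)) \<partial>lborel)"
        unfolding I p'w using Jw pb nle
        by (subst nn_integral_cmult[symmetric], simp)
          (simp add: ennreal_mult mult.left_commute mult.assoc nn_integral_cmult[symmetric] del: nn_integral_cmult)
    qed
    also have "\<dots> = ennreal e ^ card (insert r S) * (\<integral>\<^sup>+w. (\<integral>\<^sup>+y. ennreal (p' (\<lambda>s\<in>insert r S. e * (w(r := y)) s)) * J (w(r := y)) \<partial>lborel) \<partial>Pi\<^sub>M S (\<lambda>_. lborel))"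
    proof -
      have sc: "(\<lambda>w. (\<lambda>s\<in>insert r S. e * w s)) \<in> Pi\<^sub>M (insert r S) (\<lambda>_. lborel) \<rightarrow>\<^sub>M Pi\<^sub>M (insert r S) (\<lambda>_. lborel)"
        by (rule measurable_restrict) auto
      have *: "(\<lambda>w. ennreal (p' (\<lambda>s\<in>insert r S. e * w s)) * J w) \<in> borel_measurable (Pi\<^sub>M (insert r S) (\<lambda>_. lborel))"
        using measurable_compose[OF sc 3] by measurable
      have up: "(\<lambda>q. (fst q)(r := snd q)) \<in> Pi\<^sub>M S (\<lambda>_. lborel) \<Otimes>\<^sub>M lborel \<rightarrow>\<^sub>M Pi\<^sub>M (insert r S) (\<lambda>_. lborel :: real measure)"
        using measurable_add_dim[of r S "\<lambda>_. lborel :: real measure"] by (simp add: split_beta')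
      have "(\<lambda>w. \<integral>\<^sup>+y. ennreal (p' (\<lambda>s\<in>insert r S. e * (w(r := y)) s)) * J (w(r := y)) \<partial>lborel) \<in> borel_measurable (Pi\<^sub>M S (\<lambda>_. lborel))"
        using lborel.borel_measurable_nn_integral_fst[OF measurable_compose[OF up *]] by simp
      then show ?thesis using insert.hyps by (simp add: nn_integral_cmult mult_ac)
    qed
    also have "\<dots> = ennreal e ^ card (insert r S) * (\<integral>\<^sup>+w. ennreal (p' (\<lambda>s\<in>insert r S. e * w s)) * J w \<partial>Pi\<^sub>M (insert r S) (\<lambda>_. lborel))"
    proof -
      have sc: "(\<lambda>w. (\<lambda>s\<in>insert r S. e * w s)) \<in> Pi\<^sub>M (insert r S) (\<lambda>_. lborel) \<rightarrow>\<^sub>M Pi\<^sub>M (insert r S) (\<lambda>_. lborel)"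
        by (rule measurable_restrict) auto
      have *: "(\<lambda>w. ennreal (p' (\<lambda>s\<in>insert r S. e * w s)) * J w) \<in> borel_measurable (Pi\<^sub>M (insert r S) (\<lambda>_. lborel))"
        using measurable_compose[OF sc 3] by measurable
      show ?thesis by (subst P.product_nn_integral_insert[OF insert.hyps(1) rS *]) simp
    qed
    finally show "(\<integral>\<^sup>+x. \<Psi> (\<lambda>t. X t x) \<partial>M) =
      ennreal e ^ card (insert r S) * (\<integral>\<^sup>+w. ennreal (p' (\<lambda>s\<in>insert r S. e * w s)) *
        (\<integral>\<^sup>+x. \<Psi> (\<lambda>t. e * (\<Sum>s\<in>insert r S. a' t s * w s) + resd X (insert r S) a' t x) \<partial>M) \<partial>Pi\<^sub>M (insert r S) (\<lambda>_. lborel))"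
      unfolding J_def .
  qed
  show ?case
    using 1 2 3 4 5 6 mult_pos_pos[OF pb(3) n0]
    by (intro exI[of _ a'] exI[of _ p'] exI[of _ "p0 * ?n 0"]) blast
qed

text \<open>Only the law of the single coordinate \<open>U\<close> is touched: translating it by
  \<open>u\<close> times its variance multiplies its normal density by an exponential and moves each
  \<open>X t\<close> by \<open>u\<close> times its covariance with \<open>U\<close>.\<close>

lemma cameron_martin:
  assumes G: "gaussian_family M X" and S: "finite S"
    and U: "U = (\<lambda>x. \<Sum>s\<in>S. \<theta> s * X s x)"
    and pos: "expectation (\<lambda>x. (U x)\<^sup>2) > 0"
    and \<Psi>[measurable]: "\<Psi> \<in> borel_measurable (Pi\<^sub>M UNIV (\<lambda>_. borel))"
  shows "(\<integral>\<^sup>+x. \<Psi> (\<lambda>t. X t x) \<partial>M) =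
    (\<integral>\<^sup>+x. \<Psi> (\<lambda>t. X t x + u * expectation (\<lambda>x. X t x * U x)) *
      ennreal (exp (- u * U x - u\<^sup>2 * expectation (\<lambda>x. (U x)\<^sup>2) / 2)) \<partial>M)"
proof -
  define v where "v = expectation (\<lambda>x. (U x)\<^sup>2)"
  define k where "k t = regr (X t) U" for t
  let ?n = "normal_density 0 (sqrt v)"
  have Ul: "U \<in> lincombs X" unfolding U by (rule lincombsI[OF S])
  have [measurable]: "X t \<in> borel_measurable M" for t by (rule lincombs_normal(2)[OF G lincombs_base])
  have [measurable]: "U \<in> borel_measurable M" by (rule lincombs_normal(2)[OF G Ul])
  have v: "v > 0" using pos by (simp add: v_def)
  have km: "expectation (\<lambda>x. X t x * U x) = v * k t" for t
    using v by (simp add: k_def regr_def v_def)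
  \<comment> \<open>The exponential weight has to be a function of the coordinates alone. This
    identity allows \<open>\<Sum>s\<in>S. \<theta> s * z s\<close> to recover the value
    \<open>y\<close> given to \<open>U\<close> in the split.\<close>
  have \<theta>k: "(\<Sum>s\<in>S. \<theta> s * k s) = 1"
  proof -
    have "v = expectation (\<lambda>x. \<Sum>s\<in>S. \<theta> s * (X s x * U x))"
      unfolding v_def power2_eq_square
      by (intro Bochner_Integration.integral_cong) (auto simp: U sum_distrib_right mult_ac)
    also have "\<dots> = (\<Sum>s\<in>S. \<theta> s * expectation (\<lambda>x. X s x * U x))"
      using lincombs_integrable_mult[OF G lincombs_base Ul] by simp
    also have "\<dots> = v * (\<Sum>s\<in>S. \<theta> s * k s)"
      unfolding km by (simp add: sum_distrib_left mult_ac)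
    finally show ?thesis using v by simp
  qed
  define \<Phi> where "\<Phi> z = \<Psi> (\<lambda>t. z t + u * (v * k t)) * ennreal (exp (- u * (\<Sum>s\<in>S. \<theta> s * z s) - u\<^sup>2 * v / 2))" for z
  have shift: "(\<lambda>z. (\<lambda>t. z t + u * (v * k t))) \<in> Pi\<^sub>M UNIV (\<lambda>_. borel) \<rightarrow>\<^sub>M Pi\<^sub>M UNIV (\<lambda>_. borel :: real measure)"
    by (rule measurable_PiM_single') auto
  have \<Phi>m: "\<Phi> \<in> borel_measurable (Pi\<^sub>M UNIV (\<lambda>_. borel))"
    unfolding \<Phi>_def[abs_def] using measurable_compose[OF shift \<Psi>] by measurable
  have m: "(\<lambda>q. (\<lambda>t. k t * fst q + (X t (snd q) - k t * U (snd q)))) \<in> borel \<Otimes>\<^sub>M M \<rightarrow>\<^sub>M Pi\<^sub>M UNIV (\<lambda>_. borel :: real measure)"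
    by (rule measurable_PiM_single') auto
  have m': "(\<lambda>y. \<integral>\<^sup>+x. \<Psi> (\<lambda>t. k t * y + (X t x - k t * U x)) \<partial>M) \<in> borel_measurable borel"
    using borel_measurable_nn_integral_fst[OF measurable_compose[OF m \<Psi>]] by simp
  have "(\<integral>\<^sup>+x. \<Psi> (\<lambda>t. X t x) \<partial>M) = (\<integral>\<^sup>+y. ennreal (?n y) * (\<integral>\<^sup>+x. \<Psi> (\<lambda>t. k t * y + (X t x - k t * U x)) \<partial>M) \<partial>lborel)"
    unfolding k_def v_def by (rule gaussian_split[OF G Ul pos \<Psi>])
  also have "\<dots> = ennreal \<bar>1\<bar> * (\<integral>\<^sup>+y. ennreal (?n (u * v + 1 * y)) *
      (\<integral>\<^sup>+x. \<Psi> (\<lambda>t. k t * (u * v + 1 * y) + (X t x - k t * U x)) \<partial>M) \<partial>lborel)"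
    by (rule nn_integral_real_affine) (use m' in auto)
  also have "\<dots> = (\<integral>\<^sup>+y. ennreal (?n y) * (\<integral>\<^sup>+x. \<Phi> (\<lambda>t. k t * y + (X t x - k t * U x)) \<partial>M) \<partial>lborel)"
  proof -
    have n: "?n (u * v + y) = ?n y * exp (- u * y - u\<^sup>2 * v / 2)" for y
    proof -
      have "- (u * v + y)\<^sup>2 / (2 * v) = - y\<^sup>2 / (2 * v) + (- u * y - u\<^sup>2 * v / 2)"
        using v by (simp add: field_simps power2_eq_square)
      then show ?thesis using v unfolding normal_density_def by (simp flip: exp_add)
    qed
    have th: "(\<Sum>s\<in>S. \<theta> s * (k s * y + (X s x - k s * U x))) = y" for x y
    proof -
      have "(\<Sum>s\<in>S. \<theta> s * (k s * y + (X s x - k s * U x))) =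
        (\<Sum>s\<in>S. \<theta> s * k s) * y + (\<Sum>s\<in>S. \<theta> s * X s x) - (\<Sum>s\<in>S. \<theta> s * k s) * U x"
        by (simp add: sum.distrib sum_subtractf sum_distrib_right sum_distrib_left algebra_simps)
      then show ?thesis using \<theta>k by (simp add: U)
    qed
    have "(\<integral>\<^sup>+x. \<Phi> (\<lambda>t. k t * y + (X t x - k t * U x)) \<partial>M) =
        ennreal (exp (- u * y - u\<^sup>2 * v / 2)) * (\<integral>\<^sup>+x. \<Psi> (\<lambda>t. k t * (u * v + 1 * y) + (X t x - k t * U x)) \<partial>M)" for y
    proof -
      have mm: "(\<lambda>x. (\<lambda>t. k t * (u * v + 1 * y) + (X t x - k t * U x))) \<in> M \<rightarrow>\<^sub>M Pi\<^sub>M UNIV (\<lambda>_. borel :: real measure)"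
        by (rule measurable_PiM_single') auto
      have e: "(\<lambda>t. k t * y + (X t x - k t * U x) + u * (v * k t)) = (\<lambda>t. k t * (u * v + 1 * y) + (X t x - k t * U x))" for x
        by (simp add: algebra_simps)
      show ?thesis unfolding \<Phi>_def th e
        using measurable_compose[OF mm \<Psi>] by (subst nn_integral_multc) (auto simp: mult.commute)
    qed
    then show ?thesis using n by (simp add: ennreal_mult mult.assoc)
  qed
  also have "\<dots> = (\<integral>\<^sup>+x. \<Phi> (\<lambda>t. X t x) \<partial>M)"
    unfolding k_def v_def by (rule gaussian_split[OF G Ul pos \<Phi>m, symmetric])
  finally show ?thesis unfolding \<Phi>_def km v_def[symmetric] by (simp add: U)
qed

end

section \<open>Conditional expectation as linear regression\<close>

context prob_space
begin

text \<open>In the disintegration the conditioning variables are the integration variables \<open>w\<close>, on which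
  the law of the residual does not depend.\<close>

lemma resd_orthogonal_indicator:
  fixes X :: "real \<Rightarrow> 'a \<Rightarrow> real"
  assumes G: "gaussian_family M X" and S: "finite S"
    and \<delta>: "\<And>s s'. s \<in> S \<Longrightarrow> s' \<in> S \<Longrightarrow> a s s' = of_bool (s = s')"
    and dis: "disintegrates X S a p" and p: "p \<in> borel_measurable (Pi\<^sub>M S (\<lambda>_. lborel))"
    and B: "B \<in> sets (Pi\<^sub>M S (\<lambda>_. borel))"
  shows "(\<integral>x. indicator B (\<lambda>s\<in>S. X s x) * resd X S a t x \<partial>M) = 0"
proof -
  define Z where "Z = resd X S a"
  have Zl: "Z t \<in> lincombs X" for t unfolding Z_def by (rule resd_lincombs[OF S])
  have Zi: "integrable M (Z t)" "expectation (Z t) = 0" "Z t \<in> borel_measurable M" for t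
    using lincombs_normal[OF G Zl] by auto
  note Zi(3)[measurable]
  have Xm[measurable]: "X t \<in> borel_measurable M" for t by (rule lincombs_normal(2)[OF G lincombs_base])
  have B'[measurable]: "B \<in> sets (Pi\<^sub>M S (\<lambda>_. borel :: real measure))" by (rule B)
  have rm[measurable]: "(\<lambda>z. \<lambda>s\<in>S. z s) \<in> Pi\<^sub>M UNIV (\<lambda>_::real. borel :: real measure) \<rightarrow>\<^sub>M Pi\<^sub>M S (\<lambda>_. borel)"
    by (rule measurable_restrict) auto
  have Xr[measurable]: "(\<lambda>x. \<lambda>s\<in>S. X s x) \<in> M \<rightarrow>\<^sub>M Pi\<^sub>M S (\<lambda>_. borel)"
    by (rule measurable_restrict) auto
  have Zs: "Z s x = 0" if "s \<in> S" for s x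
  proof -
    have "(\<Sum>r\<in>S. a s r * X r x) = (\<Sum>r\<in>S. if r = s then X r x else 0)"
      using that \<delta> by (intro sum.cong) auto
    then show ?thesis using that S unfolding Z_def resd_def by simp
  qed
  have as: "(\<Sum>r\<in>S. a s r * w r) = w s" if "s \<in> S" for s w
  proof -
    have "(\<Sum>r\<in>S. a s r * w r) = (\<Sum>r\<in>S. if r = s then w r else 0)"
      using that \<delta> by (intro sum.cong) auto
    then show ?thesis using that S by simp
  qed
  \<comment> \<open>Since \<open>ennreal\<close> sends negative reals to 0, the sign
    \<open>\<sigma>\<close> selects the positive or the negative part. After the disintegration the
    indicator depends on \<open>w\<close> alone, so the integral factors; the two parts of the
    centred \<open>Z t\<close> have equal mass and will cancel.\<close>
  have part: "(\<integral>\<^sup>+x. indicator B (\<lambda>s\<in>S. X s x) * ennreal (\<sigma> * Z t x) \<partial>M) =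
      (\<integral>\<^sup>+w. ennreal (p w) * indicator B w \<partial>Pi\<^sub>M S (\<lambda>_. lborel)) * (\<integral>\<^sup>+x. ennreal (\<sigma> * Z t x) \<partial>M)" for \<sigma>
  proof -
    define \<Psi> where "\<Psi> z = indicator B (\<lambda>s\<in>S. z s) * ennreal (\<sigma> * (z t - (\<Sum>s\<in>S. a t s * z s)))" for z
    have \<Psi>m: "\<Psi> \<in> borel_measurable (Pi\<^sub>M UNIV (\<lambda>_. borel))" unfolding \<Psi>_def[abs_def] by measurable
    have "(\<integral>\<^sup>+x. \<Psi> (\<lambda>t. X t x) \<partial>M) = ennreal 1 ^ card S * (\<integral>\<^sup>+w. ennreal (p (\<lambda>s\<in>S. 1 * w s)) *
        (\<integral>\<^sup>+x. \<Psi> (\<lambda>t. 1 * (\<Sum>s\<in>S. a t s * w s) + resd X S a t x) \<partial>M) \<partial>Pi\<^sub>M S (\<lambda>_. lborel))"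
      by (rule dis[unfolded disintegrates_def, rule_format]) (use \<Psi>m in auto)
    also have "\<dots> = (\<integral>\<^sup>+w. ennreal (p w) * indicator B w * (\<integral>\<^sup>+x. ennreal (\<sigma> * Z t x) \<partial>M) \<partial>Pi\<^sub>M S (\<lambda>_. lborel))"
    proof -
      have "ennreal (p (\<lambda>s\<in>S. 1 * w s)) * (\<integral>\<^sup>+x. \<Psi> (\<lambda>t. 1 * (\<Sum>s\<in>S. a t s * w s) + resd X S a t x) \<partial>M) =
         ennreal (p w) * indicator B w * (\<integral>\<^sup>+x. ennreal (\<sigma> * Z t x) \<partial>M)"
        if w: "w \<in> space (Pi\<^sub>M S (\<lambda>_. lborel))" for w
      proof -
        have e: "(\<lambda>s\<in>S. w s) = w" using w by (auto simp: space_PiM PiE_iff extensional_restrict)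
        have e2: "(\<lambda>s\<in>S. (\<Sum>r\<in>S. a s r * w r) + Z s x) = w" for x
        proof -
          have "(\<lambda>s\<in>S. (\<Sum>r\<in>S. a s r * w r) + Z s x) = (\<lambda>s\<in>S. w s)"
            by (rule restrict_ext) (simp add: as Zs)
          then show ?thesis using e by simp
        qed
        have e3: "(\<Sum>s\<in>S. a t s * ((\<Sum>r\<in>S. a s r * w r) + Z s x)) = (\<Sum>s\<in>S. a t s * w s)" for x
          using as Zs by (intro sum.cong) auto
        have "\<Psi> (\<lambda>t. 1 * (\<Sum>s\<in>S. a t s * w s) + resd X S a t x) = indicator B w * ennreal (\<sigma> * Z t x)" for x
          unfolding \<Psi>_def mult_1 Z_def[symmetric] e2 e3 by simp
        then show ?thesis by (simp add: e nn_integral_cmult mult.assoc)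
      qed
      then show ?thesis by (simp cong: nn_integral_cong)
    qed
    also have "\<dots> = (\<integral>\<^sup>+w. ennreal (p w) * indicator B w \<partial>Pi\<^sub>M S (\<lambda>_. lborel)) * (\<integral>\<^sup>+x. ennreal (\<sigma> * Z t x) \<partial>M)"
    proof (rule nn_integral_multc)
      have "sets (Pi\<^sub>M S (\<lambda>_. lborel)) = sets (Pi\<^sub>M S (\<lambda>_. borel :: real measure))" by (rule sets_PiM_cong) auto
      then show "(\<lambda>w. ennreal (p w) * indicator B w) \<in> borel_measurable (Pi\<^sub>M S (\<lambda>_. lborel))"
        using p B by measurable
    qed
    finally show ?thesis unfolding \<Psi>_def Z_def resd_def .
  qed
  have half: "(\<integral>\<^sup>+x. ennreal (1 * Z t x) \<partial>M) = (\<integral>\<^sup>+x. ennreal (- 1 * Z t x) \<partial>M)"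
  proof -
    have i: "integrable M (\<lambda>x. max 0 (Z t x))" "integrable M (\<lambda>x. max 0 (- Z t x))" using Zi by auto
    have "(\<integral>\<^sup>+x. ennreal (max 0 (Z t x)) \<partial>M) = ennreal (expectation (\<lambda>x. max 0 (Z t x)))"
      by (rule nn_integral_eq_integral[OF i(1)]) simp
    moreover have "(\<integral>\<^sup>+x. ennreal (max 0 (- Z t x)) \<partial>M) = ennreal (expectation (\<lambda>x. max 0 (- Z t x)))"
      by (rule nn_integral_eq_integral[OF i(2)]) simp
    moreover have "expectation (\<lambda>x. max 0 (Z t x)) - expectation (\<lambda>x. max 0 (- Z t x)) = expectation (\<lambda>x. max 0 (Z t x) - max 0 (- Z t x))"
      using i by simp
    moreover have "expectation (\<lambda>x. max 0 (Z t x) - max 0 (- Z t x)) = expectation (Z t)"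
      by (intro Bochner_Integration.integral_cong) auto
    moreover have "ennreal (max 0 y) = ennreal y" for y by (simp add: max_def ennreal_neg)
    ultimately show ?thesis using Zi(2) by simp
  qed
  have iB: "integrable M (\<lambda>x. indicator B (\<lambda>s\<in>S. X s x) * Z t x)"
    using Zi(1)[of t] by (rule Bochner_Integration.integrable_bound) (auto simp: indicator_def)
  have "ennreal (\<sigma> * (indicator B y * Z t x)) = indicator B y * ennreal (\<sigma> * Z t x)" for \<sigma> x y
    by (auto simp: indicator_def)
  then have "(\<integral>\<^sup>+x. ennreal (1 * (indicator B (\<lambda>s\<in>S. X s x) * Z t x)) \<partial>M) =
     (\<integral>\<^sup>+x. ennreal (- 1 * (indicator B (\<lambda>s\<in>S. X s x) * Z t x)) \<partial>M)"
    using part[of 1] part[of "-1"] half by (simp only:)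
  then show ?thesis
    using integrable_mult_indicator iB by (subst real_lebesgue_integral_def) (auto simp: Z_def)
qed

text \<open>\<open>cond_coeff\<close> is a choice among the coefficient vectors that represent the
  conditional expectation. The regression coefficients are one of them, and nondegeneracy leaves no
  other on \<open>S\<close>.\<close>

lemma cond_coeff_eq:
  fixes X :: "real \<Rightarrow> 'a \<Rightarrow> real"
  assumes G: "gaussian_family M X" and S: "finite S" and nd: "nondegenerate_on M X S"
    and \<delta>: "\<And>s s'. s \<in> S \<Longrightarrow> s' \<in> S \<Longrightarrow> a s s' = of_bool (s = s')"
    and dis: "disintegrates X S a p" and p: "p \<in> borel_measurable (Pi\<^sub>M S (\<lambda>_. lborel))"
    and s: "s \<in> S"
  shows "cond_coeff M X S t s = a t s"
proof -
  have Xm[measurable]: "X t \<in> borel_measurable M" for t by (rule lincombs_normal(2)[OF G lincombs_base])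
  let ?\<F> = "generated_sigma M X S" and ?r = "\<lambda>x. \<lambda>s\<in>S. X s x"
  have Xr[measurable]: "?r \<in> M \<rightarrow>\<^sub>M Pi\<^sub>M S (\<lambda>_. borel)"
    by (rule measurable_restrict) auto
  have spF: "space ?\<F> = space M" by (simp add: generated_sigma_def)
  have setsF: "sets ?\<F> = {?r -` B \<inter> space M | B. B \<in> sets (Pi\<^sub>M S (\<lambda>_. borel))}"
    unfolding generated_sigma_def by (rule sets_vimage_algebra2) (auto simp: space_PiM)
  have "subalgebra M ?\<F>"
    unfolding subalgebra_def spF setsF using measurable_sets[OF Xr] by auto
  then interpret F: finite_measure_subalgebra M ?\<F> by unfold_locales
  have rF: "?r \<in> ?\<F> \<rightarrow>\<^sub>M Pi\<^sub>M S (\<lambda>_. borel)"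
    unfolding generated_sigma_def by (rule measurable_vimage_algebra1) (auto simp: space_PiM)
  have XsF: "X s \<in> borel_measurable ?\<F>" if "s \<in> S" for s
    using measurable_compose[OF rF measurable_component_singleton[OF that]] that by simp
  have Xi: "integrable M (X t)" for t by (rule lincombs_normal(3)[OF G lincombs_base])
  have ce: "AE x in M. real_cond_exp M ?\<F> (X t) x = (\<Sum>s\<in>S. a t s * X s x)"
  proof (rule F.real_cond_exp_charact)
    fix A assume "A \<in> sets ?\<F>"
    then obtain B where B: "B \<in> sets (Pi\<^sub>M S (\<lambda>_. borel))" and A: "A = ?r -` B \<inter> space M"
      unfolding setsF by auto
    have Am[measurable]: "A \<in> sets M" unfolding A by (rule measurable_sets[OF Xr B])
    have i1: "integrable M (\<lambda>x. indicator A x * X t x)"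
      using integrable_mult_indicator[OF Am Xi[of t]] by simp
    have i2: "integrable M (\<lambda>x. indicator A x * (\<Sum>s\<in>S. a t s * X s x))"
      using integrable_mult_indicator[OF Am, of "\<lambda>x. \<Sum>s\<in>S. a t s * X s x"] Xi by simp
    have "(\<integral>x. indicator A x * X t x - indicator A x * (\<Sum>s\<in>S. a t s * X s x) \<partial>M) =
      (\<integral>x. indicator B (?r x) * resd X S a t x \<partial>M)"
      by (intro Bochner_Integration.integral_cong) (auto simp: A indicator_def resd_def)
    also have "\<dots> = 0" by (rule resd_orthogonal_indicator[OF G S \<delta> dis p B])
    finally show "(\<integral>x\<in>A. X t x \<partial>M) = (\<integral>x\<in>A. (\<Sum>s\<in>S. a t s * X s x) \<partial>M)"
      using i1 i2 by (simp add: set_lebesgue_integral_def)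
  next
    show "integrable M (X t)" by (rule Xi)
    show "integrable M (\<lambda>x. \<Sum>s\<in>S. a t s * X s x)" using Xi by auto
    show "(\<lambda>x. \<Sum>s\<in>S. a t s * X s x) \<in> borel_measurable ?\<F>" using XsF by measurable
  qed
  have "AE x in M. real_cond_exp M ?\<F> (X t) x = (\<Sum>s\<in>S. cond_coeff M X S t s * X s x)"
    unfolding cond_coeff_def by (rule someI[of _ "a t"]) (rule ce)
  with ce have "AE x in M. (\<Sum>s\<in>S. (cond_coeff M X S t s - a t s) * X s x) = 0"
    by eventually_elim (simp add: left_diff_distrib sum_subtractf)
  then have "(\<integral>x. (\<Sum>s\<in>S. (cond_coeff M X S t s - a t s) * X s x)\<^sup>2 \<partial>M) = 0"
    by (intro integral_eq_zero_AE) auto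
  then show ?thesis
    using nd[unfolded nondegenerate_on_def, rule_format, of "\<lambda>s. cond_coeff M X S t s - a t s" s] s by simp
qed

end

section \<open>The path space\<close>

lemma uniform_limit_sum':
  fixes f :: "'i \<Rightarrow> 'x \<Rightarrow> 'y \<Rightarrow> 'z::real_normed_vector"
  assumes "\<And>i. i \<in> I \<Longrightarrow> uniform_limit X (f i) (l i) F"
  shows "uniform_limit X (\<lambda>z t. \<Sum>i\<in>I. f i z t) (\<lambda>t. \<Sum>i\<in>I. l i t) F"
  using assms
  by (induction I rule: infinite_finite_induct) (auto intro: uniform_limit_const uniform_limit_add)

lemma mspace_C_space: "mspace (C_space a b) = {f. f \<in> extensional {a..b} \<and> continuous_on {a..b} f}"
proof -
  have "Met_TC.mbounded (f ` {a..b})" if "continuous_on {a..b} f" for f :: "real \<Rightarrow> real"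
    using compact_imp_bounded[OF compact_continuous_image[OF that]] by (simp add: mbounded_iff_bounded)
  then show ?thesis
    unfolding C_space_def mspace_cfunspace
    by (auto simp: mtopology_of_euclidean continuous_map_iff_continuous)
qed

lemma mdist_C_space_le:
  assumes "a \<le> b" "f \<in> mspace (C_space a b)" "g \<in> mspace (C_space a b)"
  shows "mdist (C_space a b) f g \<le> c \<longleftrightarrow> (\<forall>t\<in>{a..b}. \<bar>f t - g t\<bar> \<le> c)"
proof -
  have "f \<in> mspace (funspace {a..b} euclidean_metric)" "g \<in> mspace (funspace {a..b} euclidean_metric)"
    using assms(2,3) cfunspace_subset_funspace[of "top_of_set {a..b}" euclidean_metric]
    unfolding C_space_def by auto
  from funspace_mdist_le[OF this, of c] assms(1) show ?thesis
    unfolding C_space_def mdist_cfunspace_eq_mdist_funspace by (auto simp: dist_real_def)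
qed

lemma restrict_in_C_space [simp]:
  "continuous_on {a..b} x \<Longrightarrow> restrict x {a..b} \<in> mspace (C_space a b)"
  by (auto simp: mspace_C_space cong: continuous_on_cong_simp)

lemma C_space_continuous_tendsto:
  assumes ab: "a \<le> b" and f: "continuous_map (mtopology_of (C_space a b)) euclideanreal f"
    and g: "\<forall>\<^sub>F n in F. continuous_on {a..b} (g n)" and g0: "continuous_on {a..b} g0"
    and lim: "uniform_limit {a..b} g g0 F"
  shows "((\<lambda>n. f (restrict (g n) {a..b})) \<longlongrightarrow> f (restrict g0 {a..b})) F"
proof -
  interpret C: Metric_space "mspace (C_space a b)" "mdist (C_space a b)"
    by (rule Metric_space_mspace_mdist)
  have "limitin (mtopology_of (C_space a b)) (\<lambda>n. restrict (g n) {a..b}) (restrict g0 {a..b}) F"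
    unfolding mtopology_of_def C.limitin_metric
  proof (intro conjI allI impI)
    show "restrict g0 {a..b} \<in> mspace (C_space a b)" using g0 by simp
    fix e :: real assume e: "e > 0"
    have "\<forall>\<^sub>F n in F. \<forall>t\<in>{a..b}. dist (g n t) (g0 t) < e / 2"
      using uniform_limitD[OF lim, of "e / 2"] e by simp
    with g show "\<forall>\<^sub>F n in F. restrict (g n) {a..b} \<in> mspace (C_space a b) \<and>
        mdist (C_space a b) (restrict (g n) {a..b}) (restrict g0 {a..b}) < e"
    proof eventually_elim
      case (elim n)
      have "mdist (C_space a b) (restrict (g n) {a..b}) (restrict g0 {a..b}) \<le> e / 2"
        using elim g0 ab by (subst mdist_C_space_le) (auto simp: dist_real_def intro: less_imp_le)
      with e elim show ?case by simp
    qed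
  qed
  from continuous_map_limit[OF f this] show ?thesis
    by (simp add: comp_def)
qed

text \<open>The distance is symmetric, so the one-sided estimate already says that
  \<open>\<phi>\<close> is Lipschitz with constant 1.\<close>

lemma continuous_map_C_spaceI:
  assumes "a \<le> b" and L: "\<And>f g. f \<in> mspace (C_space a b) \<Longrightarrow> g \<in> mspace (C_space a b) \<Longrightarrow> \<phi> f \<le> \<phi> g + mdist (C_space a b) f g"
  shows "continuous_map (mtopology_of (C_space a b)) euclideanreal \<phi>"
proof -
  have "Lipschitz_continuous_map (C_space a b) euclidean_metric \<phi>"
    unfolding Lipschitz_continuous_map_def
  proof (intro conjI exI[of _ 1] ballI)
    fix f g assume fg: "f \<in> mspace (C_space a b)" "g \<in> mspace (C_space a b)"
    have "mdist (C_space a b) f g = mdist (C_space a b) g f" by (rule mdist_commute)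
    then show "mdist euclidean_metric (\<phi> f) (\<phi> g) \<le> 1 * mdist (C_space a b) f g"
      using L[OF fg] L[OF fg(2,1)] by (simp add: dist_real_def abs_le_iff)
  qed auto
  then have "continuous_map (mtopology_of (C_space a b)) (mtopology_of euclidean_metric) \<phi>"
    by (rule Lipschitz_continuous_imp_continuous_map)
  then show ?thesis by (simp add: mtopology_of_euclidean)
qed

text \<open>The Bernstein polynomials of a path depend on finitely many of its coordinates.\<close>

lemma continuous_functional_coordinates:
  assumes ab: "a < b" and f: "continuous_map (mtopology_of (C_space a b)) euclideanreal f"
  obtains \<Psi> where "\<Psi> \<in> borel_measurable (Pi\<^sub>M UNIV (\<lambda>_::real. borel :: real measure))"
    "\<And>x. continuous_on {a..b} x \<Longrightarrow> \<Psi> x = f (restrict x {a..b})"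
proof
  define B where "B n k t = Bernstein n k ((t - a) / (b - a))" for n k t
  have Bc: "continuous_on {a..b} (B n k)" for n k
    unfolding B_def[abs_def] Bernstein_def using ab by (intro continuous_intros) auto
  define h where "h n y = f (restrict (\<lambda>t. \<Sum>k\<le>n. y k * B n k t) {a..b})" for n and y :: "nat \<Rightarrow> real"
  \<comment> \<open>\<open>h n\<close> reads only the coordinates up to \<open>n\<close>, hence it
    is continuous for the product topology; over a countable index set the Borel sets of that
    topology are the product sigma-algebra.\<close>
  have hc: "continuous_on UNIV (h n)" for n
    unfolding continuous_on_def
  proof
    fix y :: "nat \<Rightarrow> real"
    have ul: "uniform_limit {a..b} (\<lambda>z t. \<Sum>k\<le>n. z k * B n k t) (\<lambda>t. \<Sum>k\<le>n. y k * B n k t) (at y)"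
    proof (rule uniform_limit_sum')
      fix k
      have "((\<lambda>z::nat\<Rightarrow>real. z k) \<longlongrightarrow> y k) (at y)"
        using continuous_on_product_coordinates[of k] by (auto simp: continuous_on_def)
      then have "uniform_limit {a..b} (\<lambda>z t. z k) (\<lambda>t. y k) (at y)"
        by (auto simp: uniform_limit_iff tendsto_iff elim: eventually_mono)
      moreover have "bounded (B n k ` {a..b})"
        by (rule compact_imp_bounded[OF compact_continuous_image[OF Bc]]) simp
      ultimately show "uniform_limit {a..b} (\<lambda>z t. z k * B n k t) (\<lambda>t. y k * B n k t) (at y)"
        by (intro uniform_lim_mult uniform_limit_const) (auto intro: bounded_subset[of "{y k}"])
    qed
    show "(h n \<longlongrightarrow> h n y) (at y within UNIV)"
      unfolding h_def using ab ul
      by (intro C_space_continuous_tendsto f always_eventually allI continuous_intros Bc) auto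
  qed
  have hm: "h n \<in> borel_measurable (Pi\<^sub>M UNIV (\<lambda>_. borel))" for n
    using borel_measurable_continuous_onI[OF hc, of n] measurable_cong_sets[OF sets_PiM_equal_borel refl] by blast
  \<comment> \<open>\<open>lim\<close> is measurable on the whole product, and its value is
    specified only at continuous paths, where the polynomials converge. The term
    \<open>n = 0\<close> divides by zero but does not affect the limit.\<close>
  define \<Psi> where "\<Psi> x = lim (\<lambda>n. h n (\<lambda>k. x (a + (b - a) * (real k / real n))))" for x
  have sm: "(\<lambda>x. (\<lambda>k. x (a + (b - a) * (real k / real n)))) \<in> Pi\<^sub>M UNIV (\<lambda>_::real. borel :: real measure) \<rightarrow>\<^sub>M Pi\<^sub>M UNIV (\<lambda>_::nat. borel)" for n :: nat
    by (rule measurable_PiM_single') auto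
  show "\<Psi> \<in> borel_measurable (Pi\<^sub>M UNIV (\<lambda>_. borel))"
    unfolding \<Psi>_def[abs_def] using measurable_compose[OF sm hm] by (rule borel_measurable_lim_metric)
  fix x :: "real \<Rightarrow> real" assume x: "continuous_on {a..b} x"
  have "uniform_limit {a..b} (\<lambda>n t. \<Sum>k\<le>n. x (a + (b - a) * (real k / real n)) * B n k t) x sequentially"
  proof (rule uniform_limitI)
    fix e :: real assume e: "e > 0"
    have xc: "continuous_on {0..1} (\<lambda>s. x (a + (b - a) * s))"
    proof (intro continuous_on_compose2[OF x] continuous_intros image_subsetI)
      fix s :: real assume "s \<in> {0..1}"
      then have "0 \<le> (b - a) * s" "(b - a) * s \<le> (b - a) * 1"
        using ab by (auto intro: mult_left_mono)
      then show "a + (b - a) * s \<in> {a..b}" by simp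
    qed
    from Bernstein_Weierstrass[OF xc e] obtain N where
      N: "\<And>n s. N \<le> n \<Longrightarrow> s \<in> {0..1} \<Longrightarrow> \<bar>x (a + (b - a) * s) - (\<Sum>k\<le>n. x (a + (b - a) * (real k / real n)) * Bernstein n k s)\<bar> < e"
      by blast
    have "dist (\<Sum>k\<le>n. x (a + (b - a) * (real k / real n)) * B n k t) (x t) < e" if "n \<ge> N" "t \<in> {a..b}" for n t
      using N[OF that(1), of "(t - a) / (b - a)"] that(2) ab
      by (simp add: B_def dist_real_def abs_minus_commute divide_le_eq)
    then show "\<forall>\<^sub>F n in sequentially. \<forall>t\<in>{a..b}. dist (\<Sum>k\<le>n. x (a + (b - a) * (real k / real n)) * B n k t) (x t) < e"
      unfolding eventually_sequentially by blast
  qed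
  then have "(\<lambda>n. h n (\<lambda>k. x (a + (b - a) * (real k / real n)))) \<longlonglongrightarrow> f (restrict x {a..b})"
    unfolding h_def using ab
    by (intro C_space_continuous_tendsto f always_eventually allI continuous_intros Bc x) auto
  then show "\<Psi> x = f (restrict x {a..b})" unfolding \<Psi>_def by (rule limI)
qed

text \<open>An open set is the positivity set of the distance to its complement. This distance is a
  continuous functional, hence a measurable function of the coordinates \<open>X t\<close>.\<close>

lemma path_measurable:
  assumes ab: "a < b" and X: "\<And>t. X t \<in> borel_measurable M"
    and cont: "\<And>\<omega>. \<omega> \<in> space M \<Longrightarrow> continuous_on {a..b} (\<lambda>t. X t \<omega>)"
  shows "(\<lambda>\<omega>. \<lambda>t\<in>{a..b}. X t \<omega>) \<in> M \<rightarrow>\<^sub>M metric_borel (C_space a b)"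
  unfolding metric_borel_def
proof (rule measurable_sigma_sets[OF sets_measure_of])
  interpret C: Metric_space "mspace (C_space a b)" "mdist (C_space a b)"
    by (rule Metric_space_mspace_mdist)
  show "{U. openin (mtopology_of (C_space a b)) U} \<subseteq> Pow (mspace (C_space a b))"
    using openin_subset by fastforce
  show "(\<lambda>\<omega>. \<lambda>t\<in>{a..b}. X t \<omega>) \<in> space M \<rightarrow> mspace (C_space a b)"
    using cont by auto
  fix U assume "U \<in> {U. openin (mtopology_of (C_space a b)) U}"
  then have U: "openin C.mtopology U" by (simp add: mtopology_of_def)
  define K where "K = mspace (C_space a b) - U"
  \<comment> \<open>When \<open>U\<close> is the whole space there is no complement to measure the
    distance to, and any positive constant serves.\<close>
  define \<phi> where "\<phi> x = (if K = {} then 1 else INF y\<in>K. mdist (C_space a b) x y)" for x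
  have bdd: "bdd_below ((\<lambda>y. mdist (C_space a b) x y) ` K)" for x by (rule bdd_belowI[of _ 0]) auto
  have \<phi>c: "continuous_map (mtopology_of (C_space a b)) euclideanreal \<phi>"
  proof (rule continuous_map_C_spaceI)
    fix f g assume fg: "f \<in> mspace (C_space a b)" "g \<in> mspace (C_space a b)"
    show "\<phi> f \<le> \<phi> g + mdist (C_space a b) f g"
    proof (cases "K = {}")
      case False
      have "\<phi> f - mdist (C_space a b) f g \<le> mdist (C_space a b) g y" if y: "y \<in> K" for y
      proof -
        have "\<phi> f \<le> mdist (C_space a b) f y"
          unfolding \<phi>_def using False y by (auto intro: cINF_lower[OF bdd])
        also have "\<dots> \<le> mdist (C_space a b) f g + mdist (C_space a b) g y"
          using fg y by (intro C.triangle) (auto simp: K_def)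
        finally show ?thesis by simp
      qed
      then have "\<phi> f - mdist (C_space a b) f g \<le> (INF y\<in>K. mdist (C_space a b) g y)"
        using False by (intro cINF_greatest) auto
      then show ?thesis using False by (simp add: \<phi>_def)
    qed (simp add: \<phi>_def)
  qed (use ab in simp)
  have \<phi>U: "\<phi> x > 0 \<longleftrightarrow> x \<in> U" if x: "x \<in> mspace (C_space a b)" for x
  proof
    assume p: "\<phi> x > 0"
    show "x \<in> U"
    proof (rule ccontr)
      assume "x \<notin> U"
      then have xK: "x \<in> K" using x by (simp add: K_def)
      have "\<phi> x \<le> mdist (C_space a b) x x" unfolding \<phi>_def using xK by (auto intro: cINF_lower[OF bdd])
      then show False using p x by simp
    qed
  next
    assume "x \<in> U"
    with U obtain r where r: "r > 0" "C.mball x r \<subseteq> U" by (auto simp: C.openin_mtopology)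
    show "\<phi> x > 0"
    proof (cases "K = {}")
      case False
      have "r \<le> mdist (C_space a b) x y" if "y \<in> K" for y
        using r(2) that x by (force simp: K_def C.mball_def)
      then have "r \<le> (INF y\<in>K. mdist (C_space a b) x y)" using False by (intro cINF_greatest) auto
      then show ?thesis using r False by (simp add: \<phi>_def)
    qed (simp add: \<phi>_def)
  qed
  obtain \<Psi> where \<Psi>[measurable]: "\<Psi> \<in> borel_measurable (Pi\<^sub>M UNIV (\<lambda>_::real. borel :: real measure))"
    and \<Psi>\<phi>: "\<And>x. continuous_on {a..b} x \<Longrightarrow> \<Psi> x = \<phi> (restrict x {a..b})"
    using continuous_functional_coordinates[OF ab \<phi>c] by metis
  have [measurable]: "(\<lambda>\<omega> t. X t \<omega>) \<in> M \<rightarrow>\<^sub>M Pi\<^sub>M UNIV (\<lambda>_::real. borel :: real measure)"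
    by (rule measurable_PiM_single') (use X in auto)
  have "(\<lambda>\<omega>. \<lambda>t\<in>{a..b}. X t \<omega>) -` U \<inter> space M = {\<omega>\<in>space M. \<Psi> (\<lambda>t. X t \<omega>) > 0}"
    using cont by (auto simp: \<Psi>\<phi> \<phi>U)
  also have "\<dots> \<in> sets M" by measurable
  finally show "(\<lambda>\<omega>. \<lambda>t\<in>{a..b}. X t \<omega>) -` U \<inter> space M \<in> sets M" .
qed (use openin_subset in fastforce)

lemma continuous_map_INF:
  assumes "a \<le> b"
  shows "continuous_map (mtopology_of (C_space a b)) euclideanreal (\<lambda>x. INF t\<in>{a..b}. x t)"
proof (rule continuous_map_C_spaceI[OF assms])
  fix f g assume fg: "f \<in> mspace (C_space a b)" "g \<in> mspace (C_space a b)"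
  have bdd: "bdd_below (f ` {a..b})"
    using fg bounded_imp_bdd_below[OF compact_imp_bounded[OF compact_continuous_image[of "{a..b}" f]]]
    by (simp add: mspace_C_space)
  have "(INF t\<in>{a..b}. f t) - mdist (C_space a b) f g \<le> (INF t\<in>{a..b}. g t)"
  proof (rule cINF_greatest)
    fix t assume t: "t \<in> {a..b}"
    have "(INF t\<in>{a..b}. f t) \<le> f t" using bdd t by (rule cINF_lower)
    moreover have "\<bar>f t - g t\<bar> \<le> mdist (C_space a b) f g"
      using mdist_C_space_le[OF assms fg, of "mdist (C_space a b) f g"] t by simp
    ultimately show "(INF t\<in>{a..b}. f t) - mdist (C_space a b) f g \<le> g t" by linarith
  qed (use assms in simp)
  then show "(INF t\<in>{a..b}. f t) \<le> (INF t\<in>{a..b}. g t) + mdist (C_space a b) f g" by simp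
qed

lemma INF_greater_iff:
  fixes x :: "real \<Rightarrow> real"
  assumes "a \<le> b" "continuous_on {a..b} x"
  shows "(INF t\<in>{a..b}. x t) > u \<longleftrightarrow> (\<forall>t\<in>{a..b}. x t > u)"
proof -
  obtain s where s: "s \<in> {a..b}" "\<And>t. t \<in> {a..b} \<Longrightarrow> x s \<le> x t"
    using continuous_attains_inf[OF _ _ assms(2)] assms(1) by auto
  have "(INF t\<in>{a..b}. x t) = x s"
    using s by (intro cInf_eq_minimum) auto
  then show ?thesis using s by (metis less_le_trans)
qed

section \<open>The energy minimizer\<close>

text \<open>By Lindelof the complement of the support is a union of countably many null sets. In a
  finite support a neighbourhood of a point that avoids the other points still has positive measure,
  and up to a null set it is that point.\<close>

lemma borel_prob_measures_support:
  assumes \<nu>: "\<nu> \<in> borel_prob_measures {a..b}"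
  shows "measure_support \<nu> \<subseteq> {a..b}" "AE x in \<nu>. x \<in> measure_support \<nu>"
    "finite (measure_support \<nu>) \<Longrightarrow> s \<in> measure_support \<nu> \<Longrightarrow> measure \<nu> {s} > 0"
proof -
  interpret prob_space \<nu> using \<nu> by (simp add: borel_prob_measures_def)
  have sets: "sets \<nu> = sets (restrict_space borel {a..b})" using \<nu> by (simp add: borel_prob_measures_def)
  have sp: "space \<nu> = {a..b}" using sets_eq_imp_space_eq[OF sets] by (simp add: space_restrict_space)
  let ?S = "measure_support \<nu>"
  show sub: "?S \<subseteq> {a..b}" by (auto simp: measure_support_def sp)
  have open_sets: "U \<inter> {a..b} \<in> sets \<nu>" if "open U" for U
    unfolding sets sets_restrict_space using that by (auto simp: Int_commute)
  define \<U> where "\<U> = {U. open U \<and> emeasure \<nu> (U \<inter> {a..b}) = 0}"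
  obtain \<U>' where \<U>': "\<U>' \<subseteq> \<U>" "countable \<U>'" "\<Union>\<U>' = \<Union>\<U>"
    using Lindelof[of \<U>] by (auto simp: \<U>_def)
  have "(\<Union>U\<in>\<U>'. U \<inter> {a..b}) \<in> null_sets \<nu>"
    using \<U>' open_sets by (intro null_sets_UN' null_setsI) (auto simp: \<U>_def)
  moreover have "{x\<in>space \<nu>. x \<notin> ?S} \<subseteq> (\<Union>U\<in>\<U>'. U \<inter> {a..b})"
  proof
    fix x assume x: "x \<in> {x\<in>space \<nu>. x \<notin> ?S}"
    then obtain U where "open U" "x \<in> U" "emeasure \<nu> (U \<inter> {a..b}) = 0"
      by (auto simp: measure_support_def sp zero_less_iff_neq_zero)
    then have "x \<in> \<Union>\<U>" by (auto simp: \<U>_def)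
    then show "x \<in> (\<Union>U\<in>\<U>'. U \<inter> {a..b})" using \<U>' x sp by auto
  qed
  ultimately show ae: "AE x in \<nu>. x \<in> ?S" by (rule AE_I'[OF _ ]) 
  assume fin: "finite ?S" and s: "s \<in> ?S"
  have "open (- (?S - {s}))" using fin by (intro open_Compl finite_imp_closed) auto
  then have pos: "emeasure \<nu> (- (?S - {s}) \<inter> {a..b}) > 0"
    using s by (auto simp: measure_support_def sp)
  have sset: "{s} \<in> sets \<nu>"
    unfolding sets sets_restrict_space by (rule image_eqI[of _ _ "{s}"]) (use s sub in auto)
  have "emeasure \<nu> (- (?S - {s}) \<inter> {a..b}) = emeasure \<nu> {s}"
  proof (rule emeasure_eq_AE)
    show "AE x in \<nu>. x \<in> - (?S - {s}) \<inter> {a..b} \<longleftrightarrow> x \<in> {s}"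
      using ae by eventually_elim (use s sub in auto)
  qed (use sset open_sets[OF \<open>open (- (?S - {s}))\<close>] in auto)
  then show "measure \<nu> {s} > 0" using pos by (simp add: emeasure_eq_measure)
qed

lemma integral_finite_support:
  assumes \<nu>: "\<nu> \<in> borel_prob_measures {a..b}" and T: "finite T" "measure_support \<nu> \<subseteq> T" "T \<subseteq> {a..b}"
    and f: "f \<in> borel_measurable borel"
  shows "(\<integral>x. f x \<partial>\<nu>) = (\<Sum>t\<in>T. measure \<nu> {t} * f t)"
proof -
  interpret prob_space \<nu> using \<nu> by (simp add: borel_prob_measures_def)
  have sets: "sets \<nu> = sets (restrict_space borel {a..b})" using \<nu> by (simp add: borel_prob_measures_def)
  have fm[measurable]: "f \<in> borel_measurable \<nu>"
    using measurable_restrict_space1[OF f] measurable_cong_sets[OF sets refl] by blast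
  have ts[measurable]: "{t} \<in> sets \<nu>" if "t \<in> T" for t
    unfolding sets sets_restrict_space using that T by auto
  have "(\<integral>x. f x \<partial>\<nu>) = (\<integral>x. (\<Sum>t\<in>T. f t * indicator {t} x) \<partial>\<nu>)"
  proof (rule integral_cong_AE)
    show "AE x in \<nu>. f x = (\<Sum>t\<in>T. f t * indicator {t} x)"
      using borel_prob_measures_support(2)[OF \<nu>]
    proof eventually_elim
      case (elim x)
      then have "x \<in> T" using T by auto
      then have "(\<Sum>t\<in>T. f t * indicator {t} x) = (\<Sum>t\<in>T. if t = x then f t else 0)"
        by (intro sum.cong) (auto simp: indicator_def)
      then show ?case using \<open>x \<in> T\<close> T(1) by simp
    qed
  qed measurable
  also have "\<dots> = (\<Sum>t\<in>T. f t * measure \<nu> {t})"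
    by (subst Bochner_Integration.integral_sum) (auto simp: less_top[symmetric] intro!: integrable_mult_right)
  finally show ?thesis by (simp add: mult.commute)
qed

lemma discrete_borel_prob_measure:
  fixes q :: "real \<Rightarrow> real"
  assumes T: "finite T" "T \<subseteq> {a..b}" and q: "\<And>t. t \<in> T \<Longrightarrow> q t \<ge> 0" "sum q T = 1"
  obtains \<eta> where "\<eta> \<in> borel_prob_measures {a..b}"
    "\<And>f. f \<in> borel_measurable borel \<Longrightarrow> (\<integral>x. f x \<partial>\<eta>) = (\<Sum>t\<in>T. q t * f t)"
proof
  let ?P = "point_measure T (\<lambda>t. ennreal (q t))"
  let ?\<eta> = "distr ?P (restrict_space borel {a..b}) (\<lambda>x. x)"
  have m: "(\<lambda>x. x) \<in> ?P \<rightarrow>\<^sub>M restrict_space borel {a..b}"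
    using T by (auto simp: space_restrict_space)
  have "emeasure ?P (space ?P) = (\<Sum>t\<in>T. ennreal (q t))"
    using T by (simp add: space_point_measure emeasure_point_measure_finite)
  also have "\<dots> = 1" using q by (simp add: sum_ennreal)
  finally have "prob_space ?P" by (rule prob_spaceI)
  then show "?\<eta> \<in> borel_prob_measures {a..b}"
    unfolding borel_prob_measures_def using prob_space.prob_space_distr[OF _ m] by simp
  fix f :: "real \<Rightarrow> real" assume f: "f \<in> borel_measurable borel"
  have "(\<integral>x. f x \<partial>?\<eta>) = (\<integral>x. f x \<partial>?P)"
    using m measurable_restrict_space1[OF f] by (intro integral_distr) auto
  also have "\<dots> = (\<Sum>t\<in>T. q t * f t)"
    using T q by (subst lebesgue_integral_point_measure_finite) auto
  finally show "(\<integral>x. f x \<partial>?\<eta>) = (\<Sum>t\<in>T. q t * f t)" .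
qed

text \<open>First-order conditions in the direction of a point mass: the potential is nowhere on the
  interval below the minimal energy \<open>m\<close>. Its average over the minimizer is
  \<open>m\<close>, so it cannot exceed \<open>m\<close> at an atom.\<close>

lemma energy_minimizer_conditions:
  assumes min: "is_arg_min (energy R) (\<lambda>\<nu>'. \<nu>' \<in> borel_prob_measures {a..b}) \<nu>"
    and fin: "finite (measure_support \<nu>)" and sym: "\<And>s t. R s t = R t s"
    and R: "\<And>s. R s \<in> borel_measurable borel"
  defines "S \<equiv> measure_support \<nu>" and "p \<equiv> \<lambda>s. measure \<nu> {s}"
  defines "m \<equiv> (\<Sum>s\<in>S. \<Sum>t\<in>S. p s * p t * R s t)"
  shows "S \<subseteq> {a..b}" "sum p S = 1" "\<And>s. s \<in> S \<Longrightarrow> p s > 0"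
    "\<And>t. t \<in> {a..b} \<Longrightarrow> m \<le> (\<Sum>s\<in>S. p s * R s t)"
    "\<And>t. t \<in> S \<Longrightarrow> (\<Sum>s\<in>S. p s * R s t) = m"
proof -
  have \<nu>: "\<nu> \<in> borel_prob_measures {a..b}"
    and opt: "\<And>\<eta>. \<eta> \<in> borel_prob_measures {a..b} \<Longrightarrow> energy R \<nu> \<le> energy R \<eta>"
    using min by (auto simp: is_arg_min_linorder)
  interpret prob_space \<nu> using \<nu> by (simp add: borel_prob_measures_def)
  show Sab: "S \<subseteq> {a..b}" unfolding S_def by (rule borel_prob_measures_support(1)[OF \<nu>])
  have finS: "finite S" using fin by (simp add: S_def)
  show ppos: "p s > 0" if "s \<in> S" for s
    unfolding p_def using borel_prob_measures_support(3)[OF \<nu> fin] that by (simp add: S_def)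
  have int: "(\<integral>x. f x \<partial>\<nu>) = (\<Sum>t\<in>T. p t * f t)" if "finite T" "S \<subseteq> T" "T \<subseteq> {a..b}" "f \<in> borel_measurable borel" for f T
    unfolding p_def using integral_finite_support[OF \<nu> that(1) _ that(3,4)] that(2) by (simp add: S_def)
  show psum: "sum p S = 1"
    using int[OF finS _ Sab, of "\<lambda>_. 1"] prob_space by simp
  have R': "(\<lambda>s. R s t) \<in> borel_measurable borel" for t
  proof -
    have "(\<lambda>s. R s t) = R t" by (rule ext) (rule sym)
    then show ?thesis using R[of t] by simp
  qed
  have en: "energy R \<nu> = (\<Sum>s\<in>T. \<Sum>t\<in>T. p s * p t * R s t)" if T: "finite T" "S \<subseteq> T" "T \<subseteq> {a..b}" for T
  proof -
    have "energy R \<nu> = (\<integral>s. (\<Sum>t\<in>T. p t * R s t) \<partial>\<nu>)"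
      unfolding energy_def by (simp add: int[OF T R])
    also have "\<dots> = (\<Sum>s\<in>T. p s * (\<Sum>t\<in>T. p t * R s t))"
      by (rule int[OF T]) (use R' in measurable)
    finally show ?thesis by (simp add: sum_distrib_left mult.assoc)
  qed
  have m: "m = energy R \<nu>" unfolding m_def by (rule en[OF finS _ Sab, symmetric]) simp
  show ge: "m \<le> (\<Sum>s\<in>S. p s * R s t)" if t: "t \<in> {a..b}" for t
  proof -
    \<comment> \<open>The point \<open>t\<close> may lie in the support or outside it; over
      \<open>insert t S\<close> both cases read the same, because a point outside the support has no
      mass.\<close>
    define T where "T = insert t S"
    have T: "finite T" "S \<subseteq> T" "T \<subseteq> {a..b}" using finS Sab t by (auto simp: T_def)
    have p0: "p s = 0" if "s \<in> T - S" for s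
    proof -
      have "(\<Sum>s\<in>T - S. p s) = sum p T - sum p S" using T finS by (simp add: sum_diff)
      also have "sum p T = 1" using int[OF T, of "\<lambda>_. 1"] prob_space by simp
      finally have "(\<Sum>s\<in>T - S. p s) = 0" using psum by simp
      then show ?thesis using that T by (subst (asm) sum_nonneg_eq_0_iff) (auto simp: p_def)
    qed
    define h where "h = (\<Sum>s\<in>T. p s * R s t)"
    have hS: "h = (\<Sum>s\<in>S. p s * R s t)"
      unfolding h_def using T p0 by (intro sum.mono_neutral_right) auto
    \<comment> \<open>The right-hand side is the energy of the mixture of \<open>\<nu>\<close>, with
      weight \<open>1 - e\<close>, and the unit mass at \<open>t\<close>, with weight
      \<open>e\<close>. Dividing by \<open>e\<close> and letting \<open>e\<close> tend to 0 leaves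
      \<open>h - m\<close> with its sign.\<close>
    have quad: "m \<le> (1 - e)\<^sup>2 * m + 2 * e * (1 - e) * h + e\<^sup>2 * R t t" if e: "0 \<le> e" "e \<le> 1" for e
    proof -
      define q where "q s = (1 - e) * p s + e * of_bool (s = t)" for s
      have tT: "t \<in> T" by (simp add: T_def)
      have d: "(\<Sum>s\<in>T. f s * of_bool (s = t)) = f t" for f :: "real \<Rightarrow> real"
      proof -
        have "(\<Sum>s\<in>T. f s * of_bool (s = t)) = (\<Sum>s\<in>T. if s = t then f s else 0)"
          by (intro sum.cong) auto
        then show ?thesis using T tT by simp
      qed
      have sumT: "sum p T = 1" using int[OF T, of "\<lambda>_. 1"] prob_space by simp
      have "sum q T = (1 - e) * sum p T + e * (\<Sum>s\<in>T. 1 * of_bool (s = t))"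
        unfolding q_def by (simp only: sum.distrib sum_distrib_left mult_1)
      then have q1: "sum q T = 1" using d[of "\<lambda>_. 1"] sumT by simp
      have bil: "(\<Sum>s\<in>T. q s * f s) = (1 - e) * (\<Sum>s\<in>T. p s * f s) + e * f t" for f :: "real \<Rightarrow> real"
      proof -
        have "(\<Sum>s\<in>T. q s * f s) = (1 - e) * (\<Sum>s\<in>T. p s * f s) + e * (\<Sum>s\<in>T. f s * of_bool (s = t))"
          unfolding q_def sum_distrib_left sum.distrib[symmetric] by (intro sum.cong) (auto simp: algebra_simps)
        then show ?thesis by (simp only: d)
      qed
      have q0: "q s \<ge> 0" for s using e by (simp add: q_def p_def)
      obtain \<eta> where \<eta>: "\<eta> \<in> borel_prob_measures {a..b}"
        and \<eta>i: "\<And>f. f \<in> borel_measurable borel \<Longrightarrow> (\<integral>x. f x \<partial>\<eta>) = (\<Sum>t\<in>T. q t * f t)"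
        using discrete_borel_prob_measure[OF T(1,3) q0 q1] by metis
      have "energy R \<eta> = (\<integral>s. (\<Sum>t\<in>T. q t * R s t) \<partial>\<eta>)"
        unfolding energy_def by (simp add: \<eta>i[OF R])
      also have "\<dots> = (\<Sum>s\<in>T. q s * (\<Sum>t\<in>T. q t * R s t))"
        by (rule \<eta>i) (use R' in measurable)
      also have "\<dots> = (1 - e) * (\<Sum>s\<in>T. p s * ((1 - e) * (\<Sum>r\<in>T. p r * R s r) + e * R s t)) +
         e * ((1 - e) * (\<Sum>r\<in>T. p r * R t r) + e * R t t)"
        unfolding bil ..
      also have "\<dots> = (1 - e) * ((1 - e) * m + e * h) + e * ((1 - e) * h + e * R t t)"
      proof -
        have "(\<Sum>r\<in>T. p r * R t r) = h" unfolding h_def by (intro sum.cong refl) (simp add: sym[of t])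
        moreover have "(\<Sum>s\<in>T. p s * ((1 - e) * (\<Sum>r\<in>T. p r * R s r) + e * R s t)) = (1 - e) * m + e * h"
        proof -
          have "(\<Sum>s\<in>T. p s * ((1 - e) * (\<Sum>r\<in>T. p r * R s r) + e * R s t)) =
            (1 - e) * (\<Sum>s\<in>T. p s * (\<Sum>r\<in>T. p r * R s r)) + e * (\<Sum>s\<in>T. p s * R s t)"
            unfolding sum_distrib_left[where r = "1 - e" and A = T] sum_distrib_left[where r = e and A = T] sum.distrib[symmetric]
            by (intro sum.cong refl) (simp add: algebra_simps sum_distrib_left)
          moreover have "(\<Sum>s\<in>T. p s * (\<Sum>r\<in>T. p r * R s r)) = m"
            unfolding m en[OF T] by (simp add: sum_distrib_left mult.assoc)
          ultimately show ?thesis by (simp add: h_def)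
        qed
        ultimately show ?thesis by simp
      qed
      also have "\<dots> = (1 - e)\<^sup>2 * m + 2 * e * (1 - e) * h + e\<^sup>2 * R t t"
        by (simp add: power2_eq_square algebra_simps)
      finally show ?thesis using opt[OF \<eta>] m by simp
    qed
    have lin: "0 \<le> 2 * (h - m) + e * (m - 2 * h + R t t)" if e: "0 < e" "e \<le> 1" for e
    proof -
      have "0 \<le> e * (2 * (h - m) + e * (m - 2 * h + R t t))"
        using quad[of e] e by (simp add: power2_eq_square algebra_simps)
      then show ?thesis using e by (simp add: zero_le_mult_iff)
    qed
    have "((\<lambda>e. 2 * (h - m) + e * (m - 2 * h + R t t)) \<longlongrightarrow> 2 * (h - m) + 0 * (m - 2 * h + R t t)) (at_right 0)"
      by (intro tendsto_intros)
    moreover have "\<forall>\<^sub>F e in at_right 0. 0 \<le> 2 * (h - m) + e * (m - 2 * h + R t t)"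
      using lin by (auto simp: eventually_at_right_field intro: exI[of _ 1])
    ultimately have "0 \<le> 2 * (h - m) + 0 * (m - 2 * h + R t t)"
      by (rule tendsto_lowerbound) simp
    then show ?thesis using hS by simp
  qed
  show "(\<Sum>s\<in>S. p s * R s t) = m" if "t \<in> S" for t
  proof -
    let ?h = "\<lambda>t. \<Sum>s\<in>S. p s * R s t"
    have "(\<Sum>t\<in>S. p t * (?h t - m)) = (\<Sum>t\<in>S. \<Sum>s\<in>S. p s * p t * R s t) - m * sum p S"
      by (simp add: algebra_simps sum_subtractf sum_distrib_left)
    also have "(\<Sum>t\<in>S. \<Sum>s\<in>S. p s * p t * R s t) = m" unfolding m_def by (rule sum.swap)
    finally have "(\<Sum>t\<in>S. p t * (?h t - m)) = 0" using psum by simp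
    moreover have "p t * (?h t - m) \<ge> 0" if "t \<in> S" for t
      using ppos[OF that] ge[of t] that Sab by (intro mult_nonneg_nonneg) auto
    ultimately have "p t * (?h t - m) = 0" using that finS by (subst (asm) sum_nonneg_eq_0_iff) auto
    then show ?thesis using ppos[OF that] by simp
  qed
qed

section \<open>The vector theta and the normal equations\<close>

lemma pts_props:
  assumes "finite S"
  shows "length (pts S) = card S" "bij_betw ((!) (pts S)) {..<card S} S"
proof -
  show "length (pts S) = card S" by simp
  show "bij_betw ((!) (pts S)) {..<card S} S"
    by (rule bij_betw_nth) (use assms in simp_all)
qed

lemma sum_pts:
  assumes "finite S" shows "(\<Sum>i<card S. f (pts S ! i)) = (\<Sum>s\<in>S. f s)"
  by (rule sum.reindex_bij_betw[OF pts_props(2)[OF assms]])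

text \<open>\<open>theta\<close> goes through \<open>mat_inverse\<close> on the enumeration
  \<open>pts S\<close>. A trivial kernel yields a nonzero determinant and thus an inverse, and the
  inverse applied to the vector of ones returns the solution \<open>q\<close>.\<close>

lemma theta_eqI:
  assumes S: "finite S" and nd: "\<And>c. (\<And>t. t \<in> S \<Longrightarrow> (\<Sum>s\<in>S. covfun M X t s * c s) = 0) \<Longrightarrow> \<forall>s\<in>S. c s = 0"
    and q: "\<And>t. t \<in> S \<Longrightarrow> (\<Sum>s\<in>S. covfun M X t s * q s) = 1" and j: "j < card S"
  shows "theta M X S j = q (pts S ! j)"
proof -
  let ?n = "card S" and ?A = "cov_mat M X S"
  have A: "?A \<in> carrier_mat ?n ?n" by (simp add: cov_mat_def)
  have ptsS: "pts S ! i \<in> S" if "i < ?n" for i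
    using pts_props(2)[OF S] that by (auto simp: bij_betw_def)
  have Av: "(?A *\<^sub>v v) $ i = (\<Sum>k<?n. covfun M X (pts S ! i) (pts S ! k) * v $ k)"
    if "v \<in> carrier_vec ?n" "i < ?n" for v i
    using that by (simp add: cov_mat_def scalar_prod_def atLeast0LessThan)
  have "Determinant.det ?A \<noteq> 0"
  proof
    assume "Determinant.det ?A = 0"
    then obtain v where v: "v \<in> carrier_vec ?n" "v \<noteq> 0\<^sub>v ?n" "?A *\<^sub>v v = 0\<^sub>v ?n"
      using det_0_iff_vec_prod_zero_field[OF A] by auto
    define c where "c s = v $ (the_inv_into {..<?n} ((!) (pts S)) s)" for s
    have ci: "c (pts S ! i) = v $ i" if "i < ?n" for i
      unfolding c_def using pts_props(2)[OF S] that by (subst the_inv_into_f_f) (auto simp: bij_betw_def)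
    have "(\<Sum>s\<in>S. covfun M X t s * c s) = 0" if t: "t \<in> S" for t
    proof -
      obtain i where i: "i < ?n" "t = pts S ! i" using pts_props(2)[OF S] t by (auto simp: bij_betw_def)
      have "(\<Sum>s\<in>S. covfun M X t s * c s) = (\<Sum>k<?n. covfun M X t (pts S ! k) * c (pts S ! k))"
        by (rule sum_pts[OF S, symmetric])
      also have "\<dots> = (\<Sum>k<?n. covfun M X t (pts S ! k) * v $ k)" using ci by (intro sum.cong) auto
      also have "\<dots> = (?A *\<^sub>v v) $ i" using Av[OF v(1) i(1)] i by simp
      finally show ?thesis using v i by simp
    qed
    from nd[OF this] have "c (pts S ! i) = 0" if "i < ?n" for i using ptsS[OF that] by blast
    then have "v = 0\<^sub>v ?n" using v(1) ci by (intro eq_vecI) auto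
    then show False using v by simp
  qed
  then have "?A \<in> Units (ring_mat TYPE(real) ?n ())" by (rule det_non_zero_imp_unit[OF A])
  with mat_inverse(1)[OF A, where b="()"] obtain B where B: "mat_inverse ?A = Some B" by (cases "mat_inverse ?A") auto
  from mat_inverse(2)[OF A B] have BA: "B * ?A = 1\<^sub>m ?n" and Bc: "B \<in> carrier_mat ?n ?n" by auto
  let ?q = "vec ?n (\<lambda>i. q (pts S ! i))"
  have Aq: "?A *\<^sub>v ?q = vec ?n (\<lambda>_. 1)"
  proof (rule eq_vecI)
    fix i assume "i < dim_vec (vec ?n (\<lambda>_. 1 :: real))"
    then have i: "i < ?n" by simp
    have "(?A *\<^sub>v ?q) $ i = (\<Sum>k<?n. covfun M X (pts S ! i) (pts S ! k) * q (pts S ! k))"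
      using Av[of ?q i] i by simp
    also have "\<dots> = (\<Sum>s\<in>S. covfun M X (pts S ! i) s * q s)" by (rule sum_pts[OF S])
    finally show "(?A *\<^sub>v ?q) $ i = vec ?n (\<lambda>_. 1) $ i" using q ptsS[OF i] i by simp
  qed (use A in simp)
  have "B *\<^sub>v vec ?n (\<lambda>_. 1) = (B * ?A) *\<^sub>v ?q"
    unfolding Aq[symmetric] using Bc A by (subst assoc_mult_mat_vec[of _ ?n ?n _ ?n]) auto
  also have "\<dots> = ?q" unfolding BA by simp
  finally show ?thesis unfolding theta_def B using j by simp
qed

section \<open>Paths above a high level\<close>

lemma bounded_on_Icc:
  fixes f :: "real \<Rightarrow> real"
  assumes "continuous_on {a..b} f" shows "\<exists>K. \<forall>t\<in>{a..b}. \<bar>f t\<bar> \<le> K"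
  using compact_imp_bounded[OF compact_continuous_image[OF assms compact_Icc]] by (auto simp: bounded_iff)

text \<open>The part of the argument that concerns a single path. The second-order expansion is
  required only where the first derivative vanishes, and strict convexity only at interior points:
  at an end point the slope may be nonzero, and even both derivatives may vanish.\<close>

locale level_shape =
  fixes a b :: real and S :: "real set" and \<mu> \<mu>1 \<mu>2 :: "real \<Rightarrow> real"
  assumes ab: "a < b" and S: "finite S" "S \<subseteq> {a..b}"
    and cont: "continuous_on {a..b} \<mu>" and ge1: "\<And>t. t \<in> {a..b} \<Longrightarrow> \<mu> t \<ge> 1"
    and eq1: "\<And>s. s \<in> S \<Longrightarrow> \<mu> s = 1"
    and finE: "finite {t\<in>{a..b}. \<mu> t = 1}"
    and d1: "\<And>s. s \<in> S \<Longrightarrow> (\<mu> has_real_derivative \<mu>1 s) (at s)"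
    and d2: "\<And>s. s \<in> S \<Longrightarrow> \<mu>1 s = 0 \<Longrightarrow> ((\<lambda>t. (\<mu> t - 1) / (t - s)\<^sup>2) \<longlongrightarrow> \<mu>2 s / 2) (at s)"
    and pos: "\<And>s. s \<in> S \<Longrightarrow> s \<in> {a<..<b} \<Longrightarrow> \<mu>2 s > 0"
begin

definition contacts :: "real set" where "contacts = {t\<in>{a..b}. \<mu> t = 1} - S"

text \<open>At an end point with nonzero slope \<open>\<mu>\<close> leaves the value 1 linearly, and
  nothing is demanded. With zero slope, a \<open>d\<close> that makes the path rise into the
  interval suffices; otherwise the curvature has to compensate, which it cannot do when
  \<open>\<mu>2\<close> vanishes and the quadratic degenerates to a falling line.\<close>

definition pass :: "real \<Rightarrow> real \<Rightarrow> real \<Rightarrow> bool" where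
  "pass s d w \<longleftrightarrow>
    (if s = a then (\<mu>1 a = 0 \<longrightarrow> d > 0 \<or> (\<mu>2 a \<noteq> 0 \<and> w > d\<^sup>2 / (2 * \<mu>2 a)))
     else if s = b then (\<mu>1 b = 0 \<longrightarrow> d < 0 \<or> (\<mu>2 b \<noteq> 0 \<and> w > d\<^sup>2 / (2 * \<mu>2 b)))
     else w > d\<^sup>2 / (2 * \<mu>2 s))"

definition above :: "(real \<Rightarrow> real) \<Rightarrow> (real \<Rightarrow> real) \<Rightarrow> real \<Rightarrow> real \<Rightarrow> bool" where
  "above z A u t \<longleftrightarrow> u * \<mu> t + A t / u + z t > u"

text \<open>The radius is fixed before \<open>u\<close>, so that finitely many such neighbourhoods
  have a common threshold for \<open>u\<close>.\<close>

definition good :: "(real \<Rightarrow> real) \<Rightarrow> (real \<Rightarrow> real) \<Rightarrow> real \<Rightarrow> bool" where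
  "good z A t0 \<longleftrightarrow> (\<exists>\<delta>>0. \<forall>\<^sub>F u in at_top. \<forall>t\<in>{a..b}. \<bar>t - t0\<bar> < \<delta> \<longrightarrow> above z A u t)"

lemma interior_deriv_zero:
  assumes "s \<in> S" "s \<in> {a<..<b}" shows "\<mu>1 s = 0"
proof (rule DERIV_local_min[OF d1[OF assms(1)]])
  show "0 < min (s - a) (b - s)" using assms by simp
  show "\<forall>y. \<bar>s - y\<bar> < min (s - a) (b - s) \<longrightarrow> \<mu> s \<le> \<mu> y"
  proof (intro allI impI)
    fix y assume "\<bar>s - y\<bar> < min (s - a) (b - s)"
    then have "y \<in> {a..b}" by (auto simp: abs_if split: if_splits)
    then show "\<mu> s \<le> \<mu> y" using ge1 eq1[OF assms(1)] by simp
  qed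
qed

lemma second_nonneg:
  assumes "s \<in> S" "\<mu>1 s = 0" shows "\<mu>2 s \<ge> 0"
proof -
  have sab: "s \<in> {a..b}" using assms S by auto
  have nb: "at s within {a..b} \<noteq> bot"
    using ab sab by (simp add: trivial_limit_within islimpt_Icc)
  have "((\<lambda>t. (\<mu> t - 1) / (t - s)\<^sup>2) \<longlongrightarrow> \<mu>2 s / 2) (at s within {a..b})"
    by (rule tendsto_within_subset[OF d2[OF assms]]) simp
  moreover have "\<forall>\<^sub>F t in at s within {a..b}. 0 \<le> (\<mu> t - 1) / (t - s)\<^sup>2"
    using ge1 by (auto simp: eventually_at_filter)
  ultimately have "0 \<le> \<mu>2 s / 2" using tendsto_lowerbound nb by blast
  then show ?thesis by simp
qed

text \<open>A point with \<open>\<mu> t > 1\<close> is good because \<open>u * (\<mu> t - 1)\<close>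
  outgrows the bounded terms; with the assumption at the other points every point is good, and
  compactness supplies a finite cover.\<close>

lemma good_compact:
  assumes z: "continuous_on {a..b} z" and A: "continuous_on {a..b} A"
    and g: "\<And>t. t \<in> {a..b} \<Longrightarrow> \<mu> t = 1 \<Longrightarrow> good z A t"
  shows "\<forall>\<^sub>F u in at_top. \<forall>t\<in>{a..b}. above z A u t"
proof -
  obtain Kz where Kz: "\<And>t. t \<in> {a..b} \<Longrightarrow> \<bar>z t\<bar> \<le> Kz"
    using bounded_on_Icc[OF z] by blast
  obtain KA where KA: "\<And>t. t \<in> {a..b} \<Longrightarrow> \<bar>A t\<bar> \<le> KA"
    using bounded_on_Icc[OF A] by blast
  have "good z A t0" if t0: "t0 \<in> {a..b}" for t0
  proof (cases "\<mu> t0 = 1")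
    case False
    with ge1[OF t0] have m: "\<mu> t0 > 1" by simp
    define \<eta> where "\<eta> = (\<mu> t0 - 1) / 2"
    have \<eta>: "\<eta> > 0" using m by (simp add: \<eta>_def)
    obtain \<delta> where \<delta>: "\<delta> > 0" "\<And>t. t \<in> {a..b} \<Longrightarrow> dist t t0 < \<delta> \<Longrightarrow> dist (\<mu> t) (\<mu> t0) < \<eta>"
      using cont t0 \<eta> unfolding continuous_on_iff by metis
    have "\<forall>\<^sub>F u in at_top. u > max 1 ((KA + Kz) / \<eta>)" by (rule eventually_gt_at_top)
    then have "\<forall>\<^sub>F u in at_top. u \<ge> 1 \<and> u * \<eta> > KA + Kz"
      by eventually_elim (use \<eta> in \<open>auto simp: divide_less_eq\<close>)
    then have "\<forall>\<^sub>F u in at_top. \<forall>t\<in>{a..b}. \<bar>t - t0\<bar> < \<delta> \<longrightarrow> above z A u t"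
    proof eventually_elim
      case (elim u)
      show ?case
      proof (intro ballI impI)
        fix t assume t: "t \<in> {a..b}" "\<bar>t - t0\<bar> < \<delta>"
        have "\<bar>\<mu> t - \<mu> t0\<bar> < \<eta>" using \<delta>(2)[OF t(1)] t(2) by (simp add: dist_real_def)
        then have "\<mu> t > \<mu> t0 - \<eta>" by arith
        then have "\<mu> t > 1 + \<eta>" by (simp add: \<eta>_def field_simps)
        then have "u * \<mu> t > u * (1 + \<eta>)" using elim by (intro mult_strict_left_mono) auto
        moreover have "\<bar>A t / u\<bar> \<le> \<bar>A t\<bar>" using elim by (simp add: abs_div divide_le_eq mult_le_cancel_left1)
        moreover have "u * (1 + \<eta>) = u + u * \<eta>" by (simp add: distrib_left)
        ultimately show "above z A u t"
          unfolding above_def using KA[OF t(1)] Kz[OF t(1)] elim by linarith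
      qed
    qed
    then show ?thesis using \<delta>(1) unfolding good_def by blast
  qed (use g t0 in auto)
  then have "\<forall>t0\<in>{a..b}. \<exists>\<delta>. \<delta> > 0 \<and> (\<forall>\<^sub>F u in at_top. \<forall>t\<in>{a..b}. \<bar>t - t0\<bar> < \<delta> \<longrightarrow> above z A u t)"
    unfolding good_def by blast
  from bchoice[OF this] obtain \<delta> where \<delta>: "\<And>t0. t0 \<in> {a..b} \<Longrightarrow> \<delta> t0 > 0"
     "\<And>t0. t0 \<in> {a..b} \<Longrightarrow> \<forall>\<^sub>F u in at_top. \<forall>t\<in>{a..b}. \<bar>t - t0\<bar> < \<delta> t0 \<longrightarrow> above z A u t"
    by blast
  have "{a..b} \<subseteq> \<Union> ((\<lambda>t0. ball t0 (\<delta> t0)) ` {a..b})"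
  proof
    fix t assume "t \<in> {a..b}"
    then show "t \<in> \<Union> ((\<lambda>t0. ball t0 (\<delta> t0)) ` {a..b})" using \<delta>(1)[of t] by (intro UN_I[of t]) auto
  qed
  from compactE_image[OF compact_Icc _ this] obtain T where
    T: "T \<subseteq> {a..b}" "finite T" "{a..b} \<subseteq> (\<Union>t0\<in>T. ball t0 (\<delta> t0))" by auto
  have "\<forall>\<^sub>F u in at_top. \<forall>t0\<in>T. \<forall>t\<in>{a..b}. \<bar>t - t0\<bar> < \<delta> t0 \<longrightarrow> above z A u t"
    using T(1,2) \<delta>(2) by (intro eventually_ball_finite) auto
  then show ?thesis
  proof eventually_elim
    case (elim u)
    show ?case
    proof
      fix t assume t: "t \<in> {a..b}"
      then obtain t0 where "t0 \<in> T" "t \<in> ball t0 (\<delta> t0)" using T(3) by auto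
      then show "above z A u t" using elim t by (auto simp: dist_real_def abs_minus_commute)
    qed
  qed
qed

lemma good_contact:
  assumes z: "continuous_on {a..b} z" and A: "continuous_on {a..b} A"
    and t0: "t0 \<in> {a..b}" "z t0 > 0"
  shows "good z A t0"
proof -
  obtain KA where KA: "\<And>t. t \<in> {a..b} \<Longrightarrow> \<bar>A t\<bar> \<le> KA"
    using bounded_on_Icc[OF A] by blast
  obtain \<delta> where \<delta>: "\<delta> > 0" "\<And>t. t \<in> {a..b} \<Longrightarrow> dist t t0 < \<delta> \<Longrightarrow> dist (z t) (z t0) < z t0 / 2"
    using z t0 unfolding continuous_on_iff by (meson half_gt_zero)
  have "\<forall>\<^sub>F u in at_top. u > max 0 (2 * KA / z t0)" by (rule eventually_gt_at_top)
  then have "\<forall>\<^sub>F u in at_top. \<forall>t\<in>{a..b}. \<bar>t - t0\<bar> < \<delta> \<longrightarrow> above z A u t"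
  proof eventually_elim
    case (elim u)
    then have u: "u > 0" "KA < u * (z t0 / 2)" using t0 by (auto simp: field_simps)
    show ?case
    proof (intro ballI impI)
      fix t assume t: "t \<in> {a..b}" "\<bar>t - t0\<bar> < \<delta>"
      have "\<bar>z t - z t0\<bar> < z t0 / 2" using \<delta>(2)[OF t(1)] t(2) by (simp add: dist_real_def)
      then have 1: "z t > z t0 / 2" by arith
      have 2: "u * \<mu> t \<ge> u" using ge1[OF t(1)] u by (simp add: mult_le_cancel_left1)
      have "A t / u \<ge> - KA / u" using KA[OF t(1)] u by (intro divide_right_mono) auto
      moreover have "KA / u < z t0 / 2" using u by (simp add: divide_less_eq mult.commute)
      ultimately show "above z A u t" unfolding above_def using 1 2 by simp
    qed
  qed
  then show ?thesis using \<delta>(1) unfolding good_def by blast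
qed

lemma bad_contact:
  assumes t0: "\<mu> t0 = 1" "z t0 < 0"
  shows "\<forall>\<^sub>F u in at_top. \<not> above z A u t0"
proof -
  have "((\<lambda>u. A t0 / u) \<longlongrightarrow> 0) at_top" by real_asymp
  then have "\<forall>\<^sub>F u in at_top. A t0 / u < - z t0" by (rule order_tendstoD) (use t0 in simp)
  then show ?thesis by eventually_elim (simp add: above_def t0)
qed

lemma near_pos:
  fixes A :: "real \<Rightarrow> real"
  assumes A: "continuous_on {a..b} A" and s: "s \<in> {a..b}" and w: "A s > w"
  obtains \<delta> where "\<delta> > 0" "\<And>t. t \<in> {a..b} \<Longrightarrow> \<bar>t - s\<bar> < \<delta> \<Longrightarrow> A t > w"
proof -
  obtain \<delta> where "\<delta> > 0" "\<And>t. t \<in> {a..b} \<Longrightarrow> dist t s < \<delta> \<Longrightarrow> dist (A t) (A s) < A s - w"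
    using A s w unfolding continuous_on_iff by (metis diff_gt_0_iff_gt)
  then show ?thesis by (intro that[of \<delta>]) (auto simp: dist_real_def abs_less_iff)
qed

lemma deriv_bound:
  assumes z: "(z has_real_derivative d) (at s)" "z s = 0" and "e > 0"
  obtains \<delta> where "\<delta> > 0" "\<And>t. \<bar>t - s\<bar> < \<delta> \<Longrightarrow> \<bar>z t - d * (t - s)\<bar> \<le> e * \<bar>t - s\<bar>"
proof -
  have "((\<lambda>t. z t / (t - s)) \<longlongrightarrow> d) (at s)"
    using z by (simp add: has_field_derivative_iff)
  then obtain \<delta> where \<delta>: "\<delta> > 0" "\<And>t. t \<noteq> s \<Longrightarrow> dist t s < \<delta> \<Longrightarrow> dist (z t / (t - s)) d < e"
    using \<open>e > 0\<close> unfolding tendsto_iff eventually_at by (metis UNIV_I)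
  show ?thesis
  proof (rule that[OF \<delta>(1)])
    fix t assume t: "\<bar>t - s\<bar> < \<delta>"
    show "\<bar>z t - d * (t - s)\<bar> \<le> e * \<bar>t - s\<bar>"
    proof (cases "t = s")
      case False
      then have "\<bar>z t / (t - s) - d\<bar> < e" using \<delta>(2) t by (simp add: dist_real_def)
      moreover have "z t - d * (t - s) = (z t / (t - s) - d) * (t - s)" using False by (simp add: field_simps)
      ultimately show ?thesis by (simp add: abs_mult mult_right_mono)
    qed (use z in simp)
  qed
qed

lemma good_quadratic:
  assumes A: "continuous_on {a..b} A" and s: "s \<in> S" "\<mu>1 s = 0" "\<mu>2 s > 0"
    and z: "(z has_real_derivative d) (at s)" "z s = 0"
    and w: "A s > d\<^sup>2 / (2 * \<mu>2 s)"
  shows "good z A s"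
proof -
  have sab: "s \<in> {a..b}" using s S by auto
  define q where "q = \<mu>2 s"
  have q: "q > 0" using s by (simp add: q_def)
  \<comment> \<open>The hypothesis \<open>w\<close> says that the discriminant of the quadratic is
    negative. It remains so when curvature and constant term are lowered and the slope is raised by
    a small \<open>e\<close>, which leaves room for the approximation errors.\<close>
  have "\<exists>e>0. e < q \<and> (\<bar>d\<bar> + e)\<^sup>2 < 2 * (q - e) * (A s - e)"
  proof -
    have "((\<lambda>e. 2 * (q - e) * (A s - e) - (\<bar>d\<bar> + e)\<^sup>2) \<longlongrightarrow> 2 * (q - 0) * (A s - 0) - (\<bar>d\<bar> + 0)\<^sup>2) (at_right 0)"
      by (intro tendsto_intros)
    moreover have "2 * (q - 0) * (A s - 0) - (\<bar>d\<bar> + 0)\<^sup>2 > 0" using w q unfolding q_def[symmetric] by (simp add: field_simps)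
    ultimately have "\<forall>\<^sub>F e in at_right 0. 2 * (q - e) * (A s - e) - (\<bar>d\<bar> + e)\<^sup>2 > 0"
      using order_tendstoD(1) by blast
    moreover have "\<forall>\<^sub>F e in at_right 0. e < q" "\<forall>\<^sub>F e in at_right (0::real). e > 0"
      using q by (auto simp: eventually_at_right_field eventually_at_right_less)
    ultimately have "\<forall>\<^sub>F e in at_right 0. e > 0 \<and> e < q \<and> (\<bar>d\<bar> + e)\<^sup>2 < 2 * (q - e) * (A s - e)"
      by eventually_elim simp
    then show ?thesis using eventually_happens' by (metis (mono_tags, lifting) trivial_limit_at_right_real)
  qed
  then obtain e where e: "e > 0" "e < q" "(\<bar>d\<bar> + e)\<^sup>2 < 2 * (q - e) * (A s - e)" by blast
  obtain \<delta>1 where \<delta>1: "\<delta>1 > 0" "\<And>t. \<bar>t - s\<bar> < \<delta>1 \<Longrightarrow> \<bar>z t - d * (t - s)\<bar> \<le> e * \<bar>t - s\<bar>"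
    by (rule deriv_bound[OF z e(1)]) blast
  obtain \<delta>2 where \<delta>2: "\<delta>2 > 0" "\<And>t. t \<in> {a..b} \<Longrightarrow> \<bar>t - s\<bar> < \<delta>2 \<Longrightarrow> A t > A s - e"
    by (rule near_pos[OF A sab, of "A s - e"]) (use e in auto)
  have "\<forall>\<^sub>F t in at s. (\<mu> t - 1) / (t - s)\<^sup>2 > (q - e) / 2"
    by (rule order_tendstoD[OF d2[OF s(1,2)]]) (use e in \<open>simp add: q_def\<close>)
  then obtain \<delta>3 where \<delta>3: "\<delta>3 > 0" "\<And>t. t \<noteq> s \<Longrightarrow> \<bar>t - s\<bar> < \<delta>3 \<Longrightarrow> (\<mu> t - 1) / (t - s)\<^sup>2 > (q - e) / 2"
    unfolding eventually_at by (auto simp: dist_real_def)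
  have \<mu>b: "\<mu> t - 1 \<ge> (q - e) / 2 * (t - s)\<^sup>2" if "\<bar>t - s\<bar> < \<delta>3" for t
  proof (cases "t = s")
    case False
    then show ?thesis using \<delta>3(2)[OF False that] by (simp add: field_simps)
  qed (use eq1 s in simp)
  let ?\<delta> = "min \<delta>1 (min \<delta>2 \<delta>3)"
  have "\<forall>\<^sub>F u in at_top. u > (0::real)" by (rule eventually_gt_at_top)
  then have "\<forall>\<^sub>F u in at_top. \<forall>t\<in>{a..b}. \<bar>t - s\<bar> < ?\<delta> \<longrightarrow> above z A u t"
  proof eventually_elim
    case (elim u)
    show ?case
    proof (intro ballI impI)
      fix t assume t: "t \<in> {a..b}" "\<bar>t - s\<bar> < ?\<delta>"
      define h where "h = u * \<bar>t - s\<bar>"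
      have z1: "z t \<ge> - (\<bar>d\<bar> + e) * \<bar>t - s\<bar>"
      proof -
        have "\<bar>z t - d * (t - s)\<bar> \<le> e * \<bar>t - s\<bar>" using \<delta>1(2) t by simp
        moreover have "\<bar>d * (t - s)\<bar> \<le> \<bar>d\<bar> * \<bar>t - s\<bar>" by (simp add: abs_mult)
        ultimately show ?thesis by (simp add: algebra_simps abs_le_iff)
      qed
      have A1: "A t > A s - e" using \<delta>2(2) t by simp
      have "(q - e) / 2 * h\<^sup>2 - (\<bar>d\<bar> + e) * h + (A s - e) > 0"
      proof -
        have "2 * (q - e) * ((q - e) / 2 * h\<^sup>2 - (\<bar>d\<bar> + e) * h + (A s - e)) =
           ((q - e) * h - (\<bar>d\<bar> + e))\<^sup>2 + (2 * (q - e) * (A s - e) - (\<bar>d\<bar> + e)\<^sup>2)"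
          by (simp add: power2_eq_square field_simps)
        also have "\<dots> > 0" using e(3) by (intro add_nonneg_pos) auto
        finally have 0: "2 * (q - e) * ((q - e) / 2 * h\<^sup>2 - (\<bar>d\<bar> + e) * h + (A s - e)) > 0" .
        then show ?thesis using e(2) by (simp add: zero_less_mult_iff)
      qed
      also have "(q - e) / 2 * h\<^sup>2 - (\<bar>d\<bar> + e) * h + (A s - e) \<le> u * (u * (\<mu> t - 1) + A t / u + z t)"
      proof -
        have "u\<^sup>2 * ((q - e) / 2 * (t - s)\<^sup>2) \<le> u\<^sup>2 * (\<mu> t - 1)"
          using \<mu>b[of t] t by (intro mult_left_mono) auto
        moreover have "u * (- (\<bar>d\<bar> + e) * \<bar>t - s\<bar>) \<le> u * z t" using z1 elim by (intro mult_left_mono) auto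
        moreover have "(q - e) / 2 * h\<^sup>2 = u\<^sup>2 * ((q - e) / 2 * (t - s)\<^sup>2)" by (simp add: h_def power_mult_distrib)
        moreover have "(\<bar>d\<bar> + e) * h = - (u * (- (\<bar>d\<bar> + e) * \<bar>t - s\<bar>))" by (simp add: h_def algebra_simps)
        moreover have "u * (u * (\<mu> t - 1) + A t / u + z t) = u\<^sup>2 * (\<mu> t - 1) + A t + u * z t"
          using elim by (simp add: field_simps power2_eq_square)
        ultimately show ?thesis using A1 by linarith
      qed
      finally have "u * (u * (\<mu> t - 1) + A t / u + z t) > 0" .
      then have "u * (\<mu> t - 1) + A t / u + z t > 0" using elim by (simp add: zero_less_mult_iff)
      then show "above z A u t" unfolding above_def by (simp add: algebra_simps)
    qed
  qed
  then show ?thesis unfolding good_def using \<delta>1(1) \<delta>2(1) \<delta>3(1) by (intro exI[of _ ?\<delta>]) auto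
qed

lemma good_endpoint_sign:
  assumes A: "continuous_on {a..b} A" and s: "s \<in> S"
    and z: "(z has_real_derivative d) (at s)" "z s = 0" and w: "A s > 0"
    and sg: "s = a \<and> d > 0 \<or> s = b \<and> d < 0"
  shows "good z A s"
proof -
  have sab: "s \<in> {a..b}" using s S by auto
  have d0: "\<bar>d\<bar> > 0" using sg by auto
  \<comment> \<open>The tolerance equals the modulus of the slope: on the admissible side the linear
    term is \<open>\<bar>d\<bar> * \<bar>t - s\<bar>\<close>, so the error can at most cancel it and
    \<open>z t\<close> stays nonnegative.\<close>
  obtain \<delta>1 where \<delta>1: "\<delta>1 > 0" "\<And>t. \<bar>t - s\<bar> < \<delta>1 \<Longrightarrow> \<bar>z t - d * (t - s)\<bar> \<le> \<bar>d\<bar> * \<bar>t - s\<bar>"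
    by (rule deriv_bound[OF z d0]) blast
  obtain \<delta>2 where \<delta>2: "\<delta>2 > 0" "\<And>t. t \<in> {a..b} \<Longrightarrow> \<bar>t - s\<bar> < \<delta>2 \<Longrightarrow> A t > 0"
    by (rule near_pos[OF A sab w]) auto
  have "\<forall>\<^sub>F u in at_top. u > (0::real)" by (rule eventually_gt_at_top)
  then have "\<forall>\<^sub>F u in at_top. \<forall>t\<in>{a..b}. \<bar>t - s\<bar> < min \<delta>1 \<delta>2 \<longrightarrow> above z A u t"
  proof eventually_elim
    case (elim u)
    show ?case
    proof (intro ballI impI)
      fix t assume t: "t \<in> {a..b}" "\<bar>t - s\<bar> < min \<delta>1 \<delta>2"
      have "d * (t - s) = \<bar>d\<bar> * \<bar>t - s\<bar>" using sg t(1) by (auto simp: abs_if algebra_simps)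
      then have "z t \<ge> 0" using \<delta>1(2)[of t] t by (simp add: abs_le_iff)
      moreover have "A t / u > 0" using \<delta>2(2)[of t] t elim by simp
      moreover have "u * \<mu> t \<ge> u" using ge1[OF t(1)] elim by (simp add: mult_le_cancel_left1)
      ultimately show "above z A u t" unfolding above_def by simp
    qed
  qed
  then show ?thesis unfolding good_def using \<delta>1(1) \<delta>2(1) by (intro exI[of _ "min \<delta>1 \<delta>2"]) auto
qed

lemma good_endpoint_slope:
  assumes A: "continuous_on {a..b} A" and s: "s \<in> S" "\<mu>1 s \<noteq> 0"
    and z: "(z has_real_derivative d) (at s)" "z s = 0" and w: "A s > 0"
  shows "good z A s"
proof -
  have sab: "s \<in> {a..b}" using s S by auto
  define c where "c = \<bar>\<mu>1 s\<bar> / 2"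
  have c: "c > 0" using s by (simp add: c_def)
  have d': "((\<lambda>t. \<mu> t - 1) has_real_derivative \<mu>1 s) (at s)" using d1[OF s(1)] by (auto intro!: derivative_eq_intros)
  obtain \<delta>0 where \<delta>0: "\<delta>0 > 0" "\<And>t. \<bar>t - s\<bar> < \<delta>0 \<Longrightarrow> \<bar>(\<mu> t - 1) - \<mu>1 s * (t - s)\<bar> \<le> c * \<bar>t - s\<bar>"
    by (rule deriv_bound[OF d' _ c]) (use eq1 s in auto)
  obtain \<delta>1 where \<delta>1: "\<delta>1 > 0" "\<And>t. \<bar>t - s\<bar> < \<delta>1 \<Longrightarrow> \<bar>z t - d * (t - s)\<bar> \<le> 1 * \<bar>t - s\<bar>"
    by (rule deriv_bound[OF z, of 1]) auto
  obtain \<delta>2 where \<delta>2: "\<delta>2 > 0" "\<And>t. t \<in> {a..b} \<Longrightarrow> \<bar>t - s\<bar> < \<delta>2 \<Longrightarrow> A t > 0"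
    by (rule near_pos[OF A sab w]) auto
  have "\<forall>\<^sub>F u in at_top. u > max 0 ((\<bar>d\<bar> + 1) / c)" by (rule eventually_gt_at_top)
  then have "\<forall>\<^sub>F u in at_top. \<forall>t\<in>{a..b}. \<bar>t - s\<bar> < min \<delta>0 (min \<delta>1 \<delta>2) \<longrightarrow> above z A u t"
  proof eventually_elim
    case (elim u)
    then have u: "u > 0" by simp
    have "(\<bar>d\<bar> + 1) / c < u" using elim by simp
    then have uc: "u * c \<ge> \<bar>d\<bar> + 1" using c by (simp add: divide_less_eq)
    show ?case
    proof (intro ballI impI)
      fix t assume t: "t \<in> {a..b}" "\<bar>t - s\<bar> < min \<delta>0 (min \<delta>1 \<delta>2)"
      \<comment> \<open>The linear term has modulus \<open>2 * (c * \<bar>t - s\<bar>)\<close> and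
        the error at most half of that, so \<open>\<mu> t \<ge> 1\<close> decides the sign of the
        linear term and both end points are covered at once.\<close>
      have "\<mu> t - 1 \<ge> c * \<bar>t - s\<bar>"
      proof -
        have 1: "\<bar>(\<mu> t - 1) - \<mu>1 s * (t - s)\<bar> \<le> c * \<bar>t - s\<bar>" using \<delta>0(2) t by simp
        have 2: "\<bar>\<mu>1 s * (t - s)\<bar> = 2 * (c * \<bar>t - s\<bar>)" by (simp add: c_def abs_mult)
        have 3: "\<mu> t - 1 \<ge> 0" using ge1[OF t(1)] by simp
        have 4: "c * \<bar>t - s\<bar> \<ge> 0" using c by simp
        show ?thesis using 1 2 3 4 by linarith
      qed
      then have "u * (\<mu> t - 1) \<ge> u * (c * \<bar>t - s\<bar>)" using u by (intro mult_left_mono) auto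
      also have "u * (c * \<bar>t - s\<bar>) = (u * c) * \<bar>t - s\<bar>" by simp
      also have "\<dots> \<ge> (\<bar>d\<bar> + 1) * \<bar>t - s\<bar>" using uc by (intro mult_right_mono) auto
      finally have "u * (\<mu> t - 1) \<ge> (\<bar>d\<bar> + 1) * \<bar>t - s\<bar>" .
      moreover have "z t \<ge> - ((\<bar>d\<bar> + 1) * \<bar>t - s\<bar>)"
      proof -
        have "\<bar>d * (t - s)\<bar> = \<bar>d\<bar> * \<bar>t - s\<bar>" by (simp add: abs_mult)
        then show ?thesis using \<delta>1(2)[of t] t by (simp add: algebra_simps)
      qed
      moreover have "A t / u > 0" using \<delta>2(2)[of t] t u by simp
      ultimately show "above z A u t" unfolding above_def by (simp add: algebra_simps)
    qed
  qed
  then show ?thesis unfolding good_def using \<delta>0(1) \<delta>1(1) \<delta>2(1)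
    by (intro exI[of _ "min \<delta>0 (min \<delta>1 \<delta>2)"]) auto
qed

text \<open>At \<open>t = s + h / u\<close> all three contributions are of order
  \<open>1 / u\<close>, and \<open>u\<close> times the excess over the level tends to the quadratic
  at \<open>h\<close>.\<close>

lemma bad_quadratic:
  assumes A: "continuous_on {a..b} A" and s: "s \<in> S" "\<mu>1 s = 0"
    and z: "(z has_real_derivative d) (at s)" "z s = 0"
    and h: "h \<noteq> 0" "\<mu>2 s / 2 * h\<^sup>2 + d * h + A s < 0"
    and side: "\<forall>\<^sub>F u in at_top. s + h / u \<in> {a..b}"
  shows "\<forall>\<^sub>F u in at_top. \<exists>t\<in>{a..b}. \<not> above z A u t"
proof -
  have sab: "s \<in> {a..b}" using s S by auto
  have l: "((\<lambda>u. s + h / u) \<longlongrightarrow> s) at_top" by real_asymp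
  have fl: "filterlim (\<lambda>u. s + h / u) (at s) at_top"
    using l h(1) by (auto simp: filterlim_at intro: eventually_mono[OF eventually_gt_at_top[of 0]])
  have 1: "((\<lambda>u. (\<mu> (s + h / u) - 1) / (h / u)\<^sup>2) \<longlongrightarrow> \<mu>2 s / 2) at_top"
    using filterlim_compose[OF d2[OF s] fl] by simp
  have "((\<lambda>t. z t / (t - s)) \<longlongrightarrow> d) (at s)" using z by (simp add: has_field_derivative_iff)
  then have 2: "((\<lambda>u. z (s + h / u) / (h / u)) \<longlongrightarrow> d) at_top"
    using filterlim_compose[OF _ fl] by fastforce
  have 3: "((\<lambda>u. A (s + h / u)) \<longlongrightarrow> A s) at_top"
    using continuous_on_tendsto_compose[OF A l sab side] .
  have "((\<lambda>u. h\<^sup>2 * ((\<mu> (s + h / u) - 1) / (h / u)\<^sup>2) + h * (z (s + h / u) / (h / u)) + A (s + h / u)) \<longlongrightarrow>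
      h\<^sup>2 * (\<mu>2 s / 2) + h * d + A s) at_top"
    by (intro tendsto_intros 1 2 3)
  then have "\<forall>\<^sub>F u in at_top. h\<^sup>2 * ((\<mu> (s + h / u) - 1) / (h / u)\<^sup>2) + h * (z (s + h / u) / (h / u)) + A (s + h / u) < 0"
    by (rule order_tendstoD) (use h in \<open>simp add: algebra_simps\<close>)
  with side eventually_gt_at_top[of 0] show ?thesis
  proof eventually_elim
    case (elim u)
    let ?t = "s + h / u"
    have "h\<^sup>2 * ((\<mu> ?t - 1) / (h / u)\<^sup>2) + h * (z ?t / (h / u)) + A ?t = u * (u * (\<mu> ?t - 1) + A ?t / u + z ?t)"
      using elim h(1) by (simp add: field_simps power2_eq_square)
    with elim have "u * (\<mu> ?t - 1) + A ?t / u + z ?t < 0" by (simp add: mult_less_0_iff)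
    then have "\<not> above z A u ?t" unfolding above_def by (simp add: algebra_simps)
    with elim show ?case by blast
  qed
qed

text \<open>The substitution \<open>t = s + h / u\<close> turns the condition of staying above the level near \<open>s\<close>
  into positivity of the quadratic \<open>\<mu>2 s / 2 * h\<^sup>2 + d * h + w\<close>, on a half-line when \<open>s\<close> is an
  end point.\<close>

lemma eventually_above_iff:
  assumes z: "continuous_on {a..b} z" and A: "continuous_on {a..b} A"
    and zd: "\<And>s. s \<in> S \<Longrightarrow> (z has_real_derivative d s) (at s)" and zS: "\<And>s. s \<in> S \<Longrightarrow> z s = 0"
    and w: "\<And>s. s \<in> S \<Longrightarrow> A s > 0"
    and generic: "\<And>s. s \<in> S \<Longrightarrow> \<mu>2 s \<noteq> 0 \<Longrightarrow> A s \<noteq> (d s)\<^sup>2 / (2 * \<mu>2 s)"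
      "\<And>s. s \<in> S \<Longrightarrow> s \<in> {a, b} \<Longrightarrow> \<mu>1 s = 0 \<Longrightarrow> d s \<noteq> 0" "\<And>t. t \<in> contacts \<Longrightarrow> z t \<noteq> 0"
  shows "\<forall>\<^sub>F u in at_top. (\<forall>t\<in>{a..b}. above z A u t) \<longleftrightarrow>
    (\<forall>s\<in>S. pass s (d s) (A s)) \<and> (\<forall>t\<in>contacts. z t > 0)"
proof (cases "(\<forall>s\<in>S. pass s (d s) (A s)) \<and> (\<forall>t\<in>contacts. z t > 0)")
  case True
  have "good z A t" if t: "t \<in> {a..b}" "\<mu> t = 1" for t
  proof (cases "t \<in> S")
    case False
    then have "t \<in> contacts" using t by (simp add: contacts_def)
    with True t show ?thesis by (intro good_contact[OF z A]) auto
  next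
    case tS: True
    with True have p: "pass t (d t) (A t)" by blast
    have ends: "t \<in> {a<..<b} \<or> t = a \<or> t = b" using t by auto
    show ?thesis
    proof (cases "\<mu>1 t = 0")
      case False
      then show ?thesis by (intro good_endpoint_slope[OF A tS _ zd zS w] tS)
    next
      case m1: True
      show ?thesis
      proof (cases "t = a \<and> d t > 0 \<or> t = b \<and> d t < 0")
        case True
        then show ?thesis by (intro good_endpoint_sign[OF A tS zd zS w] tS) auto
      next
        case False
        then have "\<mu>2 t \<noteq> 0" "A t > (d t)\<^sup>2 / (2 * \<mu>2 t)"
          using p m1 ends ab pos[OF tS] by (auto simp: pass_def split: if_splits)
        then show ?thesis using second_nonneg[OF tS m1]
          by (intro good_quadratic[OF A tS m1 _ zd zS] tS) auto
      qed
    qed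
  qed
  from good_compact[OF z A this] show ?thesis using True by (auto elim: eventually_mono)
next
  case False
  have "\<forall>\<^sub>F u in at_top. \<exists>t\<in>{a..b}. \<not> above z A u t"
  proof (cases "\<exists>t\<in>contacts. \<not> z t > 0")
    case True
    then obtain t where t: "t \<in> contacts" "z t \<le> 0" by auto
    then have "z t < 0" using generic(3) by force
    moreover have tab: "t \<in> {a..b}" and "\<mu> t = 1" using t by (auto simp: contacts_def)
    ultimately have "\<forall>\<^sub>F u in at_top. \<not> above z A u t" by (intro bad_contact)
    then show ?thesis by (rule eventually_mono) (use tab in auto)
  next
    case False': False
    with False obtain s where s: "s \<in> S" "\<not> pass s (d s) (A s)" by blast
    have sab: "s \<in> {a..b}" using s S by auto
    have m1: "\<mu>1 s = 0"
      using s interior_deriv_zero[of s] sab by (cases "s \<in> {a<..<b}") (auto simp: pass_def split: if_splits)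
    have m2: "\<mu>2 s \<ge> 0" by (rule second_nonneg[OF s(1) m1])
    have sg: "(s = a \<longrightarrow> d s < 0) \<and> (s = b \<longrightarrow> d s > 0)"
      using s(2) generic(2)[OF s(1) _ m1] ab m1 by (auto simp: pass_def split: if_splits)
    have lt: "A s < (d s)\<^sup>2 / (2 * \<mu>2 s)" if "\<mu>2 s \<noteq> 0"
      using s(2) generic(1)[OF s(1) that] that by (auto simp: pass_def not_less split: if_splits)
    have d0: "d s \<noteq> 0"
    proof
      assume 0: "d s = 0"
      with sg have "s \<noteq> a" "s \<noteq> b" by auto
      with sab have "s \<in> {a<..<b}" by auto
      with pos[OF s(1)] lt 0 w[OF s(1)] show False by auto
    qed
    \<comment> \<open>The minimizer of the quadratic, with value
      \<open>A s - (d s)\<^sup>2 / (2 * \<mu>2 s)\<close>; if the quadratic degenerates, the point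
      where the line has the value \<open>- A s\<close>. At an end point \<open>sg\<close> makes it
      point into the interval.\<close>
    define h where "h = (if \<mu>2 s = 0 then - 2 * A s / d s else - d s / \<mu>2 s)"
    have h0: "h \<noteq> 0" using d0 w[OF s(1)] by (auto simp: h_def)
    have hq: "\<mu>2 s / 2 * h\<^sup>2 + d s * h + A s < 0"
    proof (cases "\<mu>2 s = 0")
      case True
      then show ?thesis using d0 w[OF s(1)] by (simp add: h_def)
    next
      case False
      then show ?thesis using lt m2 by (simp add: h_def field_simps power2_eq_square)
    qed
    have hsg: "(s = a \<longrightarrow> h > 0) \<and> (s = b \<longrightarrow> h < 0)"
      using sg w[OF s(1)] m2 by (auto simp: h_def divide_less_0_iff zero_less_divide_iff)
    have lim: "((\<lambda>u. s + h / u) \<longlongrightarrow> s) at_top" by real_asymp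
    have "\<forall>\<^sub>F u in at_top. s + h / u \<ge> a"
    proof (cases "s = a")
      case True
      then show ?thesis using hsg by (auto intro!: eventually_mono[OF eventually_gt_at_top[of 0]])
    next
      case False
      then have "s > a" using sab by simp
      from order_tendstoD(1)[OF lim this] show ?thesis by eventually_elim simp
    qed
    moreover have "\<forall>\<^sub>F u in at_top. s + h / u \<le> b"
    proof (cases "s = b")
      case True
      then show ?thesis using hsg by (auto intro!: eventually_mono[OF eventually_gt_at_top[of 0]] simp: divide_le_0_iff)
    next
      case False
      then have "s < b" using sab by simp
      from order_tendstoD(2)[OF lim this] show ?thesis by eventually_elim simp
    qed
    ultimately have side: "\<forall>\<^sub>F u in at_top. s + h / u \<in> {a..b}" by eventually_elim simp
    show ?thesis by (rule bad_quadratic[OF A s(1) m1 zd[OF s(1)] zS[OF s(1)] h0 hq side])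
  qed
  then show ?thesis using False by (auto elim: eventually_mono)
qed

end

section \<open>Entire functions and differentiability of paths\<close>

definition entire_real :: "(real \<Rightarrow> real) \<Rightarrow> bool" where
  "entire_real g \<longleftrightarrow> (\<exists>G. G holomorphic_on UNIV \<and> (\<forall>t. G (of_real t) = of_real (g t)))"

text \<open>Convergence at every real point makes the radius of convergence infinite, so the same
  coefficients define an entire function.\<close>

lemma entire_real_power_series:
  assumes "\<And>t. (\<lambda>n. c n * (t - x0) ^ n) sums g t"
  shows "entire_real g"
proof -
  have real: "summable (\<lambda>n. c n * t ^ n)" for t
    using assms[of "t + x0"] by (auto simp: sums_iff)
  have c: "summable (\<lambda>n. of_real (c n) * z ^ n)" for z :: complex
  proof (rule summable_norm_cancel)
    have "summable (\<lambda>n. norm (c n * (norm z) ^ n))"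
      by (rule powser_insidea[OF real[of "norm z + 1"]]) simp
    then show "summable (\<lambda>n. norm (of_real (c n) * z ^ n))"
      by (simp add: norm_mult norm_power abs_mult)
  qed
  define G0 where "G0 z = (\<Sum>n. of_real (c n) * z ^ n)" for z :: complex
  have "(G0 has_field_derivative (\<Sum>n. diffs (\<lambda>n. of_real (c n)) n * z ^ n)) (at z)" for z
    unfolding G0_def[abs_def] by (rule termdiffs_strong_converges_everywhere[OF c])
  then have h: "G0 holomorphic_on UNIV"
    by (intro holomorphic_onI) (auto simp: field_differentiable_def intro: has_field_derivative_at_within)
  have "(G0 \<circ> (\<lambda>z. z - of_real x0)) holomorphic_on UNIV"
    by (rule holomorphic_on_compose_gen[OF _ h]) (auto intro!: holomorphic_intros)
  then have "(\<lambda>z. G0 (z - of_real x0)) holomorphic_on UNIV" by (simp add: o_def)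
  moreover have "G0 (of_real t - of_real x0) = of_real (g t)" for t
  proof -
    have "(\<lambda>n. of_real (c n * (t - x0) ^ n)) sums (of_real (g t) :: complex)"
      by (rule sums_of_real[OF assms])
    then show ?thesis unfolding G0_def by (simp add: sums_iff)
  qed
  ultimately show ?thesis unfolding entire_real_def by blast
qed

lemma entire_real_const: "entire_real (\<lambda>_. c)"
  unfolding entire_real_def by (intro exI[of _ "\<lambda>_. of_real c"]) auto

lemma entire_real_add: "entire_real f \<Longrightarrow> entire_real g \<Longrightarrow> entire_real (\<lambda>t. f t + g t)"
  unfolding entire_real_def
  by (elim exE, rule_tac x="\<lambda>z. G z + Ga z" in exI) (auto intro!: holomorphic_intros)

lemma entire_real_cmult: "entire_real f \<Longrightarrow> entire_real (\<lambda>t. c * f t)"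
  unfolding entire_real_def
  by (elim exE, rule_tac x="\<lambda>z. of_real c * G z" in exI) (auto intro!: holomorphic_intros)

lemma entire_real_sum:
  "(\<And>i. i \<in> I \<Longrightarrow> entire_real (f i)) \<Longrightarrow> entire_real (\<lambda>t. \<Sum>i\<in>I. f i t)"
  by (induction I rule: infinite_finite_induct) (auto intro: entire_real_const entire_real_add)

text \<open>Difference quotients along the real axis are real, so the complex derivative, again
  entire, is real there. Applied twice it provides the second derivative of the conditional
  mean.\<close>

lemma entire_real_deriv:
  assumes "entire_real g"
  obtains g' where "entire_real g'" "\<And>t. (g has_real_derivative g' t) (at t)"
proof -
  obtain G where G: "G holomorphic_on UNIV" "\<And>t. G (of_real t) = of_real (g t)"
    using assms by (auto simp: entire_real_def)
  have dG: "(G has_field_derivative deriv G z) (at z)" for z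
    using holomorphic_derivI[OF G(1)] by auto
  have lim: "((\<lambda>h. of_real ((g (t + h) - g t) / h)) \<longlongrightarrow> deriv G (of_real t)) (at 0)" for t
  proof -
    have "((\<lambda>h. (G (of_real t + h) - G (of_real t)) / h) \<longlongrightarrow> deriv G (of_real t)) (at 0)"
      using dG[of "of_real t"] by (simp add: DERIV_def)
    moreover have "filterlim (\<lambda>h::real. of_real h :: complex) (at 0) (at 0)"
      unfolding filterlim_at by (auto intro!: tendsto_eq_intros simp: eventually_at_filter)
    ultimately have "((\<lambda>h. (G (of_real t + of_real h) - G (of_real t)) / of_real h) \<longlongrightarrow> deriv G (of_real t)) (at 0)"
      by (rule filterlim_compose)
    then show ?thesis by (simp flip: of_real_add add: G(2))
  qed
  define g' where "g' t = Re (deriv G (of_real t))" for t :: real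
  have "(g has_real_derivative g' t) (at t)" for t
    unfolding DERIV_def g'_def using tendsto_Re[OF lim[of t]] by simp
  moreover have "deriv G (of_real t) = of_real (g' t)" for t
  proof -
    have "((\<lambda>h::real. 0) \<longlongrightarrow> Im (deriv G (of_real t))) (at (0::real))"
      using tendsto_Im[OF lim[of t]] by simp
    then have "Im (deriv G (of_real t)) = 0" by (simp add: tendsto_const_iff)
    then show ?thesis by (simp add: g'_def complex_eq_iff)
  qed
  ultimately show ?thesis
    using that[of g'] holomorphic_deriv[OF G(1)] unfolding entire_real_def by auto
qed

lemma entire_real_continuous:
  assumes "entire_real g" shows "continuous_on A g"
proof -
  obtain g' where "\<And>t. (g has_real_derivative g' t) (at t)" using entire_real_deriv[OF assms] by metis
  then show ?thesis by (meson DERIV_isCont continuous_at_imp_continuous_on)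
qed

text \<open>The solutions accumulate in the compact interval, and the identity theorem applies to
  the entire extension.\<close>

lemma entire_real_infinite_level:
  assumes g: "entire_real g" and inf: "infinite {t\<in>{a..b}. g t = c}"
  shows "g t = c"
proof -
  obtain G where G: "G holomorphic_on UNIV" "\<And>t. G (of_real t) = of_real (g t)"
    using g by (auto simp: entire_real_def)
  let ?A = "{t\<in>{a..b}. g t = c}"
  obtain \<xi> where "\<xi> \<in> {a..b}" and lp: "\<xi> islimpt ?A"
    using inf compact_eq_Bolzano_Weierstrass[of "{a..b}"] compact_Icc[of a b] by auto
  have lp': "of_real \<xi> islimpt (of_real ` ?A :: complex set)"
    unfolding islimpt_approachable
  proof (intro allI impI)
    fix e :: real assume "e > 0"
    with lp obtain x where "x \<in> ?A" "x \<noteq> \<xi>" "dist x \<xi> < e" unfolding islimpt_approachable by blast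
    then show "\<exists>x'\<in>of_real ` ?A. x' \<noteq> of_real \<xi> \<and> dist x' (of_real \<xi> :: complex) < e"
      by (intro bexI[of _ "of_real x"]) (auto simp: dist_norm simp flip: of_real_diff)
  qed
  have "G (of_real t) - of_real c = 0"
    by (rule analytic_continuation[of "\<lambda>z. G z - of_real c" UNIV "of_real ` ?A" "of_real \<xi>"])
      (use G lp' in \<open>auto intro!: holomorphic_intros\<close>)
  then have "of_real (g t) = (of_real c :: complex)" using G(2) by simp
  then show ?thesis by (rule of_real_eq_iff[THEN iffD1])
qed

text \<open>One application of l'Hopital leaves half the difference quotient of \<open>g'\<close> at
  \<open>s\<close>, whose limit is a derivative by definition.\<close>

lemma second_order_quotient:
  assumes g1: "\<And>t. (g has_real_derivative g' t) (at t)" and g2: "(g' has_real_derivative D) (at s)"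
    and 0: "g s = c" "g' s = 0"
  shows "((\<lambda>t. (g t - c) / (t - s)\<^sup>2) \<longlongrightarrow> D / 2) (at s)"
proof (rule lhopital[where f' = g' and g' = "\<lambda>t. 2 * (t - s)"])
  have "isCont g s" using g1 by (rule DERIV_isCont)
  then show "((\<lambda>t. g t - c) \<longlongrightarrow> 0) (at s)" using 0 by (auto simp: isCont_def intro!: tendsto_eq_intros)
  show "((\<lambda>t. (t - s)\<^sup>2) \<longlongrightarrow> 0) (at s)" by (auto intro!: tendsto_eq_intros)
  show "\<forall>\<^sub>F t in at s. (t - s)\<^sup>2 \<noteq> 0" "\<forall>\<^sub>F t in at s. 2 * (t - s) \<noteq> 0"
    by (auto simp: eventually_at_filter)
  show "\<forall>\<^sub>F t in at s. ((\<lambda>t. g t - c) has_real_derivative g' t) (at t)"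
    using g1 by (auto intro!: derivative_eq_intros always_eventually)
  show "\<forall>\<^sub>F t in at s. ((\<lambda>t. (t - s)\<^sup>2) has_real_derivative 2 * (t - s)) (at t)"
    by (auto intro!: derivative_eq_intros always_eventually)
  have "((\<lambda>t. (g' t - g' s) / (t - s)) \<longlongrightarrow> D) (at s)" using g2 by (simp add: has_field_derivative_iff)
  then have "((\<lambda>t. g' t / (t - s) / 2) \<longlongrightarrow> D / 2) (at s)" using 0 by (intro tendsto_divide) auto
  then show "((\<lambda>t. g' t / (2 * (t - s))) \<longlongrightarrow> D / 2) (at s)" by (simp add: field_simps)
qed

section \<open>A dyadic criterion for differentiability at a point\<close>

definition second_diff :: "(real \<Rightarrow> real) \<Rightarrow> real \<Rightarrow> real \<Rightarrow> real" where
  "second_diff f l r = f l - 2 * f ((l + r) / 2) + f r"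

definition dyadic_pt :: "real \<Rightarrow> real \<Rightarrow> nat \<Rightarrow> nat \<Rightarrow> real" where
  "dyadic_pt l r j i = l + (r - l) * (real i / 2 ^ j)"

definition dyadic_dev :: "(real \<Rightarrow> real) \<Rightarrow> real \<Rightarrow> real \<Rightarrow> nat \<Rightarrow> real" where
  "dyadic_dev f l r j = (\<Sum>i<2 ^ j. \<bar>second_diff f (dyadic_pt l r j i) (dyadic_pt l r j (Suc i))\<bar>)"

definition secant :: "(real \<Rightarrow> real) \<Rightarrow> real \<Rightarrow> real \<Rightarrow> real \<Rightarrow> real" where
  "secant f l r t = f l + (f r - f l) / (r - l) * (t - l)"

lemma dyadic_dev_nonneg: "dyadic_dev f l r j \<ge> 0"
  unfolding dyadic_dev_def by (rule sum_nonneg) simp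

text \<open>The deviation from the secant at a midpoint is the mean of the two neighbouring
  deviations minus half a second difference of \<open>f\<close>, since the secant has none. Each
  level therefore adds at most its own \<open>dyadic_dev\<close>.\<close>

lemma dyadic_bound:
  assumes lr: "l < r" and i: "i \<le> 2 ^ j"
  shows "\<bar>f (dyadic_pt l r j i) - secant f l r (dyadic_pt l r j i)\<bar> \<le> (\<Sum>k<j. dyadic_dev f l r k)"
  using i
proof (induction j arbitrary: i)
  case 0
  then have "i = 0 \<or> i = 1" by auto
  then show ?case using lr by (auto simp: dyadic_pt_def secant_def)
next
  case (Suc j)
  let ?e = "\<lambda>t. f t - secant f l r t" and ?B = "\<Sum>k<j. dyadic_dev f l r k"
  show ?case
  proof (cases "even i")
    case True
    then obtain k where k: "i = 2 * k" by auto
    then have "dyadic_pt l r (Suc j) i = dyadic_pt l r j k" by (simp add: dyadic_pt_def)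
    moreover have "k \<le> 2 ^ j" using Suc.prems k by simp
    ultimately show ?thesis using Suc.IH[of k] dyadic_dev_nonneg[of f l r j] by simp
  next
    case False
    then obtain k where k: "i = 2 * k + 1" using oddE by blast
    then have kj: "k < 2 ^ j" using Suc.prems by simp
    let ?p = "dyadic_pt l r j k" and ?q = "dyadic_pt l r j (Suc k)"
    have mid: "dyadic_pt l r (Suc j) i = (?p + ?q) / 2" unfolding k dyadic_pt_def by (simp add: field_simps)
    have sec: "secant f l r ((?p + ?q) / 2) = (secant f l r ?p + secant f l r ?q) / 2"
    proof -
      have "f l + c * ((x + y) / 2 - l) = ((f l + c * (x - l)) + (f l + c * (y - l))) / 2" for c x y
        by (simp add: field_simps)
      then show ?thesis unfolding secant_def .
    qed
    have eq: "?e ((?p + ?q) / 2) = (?e ?p + ?e ?q) / 2 - second_diff f ?p ?q / 2"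
      unfolding sec second_diff_def by (simp add: field_simps)
    have B: "\<bar>?e ?p\<bar> \<le> ?B" "\<bar>?e ?q\<bar> \<le> ?B" using Suc.IH[of k] Suc.IH[of "Suc k"] kj by auto
    have sd: "\<bar>second_diff f ?p ?q\<bar> \<le> dyadic_dev f l r j"
      unfolding dyadic_dev_def using kj by (intro member_le_sum) auto
    have tri: "\<bar>x\<bar> \<le> B + d"
      if "x = (P + Q) / 2 - z / 2" "\<bar>P\<bar> \<le> B" "\<bar>Q\<bar> \<le> B" "\<bar>z\<bar> \<le> d" "0 \<le> d" for x P Q z B d :: real
    proof -
      have "2 * x = P + Q - z" using that(1) by (simp add: field_simps)
      then show ?thesis using that(2-5) by arith
    qed
    have "\<bar>?e ((?p + ?q) / 2)\<bar> \<le> ?B + dyadic_dev f l r j"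
      by (rule tri[OF eq B sd dyadic_dev_nonneg])
    then show ?thesis unfolding mid by simp
  qed
qed

lemma secant_bound:
  assumes lr: "l < r" and f: "continuous_on {l..r} f" and sm: "summable (dyadic_dev f l r)"
    and t: "t \<in> {l..r}"
  shows "\<bar>f t - secant f l r t\<bar> \<le> (\<Sum>k. dyadic_dev f l r k)"
proof -
  define s where "s = (t - l) / (r - l)"
  have s: "0 \<le> s" "s \<le> 1" "t = l + (r - l) * s" using lr t by (auto simp: s_def field_simps)
  define i where "i j = nat \<lfloor>s * 2 ^ j\<rfloor>" for j :: nat
  have i: "real (i j) \<le> s * 2 ^ j" "s * 2 ^ j < real (i j) + 1" for j
    unfolding i_def using s by (auto simp: of_nat_nat)
  have ijr: "real (i j) \<le> 2 ^ j" for j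
  proof -
    have "s * 2 ^ j \<le> 1 * 2 ^ j" using s(2) by (intro mult_right_mono) auto
    then show ?thesis using i(1)[of j] by linarith
  qed
  then have "real (i j) \<le> real (2 ^ j)" for j by simp
  then have ij: "i j \<le> 2 ^ j" for j by (simp only: of_nat_le_iff)
  have ratio: "(\<lambda>j. real (i j) / 2 ^ j) \<longlonglongrightarrow> s"
  proof (rule tendsto_sandwich[where f = "\<lambda>j. s - 1 / 2 ^ j" and h = "\<lambda>_. s"])
    show "\<forall>\<^sub>F j in sequentially. s - 1 / 2 ^ j \<le> real (i j) / 2 ^ j"
    proof (intro always_eventually allI)
      fix j
      have "(s * 2 ^ j - 1) / 2 ^ j \<le> real (i j) / 2 ^ j" using i(2)[of j] by (intro divide_right_mono) auto
      then show "s - 1 / 2 ^ j \<le> real (i j) / 2 ^ j" by (simp add: diff_divide_distrib)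
    qed
    show "\<forall>\<^sub>F j in sequentially. real (i j) / 2 ^ j \<le> s"
      using i(1) by (intro always_eventually allI) (simp add: field_simps)
    have "(\<lambda>j. (1 / 2 :: real) ^ j) \<longlonglongrightarrow> 0" by (rule LIMSEQ_realpow_zero) auto
    then have "(\<lambda>j. s - (1 / 2) ^ j) \<longlonglongrightarrow> s - 0" by (rule tendsto_diff[OF tendsto_const])
    then show "(\<lambda>j. s - 1 / 2 ^ j) \<longlonglongrightarrow> s" by (simp add: power_one_over)
  qed auto
  then have lim: "(\<lambda>j. dyadic_pt l r j (i j)) \<longlonglongrightarrow> t"
    unfolding dyadic_pt_def s(3) by (intro tendsto_intros)
  have mem: "dyadic_pt l r j (i j) \<in> {l..r}" for j
  proof -
    have "0 \<le> real (i j) / 2 ^ j" "real (i j) / 2 ^ j \<le> 1" using ijr[of j]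
      by (auto simp: divide_le_eq)
    then have "(r - l) * (real (i j) / 2 ^ j) \<le> (r - l) * 1"
      using lr by (intro mult_left_mono) auto
    moreover have "0 \<le> (r - l) * (real (i j) / 2 ^ j)" using lr by simp
    ultimately show ?thesis unfolding dyadic_pt_def by simp
  qed
  have c: "continuous_on {l..r} (\<lambda>t. \<bar>f t - secant f l r t\<bar>)"
    unfolding secant_def using f by (intro continuous_intros)
  have "(\<lambda>j. \<bar>f (dyadic_pt l r j (i j)) - secant f l r (dyadic_pt l r j (i j))\<bar>) \<longlonglongrightarrow> \<bar>f t - secant f l r t\<bar>"
    using continuous_on_tendsto_compose[OF c lim t] mem by simp
  moreover have "\<bar>f (dyadic_pt l r j (i j)) - secant f l r (dyadic_pt l r j (i j))\<bar> \<le> (\<Sum>k. dyadic_dev f l r k)" for j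
    using dyadic_bound[OF lr ij] sum_le_suminf[OF sm, of "{..<j}"] dyadic_dev_nonneg[of f l r] by (meson finite_lessThan order.trans)
  ultimately show ?thesis by (intro LIMSEQ_le_const2) auto
qed

text \<open>If the second differences of \<open>f\<close> on the dyadic grids of the intervals of radius
  \<open>2 ^ (- n)\<close> around \<open>t0\<close> are summable with weight \<open>2 ^ n\<close>, then the slopes of the secants over these
  intervals form a Cauchy sequence, and the distance from \<open>f\<close> to the secants is of smaller order
  than the radius.\<close>

lemma differentiable_of_dyadic_devs:
  fixes f :: "real \<Rightarrow> real"
  defines "r \<equiv> \<lambda>n::nat. 1 / 2 ^ n"
  assumes f: "continuous_on UNIV f"
    and sm: "\<And>n. summable (dyadic_dev f (t0 - r n) (t0 + r n))"
    and sm2: "summable (\<lambda>n. 2 ^ n * (\<Sum>j. dyadic_dev f (t0 - r n) (t0 + r n) j))"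
  shows "\<exists>D. (f has_real_derivative D) (at t0)"
proof -
  define \<Delta> where "\<Delta> n = (\<Sum>j. dyadic_dev f (t0 - r n) (t0 + r n) j)" for n
  have rpos: "r n > 0" for n by (simp add: r_def)
  have \<Delta>0: "\<Delta> n \<ge> 0" for n unfolding \<Delta>_def by (rule suminf_nonneg[OF sm]) (rule dyadic_dev_nonneg)
  define D where "D n = (f (t0 + r n) - f (t0 - r n)) / (2 * r n)" for n
  have b: "\<bar>f t - f t0 - D n * (t - t0)\<bar> \<le> 2 * \<Delta> n" if "\<bar>t - t0\<bar> \<le> r n" for n t
  proof -
    have lr: "t0 - r n < t0 + r n" using rpos[of n] by simp
    have s: "\<bar>f t - secant f (t0 - r n) (t0 + r n) t\<bar> \<le> \<Delta> n" if "\<bar>t - t0\<bar> \<le> r n" for t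
      unfolding \<Delta>_def using that
      by (intro secant_bound[OF lr continuous_on_subset[OF f] sm]) (auto simp: abs_le_iff)
    have "secant f (t0 - r n) (t0 + r n) t - secant f (t0 - r n) (t0 + r n) t0 = D n * (t - t0)"
    proof -
      have c: "(f (t0 + r n) - f (t0 - r n)) / ((t0 + r n) - (t0 - r n)) = D n" by (simp add: D_def)
      show ?thesis unfolding secant_def c by (simp add: algebra_simps)
    qed
    then show ?thesis using s[OF that] s[of t0] rpos[of n] by simp
  qed
  \<comment> \<open>The secant over the smaller interval differs from the larger one by two errors
    of size \<open>2 * \<Delta> n\<close> over a base of length
    \<open>2 * r (Suc n) = 1 / 2 ^ n\<close>.\<close>
  have dD: "\<bar>D (Suc n) - D n\<bar> \<le> 4 * (2 ^ n * \<Delta> n)" for n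
  proof -
    let ?h = "r (Suc n)"
    have h: "?h \<le> r n" "?h > 0" by (auto simp: r_def field_simps)
    have 1: "\<bar>f (t0 + ?h) - f t0 - D n * ?h\<bar> \<le> 2 * \<Delta> n" using b[of "t0 + ?h" n] h by simp
    have 2: "\<bar>f (t0 - ?h) - f t0 + D n * ?h\<bar> \<le> 2 * \<Delta> n" using b[of "t0 - ?h" n] h by simp
    have "D (Suc n) - D n = ((f (t0 + ?h) - f t0 - D n * ?h) - (f (t0 - ?h) - f t0 + D n * ?h)) / (2 * ?h)"
      unfolding D_def[of "Suc n"] using h by (simp add: field_simps)
    then have "\<bar>D (Suc n) - D n\<bar> =
        \<bar>(f (t0 + ?h) - f t0 - D n * ?h) - (f (t0 - ?h) - f t0 + D n * ?h)\<bar> / (2 * ?h)"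
      using h(2) by (simp add: abs_divide)
    also have "\<dots> \<le> 4 * \<Delta> n / (2 * ?h)"
    proof (rule divide_right_mono)
      show "\<bar>(f (t0 + ?h) - f t0 - D n * ?h) - (f (t0 - ?h) - f t0 + D n * ?h)\<bar> \<le> 4 * \<Delta> n"
        using 1 2 by linarith
    qed (use h(2) in simp)
    also have "\<dots> = 4 * (2 ^ n * \<Delta> n)" by (simp add: r_def field_simps)
    finally show ?thesis .
  qed
  have "summable (\<lambda>n. D (Suc n) - D n)"
  proof (rule summable_comparison_test')
    show "summable (\<lambda>n. 4 * (2 ^ n * \<Delta> n))" using sm2 unfolding \<Delta>_def by (rule summable_mult)
    show "norm (D (Suc n) - D n) \<le> 4 * (2 ^ n * \<Delta> n)" for n using dD by simp
  qed
  then have "(\<lambda>n. \<Sum>i<n. D (Suc i) - D i) \<longlonglongrightarrow> (\<Sum>i. D (Suc i) - D i)" by (rule summable_LIMSEQ)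
  then have "(\<lambda>n. D n - D 0) \<longlonglongrightarrow> (\<Sum>i. D (Suc i) - D i)" by (simp add: sum_lessThan_telescope)
  from tendsto_add[OF this tendsto_const[of "D 0"]] obtain D0 where D0: "D \<longlonglongrightarrow> D0" by auto
  have eps: "(\<lambda>n. 2 ^ n * \<Delta> n) \<longlonglongrightarrow> 0" using summable_LIMSEQ_zero[OF sm2] by (simp add: \<Delta>_def)
  have "((\<lambda>t. (f t - f t0) / (t - t0)) \<longlongrightarrow> D0) (at t0)"
    unfolding tendsto_iff eventually_at
  proof (intro allI impI)
    fix e :: real assume e: "e > 0"
    have "\<forall>\<^sub>F n in sequentially. dist (D n) D0 < e / 2 \<and> 4 * (2 ^ n * \<Delta> n) < e / 2"
    proof (intro eventually_conj)
      show "\<forall>\<^sub>F n in sequentially. dist (D n) D0 < e / 2"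
        using D0 half_gt_zero[OF e] unfolding tendsto_iff by blast
      have "(\<lambda>n. 4 * (2 ^ n * \<Delta> n)) \<longlonglongrightarrow> 4 * 0" by (intro tendsto_intros eps)
      then show "\<forall>\<^sub>F n in sequentially. 4 * (2 ^ n * \<Delta> n) < e / 2" by (rule order_tendstoD(2)) (use e in simp)
    qed
    then obtain N where N: "\<And>n. n \<ge> N \<Longrightarrow> dist (D n) D0 < e / 2" "\<And>n. n \<ge> N \<Longrightarrow> 4 * (2 ^ n * \<Delta> n) < e / 2"
      unfolding eventually_sequentially by blast
    have "dist ((f t - f t0) / (t - t0)) D0 < e" if t: "t \<noteq> t0" "dist t t0 < r N" for t
    proof -
      define y where "y = \<bar>t - t0\<bar>"
      have y: "y > 0" "y < r N" using t by (auto simp: y_def dist_real_def)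
      have "\<exists>m. r m < y"
        using real_arch_pow_inv[of y "1/2"] y by (auto simp: r_def power_one_over)
      \<comment> \<open>The least scale gives \<open>r m < y \<le> r n\<close> with
        \<open>m = Suc n\<close>: the secant of radius \<open>r n\<close> controls the point
        \<open>t\<close>, and division by \<open>y\<close> instead of \<open>r n\<close> costs only
        a factor 2.\<close>
      define m where "m = (LEAST m. r m < y)"
      have m: "r m < y" unfolding m_def by (rule LeastI_ex) fact
      have "m > N"
      proof (rule ccontr)
        assume "\<not> m > N"
        then have "r N \<le> r m" by (simp add: r_def field_simps power_increasing)
        with m y show False by simp
      qed
      then obtain n where n: "m = Suc n" "n \<ge> N" by (cases m) auto
      have yn: "y \<le> r n" using not_less_Least[of n "\<lambda>m. r m < y"] n by (simp add: m_def[symmetric] not_less)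
      have "(f t - f t0) / (t - t0) - D n = (f t - f t0 - D n * (t - t0)) / (t - t0)"
        using t by (simp add: diff_divide_distrib)
      then have "\<bar>(f t - f t0) / (t - t0) - D n\<bar> = \<bar>f t - f t0 - D n * (t - t0)\<bar> / y"
        by (simp only: abs_divide y_def)
      also have "\<dots> \<le> 2 * \<Delta> n / r m"
        using b[of t n] yn m rpos[of m] \<Delta>0[of n] unfolding y_def by (intro frac_le) auto
      also have "\<dots> = 4 * (2 ^ n * \<Delta> n)" by (simp add: n r_def)
      also have "\<dots> < e / 2" by (rule N(2)[OF n(2)])
      finally show ?thesis using N(1)[OF n(2)] unfolding dist_real_def by linarith
    qed
    then show "\<exists>d>0. \<forall>t\<in>UNIV. t \<noteq> t0 \<and> dist t t0 < d \<longrightarrow> dist ((f t - f t0) / (t - t0)) D0 < e"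
      using rpos[of N] by (intro exI[of _ "r N"]) auto
  qed
  then show ?thesis by (auto simp: has_field_derivative_iff)
qed

section \<open>Covariance functions\<close>

lemma gaussian_family_of_process:
  assumes "prob_space M" "centered_gaussian_process M X"
  shows "gaussian_family M X"
  unfolding gaussian_family_def
proof
  fix L assume "L \<in> lincombs X"
  then obtain I c where I: "finite I" and L: "L = (\<lambda>x. \<Sum>t\<in>I. c t * X t x)" by (auto simp: lincombs_def)
  have [measurable]: "X t \<in> borel_measurable M" for t using assms(2) by (simp add: centered_gaussian_process_def)
  have "L \<in> borel_measurable M" unfolding L by measurable
  moreover have "mean_zero_normal (distr M borel L)"
    unfolding L using assms(2) I unfolding centered_gaussian_process_def by blast
  ultimately show "centered_normal M L" by (simp add: centered_normal_def)
qed

lemma covfun_sym: "covfun M X s t = covfun M X t s"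
  by (simp add: covfun_def mult.commute)

context prob_space
begin

lemma lincomb_second_moment:
  assumes G: "gaussian_family M X" and I: "finite I"
  shows "expectation (\<lambda>x. (\<Sum>i\<in>I. c i * X (s i) x)\<^sup>2) = (\<Sum>i\<in>I. \<Sum>j\<in>I. c i * c j * covfun M X (s i) (s j))"
proof -
  have "expectation (\<lambda>x. (\<Sum>i\<in>I. c i * X (s i) x)\<^sup>2) =
    expectation (\<lambda>x. \<Sum>i\<in>I. \<Sum>j\<in>I. c i * c j * (X (s i) x * X (s j) x))"
    unfolding power2_eq_square sum_product by (intro Bochner_Integration.integral_cong sum.cong) (auto simp: mult_ac)
  also have "\<dots> = (\<Sum>i\<in>I. \<Sum>j\<in>I. c i * c j * covfun M X (s i) (s j))"
    unfolding covfun_def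
    using lincombs_integrable_mult[OF G lincombs_base lincombs_base]
    by (simp add: Bochner_Integration.integral_sum integrable_sum)
  finally show ?thesis .
qed

text \<open>The iterated series is a power series in the outer variable, with the inner sums as
  coefficients; symmetry of the covariance carries this over to the second argument.\<close>

lemma covfun_entire_a:
  assumes "assumption_a M X a b"
  shows "entire_real (covfun M X s)"
proof -
  obtain r :: "nat \<Rightarrow> nat \<Rightarrow> real" where
    r1: "\<And>s t m. summable (\<lambda>n. r m n * s ^ m * t ^ n)"
    and r2: "\<And>s t. (\<lambda>m. \<Sum>n. r m n * s ^ m * t ^ n) sums covfun M X s t"
    using assms[unfolded assumption_a_def, THEN conjunct1] by blast
  have "(\<lambda>m. (\<Sum>n. r m n * s ^ n) * (t - 0) ^ m) sums covfun M X s t" for t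
  proof -
    have sm: "summable (\<lambda>n. r m n * s ^ n)" for m using r1[of m 1 s] by simp
    have "(\<Sum>n. r m n * t ^ m * s ^ n) = (\<Sum>n. r m n * s ^ n) * (t - 0) ^ m" for m
      by (subst suminf_mult2[OF sm]) (simp add: mult_ac)
    then show ?thesis using r2[of t s] covfun_sym[of M X s t] by simp
  qed
  then show ?thesis by (rule entire_real_power_series)
qed

end

section \<open>The spectral representation\<close>

locale spectral_process = prob_space M for M :: "'a measure" +
  fixes X :: "real \<Rightarrow> 'a \<Rightarrow> real" and F :: "real measure"
  assumes G: "gaussian_family M X"
    and spec: "spectral_measure M X F"
    and expint: "\<And>t. integrable F (\<lambda>x. exp (t * x))"
begin

lemma setsF[measurable_cong]: "sets F = sets borel" using spec by (simp add: spectral_measure_def)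

lemma spaceF: "space F = UNIV" using sets_eq_imp_space_eq[OF setsF] by simp

sublocale F: finite_measure F using spec by (simp add: spectral_measure_def)

lemma expabs: "integrable F (\<lambda>x. exp (\<bar>t * x\<bar>))"
proof (rule Bochner_Integration.integrable_bound)
  show "integrable F (\<lambda>x. exp (t * x) + exp (- t * x))" using expint by (intro Bochner_Integration.integrable_add)
  show "AE x in F. norm (exp \<bar>t * x\<bar>) \<le> norm (exp (t * x) + exp (- t * x))"
  proof (intro AE_I2)
    fix x
    have "exp \<bar>t * x\<bar> \<le> exp (t * x) + exp (- t * x)" by (auto simp: abs_if)
    moreover have "0 \<le> exp (t * x) + exp (- t * x)" by (intro add_nonneg_nonneg) auto
    ultimately show "norm (exp \<bar>t * x\<bar>) \<le> norm (exp (t * x) + exp (- t * x))" by simp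
  qed
qed simp

lemma moment_integrable: "integrable F (\<lambda>x. x ^ n)"
proof (rule Bochner_Integration.integrable_bound)
  show "integrable F (\<lambda>x. fact n * exp \<bar>1 * x\<bar>)" using expabs[of 1] by (rule integrable_mult_right)
  have "\<bar>x\<bar> ^ n \<le> fact n * exp \<bar>x\<bar>" for x :: real
  proof -
    have "\<bar>x\<bar> ^ n / fact n \<le> exp \<bar>x\<bar>"
      using sum_le_suminf[of "\<lambda>n. \<bar>x\<bar> ^ n / fact n" "{n}"] summable_exp[of "\<bar>x\<bar>"]
      by (simp add: exp_def divide_inverse mult.commute)
    then show ?thesis by (simp add: field_simps)
  qed
  then show "AE x in F. norm (x ^ n) \<le> norm (fact n * exp \<bar>1 * x\<bar>)"
    by (intro AE_I2) (simp add: power_abs)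
qed simp

lemma covfun_cos: "covfun M X s t = (\<integral>x. cos ((t - s) * x) \<partial>F)"
proof -
  have "complex_of_real (covfun M X s t) = char F (t - s)" using spec by (simp add: spectral_measure_def)
  then have "covfun M X s t = Re (char F (t - s))" by (metis Re_complex_of_real)
  also have "\<dots> = (\<integral>x. Re (iexp ((t - s) * x)) \<partial>F)"
    unfolding char_def by (rule integral_Re[symmetric], rule F.integrable_const_bound[where B=1]) auto
  finally show ?thesis by (simp add: Re_exp)
qed

text \<open>The cosine series in powers of \<open>t - s\<close> may be integrated term by term,
  because its absolute partial sums are dominated by \<open>exp \<bar>(t - s) * x\<bar>\<close>,
  which is integrable by the exponential moments of both signs.\<close>

lemma covfun_entire_b: "entire_real (covfun M X s)"
proof (rule entire_real_power_series)
  fix t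
  let ?\<tau> = "t - s"
  let ?f = "\<lambda>n x. cos_coeff n * (?\<tau> * x) ^ n"
  have i: "integrable F (?f n)" for n
    using moment_integrable[of n] by (simp add: power_mult_distrib mult.assoc[symmetric])
  have cc: "\<bar>cos_coeff n\<bar> \<le> 1 / fact n" for n by (simp add: cos_coeff_def)
  have b: "norm (?f n x) \<le> \<bar>?\<tau> * x\<bar> ^ n / fact n" for n x
    using mult_right_mono[OF cc[of n], of "\<bar>?\<tau> * x\<bar> ^ n"] by (simp add: abs_mult power_abs)
  have es: "(\<lambda>n. y ^ n / fact n) sums exp y" for y :: real
    using exp_converges[of y] by (simp add: divide_inverse mult.commute)
  have "(\<lambda>n. \<integral>x. ?f n x \<partial>F) sums (\<integral>x. (\<Sum>n. ?f n x) \<partial>F)"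
  proof (rule sums_integral[OF i])
    show "AE x in F. summable (\<lambda>n. norm (?f n x))"
      by (intro AE_I2 summable_comparison_test'[OF sums_summable[OF es]]) (use b in auto)
    show "summable (\<lambda>n. \<integral>x. norm (?f n x) \<partial>F)"
    proof (rule bounded_imp_summable)
      show "0 \<le> (\<integral>x. norm (?f n x) \<partial>F)" for n by simp
      fix N
      have "(\<Sum>n\<le>N. \<integral>x. norm (?f n x) \<partial>F) = (\<integral>x. (\<Sum>n\<le>N. norm (?f n x)) \<partial>F)"
        using i by (intro Bochner_Integration.integral_sum[symmetric] integrable_norm)
      also have "\<dots> \<le> (\<integral>x. exp \<bar>?\<tau> * x\<bar> \<partial>F)"
      proof (rule integral_mono)
        show "integrable F (\<lambda>x. \<Sum>n\<le>N. norm (?f n x))" by (intro Bochner_Integration.integrable_sum integrable_norm i)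
        show "integrable F (\<lambda>x. exp \<bar>?\<tau> * x\<bar>)" by (rule expabs)
        fix x
        have "(\<Sum>n\<le>N. norm (?f n x)) \<le> (\<Sum>n\<le>N. \<bar>?\<tau> * x\<bar> ^ n / fact n)" by (intro sum_mono b)
        also have "\<dots> \<le> (\<Sum>n. \<bar>?\<tau> * x\<bar> ^ n / fact n)" by (rule sum_le_suminf[OF sums_summable[OF es]]) auto
        also have "\<dots> = exp \<bar>?\<tau> * x\<bar>" using es by (simp add: sums_iff)
        finally show "(\<Sum>n\<le>N. norm (?f n x)) \<le> exp \<bar>?\<tau> * x\<bar>" .
      qed
      finally show "(\<Sum>n\<le>N. \<integral>x. norm (?f n x) \<partial>F) \<le> (\<integral>x. exp \<bar>?\<tau> * x\<bar> \<partial>F)" .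
    qed
  qed
  moreover have "(\<Sum>n. ?f n x) = cos (?\<tau> * x)" for x
    using cos_converges[of "?\<tau> * x"] by (simp add: sums_iff)
  moreover have "(\<integral>x. ?f n x \<partial>F) = (cos_coeff n * (\<integral>x. x ^ n \<partial>F)) * (t - s) ^ n" for n
    by (simp add: power_mult_distrib mult.assoc[symmetric])
  ultimately show "(\<lambda>n. (cos_coeff n * (\<integral>x. x ^ n \<partial>F)) * (t - s) ^ n) sums covfun M X s t"
    unfolding covfun_cos by (simp only:)
qed

lemma cmod_trig_sum:
  fixes c s :: "'k \<Rightarrow> real"
  assumes "finite I"
  shows "(cmod (\<Sum>i\<in>I. of_real (c i) * iexp (s i * x)))\<^sup>2 = (\<Sum>i\<in>I. \<Sum>j\<in>I. c i * c j * cos ((s j - s i) * x))"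
proof -
  have "(cmod (\<Sum>i\<in>I. of_real (c i) * iexp (s i * x)))\<^sup>2 =
     (\<Sum>i\<in>I. c i * cos (s i * x))\<^sup>2 + (\<Sum>i\<in>I. c i * sin (s i * x))\<^sup>2"
    unfolding cmod_power2 by (simp add: Re_exp Im_exp)
  also have "\<dots> = (\<Sum>i\<in>I. \<Sum>j\<in>I. c i * c j * cos ((s j - s i) * x))"
    unfolding power2_eq_square sum_product sum.distrib[symmetric]
    by (intro sum.cong refl) (simp add: left_diff_distrib cos_diff algebra_simps)
  finally show ?thesis .
qed

text \<open>The spectral isometry: \<open>X s\<close> corresponds to the function
  \<open>iexp (s * x)\<close> of \<open>x\<close> in the square integrable functions for
  \<open>F\<close>.\<close>

lemma second_moment_spectral:
  fixes c s :: "'k \<Rightarrow> real"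
  assumes I: "finite I"
  shows "expectation (\<lambda>\<omega>. (\<Sum>i\<in>I. c i * X (s i) \<omega>)\<^sup>2) =
    (\<integral>x. (cmod (\<Sum>i\<in>I. of_real (c i) * iexp (s i * x)))\<^sup>2 \<partial>F)"
proof -
  have i: "integrable F (\<lambda>x. cos (d * x))" for d by (rule F.integrable_const_bound[where B=1]) auto
  have "(\<integral>x. (cmod (\<Sum>i\<in>I. of_real (c i) * iexp (s i * x)))\<^sup>2 \<partial>F) =
     (\<integral>x. (\<Sum>i\<in>I. \<Sum>j\<in>I. c i * c j * cos ((s j - s i) * x)) \<partial>F)"
    by (simp only: cmod_trig_sum[OF I])
  also have "\<dots> = (\<Sum>i\<in>I. \<Sum>j\<in>I. c i * c j * (\<integral>x. cos ((s j - s i) * x) \<partial>F))"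
    using i by (simp add: Bochner_Integration.integral_sum integrable_sum)
  finally show ?thesis unfolding lincomb_second_moment[OF G I] covfun_cos ..
qed

text \<open>With \<open>h\<close> half the length, the second difference corresponds to a function
  of modulus \<open>2 - 2 * cos (h * x)\<close>, at most \<open>(h * x)\<^sup>2\<close>; squaring
  gives fourth order in the step against the fourth moment of \<open>F\<close>.\<close>

lemma second_difference_moment:
  "expectation (\<lambda>\<omega>. (second_diff (\<lambda>t. X t \<omega>) l r)\<^sup>2) \<le> ((r - l) / 2) ^ 4 * (\<integral>x. x ^ 4 \<partial>F)"
proof -
  define s where "s = (\<lambda>i::nat. if i = 0 then l else if i = 1 then (l + r) / 2 else r)"
  define c where "c = (\<lambda>i::nat. if i = 1 then - 2 else 1 :: real)"
  define h where "h = (r - l) / 2"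
  have I: "{..<3::nat} = {0, 1, 2}" by auto
  have "(\<Sum>i<3. c i * X (s i) \<omega>) = second_diff (\<lambda>t. X t \<omega>) l r" for \<omega>
    by (simp add: I c_def s_def second_diff_def)
  then have "expectation (\<lambda>\<omega>. (second_diff (\<lambda>t. X t \<omega>) l r)\<^sup>2) =
     (\<integral>x. (cmod (\<Sum>i<3. of_real (c i) * iexp (s i * x)))\<^sup>2 \<partial>F)"
    using second_moment_spectral[of "{..<3}" c s] by simp
  also have "\<dots> \<le> (\<integral>x. h ^ 4 * x ^ 4 \<partial>F)"
  proof (rule integral_mono')
    show "integrable F (\<lambda>x. h ^ 4 * x ^ 4)" using moment_integrable by (rule integrable_mult_right)
    fix x
    have e: "(\<Sum>i<3. of_real (c i) * iexp (s i * x)) = iexp ((l + r) / 2 * x) * of_real (2 * cos (h * x) - 2)"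
    proof -
      have 1: "iexp (l * x) = iexp ((l + r) / 2 * x) * iexp (- (h * x))"
        unfolding h_def by (simp flip: exp_add add: field_simps)
      have 2: "iexp (r * x) = iexp ((l + r) / 2 * x) * iexp (h * x)"
        unfolding h_def by (simp flip: exp_add add: field_simps)
      have 3: "iexp (h * x) + iexp (- (h * x)) = of_real (2 * cos (h * x))"
        by (simp add: complex_eq_iff Re_exp Im_exp)
      have "(\<Sum>i<3. of_real (c i) * iexp (s i * x)) = iexp (l * x) - 2 * iexp ((l + r) / 2 * x) + iexp (r * x)"
        by (simp add: I c_def s_def)
      also have "\<dots> = iexp ((l + r) / 2 * x) * ((iexp (h * x) + iexp (- (h * x))) - 2)"
        unfolding 1 2 by (simp add: algebra_simps)
      finally show ?thesis unfolding 3 by simp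
    qed
    have "\<bar>2 * cos (h * x) - 2\<bar> \<le> (h * x)\<^sup>2"
    proof -
      have "cos (2 * (h * x / 2)) = 1 - 2 * (sin (h * x / 2))\<^sup>2" by (rule cos_double_sin)
      then have "\<bar>2 * cos (h * x) - 2\<bar> = 4 * (sin (h * x / 2))\<^sup>2" by simp
      also have "(sin (h * x / 2))\<^sup>2 \<le> (h * x / 2)\<^sup>2"
        using abs_sin_x_le_abs_x[of "h * x / 2"] unfolding abs_le_square_iff .
      finally show ?thesis by (simp add: power2_eq_square)
    qed
    then have "(\<bar>2 * cos (h * x) - 2\<bar>)\<^sup>2 \<le> ((h * x)\<^sup>2)\<^sup>2" by (intro power_mono) auto
    also have "((h * x)\<^sup>2)\<^sup>2 = h ^ 4 * x ^ 4" by (simp add: power_mult_distrib)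
    finally show "(cmod (\<Sum>i<3. of_real (c i) * iexp (s i * x)))\<^sup>2 \<le> h ^ 4 * x ^ 4"
      by (simp only: e norm_mult norm_of_real norm_exp_i_times mult_1)
  qed auto
  finally show ?thesis by (simp add: h_def)
qed

text \<open>On radius \<open>r n\<close> and level \<open>j\<close> there are \<open>2 ^ j\<close>
  second differences, each of mean modulus at most \<open>K * (r n / 2 ^ j)\<^sup>2\<close>, in
  total \<open>K * (1/4) ^ n * (1/2) ^ j\<close>. This is summable over both indices even after
  weighting with \<open>2 ^ n\<close>, so the random series required by
  \<open>differentiable_of_dyadic_devs\<close> converge almost surely.\<close>

lemma AE_differentiable:
  assumes cont: "\<And>\<omega>. \<omega> \<in> space M \<Longrightarrow> continuous_on UNIV (\<lambda>t. X t \<omega>)"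
  shows "AE \<omega> in M. \<exists>D. ((\<lambda>t. X t \<omega>) has_real_derivative D) (at t0)"
proof -
  have [measurable]: "X t \<in> borel_measurable M" for t by (rule lincombs_normal(2)[OF G lincombs_base])
  define r where "r n = (1 / 2 ^ n :: real)" for n :: nat
  define K where "K = sqrt (\<integral>x. x ^ 4 \<partial>F)"
  have dm[measurable]: "(\<lambda>\<omega>. second_diff (\<lambda>t. X t \<omega>) l r) \<in> borel_measurable M" for l r
    unfolding second_diff_def by measurable
  have m1: "(\<integral>\<^sup>+\<omega>. ennreal \<bar>second_diff (\<lambda>t. X t \<omega>) l r\<bar> \<partial>M) \<le> ennreal (K * ((r - l) / 2)\<^sup>2)" for l r
  proof -
    let ?D = "\<lambda>\<omega>. second_diff (\<lambda>t. X t \<omega>) l r"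
    have Dl: "?D \<in> lincombs X"
      unfolding second_diff_def by (intro lincombs_add lincombs_diff lincombs_cmult lincombs_base)
    have i1: "integrable M ?D" by (rule lincombs_normal(3)[OF G Dl])
    have i2: "integrable M (\<lambda>\<omega>. (?D \<omega>)\<^sup>2)" using lincombs_integrable_mult[OF G Dl Dl] by (simp add: power2_eq_square)
    have "(expectation (\<lambda>\<omega>. \<bar>?D \<omega>\<bar>))\<^sup>2 \<le> expectation (\<lambda>\<omega>. \<bar>?D \<omega>\<bar>\<^sup>2)"
    proof -
      have "0 \<le> variance (\<lambda>\<omega>. \<bar>?D \<omega>\<bar>)" by simp
      also have "\<dots> = expectation (\<lambda>\<omega>. \<bar>?D \<omega>\<bar>\<^sup>2) - (expectation (\<lambda>\<omega>. \<bar>?D \<omega>\<bar>))\<^sup>2"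
        using i1 i2 by (intro variance_eq) auto
      finally show ?thesis by simp
    qed
    also have "\<dots> \<le> ((r - l) / 2) ^ 4 * (\<integral>x. x ^ 4 \<partial>F)" using second_difference_moment[of l r] by simp
    also have "\<dots> = (K * ((r - l) / 2)\<^sup>2)\<^sup>2"
      unfolding K_def power_mult_distrib by (simp add: integral_nonneg_AE)
    finally have "expectation (\<lambda>\<omega>. \<bar>?D \<omega>\<bar>) \<le> K * ((r - l) / 2)\<^sup>2"
      by (rule power2_le_imp_le) (simp add: K_def integral_nonneg_AE)
    then show ?thesis using i1 by (subst nn_integral_eq_integral) (auto intro: ennreal_leI)
  qed
  define d where "d n j \<omega> = dyadic_dev (\<lambda>t. X t \<omega>) (t0 - r n) (t0 + r n) j" for n j \<omega>
  have d0: "d n j \<omega> \<ge> 0" for n j \<omega> unfolding d_def by (rule dyadic_dev_nonneg)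
  have dme[measurable]: "d n j \<in> borel_measurable M" for n j unfolding d_def[abs_def] dyadic_dev_def by measurable
  have md: "(\<integral>\<^sup>+\<omega>. ennreal (d n j \<omega>) \<partial>M) \<le> ennreal (K * (1/4) ^ n * (1/2) ^ j)" for n j
  proof -
    let ?p = "dyadic_pt (t0 - r n) (t0 + r n) j"
    have gap: "(?p (Suc i) - ?p i) / 2 = r n / 2 ^ j" for i
      unfolding dyadic_pt_def by (simp add: field_simps)
    have "(\<integral>\<^sup>+\<omega>. ennreal (d n j \<omega>) \<partial>M) = (\<integral>\<^sup>+\<omega>. (\<Sum>i<2 ^ j. ennreal \<bar>second_diff (\<lambda>t. X t \<omega>) (?p i) (?p (Suc i))\<bar>) \<partial>M)"
      unfolding d_def dyadic_dev_def by (simp add: sum_ennreal)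
    also have "\<dots> = (\<Sum>i<2 ^ j. \<integral>\<^sup>+\<omega>. ennreal \<bar>second_diff (\<lambda>t. X t \<omega>) (?p i) (?p (Suc i))\<bar> \<partial>M)"
      by (rule nn_integral_sum) measurable
    also have "\<dots> \<le> (\<Sum>i<(2::nat) ^ j. ennreal (K * (r n / 2 ^ j)\<^sup>2))"
      by (intro sum_mono order.trans[OF m1]) (simp only: gap order.refl)
    also have "\<dots> = ennreal (2 ^ j * (K * (r n / 2 ^ j)\<^sup>2))"
    proof -
      have "(\<Sum>i<(2::nat) ^ j. ennreal (K * (r n / 2 ^ j)\<^sup>2)) = of_nat (2 ^ j) * ennreal (K * (r n / 2 ^ j)\<^sup>2)"
        by (simp only: sum_constant card_lessThan)
      also have "of_nat (2 ^ j) = ennreal (2 ^ j)"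
        by (simp only: ennreal_of_nat_eq_real_of_nat of_nat_power of_nat_numeral)
      also have "ennreal (2 ^ j) * ennreal (K * (r n / 2 ^ j)\<^sup>2) = ennreal (2 ^ j * (K * (r n / 2 ^ j)\<^sup>2))"
        by (rule ennreal_mult[symmetric]) (simp_all add: K_def integral_nonneg_AE)
      finally show ?thesis .
    qed
    also have "2 ^ j * (K * (r n / 2 ^ j)\<^sup>2) = K * (1/4) ^ n * (1/2) ^ j"
    proof -
      have "(r n)\<^sup>2 = ((1/2)\<^sup>2) ^ n"
        unfolding r_def power_one_over[symmetric] by (simp only: power_mult[symmetric] mult.commute)
      also have "(1/2 :: real)\<^sup>2 = 1/4" by (simp add: power2_eq_square)
      finally have r2: "(r n)\<^sup>2 = (1/4) ^ n" .
      have "2 ^ j * (K * (r n / 2 ^ j)\<^sup>2) = K * (r n)\<^sup>2 * (1 / 2 ^ j)"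
        by (simp add: power2_eq_square)
      then show ?thesis unfolding r2 by (simp only: power_one_over)
    qed
    finally show ?thesis .
  qed
  have K0: "K \<ge> 0" unfolding K_def by (simp add: integral_nonneg_AE)
  have "(\<integral>\<^sup>+\<omega>. (\<Sum>n. \<Sum>j. ennreal (2 ^ n * d n j \<omega>)) \<partial>M) = (\<Sum>n. \<Sum>j. \<integral>\<^sup>+\<omega>. ennreal (2 ^ n * d n j \<omega>) \<partial>M)"
    by (subst nn_integral_suminf, measurable) (intro suminf_cong nn_integral_suminf, measurable)
  also have "\<dots> \<le> (\<Sum>n. \<Sum>j. ennreal (K * (1/2) ^ n * (1/2) ^ j))"
  proof (intro suminf_le allI)
    fix n j
    have "(\<integral>\<^sup>+\<omega>. ennreal (2 ^ n * d n j \<omega>) \<partial>M) = ennreal (2 ^ n) * (\<integral>\<^sup>+\<omega>. ennreal (d n j \<omega>) \<partial>M)"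
      by (simp add: ennreal_mult d0 nn_integral_cmult)
    also have "\<dots> \<le> ennreal (2 ^ n) * ennreal (K * (1/4) ^ n * (1/2) ^ j)" by (intro mult_left_mono md) simp
    also have "\<dots> = ennreal (2 ^ n * (K * (1/4) ^ n * (1/2) ^ j))" using K0 by (intro ennreal_mult[symmetric]) auto
    also have "2 ^ n * (K * (1/4) ^ n * (1/2) ^ j) = K * (2 * (1/4)) ^ n * (1/2) ^ j"
      unfolding power_mult_distrib by simp
    finally show "(\<integral>\<^sup>+\<omega>. ennreal (2 ^ n * d n j \<omega>) \<partial>M) \<le> ennreal (K * (1/2) ^ n * (1/2) ^ j)" by simp
  qed auto
  also have "\<dots> = (\<Sum>n. ennreal (K * (1/2) ^ n * 2))"
  proof (intro suminf_cong)
    fix n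
    have "(\<lambda>j. K * (1/2) ^ n * (1/2) ^ j) sums (K * (1/2) ^ n * 2)"
      using sums_mult[OF geometric_sums[of "1/2::real"], of "K * (1/2) ^ n"] by simp
    then show "(\<Sum>j. ennreal (K * (1/2) ^ n * (1/2) ^ j)) = ennreal (K * (1/2) ^ n * 2)"
      using K0 by (intro suminf_ennreal_eq) auto
  qed
  also have "\<dots> = ennreal (4 * K)"
  proof -
    have "(\<lambda>n. (K * 2) * (1/2) ^ n) sums (K * 2 * 2)"
      using sums_mult[OF geometric_sums[of "1/2::real"], of "K * 2"] by simp
    then have "(\<lambda>n. K * (1/2) ^ n * 2) sums (4 * K)" by (simp add: mult_ac)
    then show ?thesis using K0 by (intro suminf_ennreal_eq) auto
  qed
  finally have fin: "(\<integral>\<^sup>+\<omega>. (\<Sum>n. \<Sum>j. ennreal (2 ^ n * d n j \<omega>)) \<partial>M) \<noteq> \<infinity>"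
    by (auto simp: top_unique)
  have "AE \<omega> in M. (\<Sum>n. \<Sum>j. ennreal (2 ^ n * d n j \<omega>)) \<noteq> \<infinity>"
    by (rule nn_integral_PInf_AE[OF _ fin]) measurable
  with AE_space show ?thesis
  proof eventually_elim
    case (elim \<omega>)
    have finn: "(\<Sum>j. ennreal (2 ^ n * d n j \<omega>)) \<noteq> Orderings.top" for n
    proof
      assume "(\<Sum>j. ennreal (2 ^ n * d n j \<omega>)) = Orderings.top"
      moreover have "(\<Sum>j. ennreal (2 ^ n * d n j \<omega>)) \<le> (\<Sum>n. \<Sum>j. ennreal (2 ^ n * d n j \<omega>))"
        using sum_le_suminf[of "\<lambda>n. \<Sum>j. ennreal (2 ^ n * d n j \<omega>)" "{n}"] by simp
      ultimately show False using elim(2) by (simp add: top_unique)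
    qed
    have sj: "summable (\<lambda>j. 2 ^ n * d n j \<omega>)" for n
      by (rule summable_suminf_not_top[OF _ finn]) (simp add: d0)
    have sj': "summable (\<lambda>j. d n j \<omega>)" for n
      using summable_mult[OF sj[of n], of "1 / 2 ^ n"] by simp
    have e: "(\<Sum>j. ennreal (2 ^ n * d n j \<omega>)) = ennreal (2 ^ n * (\<Sum>j. d n j \<omega>))" for n
    proof -
      have "(\<Sum>j. ennreal (2 ^ n * d n j \<omega>)) = ennreal (\<Sum>j. 2 ^ n * d n j \<omega>)"
        by (rule suminf_ennreal[OF _ finn]) (simp add: d0)
      also have "(\<Sum>j. 2 ^ n * d n j \<omega>) = 2 ^ n * (\<Sum>j. d n j \<omega>)" by (rule suminf_mult[OF sj'])
      finally show ?thesis .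
    qed
    have sn: "summable (\<lambda>n. 2 ^ n * (\<Sum>j. d n j \<omega>))"
    proof (rule summable_suminf_not_top)
      show "0 \<le> 2 ^ n * (\<Sum>j. d n j \<omega>)" for n by (intro mult_nonneg_nonneg suminf_nonneg[OF sj']) (auto simp: d0)
      show "(\<Sum>n. ennreal (2 ^ n * (\<Sum>j. d n j \<omega>))) \<noteq> Orderings.top" using elim(2) unfolding e by simp
    qed
    show ?case
      by (rule differentiable_of_dyadic_devs[OF cont[OF elim(1)]])
        (use sj' sn in \<open>auto simp: d_def[abs_def] r_def[abs_def]\<close>)
  qed
qed

end

section \<open>Nondegeneracy of jets\<close>

text \<open>Orders above 1 are cut down to 1, so that the pairs \<open>(t, n)\<close> of a time and
  an order can serve as index type; nondegeneracy is claimed for orders 0 and 1 only.\<close>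

definition jet :: "(real \<Rightarrow> 'a \<Rightarrow> real) \<Rightarrow> real \<times> nat \<Rightarrow> 'a \<Rightarrow> real" where
  "jet X = (\<lambda>(t, n). path_deriv X (min n 1) t)"

definition diff_quot :: "(real \<Rightarrow> 'a \<Rightarrow> real) \<Rightarrow> nat \<Rightarrow> real \<times> nat \<Rightarrow> 'a \<Rightarrow> real" where
  "diff_quot X m = (\<lambda>(t, n) \<omega>. if n = 0 then X t \<omega> else real (Suc m) * (X (t + 1 / real (Suc m)) \<omega> - X t \<omega>))"

lemma path_deriv_0 [simp]: "path_deriv X 0 t = X t"
  by (simp add: path_deriv_def fun_eq_iff)

lemma path_deriv_1: "path_deriv X 1 t \<omega> = deriv (\<lambda>s. X s \<omega>) t"
  by (simp add: path_deriv_def)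

lemma diff_quot_tendsto:
  assumes "((\<lambda>s. X s \<omega>) has_real_derivative D) (at t)"
  shows "(\<lambda>m. diff_quot X m (t, n) \<omega>) \<longlonglongrightarrow> jet X (t, n) \<omega>"
proof (cases "n = 0")
  case False
  have D: "path_deriv X 1 t \<omega> = D" unfolding path_deriv_1 by (rule DERIV_imp_deriv[OF assms])
  have "((\<lambda>h. (X (t + h) \<omega> - X t \<omega>) / h) \<longlongrightarrow> D) (at 0)" using assms by (simp add: DERIV_def)
  moreover have "filterlim (\<lambda>m. 1 / real (Suc m)) (at 0) sequentially"
    unfolding filterlim_at using LIMSEQ_Suc[OF lim_1_over_n[where 'a=real]] by (auto intro: always_eventually)
  ultimately have "(\<lambda>m. (X (t + 1 / real (Suc m)) \<omega> - X t \<omega>) / (1 / real (Suc m))) \<longlonglongrightarrow> D"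
    by (rule filterlim_compose)
  moreover have mn: "min n 1 = 1" using False by simp
  have "jet X (t, n) \<omega> = D" unfolding jet_def prod.case mn D ..
  ultimately show ?thesis using False by (simp add: diff_quot_def mult.commute)
qed (simp add: diff_quot_def jet_def)

lemma diff_quot_lincombs: "diff_quot X m i \<in> lincombs X"
proof -
  obtain t n where i: "i = (t, n)" by (cases i)
  show ?thesis unfolding diff_quot_def i prod.case
    by (cases "n = 0") (simp_all add: lincombs_base lincombs_cmult lincombs_diff)
qed

text \<open>Where no derivative exists, \<open>deriv\<close> takes one fixed value that is the same
  for every path. This makes the path derivative measurable on all of the space and not only outside
  a null set.\<close>

lemma deriv_not_differentiable:
  assumes "\<not> (\<exists>D. (f has_real_derivative D) (at t))" shows "deriv f t = (SOME D. False)"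
proof -
  have "(\<lambda>D. (f has_field_derivative D) (at t)) = (\<lambda>D. False)" using assms by auto
  then show ?thesis unfolding deriv_def by simp
qed

text \<open>The difference quotient is continuous in the increment and the weak inequality is a
  closed condition, so rational increments suffice and differentiability becomes a countable
  combination of conditions.\<close>

lemma differentiable_iff_rational:
  fixes f :: "real \<Rightarrow> real"
  assumes f: "continuous_on UNIV f"
  shows "(f has_real_derivative D) (at t) \<longleftrightarrow>
    (\<forall>k::nat. \<exists>N::nat. \<forall>q::rat. q \<noteq> 0 \<longrightarrow> \<bar>of_rat q\<bar> < 1 / real (Suc N) \<longrightarrow>
       \<bar>(f (t + of_rat q) - f t) / of_rat q - D\<bar> \<le> 1 / real (Suc k))" (is "_ \<longleftrightarrow> ?R")
proof
  assume "(f has_real_derivative D) (at t)"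
  then have lim: "((\<lambda>h. (f (t + h) - f t) / h) \<longlongrightarrow> D) (at 0)" by (simp add: DERIV_def)
  show ?R
  proof
    fix k :: nat
    have "\<forall>\<^sub>F h in at 0. dist ((f (t + h) - f t) / h) D < 1 / real (Suc k)"
      using lim by (rule tendstoD) simp
    then obtain d where d: "d > 0" "\<And>h. h \<noteq> 0 \<Longrightarrow> \<bar>h\<bar> < d \<Longrightarrow> \<bar>(f (t + h) - f t) / h - D\<bar> < 1 / real (Suc k)"
      by (auto simp: eventually_at dist_real_def)
    obtain N where N: "1 / real (Suc N) < d" using nat_approx_posE[OF d(1)] by blast
    show "\<exists>N::nat. \<forall>q::rat. q \<noteq> 0 \<longrightarrow> \<bar>of_rat q\<bar> < 1 / real (Suc N) \<longrightarrow>
       \<bar>(f (t + of_rat q) - f t) / of_rat q - D\<bar> \<le> 1 / real (Suc k)"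
    proof (intro exI[of _ N] allI impI)
      fix q :: rat assume "q \<noteq> 0" "\<bar>of_rat q\<bar> < 1 / real (Suc N)"
      with d(2)[of "of_rat q"] N show "\<bar>(f (t + of_rat q) - f t) / of_rat q - D\<bar> \<le> 1 / real (Suc k)" by simp
    qed
  qed
next
  assume R: ?R
  have "((\<lambda>h. (f (t + h) - f t) / h) \<longlongrightarrow> D) (at 0)"
    unfolding tendsto_iff eventually_at
  proof (intro allI impI)
    fix e :: real assume e: "e > 0"
    obtain k where k: "1 / real (Suc k) < e" using nat_approx_posE[OF e] by blast
    obtain N where N: "\<And>q::rat. q \<noteq> 0 \<Longrightarrow> \<bar>of_rat q\<bar> < 1 / real (Suc N) \<Longrightarrow>
       \<bar>(f (t + of_rat q) - f t) / of_rat q - D\<bar> \<le> 1 / real (Suc k)" using R by blast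
    have "\<bar>(f (t + h) - f t) / h - D\<bar> \<le> 1 / real (Suc k)" if h: "h \<noteq> 0" "\<bar>h\<bar> < 1 / real (Suc N)" for h
    proof -
      let ?g = "\<lambda>h. \<bar>(f (t + h) - f t) / h - D\<bar>"
      let ?A = "{h. h \<noteq> 0 \<and> \<bar>h\<bar> < 1 / real (Suc N)}"
      have op: "open ?A"
        by (intro open_Collect_conj open_Collect_neq open_Collect_less continuous_intros)
      have gc: "continuous_on ?A ?g"
        by (intro continuous_intros continuous_on_compose2[OF f]) auto
      show ?thesis
      proof (rule ccontr)
        assume "\<not> ?g h \<le> 1 / real (Suc k)"
        then have hA: "h \<in> ?A \<inter> ?g -` {1 / real (Suc k)<..}" using h by simp
        have op2: "open (?A \<inter> ?g -` {1 / real (Suc k)<..})"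
        proof -
          have "open (?g -` {1 / real (Suc k)<..} \<inter> ?A)"
            using continuous_on_open_vimage[OF op, of ?g] gc open_greaterThan by blast
          then show ?thesis by (simp only: Int_commute)
        qed
        obtain d where d: "d > 0" "ball h d \<subseteq> ?A \<inter> ?g -` {1 / real (Suc k)<..}"
          by (rule openE[OF op2 hA])
        obtain q :: rat where "h < of_rat q" "of_rat q < h + d" using of_rat_dense[of h "h + d"] d(1) by auto
        then have "of_rat q \<in> ball h d" by (simp add: dist_real_def)
        then have qm: "of_rat q \<in> ?A \<inter> ?g -` {1 / real (Suc k)<..}" using d(2) by blast
        have q1: "of_rat q \<noteq> (0 :: real) \<and> \<bar>of_rat q :: real\<bar> < 1 / real (Suc N)" using IntD1[OF qm] by (rule CollectD)
        have q2: "?g (of_rat q) > 1 / real (Suc k)" using IntD2[OF qm] unfolding vimage_eq greaterThan_iff .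
        have "q \<noteq> 0" using q1 by auto
        from N[OF this conjunct2[OF q1]] q2 show False by linarith
      qed
    qed
    then show "\<exists>d>0. \<forall>h\<in>UNIV. h \<noteq> 0 \<and> dist h 0 < d \<longrightarrow> dist ((f (t + h) - f t) / h) D < e"
      using k by (intro exI[of _ "1 / real (Suc N)"]) (force simp: dist_real_def)
  qed
  then show "(f has_real_derivative D) (at t)" by (simp add: DERIV_def)
qed

lemma path_deriv_measurable:
  assumes [measurable]: "\<And>t. X t \<in> borel_measurable M"
    and cont: "\<And>\<omega>. \<omega> \<in> space M \<Longrightarrow> continuous_on UNIV (\<lambda>t. X t \<omega>)"
  shows "path_deriv X 1 t \<in> borel_measurable M"
proof -
  define D where "D \<omega> = lim (\<lambda>m. diff_quot X m (t, 1) \<omega>)" for \<omega>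
  have dm: "diff_quot X m (t, 1) \<in> borel_measurable M" for m
    unfolding diff_quot_def by simp
  have [measurable]: "D \<in> borel_measurable M"
    unfolding D_def[abs_def] by (rule borel_measurable_lim_metric[OF dm])
  \<comment> \<open>The set of differentiable paths. The only candidate for the derivative is the
    limit \<open>D\<close> along the steps \<open>1 / (m + 1)\<close>, which removes the quantifier
    over possible derivatives.\<close>
  define A where "A = {\<omega>\<in>space M. \<forall>k::nat. \<exists>N::nat. \<forall>q::rat. q \<noteq> 0 \<longrightarrow> \<bar>of_rat q\<bar> < 1 / real (Suc N) \<longrightarrow>
       \<bar>(X (t + of_rat q) \<omega> - X t \<omega>) / of_rat q - D \<omega>\<bar> \<le> 1 / real (Suc k)}"
  have [measurable]: "A \<in> sets M" unfolding A_def by measurable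
  have A1: "((\<lambda>s. X s \<omega>) has_real_derivative D \<omega>) (at t)" if "\<omega> \<in> A" for \<omega>
    using that unfolding differentiable_iff_rational[OF cont[of \<omega>]] A_def
    by (subst differentiable_iff_rational) (auto intro: cont)
  have A2: "\<omega> \<in> A" if "\<omega> \<in> space M" "((\<lambda>s. X s \<omega>) has_real_derivative E) (at t)" for \<omega> E
  proof -
    have "(\<lambda>m. diff_quot X m (t, 1) \<omega>) \<longlonglongrightarrow> jet X (t, 1) \<omega>"
      by (rule diff_quot_tendsto[where D = E]) (rule that(2))
    then have "jet X (t, 1) \<omega> = D \<omega>" unfolding D_def by (rule limI[symmetric])
    moreover have "jet X (t, 1) \<omega> = E" using DERIV_imp_deriv[OF that(2)] by (simp add: jet_def path_deriv_def)
    ultimately have "((\<lambda>s. X s \<omega>) has_real_derivative D \<omega>) (at t)" using that(2) by simp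
    then show ?thesis using that(1) unfolding differentiable_iff_rational[OF cont[OF that(1)]] A_def by simp
  qed
  have "path_deriv X 1 t \<omega> = (if \<omega> \<in> A then D \<omega> else (SOME D. False))" if "\<omega> \<in> space M" for \<omega>
  proof (cases "\<omega> \<in> A")
    case True
    then show ?thesis using DERIV_imp_deriv[OF A1] by (simp add: path_deriv_def)
  next
    case False
    then have "\<not> (\<exists>E. ((\<lambda>s. X s \<omega>) has_real_derivative E) (at t))" using A2[OF that] by blast
    from deriv_not_differentiable[OF this] False show ?thesis by (simp add: path_deriv_def)
  qed
  moreover have "(\<lambda>\<omega>. if \<omega> \<in> A then D \<omega> else (SOME D. False)) \<in> borel_measurable M" by measurable
  ultimately show ?thesis by (subst measurable_cong) auto
qed

context prob_space
begin

text \<open>At finitely many points the derivatives are almost sure limits of difference quotients,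
  which lie in the span of \<open>X\<close>. The convergence of second moments is what the spectral
  case evaluates.\<close>

lemma jet_gaussian:
  assumes G: "gaussian_family M X"
    and cont: "\<And>\<omega>. \<omega> \<in> space M \<Longrightarrow> continuous_on UNIV (\<lambda>t. X t \<omega>)"
    and diff: "\<And>t. AE \<omega> in M. \<exists>D. ((\<lambda>s. X s \<omega>) has_real_derivative D) (at t)"
  shows "gaussian_family M (jet X)"
    and "finite I \<Longrightarrow> (\<lambda>m. expectation (\<lambda>\<omega>. (\<Sum>i\<in>I. c i * diff_quot X m i \<omega>)\<^sup>2)) \<longlonglongrightarrow>
       expectation (\<lambda>\<omega>. (\<Sum>i\<in>I. c i * jet X i \<omega>)\<^sup>2)"
proof -
  have Xm: "X t \<in> borel_measurable M" for t by (rule lincombs_normal(2)[OF G lincombs_base])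
  have Jm[measurable]: "jet X i \<in> borel_measurable M" for i
  proof -
    obtain t n where i: "i = (t, n)" by (cases i)
    have "min n 1 = 0 \<or> min n 1 = 1" by auto
    then show ?thesis
    proof
      assume m: "min n 1 = 0"
      show ?thesis unfolding jet_def i prod.case m path_deriv_0 by (rule Xm)
    next
      assume m: "min n 1 = 1"
      show ?thesis unfolding jet_def i prod.case m by (rule path_deriv_measurable[OF Xm cont])
    qed
  qed
  have L: "AE \<omega> in M. (\<lambda>m. \<Sum>i\<in>I. c i * diff_quot X m i \<omega>) \<longlonglongrightarrow> (\<Sum>i\<in>I. c i * jet X i \<omega>)"
    if "finite I" for I c
  proof -
    have "AE \<omega> in M. \<forall>i\<in>I. \<exists>D. ((\<lambda>s. X s \<omega>) has_real_derivative D) (at (fst i))"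
      using that diff by (subst AE_finite_all) auto
    then show ?thesis
    proof eventually_elim
      case (elim \<omega>)
      have "(\<lambda>m. diff_quot X m i \<omega>) \<longlonglongrightarrow> jet X i \<omega>" if iI: "i \<in> I" for i
      proof -
        obtain D where D: "((\<lambda>s. X s \<omega>) has_real_derivative D) (at (fst i))"
          using bspec[OF elim iI] by (rule exE)
        from diff_quot_tendsto[where X = X and \<omega> = \<omega>, OF D, of "snd i"] show ?thesis by simp
      qed
      then show ?case by (intro tendsto_sum tendsto_mult tendsto_const)
    qed
  qed
  have N: "centered_normal M (\<lambda>\<omega>. \<Sum>i\<in>I. c i * diff_quot X m i \<omega>)" if "finite I" for I c m
    using that by (intro lincombs_normal(1)[OF G] lincombs_sum lincombs_cmult diff_quot_lincombs)
  have M: "(\<lambda>\<omega>. \<Sum>i\<in>I. c i * jet X i \<omega>) \<in> borel_measurable M" for I c by measurable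
  show "gaussian_family M (jet X)"
    unfolding gaussian_family_def
  proof
    fix K assume "K \<in> lincombs (jet X)"
    then obtain I c where "finite I" "K = (\<lambda>\<omega>. \<Sum>i\<in>I. c i * jet X i \<omega>)" by (auto simp: lincombs_def)
    then show "centered_normal M K" using centered_normal_limit(1)[OF N M L] by blast
  qed
  show "finite I \<Longrightarrow> (\<lambda>m. expectation (\<lambda>\<omega>. (\<Sum>i\<in>I. c i * diff_quot X m i \<omega>)\<^sup>2)) \<longlonglongrightarrow>
       expectation (\<lambda>\<omega>. (\<Sum>i\<in>I. c i * jet X i \<omega>)\<^sup>2)"
    by (rule centered_normal_limit(2)[OF N M L])
qed

lemma second_moment_zero_orthogonal:
  assumes G: "gaussian_family M V" and L: "L \<in> lincombs V" and 0: "expectation (\<lambda>\<omega>. (L \<omega>)\<^sup>2) = 0"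
  shows "expectation (\<lambda>\<omega>. V i \<omega> * L \<omega>) = 0"
proof -
  have [measurable]: "L \<in> borel_measurable M" "V i \<in> borel_measurable M"
    using lincombs_normal(2)[OF G L] lincombs_normal(2)[OF G lincombs_base] by auto
  have "integrable M (\<lambda>\<omega>. (L \<omega>)\<^sup>2)" using lincombs_integrable_mult[OF G L L] by (simp add: power2_eq_square)
  from integral_nonneg_eq_0_iff_AE[OF this] 0 have "AE \<omega> in M. L \<omega> = 0" by auto
  then show ?thesis by (intro integral_eq_zero_AE) auto
qed

lemma invertible_kernel:
  assumes A: "A \<in> carrier_mat n n" "invertible_mat A" and v: "v \<in> carrier_vec n" "A *\<^sub>v v = 0\<^sub>v n"
  shows "v = 0\<^sub>v n"
proof -
  obtain B where B: "A * B = 1\<^sub>m n" "B * A = 1\<^sub>m (dim_row B)"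
    using A unfolding invertible_mat_def inverts_mat_def by auto
  have "dim_col (B * A) = dim_col (1\<^sub>m (dim_row B))" using B by simp
  then have r: "dim_row B = n" using A by simp
  have "dim_col (A * B) = dim_col (1\<^sub>m n)" using B by simp
  then have Bc: "B \<in> carrier_mat n n" using r by auto
  have "v = (B * A) *\<^sub>v v" using B r v by simp
  also have "\<dots> = B *\<^sub>v (A *\<^sub>v v)" using Bc A v by (intro assoc_mult_mat_vec) auto
  also have "\<dots> = 0\<^sub>v n" using v Bc by auto
  finally show ?thesis .
qed

text \<open>A combination of variance zero is orthogonal to every coordinate, so its coefficients
  form a kernel vector of the covariance matrix. The means subtracted in \<open>covariance\<close>
  are zero.\<close>

lemma nondegenerate_a:
  assumes a: "assumption_a M X a b" and GJ: "gaussian_family M (jet X)"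
    and I: "finite I" "I \<subseteq> UNIV \<times> {0, 1}"
  shows "nondegenerate_on M (jet X) I"
  unfolding nondegenerate_on_def
proof (intro allI impI)
  fix c assume c: "expectation (\<lambda>\<omega>. (\<Sum>i\<in>I. c i * jet X i \<omega>)\<^sup>2) = 0"
  obtain ps where ps: "set ps = I" "distinct ps" using finite_distinct_list[OF I(1)] by auto
  let ?n = "length ps" and ?V = "\<lambda>i. jet X (ps ! i)"
  let ?A = "mat ?n ?n (\<lambda>(i, j). covariance M (path_deriv X (snd (ps ! i)) (fst (ps ! i)))
                       (path_deriv X (snd (ps ! j)) (fst (ps ! j))))"
  have inv: "invertible_mat ?A" using a ps(2) unfolding assumption_a_def by blast
  have jp: "path_deriv X (snd i) (fst i) = jet X i" if "i \<in> I" for i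
    using I(2) that by (cases i) (auto simp: jet_def)
  have psI: "ps ! i \<in> I" if "i < ?n" for i using ps that nth_mem by blast
  have cov: "covariance M (?V i) (?V j) = expectation (\<lambda>\<omega>. ?V i \<omega> * ?V j \<omega>)" for i j
    unfolding covariance_def using lincombs_normal(4)[OF GJ lincombs_base] by simp
  have bij: "bij_betw ((!) ps) {..<?n} I" using bij_betw_nth[OF ps(2)] ps(1) by simp
  let ?L = "\<lambda>\<omega>. \<Sum>i\<in>I. c i * jet X i \<omega>"
  have L: "?L \<in> lincombs (jet X)" by (rule lincombsI[OF I(1)])
  let ?v = "vec ?n (\<lambda>i. c (ps ! i))"
  have "?A *\<^sub>v ?v = 0\<^sub>v ?n"
  proof (rule eq_vecI)
    fix i assume "i < dim_vec (0\<^sub>v ?n :: real Matrix.vec)"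
    then have i: "i < ?n" by simp
    have "(?A *\<^sub>v ?v) $ i = (\<Sum>j<?n. expectation (\<lambda>\<omega>. ?V i \<omega> * ?V j \<omega>) * c (ps ! j))"
      using i by (simp add: scalar_prod_def atLeast0LessThan jp psI cov)
    also have "\<dots> = (\<Sum>j\<in>I. expectation (\<lambda>\<omega>. ?V i \<omega> * jet X j \<omega>) * c j)"
      by (rule sum.reindex_bij_betw[OF bij])
    also have "\<dots> = expectation (\<lambda>\<omega>. ?V i \<omega> * ?L \<omega>)"
    proof -
      have "?V i \<omega> * ?L \<omega> = (\<Sum>j\<in>I. (?V i \<omega> * jet X j \<omega>) * c j)" for \<omega>
        by (simp add: sum_distrib_left mult_ac)
      then show ?thesis
        using lincombs_integrable_mult[OF GJ lincombs_base lincombs_base] by simp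
    qed
    also have "\<dots> = 0" by (rule second_moment_zero_orthogonal[OF GJ L c])
    finally show "(?A *\<^sub>v ?v) $ i = 0\<^sub>v ?n $ i" using i by simp
  qed simp
  with invertible_kernel[OF _ inv, of ?n ?v] have v0: "?v = 0\<^sub>v ?n" by simp
  show "\<forall>i\<in>I. c i = 0"
  proof
    fix i assume "i \<in> I"
    then obtain k where k: "k < ?n" "i = ps ! k" using ps(1) by (metis in_set_conv_nth)
    have "?v $ k = 0\<^sub>v ?n $ k" using v0 by simp
    then show "c i = 0" using k by simp
  qed
qed

end

text \<open>Divide by the exponential with the largest exponent \<open>s\<close>: as
  \<open>y\<close> grows the other terms vanish, so \<open>\<alpha> s + \<beta> s * y\<close> tends
  to 0 and both coefficients are zero.\<close>

lemma exponential_polynomials_independent: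
  fixes \<alpha> \<beta> :: "real \<Rightarrow> real"
  assumes "finite T" "\<And>y. (\<Sum>t\<in>T. (\<alpha> t + \<beta> t * y) * exp (t * y)) = 0"
  shows "\<forall>t\<in>T. \<alpha> t = 0 \<and> \<beta> t = 0"
  using assms
proof (induction T rule: finite_linorder_max_induct)
  case (insert s A)
  have sA: "s \<notin> A" using insert.hyps by auto
  have eq: "\<alpha> s + \<beta> s * y = - (\<Sum>t\<in>A. (\<alpha> t + \<beta> t * y) * exp (- (s - t) * y))" for y
  proof -
    have "(\<alpha> s + \<beta> s * y) * exp (s * y) + (\<Sum>t\<in>A. (\<alpha> t + \<beta> t * y) * exp (t * y)) = 0"
      using insert.prems[of y] sA insert.hyps by simp
    then have "((\<alpha> s + \<beta> s * y) * exp (s * y) + (\<Sum>t\<in>A. (\<alpha> t + \<beta> t * y) * exp (t * y))) * exp (- s * y) = 0" by simp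
    then have "(\<alpha> s + \<beta> s * y) + (\<Sum>t\<in>A. (\<alpha> t + \<beta> t * y) * exp (- (s - t) * y)) = 0"
      by (simp add: distrib_right sum_distrib_right mult.assoc left_diff_distrib flip: exp_add)
    then show ?thesis by linarith
  qed
  have "((\<lambda>y. - (\<Sum>t\<in>A. (\<alpha> t + \<beta> t * y) * exp (- (s - t) * y))) \<longlongrightarrow> - (\<Sum>t\<in>A. 0)) at_top"
  proof (intro tendsto_minus tendsto_sum)
    fix t assume "t \<in> A"
    then have c: "s - t > 0" using insert.hyps by auto
    show "((\<lambda>y. (\<alpha> t + \<beta> t * y) * exp (- (s - t) * y)) \<longlongrightarrow> 0) at_top"
      using c by real_asymp
  qed
  then have lim: "((\<lambda>y. \<alpha> s + \<beta> s * y) \<longlongrightarrow> 0) at_top" unfolding eq by simp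
  have "((\<lambda>y. (\<alpha> s + \<beta> s * y) * (1 / y)) \<longlongrightarrow> 0 * 0) at_top"
    by (rule tendsto_mult[OF lim]) real_asymp
  moreover have "((\<lambda>y. (\<alpha> s + \<beta> s * y) * (1 / y)) \<longlongrightarrow> \<beta> s) at_top" by real_asymp
  ultimately have \<beta>: "\<beta> s = 0" using tendsto_unique[OF trivial_limit_at_top_linorder] by fastforce
  then have \<alpha>: "\<alpha> s = 0" using lim by (simp add: tendsto_const_iff)
  have "\<forall>t\<in>A. \<alpha> t = 0 \<and> \<beta> t = 0"
  proof (rule insert.IH)
    fix y show "(\<Sum>t\<in>A. (\<alpha> t + \<beta> t * y) * exp (t * y)) = 0"
      using insert.prems[of y] sA insert.hyps(1) \<alpha> \<beta> by simp
  qed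
  then show ?case using \<alpha> \<beta> by simp
qed simp

lemma sum_times_bool:
  fixes g :: "'i \<times> bool \<Rightarrow> 'b::comm_monoid_add"
  shows "(\<Sum>k\<in>I \<times> UNIV. g k) = (\<Sum>i\<in>I. g (i, True) + g (i, False))"
proof -
  have "(\<Sum>k\<in>I \<times> UNIV. g k) = (\<Sum>(i, b)\<in>I \<times> UNIV. g (i, b))" by (intro sum.cong) auto
  also have "\<dots> = (\<Sum>i\<in>I. \<Sum>b\<in>UNIV. g (i, b))" by (rule sum.cartesian_product[symmetric])
  finally show ?thesis by (simp add: UNIV_bool add.commute)
qed

context spectral_process
begin

text \<open>The function that corresponds to a combination of jets under the spectral isometry, with
  complex argument so that the identity theorem applies.\<close>

definition sym_fun :: "(real \<times> nat) set \<Rightarrow> (real \<times> nat \<Rightarrow> real) \<Rightarrow> complex \<Rightarrow> complex" where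
  "sym_fun I c z = (\<Sum>(t, n)\<in>I. of_real (c (t, n)) * ((if n = 0 then 1 else \<i> * z) * exp (\<i> * of_real t * z)))"

lemma quadratic_bound_integrable: "integrable F (\<lambda>x. (C * (1 + \<bar>x\<bar>))\<^sup>2)"
proof -
  have eq: "(C * (1 + \<bar>x\<bar>))\<^sup>2 = C\<^sup>2 * (1 + 2 * \<bar>x ^ 1\<bar> + x ^ 2)" for x :: real
    by (simp add: power2_eq_square algebra_simps)
  show ?thesis unfolding eq
    by (intro integrable_mult_right Bochner_Integration.integrable_add F.integrable_const integrable_abs moment_integrable)
qed

text \<open>The isometry passes to derivatives: the functions that correspond to difference
  quotients converge pointwise and are bounded by \<open>1 + \<bar>x\<bar>\<close> uniformly in
  \<open>m\<close>, which is square integrable for \<open>F\<close>.\<close>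

lemma jet_second_moment:
  assumes GJ: "finite I \<Longrightarrow> (\<lambda>m. expectation (\<lambda>\<omega>. (\<Sum>i\<in>I. c i * diff_quot X m i \<omega>)\<^sup>2)) \<longlonglongrightarrow>
       expectation (\<lambda>\<omega>. (\<Sum>i\<in>I. c i * jet X i \<omega>)\<^sup>2)" and I: "finite I"
  shows "expectation (\<lambda>\<omega>. (\<Sum>i\<in>I. c i * jet X i \<omega>)\<^sup>2) = (\<integral>x. (cmod (sym_fun I c (of_real x)))\<^sup>2 \<partial>F)"
proof -
  define \<phi> where "\<phi> m = (\<lambda>(t, n::nat) x. if n = 0 then iexp (t * x)
     else of_real (real (Suc m)) * (iexp ((t + 1 / real (Suc m)) * x) - iexp (t * x)))" for m :: nat
  have mom: "expectation (\<lambda>\<omega>. (\<Sum>i\<in>I. c i * diff_quot X m i \<omega>)\<^sup>2) = (\<integral>x. (cmod (\<Sum>i\<in>I. of_real (c i) * \<phi> m i x))\<^sup>2 \<partial>F)" for m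
  proof -
    define s where "s = (\<lambda>((t, n::nat), b). if n \<noteq> 0 \<and> b then t + 1 / real (Suc m) else t)"
    define d where "d = (\<lambda>((t, n::nat), b). c (t, n) * (if n = 0 then of_bool b else if b then real (Suc m) else - real (Suc m)))"
    have fin: "finite (I \<times> (UNIV :: bool set))" using I by simp
    have 1: "(\<Sum>k\<in>I \<times> UNIV. d k * X (s k) \<omega>) = (\<Sum>i\<in>I. c i * diff_quot X m i \<omega>)" for \<omega>
      unfolding sum_times_bool
      by (intro sum.cong) (auto simp: UNIV_bool d_def s_def diff_quot_def algebra_simps)
    have 2: "(\<Sum>k\<in>I \<times> UNIV. of_real (d k) * iexp (s k * x)) = (\<Sum>i\<in>I. of_real (c i) * \<phi> m i x)" for x
      unfolding sum_times_bool
      by (intro sum.cong) (auto simp: UNIV_bool d_def s_def \<phi>_def algebra_simps)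
    show ?thesis using second_moment_spectral[OF fin, of d s] unfolding 1 2 .
  qed
  have \<phi>lim: "(\<lambda>m. \<phi> m (t, n) x) \<longlonglongrightarrow> (if n = 0 then 1 else \<i> * of_real x) * exp (\<i> * of_real t * of_real x)" for t x and n :: nat
  proof (cases "n = 0")
    case True
    then show ?thesis by (simp add: \<phi>_def mult.assoc)
  next
    case False
    have "((\<lambda>z. exp (\<i> * z * of_real x)) has_field_derivative \<i> * of_real x * exp (\<i> * of_real t * of_real x)) (at (of_real t))"
      by (auto intro!: derivative_eq_intros)
    then have "((\<lambda>h. (exp (\<i> * (of_real t + h) * of_real x) - exp (\<i> * of_real t * of_real x)) / h) \<longlongrightarrow>
        \<i> * of_real x * exp (\<i> * of_real t * of_real x)) (at 0)" by (simp add: DERIV_def)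
    moreover have "filterlim (\<lambda>m. of_real (1 / real (Suc m)) :: complex) (at 0) sequentially"
    proof -
      have nz: "complex_of_real (1 / real (Suc m)) \<in> UNIV \<and> complex_of_real (1 / real (Suc m)) \<noteq> 0" for m
        by (simp only: of_real_eq_0_iff) simp
      have l: "(\<lambda>m. complex_of_real (1 / real (Suc m))) \<longlonglongrightarrow> 0"
        using tendsto_of_real[OF LIMSEQ_Suc[OF lim_1_over_n[where 'a=real]], where 'a=complex] by (simp only: of_real_0)
      show ?thesis unfolding filterlim_at by (intro conjI[OF always_eventually l] allI nz)
    qed
    ultimately have "(\<lambda>m. (exp (\<i> * (of_real t + of_real (1 / real (Suc m))) * of_real x) - exp (\<i> * of_real t * of_real x)) / of_real (1 / real (Suc m)))
       \<longlonglongrightarrow> \<i> * of_real x * exp (\<i> * of_real t * of_real x)" by (rule filterlim_compose)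
    moreover have "(exp (\<i> * (of_real t + of_real (1 / real (Suc m))) * of_real x) - exp (\<i> * of_real t * of_real x)) / of_real (1 / real (Suc m))
       = \<phi> m (t, n) x" for m
    proof -
      have q: "A / of_real (1 / real (Suc m)) = of_real (real (Suc m)) * A" for A :: complex
        by (simp only: inverse_eq_divide[symmetric] of_real_inverse divide_inverse inverse_inverse_eq mult_1 mult.commute)
      have e: "\<i> * (of_real t + of_real (1 / real (Suc m))) * of_real x = \<i> * of_real ((t + 1 / real (Suc m)) * x)"
        "\<i> * of_real t * of_real x = \<i> * of_real (t * x)"
        by (simp_all only: of_real_add of_real_mult mult.assoc)
      show ?thesis unfolding q e \<phi>_def prod.case using False by (simp only: if_False)
    qed
    ultimately show ?thesis using False by simp
  qed
  have \<phi>b: "cmod (\<phi> m i x) \<le> 1 + \<bar>x\<bar>" for m x and i :: "real \<times> nat"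
  proof -
    obtain t n where i: "i = (t, n)" by (cases i)
    have "cmod (iexp ((t + 1 / real (Suc m)) * x) - iexp (t * x)) \<le> \<bar>x\<bar> / real (Suc m)"
    proof -
      have "iexp ((t + 1 / real (Suc m)) * x) - iexp (t * x) = iexp (t * x) * (iexp (x / real (Suc m)) - 1)"
        by (simp add: algebra_simps flip: exp_add)
      then have "cmod (iexp ((t + 1 / real (Suc m)) * x) - iexp (t * x)) = cmod (iexp (x / real (Suc m)) - 1)"
        by (simp only: norm_mult norm_exp_i_times mult_1)
      also have "\<dots> \<le> \<bar>x / real (Suc m)\<bar>"
        using iexp_approx1[of "x / real (Suc m)" 0] by simp
      finally show ?thesis by simp
    qed
    then have "real (Suc m) * cmod (iexp ((t + 1 / real (Suc m)) * x) - iexp (t * x)) \<le> real (Suc m) * (\<bar>x\<bar> / real (Suc m))"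
      by (intro mult_left_mono) auto
    then have "real (Suc m) * cmod (iexp ((t + 1 / real (Suc m)) * x) - iexp (t * x)) \<le> \<bar>x\<bar>" by simp
    moreover have "cmod (\<phi> m i x) = (if n = 0 then 1 else real (Suc m) * cmod (iexp ((t + 1 / real (Suc m)) * x) - iexp (t * x)))"
      unfolding \<phi>_def i prod.case
      by (cases "n = 0") (simp_all only: norm_mult norm_of_real abs_of_nat norm_exp_i_times if_True if_False simp_thms)
    ultimately show ?thesis by (auto split: if_splits)
  qed
  define C where "C = (\<Sum>i\<in>I. \<bar>c i\<bar>)"
  have "(\<lambda>m. \<integral>x. (cmod (\<Sum>i\<in>I. of_real (c i) * \<phi> m i x))\<^sup>2 \<partial>F) \<longlonglongrightarrow> (\<integral>x. (cmod (sym_fun I c (of_real x)))\<^sup>2 \<partial>F)"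
  proof (rule integral_dominated_convergence[where w = "\<lambda>x. (C * (1 + \<bar>x\<bar>))\<^sup>2"])
    show "(\<lambda>x. (cmod (sym_fun I c (of_real x)))\<^sup>2) \<in> borel_measurable F"
      unfolding sym_fun_def split_def by measurable
    show "(\<lambda>x. (cmod (\<Sum>i\<in>I. of_real (c i) * \<phi> m i x))\<^sup>2) \<in> borel_measurable F" for m
      unfolding \<phi>_def split_def by measurable
    show "integrable F (\<lambda>x. (C * (1 + \<bar>x\<bar>))\<^sup>2)" by (rule quadratic_bound_integrable)
    show "AE x in F. (\<lambda>m. (cmod (\<Sum>i\<in>I. of_real (c i) * \<phi> m i x))\<^sup>2) \<longlonglongrightarrow> (cmod (sym_fun I c (of_real x)))\<^sup>2"
      unfolding sym_fun_def split_def prod.collapse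
    proof (intro AE_I2 tendsto_power tendsto_norm tendsto_sum tendsto_mult[OF tendsto_const])
      fix i x
      have "(\<lambda>m. \<phi> m (fst i, snd i) x) \<longlonglongrightarrow> (if snd i = 0 then 1 else \<i> * of_real x) * exp (\<i> * of_real (fst i) * of_real x)"
        by (rule \<phi>lim)
      then show "(\<lambda>m. \<phi> m i x) \<longlonglongrightarrow> (if snd i = 0 then 1 else \<i> * of_real x) * exp (\<i> * of_real (fst i) * of_real x)"
        by (simp only: prod.collapse)
    qed
    fix m
    show "AE x in F. norm ((cmod (\<Sum>i\<in>I. of_real (c i) * \<phi> m i x))\<^sup>2) \<le> (C * (1 + \<bar>x\<bar>))\<^sup>2"
    proof (intro AE_I2)
      fix x
      have "cmod (\<Sum>i\<in>I. of_real (c i) * \<phi> m i x) \<le> (\<Sum>i\<in>I. \<bar>c i\<bar> * (1 + \<bar>x\<bar>))"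
        using \<phi>b by (intro sum_norm_le) (simp add: norm_mult mult_left_mono)
      also have "\<dots> = C * (1 + \<bar>x\<bar>)" by (simp add: C_def sum_distrib_right)
      finally show "norm ((cmod (\<Sum>i\<in>I. of_real (c i) * \<phi> m i x))\<^sup>2) \<le> (C * (1 + \<bar>x\<bar>))\<^sup>2"
        by (simp add: power_mono)
    qed
  qed
  then have "(\<lambda>m. expectation (\<lambda>\<omega>. (\<Sum>i\<in>I. c i * diff_quot X m i \<omega>)\<^sup>2)) \<longlonglongrightarrow> (\<integral>x. (cmod (sym_fun I c (of_real x)))\<^sup>2 \<partial>F)"
    by (simp only: mom)
  from LIMSEQ_unique[OF GJ[OF I] this] show ?thesis .
qed

text \<open>If the variance is zero, the symbol vanishes almost everywhere for \<open>F\<close>,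
  hence on the support by continuity, hence everywhere because the support has an accumulation
  point. What remains is the independence of exponential polynomials.\<close>

lemma nondegenerate_b:
  assumes cont: "\<And>\<omega>. \<omega> \<in> space M \<Longrightarrow> continuous_on UNIV (\<lambda>t. X t \<omega>)"
    and lp: "x0 islimpt measure_support F"
    and I: "finite I" "I \<subseteq> UNIV \<times> {0, 1}"
  shows "nondegenerate_on M (jet X) I"
  unfolding nondegenerate_on_def
proof (intro allI impI)
  fix c assume c: "expectation (\<lambda>\<omega>. (\<Sum>i\<in>I. c i * jet X i \<omega>)\<^sup>2) = 0"
  let ?P = "sym_fun I c"
  have "(\<lambda>z. if b then 1 else \<i> * z) holomorphic_on UNIV" for b by (cases b) (auto intro!: holomorphic_intros)
  then have hol: "?P holomorphic_on UNIV" unfolding sym_fun_def split_def by (auto intro!: holomorphic_intros)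
  have mom: "expectation (\<lambda>\<omega>. (\<Sum>i\<in>I. c i * jet X i \<omega>)\<^sup>2) = (\<integral>x. (cmod (?P (of_real x)))\<^sup>2 \<partial>F)"
    by (rule jet_second_moment[OF jet_gaussian(2)[OF G cont AE_differentiable[OF cont]] I(1)])
  have gc: "continuous_on UNIV (\<lambda>x::real. (cmod (?P (of_real x)))\<^sup>2)"
    by (intro continuous_on_power continuous_on_norm continuous_on_compose2[OF holomorphic_on_imp_continuous_on[OF hol]]
        continuous_intros) auto
  have gm: "(\<lambda>x. (cmod (?P (of_real x)))\<^sup>2) \<in> borel_measurable F"
    using borel_measurable_continuous_onI[OF gc] measurable_cong_sets[OF setsF refl] by blast
  have gi: "integrable F (\<lambda>x. (cmod (?P (of_real x)))\<^sup>2)"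
  proof (rule Bochner_Integration.integrable_bound[OF _ gm])
    define C where "C = (\<Sum>i\<in>I. \<bar>c i\<bar>)"
    show "integrable F (\<lambda>x. (C * (1 + \<bar>x\<bar>))\<^sup>2)" by (rule quadratic_bound_integrable)
    show "AE x in F. norm ((cmod (?P (of_real x)))\<^sup>2) \<le> norm ((C * (1 + \<bar>x\<bar>))\<^sup>2)"
    proof (intro AE_I2)
      fix x
      have "cmod (?P (of_real x)) \<le> (\<Sum>i\<in>I. \<bar>c i\<bar> * (1 + \<bar>x\<bar>))"
        unfolding sym_fun_def split_def
        by (intro sum_norm_le) (auto simp: norm_mult mult_left_mono mult_le_cancel_left1)
      also have "\<dots> = C * (1 + \<bar>x\<bar>)" by (simp add: C_def sum_distrib_right)
      finally show "norm ((cmod (?P (of_real x)))\<^sup>2) \<le> norm ((C * (1 + \<bar>x\<bar>))\<^sup>2)"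
        by (simp add: power_mono)
    qed
  qed
  have ae: "AE x in F. (cmod (?P (of_real x)))\<^sup>2 = 0"
    using integral_nonneg_eq_0_iff_AE[OF gi] c mom by simp
  have supp: "?P (of_real x) = 0" if x: "x \<in> measure_support F" for x
  proof (rule ccontr)
    assume nz: "?P (of_real x) \<noteq> 0"
    define U where "U = {x::real. (cmod (?P (of_real x)))\<^sup>2 > 0}"
    have "open U" unfolding U_def by (intro open_Collect_less gc continuous_on_const)
    moreover have "x \<in> U" using nz by (simp add: U_def)
    ultimately have "emeasure F U > 0" using x by (auto simp: measure_support_def spaceF)
    moreover have "U \<in> sets F" using \<open>open U\<close> by (simp add: setsF)
    moreover have "AE x in F. x \<notin> U" using ae by eventually_elim (simp add: U_def)
    ultimately show False using AE_iff_measurable[of U F "\<lambda>x. x \<notin> U"] by (simp add: U_def spaceF)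
  qed
  have lp': "of_real x0 islimpt (of_real ` measure_support F :: complex set)"
    unfolding islimpt_approachable
  proof (intro allI impI)
    fix e :: real assume "e > 0"
    with lp obtain x where "x \<in> measure_support F" "x \<noteq> x0" "dist x x0 < e" unfolding islimpt_approachable by blast
    then show "\<exists>x'\<in>of_real ` measure_support F. x' \<noteq> of_real x0 \<and> dist x' (of_real x0 :: complex) < e"
      by (intro bexI[of _ "of_real x"]) (auto simp: dist_norm simp flip: of_real_diff)
  qed
  have P0: "?P z = 0" for z
    by (rule analytic_continuation[OF hol open_UNIV connected_UNIV _ _ lp']) (use supp in auto)
  define \<alpha> where "\<alpha> t = (if (t, 0) \<in> I then c (t, 0) else 0)" for t
  define \<beta> where "\<beta> t = (if (t, 1) \<in> I then c (t, 1) else 0)" for t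
  let ?T = "fst ` I"
  have "(\<Sum>t\<in>?T. (\<alpha> t + \<beta> t * y) * exp (t * y)) = 0" for y
  proof -
    define f where "f = (\<lambda>(t, n::nat). (if (t, n) \<in> I then c (t, n) else 0) * ((if n = 0 then 1 else y) * exp (t * y)))"
    \<comment> \<open>On the imaginary axis the oscillating exponentials turn into real ones, among
      which the largest exponent dominates.\<close>
    have "?P (- \<i> * of_real y) = of_real (\<Sum>i\<in>I. f i)"
    proof -
      have i1: "\<i> * of_real t * (- \<i> * of_real y) = of_real (t * y)" for t by (simp add: complex_eq_iff)
      have i2: "\<i> * (- \<i> * of_real y) = of_real y" by (simp add: complex_eq_iff)
      show ?thesis unfolding sym_fun_def f_def split_def of_real_sum i1 i2 exp_of_real
        by (intro sum.cong) auto
    qed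
    then have "of_real (\<Sum>i\<in>I. f i) = (of_real 0 :: complex)" using P0 by simp
    then have "(\<Sum>i\<in>I. f i) = 0" by (rule of_real_eq_iff[THEN iffD1])
    also have "(\<Sum>i\<in>I. f i) = (\<Sum>i\<in>?T \<times> {0, 1}. f i)"
      using I by (intro sum.mono_neutral_left) (auto simp: f_def image_iff, force+)
    also have "\<dots> = (\<Sum>t\<in>?T. \<Sum>n\<in>{0, 1}. f (t, n))"
      using sum.cartesian_product[of "\<lambda>t n. f (t, n)" "{0, 1}" ?T] by (simp only: split_def prod.collapse)
    also have "\<dots> = (\<Sum>t\<in>?T. (\<alpha> t + \<beta> t * y) * exp (t * y))"
      by (intro sum.cong) (auto simp: f_def \<alpha>_def \<beta>_def algebra_simps)
    finally show ?thesis .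
  qed
  from exponential_polynomials_independent[OF _ this] I have z: "\<forall>t\<in>?T. \<alpha> t = 0 \<and> \<beta> t = 0" by simp
  show "\<forall>i\<in>I. c i = 0"
  proof
    fix i assume i: "i \<in> I"
    obtain t n where tn: "i = (t, n)" by (cases i)
    have "t \<in> ?T" using i tn by (intro image_eqI[of _ _ i]) auto
    then have "\<alpha> t = 0 \<and> \<beta> t = 0" using z by blast
    moreover have "n = 0 \<or> n = 1" using I(2) i tn by auto
    ultimately show "c i = 0" using i tn by (auto simp: \<alpha>_def \<beta>_def)
  qed
qed

end

section \<open>The conditional mean is not constant\<close>

lemma covfun_spectral_shift:
  assumes "spectral_process M X F"
  shows "covfun M X (s + h) (t + h) = covfun M X s t"
proof -
  interpret spectral_process M X F by fact
  show ?thesis by (simp add: covfun_cos)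
qed

context prob_space
begin

text \<open>Otherwise, by stationarity, a far shift of \<open>\<Sum>s\<in>S. \<theta> s * X s\<close> would coincide with it almost surely.\<close>

lemma not_constant_b:
  assumes sp: "spectral_process M X F"
    and nd: "\<And>I. finite I \<Longrightarrow> nondegenerate_on M X I"
    and S: "finite S" "S \<noteq> {}" and \<theta>: "\<And>s. s \<in> S \<Longrightarrow> \<theta> s > 0"
  shows "\<exists>t. (\<Sum>s\<in>S. \<theta> s * covfun M X s t) \<noteq> 1"
proof (rule ccontr)
  assume "\<not> ?thesis"
  then have one: "(\<Sum>s\<in>S. \<theta> s * covfun M X s t) = 1" for t by blast
  interpret spectral_process M X F by fact
  \<comment> \<open>The shift exceeds the diameter of \<open>S\<close>, so \<open>S\<close> and its
    translate are disjoint and the difference of the two combinations has nonzero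
    coefficients.\<close>
  define h where "h = Max S - Min S + 1"
  have sh: "s + h \<notin> S" if "s \<in> S" for s
  proof
    assume "s + h \<in> S"
    then have "s + h \<le> Max S" using S by simp
    moreover have "Min S \<le> s" using S that by simp
    ultimately show False by (simp add: h_def)
  qed
  let ?I = "S \<times> (UNIV :: bool set)"
  define d where "d = (\<lambda>(s, b). if b then \<theta> s else - \<theta> s)"
  define p where "p = (\<lambda>(s, b). if b then s + h else s)"
  have fI: "finite ?I" using S by simp
  have "expectation (\<lambda>x. (\<Sum>i\<in>?I. d i * X (p i) x)\<^sup>2) = (\<Sum>i\<in>?I. \<Sum>j\<in>?I. d i * d j * covfun M X (p i) (p j))"
    by (rule lincomb_second_moment[OF G fI])
  also have "\<dots> = (\<Sum>s\<in>S. \<Sum>t\<in>S. \<theta> s * \<theta> t * (covfun M X (s + h) (t + h) - covfun M X (s + h) t - covfun M X s (t + h) + covfun M X s t))"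
    unfolding sum_times_bool sum.distrib[symmetric]
    by (intro sum.cong refl) (simp add: d_def p_def algebra_simps)
  also have "\<dots> = (\<Sum>s\<in>S. \<Sum>t\<in>S. \<theta> s * \<theta> t * covfun M X (s + h) (t + h)) - (\<Sum>s\<in>S. \<Sum>t\<in>S. \<theta> s * \<theta> t * covfun M X (s + h) t)
     - (\<Sum>s\<in>S. \<Sum>t\<in>S. \<theta> s * \<theta> t * covfun M X s (t + h)) + (\<Sum>s\<in>S. \<Sum>t\<in>S. \<theta> s * \<theta> t * covfun M X s t)"
    by (simp add: right_diff_distrib distrib_left sum_subtractf sum.distrib)
  also have "\<dots> = 0"
  proof -
    \<comment> \<open>If the mean is constantly 1, each of the four double sums equals
      \<open>sum \<theta> S\<close>, and their signed total is zero.\<close>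
    have c: "(\<Sum>s\<in>S. \<Sum>t\<in>S. \<theta> s * \<theta> t * covfun M X s (g t)) = sum \<theta> S" for g
    proof -
      have "(\<Sum>s\<in>S. \<Sum>t\<in>S. \<theta> s * \<theta> t * covfun M X s (g t)) = (\<Sum>t\<in>S. \<theta> t * (\<Sum>s\<in>S. \<theta> s * covfun M X s (g t)))"
        by (subst sum.swap) (simp add: sum_distrib_left mult_ac)
      then show ?thesis using one by simp
    qed
    have c': "(\<Sum>s\<in>S. \<Sum>t\<in>S. \<theta> s * \<theta> t * covfun M X (s + h) t) = sum \<theta> S"
    proof -
      have "(\<Sum>s\<in>S. \<Sum>t\<in>S. \<theta> s * \<theta> t * covfun M X (s + h) t) = (\<Sum>s\<in>S. \<theta> s * (\<Sum>t\<in>S. \<theta> t * covfun M X t (s + h)))"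
        by (simp add: sum_distrib_left mult_ac covfun_sym)
      then show ?thesis using one by simp
    qed
    show ?thesis
      unfolding c' c covfun_spectral_shift[OF sp] using c[of "\<lambda>t. t"] by simp
  qed
  finally have zero: "expectation (\<lambda>x. (\<Sum>i\<in>?I. d i * X (p i) x)\<^sup>2) = 0" .
  define T where "T = S \<union> (\<lambda>s. s + h) ` S"
  define c where "c t = (if t \<in> S then - \<theta> t else \<theta> (t - h))" for t
  have "(\<Sum>t\<in>T. c t * X t x) = (\<Sum>i\<in>?I. d i * X (p i) x)" for x
  proof -
    have "(\<Sum>t\<in>T. c t * X t x) = (\<Sum>t\<in>S. c t * X t x) + (\<Sum>t\<in>(\<lambda>s. s + h) ` S. c t * X t x)"
      unfolding T_def using S sh by (intro sum.union_disjoint) auto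
    also have "(\<Sum>t\<in>(\<lambda>s. s + h) ` S. c t * X t x) = (\<Sum>s\<in>S. c (s + h) * X (s + h) x)"
      by (subst sum.reindex) (auto simp: inj_on_def)
    also have "(\<Sum>t\<in>S. c t * X t x) + (\<Sum>s\<in>S. c (s + h) * X (s + h) x) = (\<Sum>s\<in>S. \<theta> s * X (s + h) x + (- \<theta> s) * X s x)"
      using sh by (simp add: c_def sum.distrib sum_negf sum_subtractf)
    finally show ?thesis unfolding sum_times_bool by (simp add: d_def p_def)
  qed
  then have z: "expectation (\<lambda>x. (\<Sum>t\<in>T. c t * X t x)\<^sup>2) = 0" using zero by simp
  have fT: "finite T" using S by (simp add: T_def)
  obtain s where s: "s \<in> S" using S by auto
  then have "s \<in> T" by (simp add: T_def)
  then have "c s = 0" by (rule nd[OF fT, unfolded nondegenerate_on_def, rule_format, where c = c, OF z])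
  then show False using \<theta>[OF s] s by (simp add: c_def)
qed

text \<open>By the limsup condition all finitely many covariances lie eventually below the positive
  number \<open>e\<close>, which is chosen small enough to push the weighted sum below 1.\<close>

lemma not_constant_a:
  assumes a: "assumption_a M X a b" and S: "finite S" "S \<subseteq> {a..b}" and \<theta>: "\<And>s. s \<in> S \<Longrightarrow> \<theta> s > 0"
  shows "\<exists>t. (\<Sum>s\<in>S. \<theta> s * covfun M X s t) \<noteq> 1"
proof (rule ccontr)
  assume "\<not> ?thesis"
  then have one: "(\<Sum>s\<in>S. \<theta> s * covfun M X s t) = 1" for t by blast
  have lim: "Limsup at_top (\<lambda>t. ereal (covfun M X s t)) \<le> 0" if "s \<in> S" for s
    using a S that unfolding assumption_a_def by blast
  define e where "e = 1 / (2 * (sum \<theta> S + 1))"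
  have \<theta>0: "sum \<theta> S \<ge> 0" using \<theta> by (intro sum_nonneg) (auto intro: less_imp_le)
  then have e: "e > 0" by (simp add: e_def)
  have "\<forall>\<^sub>F t in at_top. \<forall>s\<in>S. covfun M X s t < e"
  proof (intro eventually_ball_finite S ballI)
    fix s assume "s \<in> S"
    then have "Limsup at_top (\<lambda>t. ereal (covfun M X s t)) < ereal e"
      using lim e by (metis ereal_less(2) order_le_less_trans)
    then show "\<forall>\<^sub>F t in at_top. covfun M X s t < e" using Limsup_lessD by fastforce
  qed
  then obtain t where t: "\<And>s. s \<in> S \<Longrightarrow> covfun M X s t < e"
    using eventually_happens'[OF trivial_limit_at_top_linorder] by blast
  have "(\<Sum>s\<in>S. \<theta> s * covfun M X s t) \<le> (\<Sum>s\<in>S. \<theta> s * e)"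
    using t \<theta> by (intro sum_mono mult_left_mono) (auto intro: less_imp_le)
  also have "\<dots> = sum \<theta> S * e" by (simp add: sum_distrib_right)
  also have "\<dots> < 1" using \<theta>0 by (simp add: e_def divide_less_eq)
  finally show False using one by simp
qed

end

text \<open>What both alternatives supply; from here on they are no longer distinguished.
  Differentiability is stated at each fixed time, with an exceptional null set that may depend on
  the time.\<close>

locale smooth_gaussian = prob_space M for M :: "'a measure" +
  fixes X :: "real \<Rightarrow> 'a \<Rightarrow> real" and a b :: real
  assumes ab: "a < b"
    and G: "gaussian_family M X"
    and cont: "\<And>\<omega>. \<omega> \<in> space M \<Longrightarrow> continuous_on UNIV (\<lambda>t. X t \<omega>)"
    and entire: "\<And>s. entire_real (covfun M X s)"
    and diff: "\<And>t. AE \<omega> in M. \<exists>D. ((\<lambda>s. X s \<omega>) has_real_derivative D) (at t)"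
    and nd_jet: "\<And>I. finite I \<Longrightarrow> I \<subseteq> UNIV \<times> {0, 1} \<Longrightarrow> nondegenerate_on M (jet X) I"
    and not_constant: "\<And>S \<theta>. finite S \<Longrightarrow> S \<noteq> {} \<Longrightarrow> S \<subseteq> {a..b} \<Longrightarrow> (\<And>s. s \<in> S \<Longrightarrow> \<theta> s > 0) \<Longrightarrow>
      \<exists>t. (\<Sum>s\<in>S. \<theta> s * covfun M X s t) \<noteq> 1"

lemma nondegenerate_on_jet_0:
  assumes "\<And>I. finite I \<Longrightarrow> I \<subseteq> UNIV \<times> {0, 1} \<Longrightarrow> nondegenerate_on M (jet X) I" and I: "finite I"
  shows "nondegenerate_on M X I"
  unfolding nondegenerate_on_def
proof (intro allI impI)
  fix c assume c: "(\<integral>x. (\<Sum>s\<in>I. c s * X s x)\<^sup>2 \<partial>M) = 0"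
  let ?J = "(\<lambda>t. (t, 0::nat)) ` I"
  have "(\<Sum>i\<in>?J. c (fst i) * jet X i x) = (\<Sum>s\<in>I. c s * X s x)" for x
    by (subst sum.reindex) (auto simp: inj_on_def jet_def)
  then have z: "(\<integral>x. (\<Sum>i\<in>?J. c (fst i) * jet X i x)\<^sup>2 \<partial>M) = 0" using c by simp
  have nd: "nondegenerate_on M (jet X) ?J" by (rule assms(1)) (use I in auto)
  have "\<forall>i\<in>?J. c (fst i) = 0"
    by (rule mp[OF spec[OF nd[unfolded nondegenerate_on_def], of "\<lambda>i. c (fst i)"] z])
  then show "\<forall>s\<in>I. c s = 0" by simp
qed

lemma smooth_gaussianI:
  assumes P: "prob_space M" and ab: "a < b" and C: "centered_gaussian_process M X"
    and cont: "\<And>\<omega>. \<omega> \<in> space M \<Longrightarrow> continuous_on UNIV (\<lambda>t. X t \<omega>)"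
    and hyp: "assumption_a M X a b \<or> assumption_b M X"
  shows "smooth_gaussian M X a b"
  using hyp
proof
  interpret prob_space M by fact
  assume a: "assumption_a M X a b"
  have G: "gaussian_family M X" by (rule gaussian_family_of_process[OF P C])
  have diff: "\<exists>D. ((\<lambda>s. X s \<omega>) has_real_derivative D) (at t)" if "\<omega> \<in> space M" for t \<omega>
  proof -
    have "infinitely_differentiable (\<lambda>s. X s \<omega>)" using a that unfolding assumption_a_def by blast
    then have "(deriv ^^ 0) (\<lambda>s. X s \<omega>) field_differentiable at t" unfolding infinitely_differentiable_def by blast
    then show ?thesis by (simp add: field_differentiable_def)
  qed
  have diff': "AE \<omega> in M. \<exists>D. ((\<lambda>s. X s \<omega>) has_real_derivative D) (at t)" for t
    using diff by (intro AE_I2)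
  have GJ: "gaussian_family M (jet X)" by (rule jet_gaussian(1)[OF G cont diff'])
  show ?thesis
    by unfold_locales (use ab G cont diff' covfun_entire_a[OF a] nondegenerate_a[OF a GJ] not_constant_a[OF a] in auto)
next
  interpret prob_space M by fact
  assume b: "assumption_b M X"
  have G: "gaussian_family M X" by (rule gaussian_family_of_process[OF P C])
  obtain F x0 where F: "spectral_measure M X F" "\<And>t. integrable F (\<lambda>x. exp (t * x))" and x0: "x0 islimpt measure_support F"
    using b unfolding assumption_b_def by blast
  interpret spectral_process M X F by unfold_locales (use G F in auto)
  have sp: "spectral_process M X F" by unfold_locales
  note nd = nondegenerate_b[OF cont x0]
  have nd0: "nondegenerate_on M X I" if "finite I" for I
    by (rule nondegenerate_on_jet_0[OF nd that])
  show ?thesis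
    by unfold_locales (use ab G cont AE_differentiable[OF cont] covfun_entire_b nd not_constant_b[OF sp nd0] in auto)
qed

section \<open>Orthants and the weight\<close>

context prob_space
begin

text \<open>The Gram system is solved by adding one vector at a time: a solution on \<open>I\<close>
  is corrected by a multiple of the residual of \<open>V r\<close>, which is orthogonal to the old
  vectors and has positive variance.\<close>

lemma gram_solvable:
  assumes G: "gaussian_family M V" and "finite I" "nondegenerate_on M V I"
  shows "\<exists>c. \<forall>i\<in>I. expectation (\<lambda>\<omega>. V i \<omega> * (\<Sum>j\<in>I. c j * V j \<omega>)) = y i"
  using assms(2,3)
proof (induction I arbitrary: y rule: finite_induct)
  case empty
  then show ?case by simp
next
  case (insert r I)
  note fin = insert.hyps(1) and rI = insert.hyps(2)
  have nd: "nondegenerate_on M V I" by (rule nondegenerate_on_subset[OF insert.prems]) (use fin in auto)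
  have Gi: "integrable M (\<lambda>\<omega>. L \<omega> * L' \<omega>)" if "L \<in> lincombs V" "L' \<in> lincombs V" for L L'
    by (rule lincombs_integrable_mult[OF G that])
  obtain e where e: "\<And>i. i \<in> I \<Longrightarrow> expectation (\<lambda>\<omega>. V i \<omega> * (\<Sum>j\<in>I. e j * V j \<omega>)) = expectation (\<lambda>\<omega>. V i \<omega> * V r \<omega>)"
    using insert.IH[OF nd, of "\<lambda>i. expectation (\<lambda>\<omega>. V i \<omega> * V r \<omega>)"] by blast
  obtain d where d: "\<And>i. i \<in> I \<Longrightarrow> expectation (\<lambda>\<omega>. V i \<omega> * (\<Sum>j\<in>I. d j * V j \<omega>)) = y i"
    using insert.IH[OF nd, of y] by blast
  define E where "E \<omega> = (\<Sum>j\<in>I. e j * V j \<omega>)" for \<omega>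
  define D where "D \<omega> = (\<Sum>j\<in>I. d j * V j \<omega>)" for \<omega>
  define Z where "Z \<omega> = V r \<omega> - E \<omega>" for \<omega>
  have l: "E \<in> lincombs V" "D \<in> lincombs V" "V i \<in> lincombs V" for i
    unfolding E_def[abs_def] D_def[abs_def] using fin by (auto intro: lincombsI lincombs_base)
  have lZ: "Z \<in> lincombs V" unfolding Z_def[abs_def] by (intro lincombs_diff l)
  have ZI: "expectation (\<lambda>\<omega>. V i \<omega> * Z \<omega>) = 0" if "i \<in> I" for i
    using e[OF that, folded E_def] Gi[OF l(3) l(3), of i r] Gi[OF l(3) l(1), of i]
    by (simp add: Z_def right_diff_distrib)
  have Zpos: "expectation (\<lambda>\<omega>. (Z \<omega>)\<^sup>2) > 0"
  proof (rule ccontr)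
    assume "\<not> ?thesis"
    moreover have "expectation (\<lambda>\<omega>. (Z \<omega>)\<^sup>2) \<ge> 0" by simp
    ultimately have z: "expectation (\<lambda>\<omega>. (Z \<omega>)\<^sup>2) = 0" by linarith
    let ?c = "\<lambda>j. if j = r then 1 else - e j"
    have s: "(\<Sum>j\<in>insert r I. ?c j * V j \<omega>) = Z \<omega>" for \<omega>
    proof -
      have "(\<Sum>j\<in>I. ?c j * V j \<omega>) = (\<Sum>j\<in>I. - e j * V j \<omega>)" using rI by (intro sum.cong) auto
      then show ?thesis using rI fin by (simp add: Z_def E_def sum_negf)
    qed
    have z': "expectation (\<lambda>\<omega>. (\<Sum>j\<in>insert r I. ?c j * V j \<omega>)\<^sup>2) = 0" unfolding s by (rule z)
    have "\<forall>j\<in>insert r I. ?c j = 0"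
      by (rule mp[OF spec[OF insert.prems[unfolded nondegenerate_on_def], of ?c] z'])
    then show False by auto
  qed
  have Zr: "expectation (\<lambda>\<omega>. V r \<omega> * Z \<omega>) = expectation (\<lambda>\<omega>. (Z \<omega>)\<^sup>2)"
  proof -
    have "expectation (\<lambda>\<omega>. E \<omega> * Z \<omega>) = (\<Sum>j\<in>I. e j * expectation (\<lambda>\<omega>. V j \<omega> * Z \<omega>))"
      unfolding E_def sum_distrib_right mult.assoc using Gi[OF l(3) lZ] by simp
    also have "\<dots> = 0" using ZI by simp
    finally have EZ: "expectation (\<lambda>\<omega>. E \<omega> * Z \<omega>) = 0" .
    have "expectation (\<lambda>\<omega>. (Z \<omega>)\<^sup>2) = expectation (\<lambda>\<omega>. V r \<omega> * Z \<omega> - E \<omega> * Z \<omega>)"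
      by (intro Bochner_Integration.integral_cong) (auto simp: Z_def power2_eq_square algebra_simps)
    also have "\<dots> = expectation (\<lambda>\<omega>. V r \<omega> * Z \<omega>)" using Gi[OF l(3) lZ, of r] Gi[OF l(1) lZ] EZ by simp
    finally show ?thesis ..
  qed
  define \<kappa> where "\<kappa> = (y r - expectation (\<lambda>\<omega>. V r \<omega> * D \<omega>)) / expectation (\<lambda>\<omega>. (Z \<omega>)\<^sup>2)"
  define c where "c j = (if j = r then \<kappa> else d j - \<kappa> * e j)" for j
  have c: "(\<Sum>j\<in>insert r I. c j * V j \<omega>) = D \<omega> + \<kappa> * Z \<omega>" for \<omega>
  proof -
    have "(\<Sum>j\<in>I. c j * V j \<omega>) = (\<Sum>j\<in>I. d j * V j \<omega> - \<kappa> * (e j * V j \<omega>))"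
      using rI by (intro sum.cong) (auto simp: c_def algebra_simps)
    then show ?thesis using rI fin
      by (simp add: c_def D_def Z_def E_def sum_subtractf sum_distrib_left algebra_simps)
  qed
  have "expectation (\<lambda>\<omega>. V i \<omega> * (\<Sum>j\<in>insert r I. c j * V j \<omega>)) = y i" if "i \<in> insert r I" for i
  proof -
    have "expectation (\<lambda>\<omega>. V i \<omega> * (\<Sum>j\<in>insert r I. c j * V j \<omega>)) =
      expectation (\<lambda>\<omega>. V i \<omega> * D \<omega> + \<kappa> * (V i \<omega> * Z \<omega>))"
      unfolding c by (simp add: algebra_simps)
    also have "\<dots> = expectation (\<lambda>\<omega>. V i \<omega> * D \<omega>) + \<kappa> * expectation (\<lambda>\<omega>. V i \<omega> * Z \<omega>)"
      using Gi[OF l(3) l(2), of i] Gi[OF l(3) lZ, of i] by simp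
    also have "\<dots> = y i"
      using that d ZI Zr Zpos by (cases "i = r") (auto simp: \<kappa>_def D_def)
    finally show ?thesis .
  qed
  then show ?case by blast
qed

text \<open>Shift the vector by a Gaussian variable \<open>U\<close> whose covariances with the coordinates have the
  signs of \<open>y\<close>.\<close>

lemma gaussian_orthant:
  assumes G: "gaussian_family M V" and K: "finite K" "nondegenerate_on M V K" and y: "\<And>i. i \<in> K \<Longrightarrow> y i \<noteq> 0"
  shows "prob {\<omega>\<in>space M. \<forall>i\<in>K. y i * V i \<omega> > 0} > 0"
proof (cases "K = {}")
  case True
  then show ?thesis using prob_space by simp
next
  case False
  have Vm[measurable]: "V i \<in> borel_measurable M" for i by (rule lincombs_normal(2)[OF G lincombs_base])
  obtain c where c: "\<And>i. i \<in> K \<Longrightarrow> expectation (\<lambda>\<omega>. V i \<omega> * (\<Sum>j\<in>K. c j * V j \<omega>)) = y i"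
    using gram_solvable[OF G K] by blast
  define U where "U \<omega> = (\<Sum>j\<in>K. c j * V j \<omega>)" for \<omega>
  have U: "U \<in> lincombs V" unfolding U_def[abs_def] by (rule lincombsI[OF K(1)])
  have Um[measurable]: "U \<in> borel_measurable M" by (rule lincombs_normal(2)[OF G U])
  define v where "v = expectation (\<lambda>\<omega>. (U \<omega>)\<^sup>2)"
  have v: "v > 0"
  proof (rule ccontr)
    assume "\<not> v > 0"
    moreover have "v \<ge> 0" by (simp add: v_def)
    ultimately have "v = 0" by linarith
    then have "expectation (\<lambda>\<omega>. (U \<omega>)\<^sup>2) = 0" by (simp only: v_def)
    from second_moment_zero_orthogonal[OF G U this] have "expectation (\<lambda>\<omega>. V i \<omega> * U \<omega>) = 0" for i .
    with c y False show False unfolding U_def[symmetric] by auto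
  qed
  have k: "regr (V i) U = y i / v" if "i \<in> K" for i
    unfolding regr_def v_def[symmetric] using c[OF that] by (simp add: U_def)
  define Q where "Q i \<omega> = V i \<omega> - regr (V i) U * U \<omega>" for i \<omega>
  have Qm[measurable]: "Q i \<in> borel_measurable M" for i unfolding Q_def[abs_def] by measurable
  define B where "B n = {\<omega>\<in>space M. \<forall>i\<in>K. \<bar>y i * Q i \<omega>\<bar> \<le> real n}" for n
  have Bm[measurable]: "B n \<in> sets M" for n
    unfolding B_def using K(1) by measurable
  have "(\<lambda>n. prob (B n)) \<longlonglongrightarrow> prob (\<Union>n. B n)"
  proof (rule finite_Lim_measure_incseq)
    show "range B \<subseteq> sets M" using Bm by auto
    show "incseq B" unfolding incseq_def B_def by (auto intro: order.trans)
  qed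
  moreover have "(\<Union>n. B n) = space M"
  proof -
    have "\<exists>n. \<forall>i\<in>K. \<bar>y i * Q i \<omega>\<bar> \<le> real n" for \<omega>
    proof -
      obtain n where n: "(\<Sum>i\<in>K. \<bar>y i * Q i \<omega>\<bar>) \<le> real n" using real_arch_simple by blast
      have "\<bar>y i * Q i \<omega>\<bar> \<le> real n" if "i \<in> K" for i
        using member_le_sum[of i K "\<lambda>i. \<bar>y i * Q i \<omega>\<bar>"] that K(1) n by simp
      then show ?thesis by blast
    qed
    then show ?thesis by (auto simp: B_def)
  qed
  ultimately have lim: "(\<lambda>n. prob (B n)) \<longlonglongrightarrow> 1" using prob_space by simp
  have "\<forall>\<^sub>F n in sequentially. 0 < prob (B n)" by (rule order_tendstoD(1)[OF lim]) simp
  then obtain n where n: "prob (B n) > 0"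
    by (auto simp: eventually_sequentially)
  define m where "m = Min ((\<lambda>i. (y i)\<^sup>2) ` K)"
  have m: "m > 0" "\<And>i. i \<in> K \<Longrightarrow> m \<le> (y i)\<^sup>2"
    using K(1) False y by (auto simp: m_def)
  \<comment> \<open>On \<open>B n\<close> the residual terms are at most \<open>n\<close> in
    modulus, while the drift produced by \<open>U = s\<close> is at least \<open>m * s / v\<close>.
    Beyond \<open>y0\<close> the drift wins for all coordinates at once.\<close>
  define y0 where "y0 = real n * v / m"
  define O' where "O' = {z \<in> space (Pi\<^sub>M UNIV (\<lambda>_. borel :: real measure)). \<forall>i\<in>K. y i * z i > 0}"
  have O'm: "O' \<in> sets (Pi\<^sub>M UNIV (\<lambda>_. borel))" unfolding O'_def using K(1) by measurable
  define I where "I s = (\<integral>\<^sup>+\<omega>. indicator O' (\<lambda>i. regr (V i) U * s + (V i \<omega> - regr (V i) U * U \<omega>)) \<partial>M)" for s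
  have spl: "(\<integral>\<^sup>+\<omega>. indicator O' (\<lambda>i. V i \<omega>) \<partial>M) = (\<integral>\<^sup>+s. ennreal (normal_density 0 (sqrt v) s) * I s \<partial>lborel)"
    unfolding I_def v_def by (rule gaussian_split[OF G U]) (use O'm v v_def in auto)
  have Ige: "I s \<ge> ennreal (prob (B n))" if s: "s > y0" for s
  proof -
    have "indicator (B n) \<omega> \<le> (indicator O' (\<lambda>i. regr (V i) U * s + (V i \<omega> - regr (V i) U * U \<omega>)) :: ennreal)" for \<omega>
    proof (cases "\<omega> \<in> B n")
      case True
      have "y i * (regr (V i) U * s + (V i \<omega> - regr (V i) U * U \<omega>)) > 0" if i: "i \<in> K" for i
      proof -
        have "real n < m * s / v" using s m(1) v by (simp add: y0_def field_simps)
        moreover have s0: "s \<ge> 0" using s m v by (simp add: y0_def order.trans[OF _ less_imp_le[OF s]])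
        moreover have "m * s / v \<le> (y i)\<^sup>2 * s / v" using m(2)[OF i] s0 v by (intro divide_right_mono mult_right_mono) auto
        moreover have "\<bar>y i * Q i \<omega>\<bar> \<le> real n" using True i by (simp add: B_def)
        ultimately have "(y i)\<^sup>2 * s / v + y i * Q i \<omega> > 0" by linarith
        then show ?thesis using k[OF i] unfolding Q_def by (simp add: power2_eq_square algebra_simps)
      qed
      then have "(\<lambda>i. regr (V i) U * s + (V i \<omega> - regr (V i) U * U \<omega>)) \<in> O'" by (simp add: O'_def space_PiM)
      then show ?thesis by (simp add: indicator_def)
    qed simp
    then have "(\<integral>\<^sup>+\<omega>. indicator (B n) \<omega> \<partial>M) \<le> I s" unfolding I_def by (intro nn_integral_mono)
    then show ?thesis by (simp add: emeasure_eq_measure)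
  qed
  have "(\<integral>\<^sup>+\<omega>. indicator O' (\<lambda>i. V i \<omega>) \<partial>M) \<noteq> 0"
  proof
    assume "(\<integral>\<^sup>+\<omega>. indicator O' (\<lambda>i. V i \<omega>) \<partial>M) = 0"
    then have z: "(\<integral>\<^sup>+s. ennreal (normal_density 0 (sqrt v) s) * I s \<partial>lborel) = 0" using spl by simp
    have "(\<integral>\<^sup>+s. ennreal (normal_density 0 (sqrt v) s) * (ennreal (prob (B n)) * indicator {y0<..} s) \<partial>lborel) \<le>
       (\<integral>\<^sup>+s. ennreal (normal_density 0 (sqrt v) s) * I s \<partial>lborel)"
      using Ige by (intro nn_integral_mono mult_left_mono) (auto simp: indicator_def)
    then have "(\<integral>\<^sup>+s. ennreal (normal_density 0 (sqrt v) s) * (ennreal (prob (B n)) * indicator {y0<..} s) \<partial>lborel) = 0"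
      using z by simp
    then have "AE s in lborel. ennreal (normal_density 0 (sqrt v) s) * (ennreal (prob (B n)) * indicator {y0<..} s) = 0"
      by (subst (asm) nn_integral_0_iff_AE) auto
    then have "AE s in lborel. s \<notin> {y0<..}"
    proof eventually_elim
      case (elim s)
      have "normal_density 0 (sqrt v) s > 0" using v by (intro normal_density_pos) simp
      then show ?case using elim n by (auto simp: indicator_def split: if_splits)
    qed
    then have "emeasure lborel {y0<..} = 0" by (subst (asm) AE_iff_null_sets[symmetric]) auto
    moreover have "emeasure lborel {y0<..<y0 + 1} \<le> emeasure lborel {y0<..}" by (rule emeasure_mono) auto
    ultimately show False by simp
  qed
  moreover have "(\<integral>\<^sup>+\<omega>. indicator O' (\<lambda>i. V i \<omega>) \<partial>M) = (\<integral>\<^sup>+\<omega>. indicator {\<omega>\<in>space M. \<forall>i\<in>K. y i * V i \<omega> > 0} \<omega> \<partial>M)"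
    by (intro nn_integral_cong) (auto simp: O'_def space_PiM indicator_def)
  moreover have "{\<omega>\<in>space M. \<forall>i\<in>K. y i * V i \<omega> > 0} \<in> sets M" using K(1) by measurable
  ultimately have "emeasure M {\<omega>\<in>space M. \<forall>i\<in>K. y i * V i \<omega> > 0} \<noteq> 0" by simp
  then show ?thesis by (simp add: emeasure_eq_measure zero_less_measure_iff)
qed

end

section \<open>Exponential integrals over the passing values\<close>

lemma nn_integral_exp_tail:
  assumes "\<theta> > 0"
  shows "(\<integral>\<^sup>+w. ennreal (exp (- \<theta> * w)) * indicator {c<..} w \<partial>lborel) = ennreal (exp (- \<theta> * c) / \<theta>)"
proof -
  have "(\<integral>\<^sup>+w. ennreal (exp (- \<theta> * w)) * indicator {c<..} w \<partial>lborel) =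
      (\<integral>\<^sup>+w. ennreal (exp (- \<theta> * w)) * indicator {c..} w \<partial>lborel)"
    by (intro nn_integral_cong_AE eventually_mono[OF AE_lborel_singleton[of c]]) (auto simp: indicator_def)
  also have "\<dots> = ennreal (0 - (- exp (- \<theta> * c) / \<theta>))"
  proof (rule nn_integral_FTC_atLeast)
    show "((\<lambda>x. - exp (- \<theta> * x) / \<theta>) \<longlongrightarrow> 0) at_top" using assms by real_asymp
    show "((\<lambda>x. - exp (- \<theta> * x) / \<theta>) has_real_derivative exp (- \<theta> * x)) (at x)" for x
      using assms by (auto intro!: derivative_eq_intros)
  qed auto
  finally show ?thesis by simp
qed

context level_shape
begin

text \<open>The factor of \<open>W\<close> contributed by \<open>s\<close>, as a function of the
  slope \<open>d\<close>. A zero slope at an end point with vanishing \<open>\<mu>1\<close> gets the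
  value 0, as in \<open>W_left\<close> and \<open>W_right\<close>.\<close>

definition wt :: "real \<Rightarrow> real \<Rightarrow> real \<Rightarrow> real" where
  "wt \<theta> s d =
    (if s = a then (if \<mu>1 a = 0 then of_bool (d > 0) + exp_ratio \<theta> (\<mu>2 a) d * of_bool (d < 0) else 1)
     else if s = b then (if \<mu>1 b = 0 then of_bool (d < 0) + exp_ratio \<theta> (\<mu>2 b) d * of_bool (d > 0) else 1)
     else exp (- (\<theta> / (2 * \<mu>2 s)) * d\<^sup>2))"

lemma pass_measurable [measurable]: "Measurable.pred borel (\<lambda>w. pass s d w)"
  unfolding pass_def by (auto split: if_splits)

text \<open>The weight is the tail of an exponential law of rate \<open>\<theta>\<close> beyond the
  threshold \<open>d\<^sup>2 / (2 * \<mu>2 s)\<close>. If the curvature vanishes and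
  \<open>d\<close> has the wrong sign, no \<open>w\<close> passes, which matches the value 0 of
  \<open>exp_ratio\<close>.\<close>

lemma integral_pass:
  assumes \<theta>: "\<theta> > 0" and s: "s \<in> S" and d: "s \<in> {a, b} \<Longrightarrow> \<mu>1 s = 0 \<Longrightarrow> d \<noteq> 0"
  shows "(\<integral>\<^sup>+w. ennreal (exp (- \<theta> * w)) * indicator {w. w > 0 \<and> pass s d w} w \<partial>lborel) = ennreal (wt \<theta> s d / \<theta>)"
proof -
  have sab: "s \<in> {a..b}" using s S by auto
  have full: "(\<integral>\<^sup>+w. ennreal (exp (- \<theta> * w)) * indicator {w. w > 0 \<and> True} w \<partial>lborel) = ennreal (1 / \<theta>)"
    using nn_integral_exp_tail[OF \<theta>, of 0] by (simp add: greaterThan_def)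
  have thr: "(\<integral>\<^sup>+w. ennreal (exp (- \<theta> * w)) * indicator {w. w > 0 \<and> w > d\<^sup>2 / (2 * q)} w \<partial>lborel) =
      ennreal (exp (- (\<theta> / (2 * q)) * d\<^sup>2) / \<theta>)" if "q > 0" for q
  proof -
    have "d\<^sup>2 / (2 * q) \<ge> 0" using that by simp
    then have "{w. w > 0 \<and> w > d\<^sup>2 / (2 * q)} = {d\<^sup>2 / (2 * q)<..}" by auto
    then show ?thesis using nn_integral_exp_tail[OF \<theta>, of "d\<^sup>2 / (2 * q)"] by simp
  qed
  show ?thesis
  proof (cases "s = a \<or> s = b")
    case False
    then have "\<mu>2 s > 0" using pos[OF s] sab by auto
    then show ?thesis using thr[of "\<mu>2 s"] False by (simp add: pass_def wt_def)
  next
    case True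
    show ?thesis
    proof (cases "\<mu>1 s = 0")
      case False
      then show ?thesis using True full ab by (auto simp: pass_def wt_def)
    next
      case m1: True
      have m2: "\<mu>2 s \<ge> 0" by (rule second_nonneg[OF s m1])
      have d0: "d \<noteq> 0" using d True m1 by auto
      show ?thesis
      proof (cases "s = a \<and> d > 0 \<or> s = b \<and> d < 0")
        case t: True
        then show ?thesis using full ab m1 by (auto simp: pass_def wt_def)
      next
        case f: False
        have e: "pass s d w \<longleftrightarrow> \<mu>2 s \<noteq> 0 \<and> w > d\<^sup>2 / (2 * \<mu>2 s)" for w
          using f True m1 ab by (auto simp: pass_def)
        have w: "wt \<theta> s d = exp_ratio \<theta> (\<mu>2 s) d"
          using f True m1 ab d0 by (auto simp: wt_def)
        show ?thesis
        proof (cases "\<mu>2 s = 0")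
          case True
          then show ?thesis unfolding e w by (simp add: exp_ratio_def)
        next
          case False
          then show ?thesis unfolding e w using thr[of "\<mu>2 s"] m2 by (simp add: exp_ratio_def)
        qed
      qed
    qed
  qed
qed

lemma wt_bounds: assumes "\<theta> > 0" "s \<in> S" shows "0 \<le> wt \<theta> s d" "wt \<theta> s d \<le> 1"
proof -
  have sab: "s \<in> {a..b}" using assms S by auto
  have e: "0 \<le> exp_ratio \<theta> q d \<and> exp_ratio \<theta> q d \<le> 1" if "q \<ge> 0" for q
    using that assms by (auto simp: exp_ratio_def)
  have "0 \<le> wt \<theta> s d \<and> wt \<theta> s d \<le> 1"
  proof (cases "s = a \<or> s = b")
    case False
    then have "\<mu>2 s > 0" using pos[OF assms(2)] sab by auto
    then show ?thesis using False assms by (simp add: wt_def)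
  next
    case True
    then show ?thesis using e[OF second_nonneg[OF assms(2)]] ab by (auto simp: wt_def)
  qed
  then show "0 \<le> wt \<theta> s d" "wt \<theta> s d \<le> 1" by auto
qed

lemma wt_pos:
  assumes "s = a \<Longrightarrow> \<mu>1 a = 0 \<Longrightarrow> d > 0" "s = b \<Longrightarrow> \<mu>1 b = 0 \<Longrightarrow> d < 0"
  shows "wt \<theta> s d > 0"
  using assms by (auto simp: wt_def)

lemma wt_measurable [measurable]: "wt \<theta> s \<in> borel_measurable borel"
proof -
  have "exp_ratio \<theta> q \<in> borel_measurable borel" for q unfolding exp_ratio_def[abs_def] by measurable
  then show ?thesis unfolding wt_def[abs_def] by measurable
qed

end

section \<open>The residual process\<close>

context smooth_gaussian
begin

lemma nd: "finite I \<Longrightarrow> nondegenerate_on M X I"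
  by (rule nondegenerate_on_jet_0[OF nd_jet])

lemma Xm [measurable]: "X t \<in> borel_measurable M"
  by (rule lincombs_normal(2)[OF G lincombs_base])

lemma integrable_XX: "integrable M (\<lambda>\<omega>. X s \<omega> * X t \<omega>)"
  by (rule lincombs_integrable_mult[OF G lincombs_base lincombs_base])

lemma covfun_coeff:
  assumes S: "finite S" and orth: "\<And>t s. s \<in> S \<Longrightarrow> expectation (\<lambda>\<omega>. resd X S \<alpha> t \<omega> * X s \<omega>) = 0" and s: "s \<in> S"
  shows "covfun M X t s = (\<Sum>r\<in>S. \<alpha> t r * covfun M X r s)"
proof -
  have "expectation (\<lambda>\<omega>. resd X S \<alpha> t \<omega> * X s \<omega>) = expectation (\<lambda>\<omega>. X t \<omega> * X s \<omega> - (\<Sum>r\<in>S. \<alpha> t r * (X r \<omega> * X s \<omega>)))"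
    unfolding resd_def left_diff_distrib sum_distrib_right mult.assoc ..
  also have "\<dots> = covfun M X t s - (\<Sum>r\<in>S. \<alpha> t r * covfun M X r s)"
    using integrable_XX by (simp add: covfun_def)
  finally show ?thesis using orth[OF s, of t] by simp
qed

text \<open>The covariance of \<open>X t\<close> with the tilting variable is that of its regression
  on \<open>S\<close>, and on \<open>S\<close> these covariances are 1. This identifies the
  conditional mean with the normalized potential of the minimizer.\<close>

lemma sum_coeff:
  assumes S: "finite S" and orth: "\<And>t s. s \<in> S \<Longrightarrow> expectation (\<lambda>\<omega>. resd X S \<alpha> t \<omega> * X s \<omega>) = 0"
    and one: "\<And>t. t \<in> S \<Longrightarrow> (\<Sum>s\<in>S. \<theta> s * covfun M X s t) = 1"
  shows "(\<Sum>r\<in>S. \<alpha> t r) = (\<Sum>s\<in>S. \<theta> s * covfun M X s t)"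
proof -
  have "(\<Sum>s\<in>S. \<theta> s * covfun M X s t) = (\<Sum>s\<in>S. \<Sum>r\<in>S. \<theta> s * (\<alpha> t r * covfun M X r s))"
    using covfun_coeff[OF S orth] by (simp add: covfun_sym[of M X _ t] sum_distrib_left)
  also have "\<dots> = (\<Sum>r\<in>S. \<alpha> t r * (\<Sum>s\<in>S. \<theta> s * covfun M X s r))"
    by (subst sum.swap) (simp add: sum_distrib_left mult_ac covfun_sym)
  also have "\<dots> = (\<Sum>r\<in>S. \<alpha> t r)" using one by simp
  finally show ?thesis ..
qed

end

section \<open>The conditional mean and the tilting variable\<close>

locale level_gaussian = smooth_gaussian M X a b
  for M :: "'a measure" and X :: "real \<Rightarrow> 'a \<Rightarrow> real" and a b :: real +
  fixes S :: "real set" and \<theta> :: "real \<Rightarrow> real" and mean :: "real \<Rightarrow> real"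
  assumes S: "finite S" "S \<noteq> {}" "S \<subseteq> {a..b}"
    and \<theta>: "\<And>s. s \<in> S \<Longrightarrow> \<theta> s > 0"
    and mean: "mean = (\<lambda>t. \<Sum>s\<in>S. \<theta> s * covfun M X s t)"
    and mean_S: "\<And>t. t \<in> S \<Longrightarrow> mean t = 1"
    and mean_ge: "\<And>t. t \<in> {a..b} \<Longrightarrow> mean t \<ge> 1"
    and mean_pos: "\<And>s. s \<in> S \<Longrightarrow> s \<in> {a<..<b} \<Longrightarrow> (deriv ^^ 2) mean s > 0"
begin

lemma entire_mean: "entire_real mean"
  unfolding mean by (intro entire_real_sum entire_real_cmult entire S)

lemma mean_deriv: "(mean has_real_derivative deriv mean t) (at t)"
  by (rule entire_real_deriv[OF entire_mean]) (auto simp: DERIV_deriv_iff_real_differentiable real_differentiable_def)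

lemma mean_deriv2: "(deriv mean has_real_derivative (deriv ^^ 2) mean t) (at t)"
proof -
  obtain g where g: "entire_real g" "\<And>t. (mean has_real_derivative g t) (at t)"
    using entire_real_deriv[OF entire_mean] by blast
  have "deriv mean = g" using g(2) by (auto intro: DERIV_imp_deriv)
  moreover obtain g' where "\<And>t. (g has_real_derivative g' t) (at t)" using entire_real_deriv[OF g(1)] by blast
  ultimately have "(deriv mean has_real_derivative deriv (deriv mean) t) (at t)"
    by (metis DERIV_imp_deriv)
  then show ?thesis by (simp add: numeral_2_eq_2)
qed

sublocale L: level_shape a b S mean "deriv mean" "(deriv ^^ 2) mean"
proof
  show "finite {t \<in> {a..b}. mean t = 1}"
  proof (rule ccontr)
    assume "infinite {t \<in> {a..b}. mean t = 1}"
    then have "mean t = 1" for t by (rule entire_real_infinite_level[OF entire_mean])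
    then show False using not_constant[OF S, of \<theta>] \<theta> unfolding mean by auto
  qed
  show "((\<lambda>t. (mean t - 1) / (t - s)\<^sup>2) \<longlongrightarrow> (deriv ^^ 2) mean s / 2) (at s)"
    if "s \<in> S" "deriv mean s = 0" for s
    by (rule second_order_quotient[OF mean_deriv mean_deriv2 mean_S[OF that(1)] that(2)])
qed (use ab S mean_S mean_ge mean_pos mean_deriv entire_real_continuous[OF entire_mean] in auto)

lemma covariance_tilt: "expectation (\<lambda>\<omega>. X t \<omega> * (\<Sum>s\<in>S. \<theta> s * X s \<omega>)) = mean t"
proof -
  have "expectation (\<lambda>\<omega>. X t \<omega> * (\<Sum>s\<in>S. \<theta> s * X s \<omega>)) = expectation (\<lambda>\<omega>. \<Sum>s\<in>S. \<theta> s * (X s \<omega> * X t \<omega>))"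
    by (simp add: sum_distrib_left mult_ac)
  also have "\<dots> = mean t" using integrable_XX by (simp add: mean covfun_def)
  finally show ?thesis .
qed

lemma variance_tilt: "expectation (\<lambda>\<omega>. (\<Sum>s\<in>S. \<theta> s * X s \<omega>)\<^sup>2) = sum \<theta> S"
proof -
  have "expectation (\<lambda>\<omega>. (\<Sum>s\<in>S. \<theta> s * X s \<omega>)\<^sup>2) = (\<Sum>s\<in>S. \<Sum>t\<in>S. \<theta> s * \<theta> t * covfun M X s t)"
    by (rule lincomb_second_moment[OF G S(1)])
  also have "\<dots> = (\<Sum>t\<in>S. \<theta> t * mean t)"
    unfolding mean by (subst sum.swap) (simp add: sum_distrib_left mult_ac)
  finally have "expectation (\<lambda>\<omega>. (\<Sum>s\<in>S. \<theta> s * X s \<omega>)\<^sup>2) = (\<Sum>t\<in>S. \<theta> t * mean t)" .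
  then show ?thesis using mean_S by simp
qed

lemma sum_\<theta>_pos: "sum \<theta> S > 0"
  using S \<theta> by (intro sum_pos) auto

end

locale conditioned_gaussian = level_gaussian M X a b S \<theta> mean
  for M :: "'a measure" and X :: "real \<Rightarrow> 'a \<Rightarrow> real" and a b S \<theta> mean +
  fixes \<alpha> :: "real \<Rightarrow> real \<Rightarrow> real" and p :: "(real \<Rightarrow> real) \<Rightarrow> real" and p0 :: real
  assumes \<delta>: "\<And>s s'. s \<in> S \<Longrightarrow> s' \<in> S \<Longrightarrow> \<alpha> s s' = of_bool (s = s')"
    and orth: "\<And>t s. s \<in> S \<Longrightarrow> expectation (\<lambda>\<omega>. resd X S \<alpha> t \<omega> * X s \<omega>) = 0"
    and p [measurable]: "p \<in> borel_measurable (Pi\<^sub>M S (\<lambda>_. lborel))"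
    and p_bounds: "\<And>w. 0 \<le> p w" "\<And>w. p w \<le> p0" and p0: "p0 > 0"
    and p_lim: "\<And>w. ((\<lambda>e. p (\<lambda>s\<in>S. e * w s)) \<longlongrightarrow> p0) (at_right 0)"
    and dis: "disintegrates X S \<alpha> p"
begin

abbreviation Z :: "real \<Rightarrow> 'a \<Rightarrow> real" where "Z \<equiv> resd X S \<alpha>"

lemmas coeff = covfun_coeff[OF S(1) orth]

lemma coeff_sum: "(\<Sum>r\<in>S. \<alpha> t r) = mean t"
  unfolding mean by (rule sum_coeff[OF S(1) orth]) (use mean_S mean in auto)

text \<open>Solving the Gram system for the unit vector at \<open>r\<close> gives a row of the
  inverse covariance matrix, which writes the coefficient as a finite combination of covariance
  functions.\<close>

lemma entire_coeff:
  assumes r: "r \<in> S" shows "entire_real (\<lambda>t. \<alpha> t r)"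
proof -
  obtain d where d: "\<And>i. i \<in> S \<Longrightarrow> expectation (\<lambda>\<omega>. X i \<omega> * (\<Sum>j\<in>S. d j * X j \<omega>)) = of_bool (i = r)"
    using gram_solvable[OF G S(1) nd[OF S(1)], of "\<lambda>i. of_bool (i = r)"] by blast
  have d': "(\<Sum>j\<in>S. d j * covfun M X i j) = of_bool (i = r)" if "i \<in> S" for i
  proof -
    have "expectation (\<lambda>\<omega>. X i \<omega> * (\<Sum>j\<in>S. d j * X j \<omega>)) = expectation (\<lambda>\<omega>. \<Sum>j\<in>S. d j * (X i \<omega> * X j \<omega>))"
      by (simp add: sum_distrib_left mult_ac)
    then show ?thesis using d[OF that] integrable_XX by (simp add: covfun_def)
  qed
  have "\<alpha> t r = (\<Sum>j\<in>S. d j * covfun M X j t)" for t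
  proof -
    have "(\<Sum>j\<in>S. d j * covfun M X j t) = (\<Sum>j\<in>S. \<Sum>i\<in>S. d j * (\<alpha> t i * covfun M X i j))"
      using coeff by (simp add: covfun_sym[of M X _ t] sum_distrib_left)
    also have "\<dots> = (\<Sum>i\<in>S. \<alpha> t i * (\<Sum>j\<in>S. d j * covfun M X i j))"
      by (subst sum.swap) (simp add: sum_distrib_left mult_ac)
    also have "\<dots> = (\<Sum>i\<in>S. if i = r then \<alpha> t i else 0)" using d' by (intro sum.cong) auto
    also have "\<dots> = \<alpha> t r" using r S(1) by simp
    finally show ?thesis ..
  qed
  then show ?thesis by (simp only:) (intro entire_real_sum entire_real_cmult entire S)
qed

lemma coeff_continuous: "r \<in> S \<Longrightarrow> continuous_on A (\<lambda>t. \<alpha> t r)"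
  by (rule entire_real_continuous[OF entire_coeff])

lemma coeff_deriv: "r \<in> S \<Longrightarrow> ((\<lambda>t. \<alpha> t r) has_real_derivative deriv (\<lambda>t. \<alpha> t r) t) (at t)"
  by (rule entire_real_deriv[OF entire_coeff]) (auto simp: DERIV_deriv_iff_real_differentiable real_differentiable_def)

lemma cond_mean_eq: "cond_mean M X S = mean"
  using cond_coeff_eq[OF G S(1) nd[OF S(1)] \<delta> dis p] coeff_sum
  by (auto simp: cond_mean_def fun_eq_iff)

lemma resid_eq: "resid M X S = Z"
  using cond_coeff_eq[OF G S(1) nd[OF S(1)] \<delta> dis p]
  by (auto simp: resid_def cond_proc_def resd_def fun_eq_iff)

lemma Z_measurable [measurable]: "Z t \<in> borel_measurable M"
  by (rule resd_measurable[OF G S(1)])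

lemma Z_continuous: "\<omega> \<in> space M \<Longrightarrow> continuous_on UNIV (\<lambda>t. Z t \<omega>)"
  unfolding resd_def by (intro continuous_intros cont coeff_continuous)

lemma Z_zero: "s \<in> S \<Longrightarrow> Z s \<omega> = 0"
proof -
  assume s: "s \<in> S"
  have "(\<Sum>r\<in>S. \<alpha> s r * X r \<omega>) = (\<Sum>r\<in>S. if s = r then X r \<omega> else 0)"
    using \<delta>[OF s] by (intro sum.cong) auto
  also have "\<dots> = X s \<omega>" using s S(1) by simp
  finally show ?thesis by (simp add: resd_def)
qed

definition jet_coeff :: "real \<times> nat \<Rightarrow> real \<Rightarrow> real" where
  "jet_coeff = (\<lambda>(t, n) r. if n = 0 then \<alpha> t r else deriv (\<lambda>t. \<alpha> t r) t)"

text \<open>A linear combination of jets for every \<open>\<omega>\<close>, hence a Gaussian family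
  by construction. The path derivative of \<open>Z\<close> is known to agree with it only where the
  path is differentiable, so the two are kept apart and linked by \<open>AE_Zd\<close>.\<close>

definition jetZ :: "real \<times> nat \<Rightarrow> 'a \<Rightarrow> real" where
  "jetZ i \<omega> = jet X i \<omega> - (\<Sum>r\<in>S. jet_coeff i r * X r \<omega>)"

lemma gaussian_jet: "gaussian_family M (jet X)"
  by (rule jet_gaussian(1)[OF G cont diff])

lemma X_jet: "X r \<in> lincombs (jet X)"
  using lincombs_base[of "jet X" "(r, 0)"] by (simp add: jet_def)

lemma gaussian_jetZ: "gaussian_family M jetZ"
  by (rule gaussian_family_lincombs[OF gaussian_jet])
    (auto simp: jetZ_def[abs_def] intro!: lincombs_diff lincombs_base lincombs_sum lincombs_cmult X_jet S)

lemma jetZ_0: "jetZ (t, 0) = Z t"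
  by (simp add: jetZ_def jet_def jet_coeff_def resd_def fun_eq_iff)

lemma Z_deriv:
  assumes "((\<lambda>s. X s \<omega>) has_real_derivative D) (at t)"
  shows "((\<lambda>s. Z s \<omega>) has_real_derivative jetZ (t, 1) \<omega>) (at t)"
proof -
  have "path_deriv X 1 t \<omega> = D" using assms by (simp add: path_deriv_1 DERIV_imp_deriv del: One_nat_def)
  then have "jetZ (t, 1) \<omega> = D - (\<Sum>r\<in>S. deriv (\<lambda>t. \<alpha> t r) t * X r \<omega>)"
    by (simp add: jetZ_def jet_def jet_coeff_def)
  moreover have "((\<lambda>s. X s \<omega> - (\<Sum>r\<in>S. \<alpha> s r * X r \<omega>)) has_real_derivative
      D - (\<Sum>r\<in>S. deriv (\<lambda>t. \<alpha> t r) t * X r \<omega>)) (at t)"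
    by (intro DERIV_diff assms DERIV_sum DERIV_cmult_right coeff_deriv)
  ultimately show ?thesis unfolding resd_def by simp
qed

definition Zd :: "real \<Rightarrow> 'a \<Rightarrow> real" where "Zd = path_deriv Z 1"

lemma Zd_measurable [measurable]: "Zd t \<in> borel_measurable M"
  unfolding Zd_def by (rule path_deriv_measurable[OF Z_measurable Z_continuous])

lemma AE_Zd:
  "AE \<omega> in M. \<forall>s\<in>S. ((\<lambda>t. Z t \<omega>) has_real_derivative Zd s \<omega>) (at s) \<and> Zd s \<omega> = jetZ (s, 1) \<omega>"
proof (intro AE_finite_allI S)
  fix s
  show "AE \<omega> in M. ((\<lambda>t. Z t \<omega>) has_real_derivative Zd s \<omega>) (at s) \<and> Zd s \<omega> = jetZ (s, 1) \<omega>"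
    using diff[of s]
  proof eventually_elim
    case (elim \<omega>)
    then have d: "((\<lambda>t. Z t \<omega>) has_real_derivative jetZ (s, 1) \<omega>) (at s)" using Z_deriv by blast
    then have "Zd s \<omega> = jetZ (s, 1) \<omega>" unfolding Zd_def path_deriv_1 by (rule DERIV_imp_deriv)
    with d show ?case by simp
  qed
qed

text \<open>A combination of residual jets is a combination of jets with the same coefficients on
  \<open>K\<close> and further ones on \<open>S \<times> {0}\<close>, which \<open>K\<close> avoids;
  vanishing of all of them includes those on \<open>K\<close>.\<close>

lemma nondegenerate_jetZ:
  assumes K: "finite K" "K \<subseteq> UNIV \<times> {0, 1}" "K \<inter> S \<times> {0} = {}"
  shows "nondegenerate_on M jetZ K"
  unfolding nondegenerate_on_def
proof (intro allI impI)
  fix c assume z: "expectation (\<lambda>\<omega>. (\<Sum>i\<in>K. c i * jetZ i \<omega>)\<^sup>2) = 0"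
  let ?T = "K \<union> S \<times> {0}"
  define e where "e i = (if i \<in> K then c i else - (\<Sum>j\<in>K. c j * jet_coeff j (fst i)))" for i
  have e: "(\<Sum>i\<in>?T. e i * jet X i \<omega>) = (\<Sum>i\<in>K. c i * jetZ i \<omega>)" for \<omega>
  proof -
    have 1: "(\<Sum>i\<in>?T. e i * jet X i \<omega>) = (\<Sum>i\<in>K. e i * jet X i \<omega>) + (\<Sum>i\<in>S \<times> {0}. e i * jet X i \<omega>)"
      using K S by (intro sum.union_disjoint) auto
    have 2: "S \<times> {0::nat} = (\<lambda>r. (r, 0)) ` S" by auto
    have 3: "(\<Sum>i\<in>S \<times> {0::nat}. e i * jet X i \<omega>) = (\<Sum>r\<in>S. e (r, 0) * X r \<omega>)"
      unfolding 2 by (subst sum.reindex) (auto simp: inj_on_def jet_def)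
    have 4: "(\<Sum>i\<in>K. e i * jet X i \<omega>) = (\<Sum>i\<in>K. c i * jet X i \<omega>)" by (simp add: e_def)
    have "e (r, 0) * X r \<omega> = - (\<Sum>j\<in>K. c j * (jet_coeff j r * X r \<omega>))" if "r \<in> S" for r
    proof -
      have "(r, 0) \<notin> K" using K(3) that by blast
      then have "e (r, 0) = - (\<Sum>j\<in>K. c j * jet_coeff j r)" by (simp add: e_def)
      then show ?thesis by (simp add: sum_distrib_right mult.assoc)
    qed
    then have 5: "(\<Sum>r\<in>S. e (r, 0) * X r \<omega>) = (\<Sum>r\<in>S. - (\<Sum>j\<in>K. c j * (jet_coeff j r * X r \<omega>)))"
      by (rule sum.cong[OF refl])
    have 6: "(\<Sum>r\<in>S. \<Sum>j\<in>K. c j * (jet_coeff j r * X r \<omega>)) = (\<Sum>j\<in>K. \<Sum>r\<in>S. c j * (jet_coeff j r * X r \<omega>))"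
      by (rule sum.swap)
    have "(\<Sum>i\<in>K. c i * jetZ i \<omega>) = (\<Sum>i\<in>K. c i * jet X i \<omega>) - (\<Sum>j\<in>K. \<Sum>r\<in>S. c j * (jet_coeff j r * X r \<omega>))"
      unfolding jetZ_def right_diff_distrib sum_subtractf sum_distrib_left ..
    then show ?thesis unfolding 1 3 4 5 sum_negf 6 by simp
  qed
  have nT: "nondegenerate_on M (jet X) ?T" using K S by (intro nd_jet) auto
  have z': "expectation (\<lambda>\<omega>. (\<Sum>i\<in>?T. e i * jet X i \<omega>)\<^sup>2) = 0" unfolding e by (rule z)
  have "\<forall>i\<in>?T. e i = 0" by (rule mp[OF spec[OF nT[unfolded nondegenerate_on_def], of e] z'])
  then show "\<forall>i\<in>K. c i = 0" by (auto simp: e_def split: if_splits)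
qed

text \<open>The coordinates whose sign matters: values at contact points outside \<open>S\<close>,
  and slopes at end points of \<open>S\<close> with vanishing first derivative. Zeros of these are
  the ties to be excluded.\<close>

definition gen :: "(real \<times> nat) set" where
  "gen = L.contacts \<times> {0} \<union> {e \<in> {a, b} \<inter> S. deriv mean e = 0} \<times> {1}"

lemma finite_contacts: "finite L.contacts"
  using L.finE unfolding L.contacts_def by (rule finite_subset[rotated]) auto

lemma gen: "finite gen" "gen \<subseteq> UNIV \<times> {0, 1}" "gen \<inter> S \<times> {0} = {}"
proof -
  show "finite gen" unfolding gen_def using finite_contacts by simp
qed (auto simp: gen_def L.contacts_def)

text \<open>A centred normal variable with positive variance has a density, so it is almost surely
  nonzero.\<close>

lemma AE_jetZ_nonzero: "AE \<omega> in M. \<forall>i\<in>gen. jetZ i \<omega> \<noteq> 0"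
proof (intro AE_finite_allI gen)
  fix i assume i: "i \<in> gen"
  have nd1: "nondegenerate_on M jetZ {i}"
    by (rule nondegenerate_on_subset[OF nondegenerate_jetZ[OF gen]]) (use i gen in auto)
  have N: "centered_normal M (jetZ i)" by (rule lincombs_normal(1)[OF gaussian_jetZ lincombs_base])
  then have m[measurable]: "jetZ i \<in> borel_measurable M" by (simp add: centered_normal_def)
  have nz: "expectation (\<lambda>\<omega>. (jetZ i \<omega>)\<^sup>2) \<noteq> 0"
  proof
    assume "expectation (\<lambda>\<omega>. (jetZ i \<omega>)\<^sup>2) = 0"
    then have z: "expectation (\<lambda>\<omega>. (\<Sum>j\<in>{i}. (\<lambda>_. 1) j * jetZ j \<omega>)\<^sup>2) = 0" by simp
    have "\<forall>j\<in>{i}. (\<lambda>_. 1::real) j = 0"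
      by (rule mp[OF spec[OF nd1[unfolded nondegenerate_on_def], of "\<lambda>_. 1"] z])
    then show False by simp
  qed
  have "distr M borel (jetZ i) \<noteq> return borel 0"
  proof
    assume r: "distr M borel (jetZ i) = return borel 0"
    have "AE x in distr M borel (jetZ i). x = 0" unfolding r by (subst AE_return) auto
    then have "AE \<omega> in M. jetZ i \<omega> = 0" by (simp add: AE_distr_iff)
    then have "expectation (\<lambda>\<omega>. (jetZ i \<omega>)\<^sup>2) = expectation (\<lambda>_. 0)"
      by (intro integral_cong_AE) auto
    then show False using nz by simp
  qed
  then obtain \<sigma> where "\<sigma> > 0" and D: "distr M borel (jetZ i) = density lborel (\<lambda>x. ennreal (normal_density 0 \<sigma> x))"
    using N unfolding centered_normal_def mean_zero_normal_def by blast
  have "AE x in distr M borel (jetZ i). x \<noteq> 0"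
    unfolding D by (subst AE_density) (auto intro: eventually_mono[OF AE_lborel_singleton[of 0]])
  then show "AE \<omega> in M. jetZ i \<omega> \<noteq> 0" by (simp add: AE_distr_iff)
qed

definition weight :: "'a \<Rightarrow> real" where
  "weight \<omega> = (\<Prod>s\<in>S. L.wt (\<theta> s) s (Zd s \<omega>)) * (\<Prod>t\<in>L.contacts. of_bool (Z t \<omega> > 0))"

lemma weight_measurable [measurable]: "weight \<in> borel_measurable M"
  unfolding weight_def[abs_def] by measurable

lemma weight_bounds: "0 \<le> weight \<omega>" "weight \<omega> \<le> 1"
proof -
  have "0 \<le> (\<Prod>s\<in>S. L.wt (\<theta> s) s (Zd s \<omega>)) \<and> (\<Prod>s\<in>S. L.wt (\<theta> s) s (Zd s \<omega>)) \<le> 1"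
    using L.wt_bounds[OF \<theta>] by (intro conjI prod_nonneg prod_le_1) auto
  moreover have "(\<Prod>t\<in>L.contacts. of_bool (Z t \<omega> > 0)) \<in> {0, 1::real}"
    using finite_contacts by (induction rule: finite_induct) auto
  ultimately show "0 \<le> weight \<omega>" "weight \<omega> \<le> 1" by (auto simp: weight_def)
qed

lemma integrable_weight: "integrable M weight"
  by (rule integrable_const_bound[where B = 1]) (use weight_bounds in auto)

lemma expectation_weight_pos: "expectation weight > 0"
proof -
  \<comment> \<open>The signs that make every factor of the weight positive. At \<open>b\<close> the
    interval lies to the left, so the residual has to have a negative slope there.\<close>
  define y where "y = (\<lambda>(t, n::nat). if n = 1 \<and> t = b then -1 else 1 :: real)"
  define O' where "O' = {\<omega>\<in>space M. \<forall>i\<in>gen. y i * jetZ i \<omega> > 0}"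
  have Om[measurable]: "O' \<in> sets M"
  proof -
    have [measurable]: "jetZ i \<in> borel_measurable M" for i
      by (rule lincombs_normal(2)[OF gaussian_jetZ lincombs_base])
    show ?thesis unfolding O'_def using gen(1) by measurable
  qed
  have "prob O' > 0" unfolding O'_def
    by (rule gaussian_orthant[OF gaussian_jetZ gen(1) nondegenerate_jetZ[OF gen]]) (simp add: y_def split_beta)
  have pos: "AE \<omega> in M. \<omega> \<in> O' \<longrightarrow> weight \<omega> > 0"
    using AE_Zd
  proof eventually_elim
    case (elim \<omega>)
    show ?case
    proof
      assume O: "\<omega> \<in> O'"
      have "Z t \<omega> > 0" if "t \<in> L.contacts" for t
      proof -
        have "(t, 0) \<in> gen" using that by (auto simp: gen_def)
        then have "y (t, 0) * jetZ (t, 0) \<omega> > 0" using O unfolding O'_def by blast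
        then show ?thesis by (simp add: y_def jetZ_0)
      qed
      moreover have "L.wt (\<theta> s) s (Zd s \<omega>) > 0" if s: "s \<in> S" for s
      proof (rule L.wt_pos)
        have g: "y (s, 1) * Zd s \<omega> > 0" if "s \<in> {a, b}" "deriv mean s = 0"
        proof -
          have "(s, 1) \<in> gen" using that s by (auto simp: gen_def)
          then have "y (s, 1) * jetZ (s, 1) \<omega> > 0" using O unfolding O'_def by blast
          then show ?thesis using elim s by simp
        qed
        show "Zd s \<omega> > 0" if "s = a" "deriv mean a = 0" using g that ab by (simp add: y_def)
        show "Zd s \<omega> < 0" if "s = b" "deriv mean b = 0" using g that ab by (simp add: y_def)
      qed
      ultimately show "weight \<omega> > 0" unfolding weight_def by (intro mult_pos_pos prod_pos) auto
    qed
  qed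
  show ?thesis
  proof (rule ccontr)
    assume "\<not> ?thesis"
    moreover have "expectation weight \<ge> 0" using weight_bounds by simp
    ultimately have "expectation weight = 0" by linarith
    then have "AE \<omega> in M. weight \<omega> = 0"
      using integral_nonneg_eq_0_iff_AE[OF integrable_weight] weight_bounds by simp
    with pos have "AE \<omega> in M. \<omega> \<notin> O'" by eventually_elim auto
    then have "prob O' = 0" using Om prob_eq_0 by simp
    with \<open>prob O' > 0\<close> show False by simp
  qed
qed

end

section \<open>Identification of the weight with W\<close>

context conditioned_gaussian
begin

lemma theta_eq: "j < card S \<Longrightarrow> theta M X S j = \<theta> (pts S ! j)"
proof (rule theta_eqI[OF S(1)])
  fix c assume c: "\<And>t. t \<in> S \<Longrightarrow> (\<Sum>s\<in>S. covfun M X t s * c s) = 0"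
  have "expectation (\<lambda>\<omega>. (\<Sum>s\<in>S. c s * X s \<omega>)\<^sup>2) = (\<Sum>s\<in>S. \<Sum>t\<in>S. c s * c t * covfun M X s t)"
    by (rule lincomb_second_moment[OF G S(1)])
  also have "\<dots> = (\<Sum>s\<in>S. c s * (\<Sum>t\<in>S. covfun M X s t * c t))"
    by (simp add: sum_distrib_left mult_ac)
  also have "\<dots> = 0" using c by simp
  finally have z: "expectation (\<lambda>\<omega>. (\<Sum>s\<in>S. c s * X s \<omega>)\<^sup>2) = 0" .
  show "\<forall>s\<in>S. c s = 0" by (rule mp[OF spec[OF nd[OF S(1), unfolded nondegenerate_on_def], of c] z])
next
  fix t assume "t \<in> S"
  then have "mean t = 1" by (rule mean_S)
  then show "(\<Sum>s\<in>S. covfun M X t s * \<theta> s) = 1"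
    by (simp add: mean covfun_sym[of M X t] mult.commute)
qed

lemma W_interior_eq:
  "W_interior M X S a b \<omega> = (\<Prod>s\<in>S \<inter> {a<..<b}. exp (- (\<theta> s / (2 * (deriv ^^ 2) mean s)) * (Zd s \<omega>)\<^sup>2))"
proof -
  let ?f = "\<lambda>s. \<theta> s / (deriv ^^ 2) mean s * (Zd s \<omega>)\<^sup>2"
  have "(\<Sum>j | j < card S \<and> pts S ! j \<in> {a<..<b}. theta M X S j / (deriv ^^ 2) mean (pts S ! j) * (Zd (pts S ! j) \<omega>)\<^sup>2)
      = (\<Sum>j\<in>{j \<in> {..<card S}. pts S ! j \<in> {a<..<b}}. ?f (pts S ! j))"
    by (intro sum.cong) (auto simp: theta_eq)
  also have "\<dots> = (\<Sum>j<card S. if pts S ! j \<in> {a<..<b} then ?f (pts S ! j) else 0)"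
    by (rule sum.inter_filter) simp
  also have "\<dots> = (\<Sum>s\<in>S. if s \<in> {a<..<b} then ?f s else 0)"
    by (rule sum_pts[OF S(1), of "\<lambda>s. if s \<in> {a<..<b} then ?f s else 0"])
  also have "\<dots> = (\<Sum>s\<in>S \<inter> {a<..<b}. ?f s)" using S(1) by (rule sum.inter_restrict[symmetric])
  finally have "W_interior M X S a b \<omega> = exp (\<Sum>s\<in>S \<inter> {a<..<b}. - (1 / 2) * ?f s)"
    unfolding W_interior_def cond_mean_eq resid_eq Zd_def[symmetric] by (simp only: sum_distrib_left)
  also have "\<dots> = (\<Prod>s\<in>S \<inter> {a<..<b}. exp (- (1 / 2) * ?f s))" using S(1) by (simp add: exp_sum)
  finally show ?thesis by (simp add: field_simps)
qed

lemma pts_nth_mem: "j < card S \<Longrightarrow> pts S ! j \<in> S"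
  using pts_props(2)[OF S(1)] by (auto simp: bij_betw_def)

lemma card_S_pos: "card S > 0" using S by (simp add: card_gt_0_iff)

lemma pts_index: assumes "s \<in> S" shows "\<exists>j<card S. pts S ! j = s"
proof -
  have "s \<in> (!) (pts S) ` {..<card S}" using pts_props(2)[OF S(1)] assms unfolding bij_betw_def by blast
  then show ?thesis by auto
qed

lemma pts_mono: "i \<le> j \<Longrightarrow> j < card S \<Longrightarrow> pts S ! i \<le> pts S ! j"
  by (rule sorted_nth_mono) (auto simp: pts_props(1)[OF S(1)])

text \<open>Since \<open>S\<close> lies in \<open>{a..b}\<close>, the point \<open>a\<close> can
  only be the first of the enumeration. In this way the indices in the definition of the boundary
  factor turn into membership in \<open>S\<close>.\<close>

lemma pts_first: "pts S ! 0 = a \<longleftrightarrow> a \<in> S"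
proof
  assume "a \<in> S"
  then obtain j where j: "j < card S" "pts S ! j = a" using pts_index by blast
  have "pts S ! 0 \<le> a" using pts_mono[of 0 j] j by simp
  moreover have "pts S ! 0 \<ge> a" using pts_nth_mem[OF card_S_pos] S(3) by auto
  ultimately show "pts S ! 0 = a" by simp
qed (use pts_nth_mem[OF card_S_pos] in auto)

lemma pts_last: "pts S ! (card S - 1) = b \<longleftrightarrow> b \<in> S"
proof -
  have c: "card S - 1 < card S" using card_S_pos by simp
  show ?thesis
  proof
    assume "b \<in> S"
    then obtain j where j: "j < card S" "pts S ! j = b" using pts_index by blast
    have "b \<le> pts S ! (card S - 1)" using pts_mono[of j "card S - 1"] j c by simp
    moreover have "pts S ! (card S - 1) \<le> b" using pts_nth_mem[OF c] S(3) by auto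
    ultimately show "pts S ! (card S - 1) = b" by simp
  qed (use pts_nth_mem[OF c] in auto)
qed

lemma W_left_eq: "W_left M X S a \<omega> = (if a \<in> S then L.wt (\<theta> a) a (Zd a \<omega>) else 1)"
proof (cases "a \<in> S")
  case True
  then have "pts S ! 0 = a" by (simp add: pts_first)
  moreover have "theta M X S 0 = \<theta> (pts S ! 0)" by (rule theta_eq[OF card_S_pos])
  ultimately show ?thesis using True
    unfolding W_left_def cond_mean_eq resid_eq Zd_def[symmetric] by (simp add: L.wt_def)
next
  case False
  then have "pts S ! 0 \<noteq> a" by (simp add: pts_first)
  then show ?thesis using False by (simp add: W_left_def)
qed

lemma W_right_eq: "W_right M X S b \<omega> = (if b \<in> S then L.wt (\<theta> b) b (Zd b \<omega>) else 1)"
proof (cases "b \<in> S")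
  case True
  then have "pts S ! (card S - 1) = b" by (simp only: pts_last)
  moreover have "theta M X S (card S - 1) = \<theta> (pts S ! (card S - 1))" by (rule theta_eq) (simp add: card_S_pos)
  ultimately show ?thesis using True ab
    unfolding W_right_def cond_mean_eq resid_eq Zd_def[symmetric] Let_def by (simp add: L.wt_def)
next
  case False
  then have "pts S ! (card S - 1) \<noteq> b" by (simp only: pts_last not_False_eq_True)
  then show ?thesis using False by (simp add: W_right_def Let_def)
qed

lemma W_eq_weight: "W M X S a b = weight"
proof
  fix \<omega>
  let ?g = "\<lambda>s. L.wt (\<theta> s) s (Zd s \<omega>)"
  have "W_interior M X S a b \<omega> = (\<Prod>s\<in>S \<inter> {a<..<b}. ?g s)"
    unfolding W_interior_eq by (intro prod.cong) (auto simp: L.wt_def)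
  moreover have "W_left M X S a \<omega> = (\<Prod>s\<in>S \<inter> {a}. ?g s)" by (simp add: W_left_eq)
  moreover have "W_right M X S b \<omega> = (\<Prod>s\<in>S \<inter> {b}. ?g s)" by (simp add: W_right_eq)
  moreover have "(\<Prod>s\<in>S. ?g s) = (\<Prod>s\<in>S \<inter> {a<..<b}. ?g s) * (\<Prod>s\<in>S \<inter> {a}. ?g s) * (\<Prod>s\<in>S \<inter> {b}. ?g s)"
  proof -
    have e: "S = (S \<inter> {a<..<b} \<union> S \<inter> {a}) \<union> S \<inter> {b}" using S(3) by auto
    have "(\<Prod>s\<in>S. ?g s) = (\<Prod>s\<in>(S \<inter> {a<..<b} \<union> S \<inter> {a}) \<union> S \<inter> {b}. ?g s)" using e by simp
    also have "\<dots> = (\<Prod>s\<in>S \<inter> {a<..<b} \<union> S \<inter> {a}. ?g s) * (\<Prod>s\<in>S \<inter> {b}. ?g s)"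
      using S(1) ab by (intro prod.union_disjoint) auto
    also have "(\<Prod>s\<in>S \<inter> {a<..<b} \<union> S \<inter> {a}. ?g s) = (\<Prod>s\<in>S \<inter> {a<..<b}. ?g s) * (\<Prod>s\<in>S \<inter> {a}. ?g s)"
      using S(1) ab by (intro prod.union_disjoint) auto
    finally show ?thesis .
  qed
  moreover have "{t \<in> {a..b}. cond_mean M X S t = 1} - S = L.contacts"
    by (simp add: cond_mean_eq L.contacts_def)
  ultimately show "W M X S a b \<omega> = weight \<omega>"
    unfolding W_def resid_eq weight_def by simp
qed

end

section \<open>Asymptotics of excursion integrals\<close>

context conditioned_gaussian
begin

text \<open>The regression curve through the values \<open>w s\<close> on \<open>S\<close>; divided
  by \<open>u\<close> it is the deterministic part of the conditioned path.\<close>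

definition slope :: "(real \<Rightarrow> real) \<Rightarrow> real \<Rightarrow> real" where
  "slope w t = (\<Sum>s\<in>S. \<alpha> t s * w s)"

lemma slope_continuous: "continuous_on A (slope w)"
  unfolding slope_def[abs_def] by (intro continuous_intros coeff_continuous)

lemma slope_S: "s \<in> S \<Longrightarrow> slope w s = w s"
proof -
  assume s: "s \<in> S"
  have "slope w s = (\<Sum>r\<in>S. if s = r then w r else 0)"
    unfolding slope_def using \<delta>[OF s] by (intro sum.cong) auto
  then show ?thesis using s S(1) by simp
qed

text \<open>The almost sure conditions on the residual path under which the fate of the event for
  large \<open>u\<close> is decided; the remaining ties concern \<open>w\<close> alone.\<close>

definition regular :: "'a \<Rightarrow> bool" where
  "regular \<omega> \<longleftrightarrow> \<omega> \<in> space M \<and> (\<forall>s\<in>S. ((\<lambda>t. Z t \<omega>) has_real_derivative Zd s \<omega>) (at s)) \<and>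
     (\<forall>s\<in>S. s \<in> {a, b} \<longrightarrow> deriv mean s = 0 \<longrightarrow> Zd s \<omega> \<noteq> 0) \<and> (\<forall>t\<in>L.contacts. Z t \<omega> \<noteq> 0)"

lemma AE_regular: "AE \<omega> in M. regular \<omega>"
  using AE_Zd AE_jetZ_nonzero AE_space
proof eventually_elim
  case (elim \<omega>)
  have "Zd s \<omega> \<noteq> 0" if "s \<in> S" "s \<in> {a, b}" "deriv mean s = 0" for s
  proof -
    have "(s, 1) \<in> gen" using that by (auto simp: gen_def)
    then have "jetZ (s, 1) \<omega> \<noteq> 0" using elim(2) by blast
    then show ?thesis using elim(1) that(1) by simp
  qed
  moreover have "Z t \<omega> \<noteq> 0" if "t \<in> L.contacts" for t
  proof -
    have "(t, 0) \<in> gen" using that by (auto simp: gen_def)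
    then have "jetZ (t, 0) \<omega> \<noteq> 0" using elim(2) by blast
    then show ?thesis by (simp add: jetZ_0)
  qed
  ultimately show ?case unfolding regular_def using elim by blast
qed

text \<open>The constant of the Cameron--Martin density, where \<open>sum \<theta> S\<close> is the
  variance of the tilting variable, times the Jacobian of rescaling \<open>card S\<close>
  coordinates by \<open>1 / u\<close>.\<close>

definition rate :: "real \<Rightarrow> real" where
  "rate u = exp (- (u\<^sup>2 * sum \<theta> S / 2)) * (1 / u) ^ card S"

lemma rate_pos: "u > 0 \<Longrightarrow> rate u > 0" by (simp add: rate_def)

lemma nn_integral_prod_S:
  fixes h :: "real \<Rightarrow> real \<Rightarrow> ennreal"
  assumes "\<And>s. s \<in> S \<Longrightarrow> h s \<in> borel_measurable borel"
  shows "(\<integral>\<^sup>+w. (\<Prod>s\<in>S. h s (w s)) \<partial>Pi\<^sub>M S (\<lambda>_. lborel)) = (\<Prod>s\<in>S. \<integral>\<^sup>+x. h s x \<partial>lborel)"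
proof -
  interpret P: product_sigma_finite "\<lambda>_::real. lborel :: real measure" ..
  show ?thesis by (rule P.product_nn_integral_prod[OF S(1)]) (simp add: assms)
qed

lemma AE_coordinate: "s \<in> S \<Longrightarrow> AE w in Pi\<^sub>M S (\<lambda>_. lborel). w s \<noteq> (c :: real)"
proof -
  assume s: "s \<in> S"
  have "(\<integral>\<^sup>+w. indicator {w. w s = c} w \<partial>Pi\<^sub>M S (\<lambda>_. lborel)) \<le>
      (\<integral>\<^sup>+w. (\<Prod>r\<in>S. (if r = s then indicator {c} (w r) else 1)) \<partial>Pi\<^sub>M S (\<lambda>_. lborel))"
    using s S(1) by (intro nn_integral_mono) (simp add: indicator_def prod.delta)
  also have "\<dots> = (\<Prod>r\<in>S. \<integral>\<^sup>+x. (if r = s then indicator {c} x else 1) \<partial>lborel)"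
    by (rule nn_integral_prod_S[where h = "\<lambda>r x. if r = s then indicator {c} x else 1"]) simp
  also have "\<dots> = 0" by (intro prod_zero bexI[of _ s]) (use s S(1) in auto)
  finally have z: "(\<integral>\<^sup>+w. indicator {w. w s = c} w \<partial>Pi\<^sub>M S (\<lambda>_. lborel)) = 0" by simp
  have [measurable]: "(\<lambda>w. w s) \<in> borel_measurable (Pi\<^sub>M S (\<lambda>_. lborel))"
    using measurable_component_singleton[OF s, of "\<lambda>_. lborel"] by simp
  have "(\<lambda>w. indicator {w. w s = c} w :: ennreal) \<in> borel_measurable (Pi\<^sub>M S (\<lambda>_. lborel))"
    by (simp add: indicator_def)
  with z have "AE w in Pi\<^sub>M S (\<lambda>_. lborel). (indicator {w. w s = c} w :: ennreal) = 0"
    by (simp add: nn_integral_0_iff_AE)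
  then show ?thesis by eventually_elim (auto simp: indicator_def split: if_splits)
qed

end

text \<open>\<open>\<Psi>\<close> and \<open>\<Upsilon>\<close> represent the functional \<open>f\<close> and the minimum in terms of the
  coordinates, so that the distributional identities for Gaussian families apply.\<close>

locale test_functional = conditioned_gaussian M X a b S \<theta> mean \<alpha> p p0
  for M :: "'a measure" and X :: "real \<Rightarrow> 'a \<Rightarrow> real" and a b S \<theta> mean \<alpha> p p0 +
  fixes f :: "(real \<Rightarrow> real) \<Rightarrow> real" and B :: real and \<Psi> \<Upsilon> :: "(real \<Rightarrow> real) \<Rightarrow> real"
  assumes f: "continuous_map (mtopology_of (C_space a b)) euclideanreal f"
    and f_bounds: "\<And>x. x \<in> mspace (C_space a b) \<Longrightarrow> 0 \<le> f x \<and> f x \<le> B"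
    and \<Psi>m [measurable]: "\<Psi> \<in> borel_measurable (Pi\<^sub>M UNIV (\<lambda>_. borel))"
    and \<Psi>: "\<And>x. continuous_on {a..b} x \<Longrightarrow> \<Psi> x = f (restrict x {a..b})"
    and \<Upsilon>m [measurable]: "\<Upsilon> \<in> borel_measurable (Pi\<^sub>M UNIV (\<lambda>_. borel))"
    and \<Upsilon>: "\<And>x. continuous_on {a..b} x \<Longrightarrow> \<Upsilon> x = (INF t\<in>{a..b}. x t)"
begin

lemma B_nonneg: "B \<ge> 0"
proof -
  have "restrict (\<lambda>_. 0) {a..b} \<in> mspace (C_space a b)" by (rule restrict_in_C_space) simp
  from f_bounds[OF this] show ?thesis by simp
qed

lemma \<Psi>_bounds: "continuous_on {a..b} x \<Longrightarrow> 0 \<le> \<Psi> x" "continuous_on {a..b} x \<Longrightarrow> \<Psi> x \<le> B"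
  using f_bounds[OF restrict_in_C_space] \<Psi> by auto

lemma \<Upsilon>_greater: "continuous_on {a..b} x \<Longrightarrow> \<Upsilon> x > u \<longleftrightarrow> (\<forall>t\<in>{a..b}. x t > u)"
  using INF_greater_iff[of a b x u] ab \<Upsilon> by simp

text \<open>The integrand after the shift by \<open>u * mean\<close>; the constant part of the
  Cameron--Martin factor is left to \<open>rate\<close>.\<close>

definition tilted :: "real \<Rightarrow> (real \<Rightarrow> real) \<Rightarrow> ennreal" where
  "tilted u x = (if \<Upsilon> (\<lambda>t. x t + u * mean t) > u
     then ennreal (\<Psi> x) * ennreal (exp (- u * (\<Sum>s\<in>S. \<theta> s * x s))) else 0)"

lemma shift_measurable: "(\<lambda>x t. x t + c t) \<in> Pi\<^sub>M UNIV (\<lambda>_. borel) \<rightarrow>\<^sub>M Pi\<^sub>M UNIV (\<lambda>_::real. borel :: real measure)"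
  by (rule measurable_PiM_single') auto

lemma tilted_measurable [measurable]: "tilted u \<in> borel_measurable (Pi\<^sub>M UNIV (\<lambda>_. borel))"
proof -
  have [measurable]: "(\<lambda>x. \<Upsilon> (\<lambda>t. x t + u * mean t)) \<in> borel_measurable (Pi\<^sub>M UNIV (\<lambda>_. borel))"
    by (rule measurable_compose[OF shift_measurable \<Upsilon>m])
  show ?thesis unfolding tilted_def[abs_def] by measurable
qed

text \<open>The integrand of the disintegration at scale \<open>1 / u\<close>, as a function of
  \<open>w\<close> and \<open>\<omega>\<close> jointly, so that the order of integration can be
  exchanged.\<close>

definition kernel :: "real \<Rightarrow> (real \<Rightarrow> real) \<Rightarrow> 'a \<Rightarrow> ennreal" where
  "kernel u w \<omega> = ennreal (p (\<lambda>s\<in>S. (1 / u) * w s)) * tilted u (\<lambda>t. (1 / u) * (\<Sum>s\<in>S. \<alpha> t s * w s) + Z t \<omega>)"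

lemma kernel_measurable: "(\<lambda>q. kernel u (fst q) (snd q)) \<in> borel_measurable (Pi\<^sub>M S (\<lambda>_. lborel) \<Otimes>\<^sub>M M)"
proof -
  have 1: "(\<lambda>w. \<lambda>s\<in>S. (1 / u) * w s) \<in> Pi\<^sub>M S (\<lambda>_. lborel) \<rightarrow>\<^sub>M Pi\<^sub>M S (\<lambda>_. lborel :: real measure)"
    by (rule measurable_restrict) measurable
  have [measurable]: "(\<lambda>w. p (\<lambda>s\<in>S. (1 / u) * w s)) \<in> borel_measurable (Pi\<^sub>M S (\<lambda>_. lborel))"
    by (rule measurable_compose[OF 1 p])
  note [measurable] = disintegration_measurable[OF G S(1) tilted_measurable[of u], where e = "1 / u" and b = \<alpha> and a = \<alpha>]
  show ?thesis unfolding kernel_def by measurable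
qed

lemma kernel_eq:
  assumes \<omega>: "\<omega> \<in> space M" and u: "u > 0"
  shows "kernel u w \<omega> = (if \<forall>t\<in>{a..b}. L.above (\<lambda>t. Z t \<omega>) (slope w) u t
    then ennreal (p (\<lambda>s\<in>S. (1 / u) * w s)) * ennreal (\<Psi> (\<lambda>t. (1 / u) * slope w t + Z t \<omega>)) *
      (\<Prod>s\<in>S. ennreal (exp (- \<theta> s * w s))) else 0)"
proof -
  let ?y = "\<lambda>t. (1 / u) * slope w t + Z t \<omega>"
  have cy: "continuous_on {a..b} ?y"
    by (intro continuous_intros slope_continuous continuous_on_subset[OF Z_continuous[OF \<omega>]]) auto
  have "continuous_on {a..b} (\<lambda>t. ?y t + u * mean t)"
    by (intro continuous_intros cy L.cont)
  from \<Upsilon>_greater[OF this, of u]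
  have 1: "\<Upsilon> (\<lambda>t. ?y t + u * mean t) > u \<longleftrightarrow> (\<forall>t\<in>{a..b}. L.above (\<lambda>t. Z t \<omega>) (slope w) u t)"
    by (simp add: L.above_def add_ac)
  \<comment> \<open>On \<open>S\<close> the residual vanishes and the path equals
    \<open>w s / u\<close>, so the factor \<open>u\<close> cancels and the tilt does not depend on
    \<open>u\<close>.\<close>
  have "u * (\<Sum>s\<in>S. \<theta> s * ?y s) = (\<Sum>s\<in>S. \<theta> s * w s)"
    using u by (simp add: slope_S Z_zero sum_distrib_left)
  then have "exp (- u * (\<Sum>s\<in>S. \<theta> s * ?y s)) = exp (\<Sum>s\<in>S. - \<theta> s * w s)" by (simp add: sum_negf)
  also have "\<dots> = (\<Prod>s\<in>S. exp (- \<theta> s * w s))" using S(1) by (simp add: exp_sum)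
  finally have 2: "ennreal (exp (- u * (\<Sum>s\<in>S. \<theta> s * ?y s))) = (\<Prod>s\<in>S. ennreal (exp (- \<theta> s * w s)))"
    by (simp add: prod_ennreal)
  show ?thesis unfolding kernel_def tilted_def slope_def[symmetric] 1 2 by (simp add: mult.assoc)
qed

definition tail :: "(real \<Rightarrow> real) \<Rightarrow> ennreal" where
  "tail w = (\<Prod>s\<in>S. ennreal (exp (- \<theta> s * w s)) * indicator {0<..} (w s))"

text \<open>Staying above the level at the points of \<open>S\<close>, where the mean is 1 and
  \<open>Z\<close> is 0, already forces every \<open>w s\<close> to be positive. There the tilt is
  integrable, which gives one bound for all \<open>u\<close> and \<open>\<omega>\<close>.\<close>

lemma kernel_le:
  assumes \<omega>: "\<omega> \<in> space M" and u: "u > 0"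
  shows "kernel u w \<omega> \<le> ennreal (p0 * B) * tail w"
proof (cases "\<forall>t\<in>{a..b}. L.above (\<lambda>t. Z t \<omega>) (slope w) u t")
  case True
  have w: "w s > 0" if s: "s \<in> S" for s
  proof -
    have "L.above (\<lambda>t. Z t \<omega>) (slope w) u s" using True S(3) s by blast
    then have "w s / u > 0" using s mean_S[OF s] by (simp add: L.above_def slope_S Z_zero)
    then show ?thesis using u by (simp add: zero_less_divide_iff)
  qed
  have t: "tail w = (\<Prod>s\<in>S. ennreal (exp (- \<theta> s * w s)))"
    unfolding tail_def using w by (intro prod.cong) auto
  have c: "continuous_on {a..b} (\<lambda>t. (1 / u) * slope w t + Z t \<omega>)"
    by (intro continuous_intros slope_continuous continuous_on_subset[OF Z_continuous[OF \<omega>]]) auto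
  have "ennreal (p (\<lambda>s\<in>S. (1 / u) * w s)) * ennreal (\<Psi> (\<lambda>t. (1 / u) * slope w t + Z t \<omega>)) \<le> ennreal p0 * ennreal B"
    using p_bounds(2) \<Psi>_bounds(2)[OF c] by (intro mult_mono ennreal_leI) auto
  also have "\<dots> = ennreal (p0 * B)" using p0 B_nonneg by (simp add: ennreal_mult)
  finally show ?thesis unfolding kernel_eq[OF \<omega> u] t if_P[OF True] by (rule mult_right_mono) simp
next
  case False
  then have "kernel u w \<omega> = 0" unfolding kernel_eq[OF \<omega> u] by (simp only: if_False)
  then show ?thesis by simp
qed

lemma tail_measurable [measurable]: "tail \<in> borel_measurable (Pi\<^sub>M S (\<lambda>_. lborel))"
  unfolding tail_def[abs_def] by measurable

lemma integral_tail: "(\<integral>\<^sup>+w. tail w \<partial>Pi\<^sub>M S (\<lambda>_. lborel)) = ennreal (1 / prod \<theta> S)"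
proof -
  have "(\<integral>\<^sup>+w. tail w \<partial>Pi\<^sub>M S (\<lambda>_. lborel)) = (\<Prod>s\<in>S. \<integral>\<^sup>+x. ennreal (exp (- \<theta> s * x)) * indicator {0<..} x \<partial>lborel)"
    unfolding tail_def by (rule nn_integral_prod_S[where h = "\<lambda>s x. ennreal (exp (- \<theta> s * x)) * indicator {0<..} x"]) simp
  also have "\<dots> = (\<Prod>s\<in>S. ennreal (1 / \<theta> s))"
    by (intro prod.cong refl) (subst nn_integral_exp_tail, use \<theta> in auto)
  also have "\<dots> = ennreal (\<Prod>s\<in>S. 1 / \<theta> s)"
    by (rule prod_ennreal) (use \<theta> in \<open>auto intro: less_imp_le\<close>)
  finally show ?thesis by (simp add: prod_dividef)
qed

definition inner_limit :: "'a \<Rightarrow> real" where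
  "inner_limit \<omega> = p0 * f (\<lambda>t\<in>{a..b}. Z t \<omega>) * weight \<omega> / prod \<theta> S"

text \<open>For fixed \<open>\<omega>\<close> and \<open>w\<close> the indicator is eventually
  constant by \<open>eventually_above_iff\<close>, the path converges uniformly to \<open>Z\<close>,
  and the density of the values on \<open>S\<close> converges to its value \<open>p0\<close> at the
  origin.\<close>

lemma kernel_limit:
  assumes \<omega>: "regular \<omega>" and U: "filterlim U at_top sequentially" "\<And>n. U n > 0"
    and w: "\<And>s. s \<in> S \<Longrightarrow> w s > 0" "\<And>s. s \<in> S \<Longrightarrow> w s \<noteq> (Zd s \<omega>)\<^sup>2 / (2 * (deriv ^^ 2) mean s)"
  shows "(\<lambda>n. kernel (U n) w \<omega>) \<longlonglongrightarrow>
    (if (\<forall>s\<in>S. L.pass s (Zd s \<omega>) (w s)) \<and> (\<forall>t\<in>L.contacts. Z t \<omega> > 0)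
     then ennreal p0 * ennreal (f (\<lambda>t\<in>{a..b}. Z t \<omega>)) * (\<Prod>s\<in>S. ennreal (exp (- \<theta> s * w s))) else 0)"
    (is "_ \<longlonglongrightarrow> (if ?P then ?l else 0)")
proof -
  have sp: "\<omega> \<in> space M" using \<omega> by (simp add: regular_def)
  have cZ: "continuous_on {a..b} (\<lambda>t. Z t \<omega>)" by (rule continuous_on_subset[OF Z_continuous[OF sp]]) simp
  have U0: "filterlim (\<lambda>n. 1 / U n) (at_right 0) sequentially"
    using filterlim_compose[OF filterlim_inverse_at_right_top U(1)] by (simp add: inverse_eq_divide)
  have ev: "\<forall>\<^sub>F u in at_top. (\<forall>t\<in>{a..b}. L.above (\<lambda>t. Z t \<omega>) (slope w) u t) \<longleftrightarrow> ?P"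
  proof -
    have "\<forall>\<^sub>F u in at_top. (\<forall>t\<in>{a..b}. L.above (\<lambda>t. Z t \<omega>) (slope w) u t) \<longleftrightarrow>
        (\<forall>s\<in>S. L.pass s (Zd s \<omega>) (slope w s)) \<and> (\<forall>t\<in>L.contacts. Z t \<omega> > 0)"
      by (rule L.eventually_above_iff[OF cZ slope_continuous])
        (use \<omega> w in \<open>auto simp: regular_def slope_S Z_zero\<close>)
    then show ?thesis by (simp add: slope_S)
  qed
  have ev': "\<forall>\<^sub>F n in sequentially. (\<forall>t\<in>{a..b}. L.above (\<lambda>t. Z t \<omega>) (slope w) (U n) t) \<longleftrightarrow> ?P"
    using ev U(1) by (rule eventually_compose_filterlim)
  have path: "continuous_on {a..b} (\<lambda>t. e * slope w t + Z t \<omega>)" for e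
    by (intro continuous_intros slope_continuous cZ)
  obtain K where K: "\<And>t. t \<in> {a..b} \<Longrightarrow> \<bar>slope w t\<bar> \<le> K"
    using bounded_on_Icc[OF slope_continuous] by blast
  have unif: "uniform_limit {a..b} (\<lambda>n t. (1 / U n) * slope w t + Z t \<omega>) (\<lambda>t. Z t \<omega>) sequentially"
  proof (rule uniform_limitI)
    fix \<epsilon> :: real assume \<epsilon>: "\<epsilon> > 0"
    have "(\<lambda>n. (1 / U n) * (K + 1)) \<longlonglongrightarrow> 0 * (K + 1)"
      using U0 by (intro tendsto_intros) (simp add: filterlim_at)
    then have "\<forall>\<^sub>F n in sequentially. (1 / U n) * (K + 1) < \<epsilon>"
      using \<epsilon> by (auto dest: order_tendstoD(2))
    then show "\<forall>\<^sub>F n in sequentially. \<forall>t\<in>{a..b}. dist ((1 / U n) * slope w t + Z t \<omega>) (Z t \<omega>) < \<epsilon>"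
    proof eventually_elim
      case (elim n)
      show ?case
      proof
        fix t assume "t \<in> {a..b}"
        then have "\<bar>slope w t\<bar> \<le> K + 1" using K[of t] by simp
        then have "(1 / U n) * \<bar>slope w t\<bar> \<le> (1 / U n) * (K + 1)"
          using U(2)[of n] by (intro mult_left_mono) auto
        then show "dist ((1 / U n) * slope w t + Z t \<omega>) (Z t \<omega>) < \<epsilon>"
          using elim U(2)[of n] by (simp add: dist_real_def abs_mult)
      qed
    qed
  qed
  have "(\<lambda>n. f (restrict (\<lambda>t. (1 / U n) * slope w t + Z t \<omega>) {a..b})) \<longlonglongrightarrow> f (restrict (\<lambda>t. Z t \<omega>) {a..b})"
    by (rule C_space_continuous_tendsto[OF less_imp_le[OF ab] f always_eventually[OF allI[OF path]] cZ unif])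
  then have l1: "(\<lambda>n. \<Psi> (\<lambda>t. (1 / U n) * slope w t + Z t \<omega>)) \<longlonglongrightarrow> f (\<lambda>t\<in>{a..b}. Z t \<omega>)"
    by (simp only: \<Psi>[OF path])
  have l2: "(\<lambda>n. p (\<lambda>s\<in>S. (1 / U n) * w s)) \<longlonglongrightarrow> p0"
    by (rule filterlim_compose[OF p_lim U0])
  have "(\<lambda>n. ennreal (p (\<lambda>s\<in>S. (1 / U n) * w s)) * ennreal (\<Psi> (\<lambda>t. (1 / U n) * slope w t + Z t \<omega>)) *
      (\<Prod>s\<in>S. ennreal (exp (- \<theta> s * w s)))) \<longlonglongrightarrow> ?l"
  proof -
    have c: "(\<Prod>s\<in>S. ennreal (exp (- \<theta> s * w s))) = ennreal (\<Prod>s\<in>S. exp (- \<theta> s * w s))"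
      by (simp add: prod_ennreal)
    have fz: "f (\<lambda>t\<in>{a..b}. Z t \<omega>) \<ge> 0" using f_bounds[OF restrict_in_C_space[OF cZ]] by simp
    have "(\<lambda>n. ennreal (p (\<lambda>s\<in>S. (1 / U n) * w s) * \<Psi> (\<lambda>t. (1 / U n) * slope w t + Z t \<omega>) * (\<Prod>s\<in>S. exp (- \<theta> s * w s))))
       \<longlonglongrightarrow> ennreal (p0 * f (\<lambda>t\<in>{a..b}. Z t \<omega>) * (\<Prod>s\<in>S. exp (- \<theta> s * w s)))"
      by (intro tendsto_ennrealI tendsto_mult l1 l2 tendsto_const)
    moreover have c0: "(\<Prod>s\<in>S. exp (- \<theta> s * w s)) \<ge> 0" by (intro prod_nonneg) simp
    moreover have em: "ennreal (x * y * z) = ennreal x * ennreal y * ennreal z" if "0 \<le> x" "0 \<le> y" "0 \<le> z" for x y z :: real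
      using that by (simp add: ennreal_mult)
    ultimately show ?thesis unfolding c
      by (simp only: em[OF p_bounds(1) \<Psi>_bounds(1)[OF path] c0] em[OF less_imp_le[OF p0] fz c0])
  qed
  note lim = this
  show ?thesis
  proof (cases ?P)
    case True
    have "\<forall>\<^sub>F n in sequentially. ennreal (p (\<lambda>s\<in>S. (1 / U n) * w s)) * ennreal (\<Psi> (\<lambda>t. (1 / U n) * slope w t + Z t \<omega>)) *
      (\<Prod>s\<in>S. ennreal (exp (- \<theta> s * w s))) = kernel (U n) w \<omega>"
      using ev'
    proof eventually_elim
      case (elim n)
      show ?case unfolding kernel_eq[OF sp U(2)] if_P[OF iffD2[OF elim True]] ..
    qed
    from Lim_transform_eventually[OF lim this] show ?thesis unfolding if_P[OF True] .
  next
    case False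
    have "\<forall>\<^sub>F n in sequentially. 0 = kernel (U n) w \<omega>"
      using ev'
    proof eventually_elim
      case (elim n)
      have "\<not> (\<forall>t\<in>{a..b}. L.above (\<lambda>t. Z t \<omega>) (slope w) (U n) t)" using elim False by (simp only: not_False_eq_True)
      then show ?case unfolding kernel_eq[OF sp U(2)] by (simp only: if_False)
    qed
    from Lim_transform_eventually[OF tendsto_const this] show ?thesis unfolding if_not_P[OF False] .
  qed
qed

end

section \<open>Passage to the limit under the integrals\<close>

context test_functional
begin

lemma p0B: "p0 * B \<ge> 0" using p0 B_nonneg by simp

lemma bound_finite: "(\<integral>\<^sup>+w. ennreal (p0 * B) * tail w \<partial>Pi\<^sub>M S (\<lambda>_. lborel)) = ennreal (p0 * B / prod \<theta> S)"
proof -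
  have "prod \<theta> S > 0" using \<theta> by (intro prod_pos) auto
  then show ?thesis using p0B
    by (simp add: nn_integral_cmult integral_tail ennreal_mult[symmetric])
qed

lemma slice_measurable:
  assumes "\<omega> \<in> space M" shows "(\<lambda>w. kernel u w \<omega>) \<in> borel_measurable (Pi\<^sub>M S (\<lambda>_. lborel))"
  using measurable_compose[OF measurable_Pair2'[OF assms] kernel_measurable[of u]] by simp

text \<open>Dominated convergence in \<open>w\<close>. The ties in \<open>w\<close> lie on finitely
  many coordinate hyperplanes, and where some \<open>w s\<close> is not positive both the kernel and
  the limit vanish. The limit integrand is a product over \<open>S\<close>, so it splits into the
  integrals of \<open>integral_pass\<close>, which assemble the weight.\<close>

lemma inner_integral_limit:
  assumes \<omega>: "regular \<omega>" and U: "filterlim U at_top sequentially" "\<And>n. U n > 0"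
  shows "(\<lambda>n. \<integral>\<^sup>+w. kernel (U n) w \<omega> \<partial>Pi\<^sub>M S (\<lambda>_. lborel)) \<longlonglongrightarrow> ennreal (inner_limit \<omega>)"
proof -
  let ?N = "Pi\<^sub>M S (\<lambda>_. lborel) :: (real \<Rightarrow> real) measure"
  have sp: "\<omega> \<in> space M" using \<omega> by (simp add: regular_def)
  have cZ: "continuous_on {a..b} (\<lambda>t. Z t \<omega>)" by (rule continuous_on_subset[OF Z_continuous[OF sp]]) simp
  have fz: "f (\<lambda>t\<in>{a..b}. Z t \<omega>) \<ge> 0" using f_bounds[OF restrict_in_C_space[OF cZ]] by simp
  define \<kappa> where "\<kappa> = p0 * f (\<lambda>t\<in>{a..b}. Z t \<omega>) * (\<Prod>t\<in>L.contacts. of_bool (Z t \<omega> > 0))"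
  have cp: "(\<Prod>t\<in>L.contacts. of_bool (Z t \<omega> > 0)) = (of_bool (\<forall>t\<in>L.contacts. Z t \<omega> > 0) :: real)"
    using finite_contacts by (induction rule: finite_induct) auto
  have \<kappa>0: "\<kappa> \<ge> 0" unfolding \<kappa>_def cp using fz p0 by simp
  define h where "h s x = ennreal (exp (- \<theta> s * x)) * indicator {x. x > 0 \<and> L.pass s (Zd s \<omega>) x} x" for s x
  have [measurable]: "h s \<in> borel_measurable borel" for s
    unfolding h_def[abs_def] by measurable
  have hprod: "(\<lambda>w. \<Prod>s\<in>S. h s (w s)) \<in> borel_measurable ?N" by measurable
  have "(\<lambda>n. \<integral>\<^sup>+w. kernel (U n) w \<omega> \<partial>?N) \<longlonglongrightarrow> (\<integral>\<^sup>+w. ennreal \<kappa> * (\<Prod>s\<in>S. h s (w s)) \<partial>?N)"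
  proof (rule nn_integral_dominated_convergence[where w = "\<lambda>w. ennreal (p0 * B) * tail w"])
    show "(\<lambda>w. ennreal (p0 * B) * tail w) \<in> borel_measurable ?N" by measurable
    show "(\<lambda>w. kernel (U n) w \<omega>) \<in> borel_measurable ?N" for n by (rule slice_measurable[OF sp])
    show "(\<lambda>w. ennreal \<kappa> * (\<Prod>s\<in>S. h s (w s))) \<in> borel_measurable ?N" using hprod by simp
    show "AE w in ?N. kernel (U n) w \<omega> \<le> ennreal (p0 * B) * tail w" for n
      by (intro AE_I2 kernel_le[OF sp U(2)])
    show "(\<integral>\<^sup>+w. ennreal (p0 * B) * tail w \<partial>?N) < \<infinity>" unfolding bound_finite by simp
    have "AE w in ?N. \<forall>s\<in>S. w s \<noteq> (Zd s \<omega>)\<^sup>2 / (2 * (deriv ^^ 2) mean s)"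
      by (intro AE_finite_allI S(1) AE_coordinate)
    then show "AE w in ?N. (\<lambda>n. kernel (U n) w \<omega>) \<longlonglongrightarrow> ennreal \<kappa> * (\<Prod>s\<in>S. h s (w s))"
    proof eventually_elim
      case (elim w)
      show ?case
      proof (cases "\<forall>s\<in>S. w s > 0")
        case True
        have "(\<lambda>n. kernel (U n) w \<omega>) \<longlonglongrightarrow>
          (if (\<forall>s\<in>S. L.pass s (Zd s \<omega>) (w s)) \<and> (\<forall>t\<in>L.contacts. Z t \<omega> > 0)
           then ennreal p0 * ennreal (f (\<lambda>t\<in>{a..b}. Z t \<omega>)) * (\<Prod>s\<in>S. ennreal (exp (- \<theta> s * w s))) else 0)"
          by (rule kernel_limit[OF \<omega> U]) (use True elim in auto)
        also have "(if (\<forall>s\<in>S. L.pass s (Zd s \<omega>) (w s)) \<and> (\<forall>t\<in>L.contacts. Z t \<omega> > 0)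
           then ennreal p0 * ennreal (f (\<lambda>t\<in>{a..b}. Z t \<omega>)) * (\<Prod>s\<in>S. ennreal (exp (- \<theta> s * w s))) else 0)
            = ennreal \<kappa> * (\<Prod>s\<in>S. h s (w s))"
        proof (cases "\<forall>s\<in>S. L.pass s (Zd s \<omega>) (w s)")
          case p: True
          have "(\<Prod>s\<in>S. h s (w s)) = (\<Prod>s\<in>S. ennreal (exp (- \<theta> s * w s)))"
            using p True by (intro prod.cong) (auto simp: h_def)
          moreover have "ennreal \<kappa> = (if \<forall>t\<in>L.contacts. Z t \<omega> > 0 then ennreal p0 * ennreal (f (\<lambda>t\<in>{a..b}. Z t \<omega>)) else 0)"
            unfolding \<kappa>_def cp using p0 fz by (auto simp: ennreal_mult)
          ultimately show ?thesis using p by auto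
        next
          case False
          then obtain s where "s \<in> S" "h s (w s) = 0" by (auto simp: h_def)
          then have z: "(\<Prod>s\<in>S. h s (w s)) = 0" using S(1) by (intro prod_zero bexI[of _ s]) auto
          show ?thesis unfolding z using False by auto
        qed
        finally show ?thesis .
      next
        case False
        then obtain s where s: "s \<in> S" "\<not> w s > 0" by auto
        then have "h s (w s) = 0" "ennreal (exp (- \<theta> s * w s)) * indicator {0<..} (w s) = 0" by (auto simp: h_def)
        then have 1: "(\<Prod>s\<in>S. h s (w s)) = 0" and 2: "tail w = 0"
          unfolding tail_def using s(1) S(1) by (auto intro!: prod_zero bexI[of _ s])
        have "kernel (U n) w \<omega> = 0" for n using kernel_le[OF sp U(2), of n w] unfolding 2 by simp
        then show ?thesis unfolding 1 by simp
      qed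
    qed
  qed
  also have "(\<integral>\<^sup>+w. ennreal \<kappa> * (\<Prod>s\<in>S. h s (w s)) \<partial>?N) = ennreal \<kappa> * (\<Prod>s\<in>S. \<integral>\<^sup>+x. h s x \<partial>lborel)"
    using hprod by (simp add: nn_integral_cmult nn_integral_prod_S)
  also have "(\<Prod>s\<in>S. \<integral>\<^sup>+x. h s x \<partial>lborel) = (\<Prod>s\<in>S. ennreal (L.wt (\<theta> s) s (Zd s \<omega>) / \<theta> s))"
    unfolding h_def using \<omega> by (intro prod.cong refl L.integral_pass \<theta>) (auto simp: regular_def)
  also have "\<dots> = ennreal (\<Prod>s\<in>S. L.wt (\<theta> s) s (Zd s \<omega>) / \<theta> s)"
    by (rule prod_ennreal) (use L.wt_bounds(1)[OF \<theta>] \<theta> in \<open>auto intro!: divide_nonneg_pos\<close>)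
  also have "ennreal \<kappa> * \<dots> = ennreal (\<kappa> * (\<Prod>s\<in>S. L.wt (\<theta> s) s (Zd s \<omega>) / \<theta> s))"
    by (subst ennreal_mult'[OF \<kappa>0]) simp
  also have "\<kappa> * (\<Prod>s\<in>S. L.wt (\<theta> s) s (Zd s \<omega>) / \<theta> s) = inner_limit \<omega>"
    by (simp add: \<kappa>_def inner_limit_def weight_def prod_dividef)
  finally show ?thesis .
qed

lemma functional_measurable [measurable]: "(\<lambda>\<omega>. \<Psi> (\<lambda>t. Z t \<omega>)) \<in> borel_measurable M"
proof (rule measurable_compose[OF _ \<Psi>m])
  show "(\<lambda>\<omega> t. Z t \<omega>) \<in> M \<rightarrow>\<^sub>M Pi\<^sub>M UNIV (\<lambda>_. borel)" by (rule measurable_PiM_single') auto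
qed

lemma f_Z: "\<omega> \<in> space M \<Longrightarrow> f (\<lambda>t\<in>{a..b}. Z t \<omega>) = \<Psi> (\<lambda>t. Z t \<omega>)"
  by (rule \<Psi>[symmetric, OF continuous_on_subset[OF Z_continuous]]) auto

lemma inner_limit_measurable [measurable]: "inner_limit \<in> borel_measurable M"
proof -
  have "(\<lambda>\<omega>. p0 * \<Psi> (\<lambda>t. Z t \<omega>) * weight \<omega> / prod \<theta> S) \<in> borel_measurable M" by measurable
  then show ?thesis
    by (rule measurable_cong[THEN iffD1, rotated]) (simp add: inner_limit_def f_Z)
qed

text \<open>The order of integration is exchanged because the irregular \<open>\<omega>\<close> form
  a null set that does not depend on \<open>w\<close>. The inner integrals are then bounded by one
  constant, integrable for a probability measure.\<close>

lemma kernel_integral_limit: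
  assumes U: "filterlim U at_top sequentially" "\<And>n. U n > 0"
  shows "(\<lambda>n. \<integral>\<^sup>+w. \<integral>\<^sup>+\<omega>. kernel (U n) w \<omega> \<partial>M \<partial>Pi\<^sub>M S (\<lambda>_. lborel)) \<longlonglongrightarrow> (\<integral>\<^sup>+\<omega>. ennreal (inner_limit \<omega>) \<partial>M)"
proof -
  let ?N = "Pi\<^sub>M S (\<lambda>_. lborel) :: (real \<Rightarrow> real) measure"
  interpret P: product_sigma_finite "\<lambda>_::real. lborel :: real measure" ..
  interpret N: sigma_finite_measure ?N by (rule P.sigma_finite[OF S(1)])
  interpret NM: pair_sigma_finite ?N M ..
  have sw: "(\<integral>\<^sup>+w. \<integral>\<^sup>+\<omega>. kernel u w \<omega> \<partial>M \<partial>?N) = (\<integral>\<^sup>+\<omega>. \<integral>\<^sup>+w. kernel u w \<omega> \<partial>?N \<partial>M)" for u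
    by (rule NM.Fubini'[symmetric]) (use kernel_measurable[of u] in \<open>simp add: split_beta'\<close>)
  have meas: "(\<lambda>\<omega>. \<integral>\<^sup>+w. kernel u w \<omega> \<partial>?N) \<in> borel_measurable M" for u
  proof (rule N.borel_measurable_nn_integral)
    have "(\<lambda>q. kernel u (fst (snd q, fst q)) (snd (snd q, fst q))) \<in> borel_measurable (M \<Otimes>\<^sub>M ?N)"
      by (rule measurable_compose[OF _ kernel_measurable]) simp
    then show "(\<lambda>(\<omega>, w). kernel u w \<omega>) \<in> borel_measurable (M \<Otimes>\<^sub>M ?N)" by (simp add: split_beta')
  qed
  show ?thesis unfolding sw
  proof (rule nn_integral_dominated_convergence[where w = "\<lambda>_. ennreal (p0 * B / prod \<theta> S)"])
    show "AE \<omega> in M. (\<integral>\<^sup>+w. kernel (U n) w \<omega> \<partial>?N) \<le> ennreal (p0 * B / prod \<theta> S)" for n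
      unfolding bound_finite[symmetric] by (intro AE_I2 nn_integral_mono kernel_le U)
    show "(\<integral>\<^sup>+\<omega>. ennreal (p0 * B / prod \<theta> S) \<partial>M) < \<infinity>" by (simp add: emeasure_space_1)
    show "AE \<omega> in M. (\<lambda>n. \<integral>\<^sup>+w. kernel (U n) w \<omega> \<partial>?N) \<longlonglongrightarrow> ennreal (inner_limit \<omega>)"
      using AE_regular by eventually_elim (rule inner_integral_limit[OF _ U])
  qed (use meas in simp_all)
qed

text \<open>The Cameron--Martin shift brings the path down to its fluctuations and contributes the
  exponential of \<open>rate\<close>; the disintegration with \<open>e = 1 / u\<close> contributes
  the power of \<open>1 / u\<close>.\<close>

lemma excursion_integral:
  assumes u: "u > 0"
  shows "(\<integral>\<^sup>+\<omega>. (if (INF t\<in>{a..b}. X t \<omega>) > u then ennreal (f (\<lambda>t\<in>{a..b}. X t \<omega> - u * mean t)) else 0) \<partial>M) =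
    ennreal (rate u) * (\<integral>\<^sup>+w. \<integral>\<^sup>+\<omega>. kernel u w \<omega> \<partial>M \<partial>Pi\<^sub>M S (\<lambda>_. lborel))"
proof -
  define \<Theta> where "\<Theta> = (\<lambda>\<omega>. \<Sum>s\<in>S. \<theta> s * X s \<omega>)"
  have E\<Theta>: "expectation (\<lambda>\<omega>. (\<Theta> \<omega>)\<^sup>2) = sum \<theta> S" unfolding \<Theta>_def by (rule variance_tilt)
  have EX: "expectation (\<lambda>\<omega>. X t \<omega> * \<Theta> \<omega>) = mean t" for t unfolding \<Theta>_def by (rule covariance_tilt)
  define \<Phi> where "\<Phi> x = (if \<Upsilon> x > u then ennreal (\<Psi> (\<lambda>t. x t + (- u * mean t))) else 0)" for x
  have [measurable]: "(\<lambda>x. \<Psi> (\<lambda>t. x t + (- u * mean t))) \<in> borel_measurable (Pi\<^sub>M UNIV (\<lambda>_. borel))"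
    by (rule measurable_compose[OF shift_measurable \<Psi>m])
  have \<Phi>: "\<Phi> \<in> borel_measurable (Pi\<^sub>M UNIV (\<lambda>_. borel))" unfolding \<Phi>_def[abs_def] by measurable
  have cX: "continuous_on {a..b} (\<lambda>t. X t \<omega>)" if "\<omega> \<in> space M" for \<omega>
    by (rule continuous_on_subset[OF cont[OF that]]) simp
  have "(\<integral>\<^sup>+\<omega>. (if (INF t\<in>{a..b}. X t \<omega>) > u then ennreal (f (\<lambda>t\<in>{a..b}. X t \<omega> - u * mean t)) else 0) \<partial>M) =
      (\<integral>\<^sup>+\<omega>. \<Phi> (\<lambda>t. X t \<omega>) \<partial>M)"
  proof (intro nn_integral_cong)
    fix \<omega> assume \<omega>: "\<omega> \<in> space M"
    have "continuous_on {a..b} (\<lambda>t. X t \<omega> + (- u * mean t))" by (intro continuous_intros cX[OF \<omega>] L.cont)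
    from \<Psi>[OF this] show "(if (INF t\<in>{a..b}. X t \<omega>) > u then ennreal (f (\<lambda>t\<in>{a..b}. X t \<omega> - u * mean t)) else 0) = \<Phi> (\<lambda>t. X t \<omega>)"
      unfolding \<Phi>_def \<Upsilon>[OF cX[OF \<omega>]] by simp
  qed
  also have "\<dots> = (\<integral>\<^sup>+\<omega>. \<Phi> (\<lambda>t. X t \<omega> + u * mean t) * ennreal (exp (- u * \<Theta> \<omega> - u\<^sup>2 * sum \<theta> S / 2)) \<partial>M)"
    using cameron_martin[OF G S(1) \<Theta>_def _ \<Phi>, of u] sum_\<theta>_pos unfolding E\<Theta> EX by blast
  also have "\<dots> = (\<integral>\<^sup>+\<omega>. ennreal (exp (- (u\<^sup>2 * sum \<theta> S / 2))) * tilted u (\<lambda>t. X t \<omega>) \<partial>M)"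
  proof (intro nn_integral_cong)
    fix \<omega>
    have "exp (- u * \<Theta> \<omega> - u\<^sup>2 * sum \<theta> S / 2) = exp (- (u\<^sup>2 * sum \<theta> S / 2)) * exp (- u * \<Theta> \<omega>)"
      by (simp add: exp_add[symmetric])
    then show "\<Phi> (\<lambda>t. X t \<omega> + u * mean t) * ennreal (exp (- u * \<Theta> \<omega> - u\<^sup>2 * sum \<theta> S / 2)) =
      ennreal (exp (- (u\<^sup>2 * sum \<theta> S / 2))) * tilted u (\<lambda>t. X t \<omega>)"
      by (simp add: \<Phi>_def tilted_def \<Theta>_def ennreal_mult mult_ac)
  qed
  also have "\<dots> = ennreal (exp (- (u\<^sup>2 * sum \<theta> S / 2))) * (\<integral>\<^sup>+\<omega>. tilted u (\<lambda>t. X t \<omega>) \<partial>M)"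
  proof (rule nn_integral_cmult)
    have m: "(\<lambda>\<omega> t. X t \<omega>) \<in> M \<rightarrow>\<^sub>M Pi\<^sub>M UNIV (\<lambda>_. borel)" by (rule measurable_PiM_single') auto
    show "(\<lambda>\<omega>. tilted u (\<lambda>t. X t \<omega>)) \<in> borel_measurable M" by (rule measurable_compose[OF m tilted_measurable])
  qed
  also have "(\<integral>\<^sup>+\<omega>. tilted u (\<lambda>t. X t \<omega>) \<partial>M) = ennreal (1 / u) ^ card S *
      (\<integral>\<^sup>+w. ennreal (p (\<lambda>s\<in>S. (1 / u) * w s)) * (\<integral>\<^sup>+\<omega>. tilted u (\<lambda>t. (1 / u) * (\<Sum>s\<in>S. \<alpha> t s * w s) + Z t \<omega>) \<partial>M) \<partial>Pi\<^sub>M S (\<lambda>_. lborel))"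
    by (rule dis[unfolded disintegrates_def, rule_format]) (use u in auto)
  also have "(\<integral>\<^sup>+w. ennreal (p (\<lambda>s\<in>S. (1 / u) * w s)) * (\<integral>\<^sup>+\<omega>. tilted u (\<lambda>t. (1 / u) * (\<Sum>s\<in>S. \<alpha> t s * w s) + Z t \<omega>) \<partial>M) \<partial>Pi\<^sub>M S (\<lambda>_. lborel)) =
     (\<integral>\<^sup>+w. \<integral>\<^sup>+\<omega>. kernel u w \<omega> \<partial>M \<partial>Pi\<^sub>M S (\<lambda>_. lborel))"
  proof (intro nn_integral_cong)
    fix w :: "real \<Rightarrow> real"
    have m: "(\<lambda>\<omega> t. (1 / u) * (\<Sum>s\<in>S. \<alpha> t s * w s) + Z t \<omega>) \<in> M \<rightarrow>\<^sub>M Pi\<^sub>M UNIV (\<lambda>_. borel)"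
      by (rule measurable_PiM_single') auto
    show "ennreal (p (\<lambda>s\<in>S. (1 / u) * w s)) * (\<integral>\<^sup>+\<omega>. tilted u (\<lambda>t. (1 / u) * (\<Sum>s\<in>S. \<alpha> t s * w s) + Z t \<omega>) \<partial>M) =
      (\<integral>\<^sup>+\<omega>. kernel u w \<omega> \<partial>M)"
      unfolding kernel_def by (rule nn_integral_cmult[symmetric]) (rule measurable_compose[OF m tilted_measurable])
  qed
  finally show ?thesis using u by (simp add: rate_def ennreal_mult ennreal_power mult.assoc)
qed

lemma excursion_limit:
  "((\<lambda>u. expectation (\<lambda>\<omega>. of_bool ((INF t\<in>{a..b}. X t \<omega>) > u) * f (\<lambda>t\<in>{a..b}. X t \<omega> - u * mean t)) / rate u)
    \<longlongrightarrow> p0 / prod \<theta> S * expectation (\<lambda>\<omega>. f (\<lambda>t\<in>{a..b}. Z t \<omega>) * weight \<omega>)) at_top"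
proof -
  let ?g = "\<lambda>u \<omega>. of_bool ((INF t\<in>{a..b}. X t \<omega>) > u) * f (\<lambda>t\<in>{a..b}. X t \<omega> - u * mean t)"
  have cX: "continuous_on {a..b} (\<lambda>t. X t \<omega>)" if "\<omega> \<in> space M" for \<omega>
    by (rule continuous_on_subset[OF cont[OF that]]) simp
  have cY: "continuous_on {a..b} (\<lambda>t. X t \<omega> - u * mean t)" if "\<omega> \<in> space M" for \<omega> u
    by (intro continuous_intros cX[OF that] L.cont)
  have gm: "?g u \<in> borel_measurable M" for u
  proof -
    have 1: "(\<lambda>\<omega> t. X t \<omega>) \<in> M \<rightarrow>\<^sub>M Pi\<^sub>M UNIV (\<lambda>_. borel)" by (rule measurable_PiM_single') auto
    have 2: "(\<lambda>\<omega> t. X t \<omega> - u * mean t) \<in> M \<rightarrow>\<^sub>M Pi\<^sub>M UNIV (\<lambda>_. borel)" by (rule measurable_PiM_single') auto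
    note [measurable] = measurable_compose[OF 1 \<Upsilon>m] measurable_compose[OF 2 \<Psi>m]
    have "(\<lambda>\<omega>. of_bool (\<Upsilon> (\<lambda>t. X t \<omega>) > u) * \<Psi> (\<lambda>t. X t \<omega> - u * mean t)) \<in> borel_measurable M" by measurable
    then show ?thesis
      by (rule measurable_cong[THEN iffD1, rotated]) (simp only: \<Psi>[OF cY] \<Upsilon>[OF cX])
  qed
  have gb: "0 \<le> ?g u \<omega> \<and> ?g u \<omega> \<le> B" if "\<omega> \<in> space M" for u \<omega>
    using f_bounds[OF restrict_in_C_space[OF cY[OF that, of u]]] B_nonneg by auto
  have gi: "integrable M (?g u)" for u
    by (rule integrable_const_bound[where B = B]) (use gb gm in auto)
  have li: "integrable M inner_limit"
  proof (rule integrable_const_bound[where B = "p0 * B / prod \<theta> S"])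
    show "AE \<omega> in M. norm (inner_limit \<omega>) \<le> p0 * B / prod \<theta> S"
    proof (rule AE_I2)
      fix \<omega> assume \<omega>: "\<omega> \<in> space M"
      have cZ: "continuous_on {a..b} (\<lambda>t. Z t \<omega>)" by (rule continuous_on_subset[OF Z_continuous[OF \<omega>]]) simp
      have fb: "0 \<le> f (\<lambda>t\<in>{a..b}. Z t \<omega>)" "f (\<lambda>t\<in>{a..b}. Z t \<omega>) \<le> B"
        using f_bounds[OF restrict_in_C_space[OF cZ]] by auto
      have \<theta>p: "prod \<theta> S > 0" using \<theta> by (intro prod_pos) auto
      have "p0 * f (\<lambda>t\<in>{a..b}. Z t \<omega>) * weight \<omega> \<le> p0 * B * 1"
        using fb weight_bounds p0 B_nonneg by (intro mult_mono) auto
      then have "inner_limit \<omega> \<le> p0 * B / prod \<theta> S"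
        unfolding inner_limit_def using \<theta>p by (intro divide_right_mono) auto
      moreover have "0 \<le> inner_limit \<omega>" using fb weight_bounds p0 \<theta>p by (simp add: inner_limit_def)
      ultimately show "norm (inner_limit \<omega>) \<le> p0 * B / prod \<theta> S" by simp
    qed
  qed simp
  have l0: "0 \<le> inner_limit \<omega>" if \<omega>: "\<omega> \<in> space M" for \<omega>
  proof -
    have cZ: "continuous_on {a..b} (\<lambda>t. Z t \<omega>)" by (rule continuous_on_subset[OF Z_continuous[OF \<omega>]]) simp
    have "prod \<theta> S > 0" using \<theta> by (intro prod_pos) auto
    then show ?thesis using f_bounds[OF restrict_in_C_space[OF cZ]] weight_bounds p0 by (simp add: inner_limit_def)
  qed
  have E0: "expectation (?g u) \<ge> 0" for u by (rule integral_nonneg_AE) (use gb in auto)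
  have J: "(\<integral>\<^sup>+w. \<integral>\<^sup>+\<omega>. kernel u w \<omega> \<partial>M \<partial>Pi\<^sub>M S (\<lambda>_. lborel)) = ennreal (expectation (?g u) / rate u)" if u: "u > 0" for u
  proof -
    have "ennreal (expectation (?g u)) = (\<integral>\<^sup>+\<omega>. ennreal (?g u \<omega>) \<partial>M)"
      by (rule nn_integral_eq_integral[symmetric, OF gi]) (use gb in auto)
    also have "\<dots> = (\<integral>\<^sup>+\<omega>. (if (INF t\<in>{a..b}. X t \<omega>) > u then ennreal (f (\<lambda>t\<in>{a..b}. X t \<omega> - u * mean t)) else 0) \<partial>M)"
      by (intro nn_integral_cong) auto
    also have "\<dots> = ennreal (rate u) * (\<integral>\<^sup>+w. \<integral>\<^sup>+\<omega>. kernel u w \<omega> \<partial>M \<partial>Pi\<^sub>M S (\<lambda>_. lborel))"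
      by (rule excursion_integral[OF u])
    finally have e: "ennreal (expectation (?g u)) = ennreal (rate u) * (\<integral>\<^sup>+w. \<integral>\<^sup>+\<omega>. kernel u w \<omega> \<partial>M \<partial>Pi\<^sub>M S (\<lambda>_. lborel))" .
    have "ennreal (rate u) * ennreal (expectation (?g u) / rate u) = ennreal (expectation (?g u))"
      using rate_pos[OF u] E0[of u] by (simp add: ennreal_mult[symmetric])
    with e show ?thesis using rate_pos[OF u] by (simp add: ennreal_mult_cancel_left)
  qed
  \<comment> \<open>An arbitrary sequence tending to infinity may start with nonpositive terms;
    \<open>max 1\<close> makes every term positive, as the kernel limit requires, and changes
    nothing for large \<open>u\<close>.\<close>
  have "((\<lambda>u. expectation (?g (max 1 u)) / rate (max 1 u)) \<longlongrightarrow> expectation inner_limit) at_top"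
  proof (rule tendsto_at_topI_sequentially)
    fix V :: "nat \<Rightarrow> real" assume V: "filterlim V at_top sequentially"
    have U: "filterlim (\<lambda>n. max 1 (V n)) at_top sequentially"
      by (rule filterlim_at_top_mono[OF V]) simp
    have "(\<lambda>n. \<integral>\<^sup>+w. \<integral>\<^sup>+\<omega>. kernel (max 1 (V n)) w \<omega> \<partial>M \<partial>Pi\<^sub>M S (\<lambda>_. lborel)) \<longlonglongrightarrow> (\<integral>\<^sup>+\<omega>. ennreal (inner_limit \<omega>) \<partial>M)"
      by (rule kernel_integral_limit[OF U]) simp
    also have "(\<integral>\<^sup>+\<omega>. ennreal (inner_limit \<omega>) \<partial>M) = ennreal (expectation inner_limit)"
      by (rule nn_integral_eq_integral[OF li]) (use l0 in auto)
    finally have "(\<lambda>n. ennreal (expectation (?g (max 1 (V n))) / rate (max 1 (V n)))) \<longlonglongrightarrow> ennreal (expectation inner_limit)"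
      by (subst (asm) J) auto
    then show "(\<lambda>n. expectation (?g (max 1 (V n))) / rate (max 1 (V n))) \<longlonglongrightarrow> expectation inner_limit"
    proof (rule tendsto_ennrealD)
      have "0 \<le> expectation (?g (max 1 (V n))) / rate (max 1 (V n))" for n
        by (intro divide_nonneg_pos rate_pos E0) simp
      then show "\<forall>\<^sub>F n in sequentially. 0 \<le> expectation (?g (max 1 (V n))) / rate (max 1 (V n))" by simp
    qed (auto intro!: integral_nonneg_AE l0)
  qed
  moreover have "\<forall>\<^sub>F u in at_top. expectation (?g (max 1 u)) / rate (max 1 u) = expectation (?g u) / rate u"
    using eventually_ge_at_top[of 1] by eventually_elim (simp add: max_absorb2)
  ultimately have "((\<lambda>u. expectation (?g u) / rate u) \<longlongrightarrow> expectation inner_limit) at_top"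
    by (rule Lim_transform_eventually)
  also have "expectation inner_limit = p0 / prod \<theta> S * expectation (\<lambda>\<omega>. f (\<lambda>t\<in>{a..b}. Z t \<omega>) * weight \<omega>)"
  proof -
    have "expectation inner_limit = expectation (\<lambda>\<omega>. (p0 / prod \<theta> S) * (f (\<lambda>t\<in>{a..b}. Z t \<omega>) * weight \<omega>))"
      by (intro Bochner_Integration.integral_cong) (auto simp: inner_limit_def)
    then show ?thesis by (simp only: integral_mult_right_zero)
  qed
  finally show ?thesis .
qed

end

section \<open>Weak convergence\<close>

lemma space_metric_borel: "space (metric_borel m) = mspace m"
proof -
  have "{U. openin (mtopology_of m) U} \<subseteq> Pow (mspace m)" using openin_subset by fastforce
  then show ?thesis unfolding metric_borel_def by (rule space_measure_of)
qed

lemma sets_metric_borel: "sets (metric_borel m) = sigma_sets (mspace m) {U. openin (mtopology_of m) U}"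
proof -
  have "{U. openin (mtopology_of m) U} \<subseteq> Pow (mspace m)" using openin_subset by fastforce
  then show ?thesis unfolding metric_borel_def by (rule sets_measure_of)
qed

lemma continuous_map_measurable:
  fixes f :: "'b \<Rightarrow> real"
  assumes "continuous_map (mtopology_of m) euclideanreal f"
  shows "f \<in> borel_measurable (metric_borel m)"
proof (rule borel_measurableI)
  fix U :: "real set" assume "open U"
  then have "openin (mtopology_of m) {x \<in> topspace (mtopology_of m). f x \<in> U}"
    by (intro openin_continuous_map_preimage[OF assms]) simp
  moreover have "{x \<in> topspace (mtopology_of m). f x \<in> U} = f -` U \<inter> space (metric_borel m)"
    by (auto simp: space_metric_borel)
  ultimately show "f -` U \<inter> space (metric_borel m) \<in> sets (metric_borel m)"
    unfolding sets_metric_borel by (metis mem_Collect_eq sigma_sets.Basic)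
qed

context conditioned_gaussian
begin

lemma X_continuous_Icc: "\<omega> \<in> space M \<Longrightarrow> continuous_on {a..b} (\<lambda>t. X t \<omega>)"
  by (rule continuous_on_subset[OF cont]) auto

lemma Z_continuous_Icc: "\<omega> \<in> space M \<Longrightarrow> continuous_on {a..b} (\<lambda>t. Z t \<omega>)"
  by (rule continuous_on_subset[OF Z_continuous]) auto

lemma centred_continuous: "\<omega> \<in> space M \<Longrightarrow> continuous_on {a..b} (\<lambda>t. X t \<omega> - u * mean t)"
  by (intro continuous_intros X_continuous_Icc L.cont)

lemma path_maps:
  "(\<lambda>\<omega>. \<lambda>t\<in>{a..b}. X t \<omega> - u * mean t) \<in> M \<rightarrow>\<^sub>M metric_borel (C_space a b)"
  "(\<lambda>\<omega>. \<lambda>t\<in>{a..b}. Z t \<omega>) \<in> M \<rightarrow>\<^sub>M metric_borel (C_space a b)"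
  "(\<lambda>\<omega>. \<lambda>t\<in>{a..b}. X t \<omega>) \<in> M \<rightarrow>\<^sub>M metric_borel (C_space a b)"
  by (rule path_measurable[OF ab]; (rule centred_continuous Z_continuous_Icc X_continuous_Icc)?; measurable)+

definition excursion :: "real \<Rightarrow> 'a set" where
  "excursion u = {\<omega> \<in> space M. (INF t\<in>{a..b}. X t \<omega>) > u}"

lemma excursion_sets [measurable]: "excursion u \<in> sets M"
proof -
  have "(\<lambda>\<omega>. INF t\<in>{a..b}. (\<lambda>t\<in>{a..b}. X t \<omega>) t) \<in> borel_measurable M"
    by (rule measurable_compose[OF path_maps(3) continuous_map_measurable[OF continuous_map_INF]]) (use ab in simp)
  then have [measurable]: "(\<lambda>\<omega>. INF t\<in>{a..b}. X t \<omega>) \<in> borel_measurable M" by simp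
  show ?thesis unfolding excursion_def by measurable
qed

definition excursion_mean :: "((real \<Rightarrow> real) \<Rightarrow> real) \<Rightarrow> real \<Rightarrow> real" where
  "excursion_mean f u = expectation (\<lambda>\<omega>. indicator (excursion u) \<omega> * f (\<lambda>t\<in>{a..b}. X t \<omega> - u * mean t))"

lemma nonneg_limit:
  assumes f: "continuous_map (mtopology_of (C_space a b)) euclideanreal f"
    and fb: "\<And>x. x \<in> mspace (C_space a b) \<Longrightarrow> 0 \<le> f x \<and> f x \<le> B"
  shows "((\<lambda>u. excursion_mean f u / rate u) \<longlongrightarrow>
    p0 / prod \<theta> S * expectation (\<lambda>\<omega>. f (\<lambda>t\<in>{a..b}. Z t \<omega>) * weight \<omega>)) at_top"
proof -
  obtain \<Psi> where \<Psi>: "\<Psi> \<in> borel_measurable (Pi\<^sub>M UNIV (\<lambda>_::real. borel :: real measure))"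
    "\<And>x. continuous_on {a..b} x \<Longrightarrow> \<Psi> x = f (restrict x {a..b})"
    using continuous_functional_coordinates[OF ab f] by blast
  obtain \<Upsilon> where \<Upsilon>: "\<Upsilon> \<in> borel_measurable (Pi\<^sub>M UNIV (\<lambda>_::real. borel :: real measure))"
    "\<And>x. continuous_on {a..b} x \<Longrightarrow> \<Upsilon> x = (INF t\<in>{a..b}. restrict x {a..b} t)"
    using continuous_functional_coordinates[OF ab continuous_map_INF[OF less_imp_le[OF ab]]] by blast
  interpret T: test_functional M X a b S \<theta> mean \<alpha> p p0 f B \<Psi> \<Upsilon>
    by unfold_locales (use f fb \<Psi> \<Upsilon> in simp_all)
  have "excursion_mean f u = expectation (\<lambda>\<omega>. of_bool ((INF t\<in>{a..b}. X t \<omega>) > u) * f (\<lambda>t\<in>{a..b}. X t \<omega> - u * mean t))" for u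
    unfolding excursion_mean_def
    by (intro Bochner_Integration.integral_cong) (auto simp: excursion_def indicator_def)
  then show ?thesis using T.excursion_limit by simp
qed

lemma functional_integrable:
  fixes f :: "(real \<Rightarrow> real) \<Rightarrow> real"
  assumes f: "continuous_map (mtopology_of (C_space a b)) euclideanreal f"
    and fb: "\<And>x. x \<in> mspace (C_space a b) \<Longrightarrow> \<bar>f x\<bar> \<le> C"
  shows "integrable M (\<lambda>\<omega>. indicator (excursion u) \<omega> * f (\<lambda>t\<in>{a..b}. X t \<omega> - u * mean t))"
    and "integrable M (\<lambda>\<omega>. f (\<lambda>t\<in>{a..b}. Z t \<omega>) * weight \<omega>)"
proof -
  note fm = continuous_map_measurable[OF f]
  have [measurable]: "(\<lambda>\<omega>. f (\<lambda>t\<in>{a..b}. X t \<omega> - u * mean t)) \<in> borel_measurable M"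
    by (rule measurable_compose[OF path_maps(1) fm])
  have [measurable]: "(\<lambda>\<omega>. f (\<lambda>t\<in>{a..b}. Z t \<omega>)) \<in> borel_measurable M"
    by (rule measurable_compose[OF path_maps(2) fm])
  have C: "C \<ge> 0" using fb[OF restrict_in_C_space[of a b "\<lambda>_. 0"]] by simp
  show "integrable M (\<lambda>\<omega>. indicator (excursion u) \<omega> * f (\<lambda>t\<in>{a..b}. X t \<omega> - u * mean t))"
  proof (rule integrable_const_bound[where B = C])
    show "AE \<omega> in M. norm (indicator (excursion u) \<omega> * f (\<lambda>t\<in>{a..b}. X t \<omega> - u * mean t)) \<le> C"
      using fb[OF restrict_in_C_space[OF centred_continuous]] C by (intro AE_I2) (simp add: indicator_def)
  qed measurable
  show "integrable M (\<lambda>\<omega>. f (\<lambda>t\<in>{a..b}. Z t \<omega>) * weight \<omega>)"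
  proof (rule integrable_const_bound[where B = C])
    show "AE \<omega> in M. norm (f (\<lambda>t\<in>{a..b}. Z t \<omega>) * weight \<omega>) \<le> C"
    proof (rule AE_I2)
      fix \<omega> assume "\<omega> \<in> space M"
      then have "\<bar>f (\<lambda>t\<in>{a..b}. Z t \<omega>)\<bar> \<le> C" using fb[OF restrict_in_C_space[OF Z_continuous_Icc]] by blast
      then have "\<bar>f (\<lambda>t\<in>{a..b}. Z t \<omega>)\<bar> * \<bar>weight \<omega>\<bar> \<le> C * 1"
        using weight_bounds[of \<omega>] C by (intro mult_mono) auto
      then show "norm (f (\<lambda>t\<in>{a..b}. Z t \<omega>) * weight \<omega>) \<le> C" by (simp add: abs_mult)
    qed
  qed measurable
qed

text \<open>Adding the constant \<open>C\<close> makes the functional nonnegative; the contribution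
  of the constant, itself covered by \<open>nonneg_limit\<close>, is then subtracted.\<close>

lemma bounded_limit:
  assumes f: "continuous_map (mtopology_of (C_space a b)) euclideanreal f"
    and fb: "bounded (f ` mspace (C_space a b))"
  shows "((\<lambda>u. excursion_mean f u / rate u) \<longlongrightarrow>
    p0 / prod \<theta> S * expectation (\<lambda>\<omega>. f (\<lambda>t\<in>{a..b}. Z t \<omega>) * weight \<omega>)) at_top"
proof -
  obtain C where C: "\<And>x. x \<in> mspace (C_space a b) \<Longrightarrow> \<bar>f x\<bar> \<le> C"
    using fb by (auto simp: bounded_iff)
  have C0: "C \<ge> 0" using C[OF restrict_in_C_space[of a b "\<lambda>_. 0"]] by simp
  have fC: "continuous_map (mtopology_of (C_space a b)) euclideanreal (\<lambda>x. f x + C)"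
    by (intro continuous_map_add f) simp
  have c: "continuous_map (mtopology_of (C_space a b)) euclideanreal (\<lambda>x. C)" by simp
  have cC: "\<bar>C\<bar> \<le> C" using C0 by simp
  have fCb: "0 \<le> f x + C \<and> f x + C \<le> 2 * C" if "x \<in> mspace (C_space a b)" for x
    using C[OF that] by (simp add: abs_le_iff)
  have l1: "((\<lambda>u. excursion_mean (\<lambda>x. f x + C) u / rate u) \<longlongrightarrow>
    p0 / prod \<theta> S * expectation (\<lambda>\<omega>. (f (\<lambda>t\<in>{a..b}. Z t \<omega>) + C) * weight \<omega>)) at_top"
    by (rule nonneg_limit[OF fC fCb])
  have l2: "((\<lambda>u. excursion_mean (\<lambda>x. C) u / rate u) \<longlongrightarrow>
    p0 / prod \<theta> S * expectation (\<lambda>\<omega>. C * weight \<omega>)) at_top"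
    by (rule nonneg_limit[OF c, where B = C]) (use C0 in simp)
  have e1: "excursion_mean (\<lambda>x. f x + C) u = excursion_mean f u + excursion_mean (\<lambda>x. C) u" for u
    unfolding excursion_mean_def distrib_left
    by (rule Bochner_Integration.integral_add) (rule functional_integrable(1)[OF f C] functional_integrable(1)[OF c cC], assumption?)+
  have e2: "expectation (\<lambda>\<omega>. (f (\<lambda>t\<in>{a..b}. Z t \<omega>) + C) * weight \<omega>) =
      expectation (\<lambda>\<omega>. f (\<lambda>t\<in>{a..b}. Z t \<omega>) * weight \<omega>) + expectation (\<lambda>\<omega>. C * weight \<omega>)"
    unfolding distrib_right
    by (rule Bochner_Integration.integral_add) (rule functional_integrable(2)[OF f C] functional_integrable(2)[OF c cC], assumption?)+
  from tendsto_diff[OF l1 l2] show ?thesis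
    unfolding e1 e2 by (simp add: add_divide_distrib distrib_left)
qed

lemma excursion_prob: "prob (excursion u) = excursion_mean (\<lambda>_. 1) u"
  by (simp add: excursion_mean_def)

lemma cond_law_eq: "cond_law M X mean a b u =
  distr (uniform_measure M (excursion u)) (metric_borel (C_space a b)) (\<lambda>\<omega>. \<lambda>t\<in>{a..b}. X t \<omega> - u * mean t)"
  by (simp add: cond_law_def excursion_def)

lemma cond_law_integral:
  assumes f: "continuous_map (mtopology_of (C_space a b)) euclideanreal f" and pos: "prob (excursion u) > 0"
  shows "(\<integral>x. f x \<partial>cond_law M X mean a b u) = excursion_mean f u / prob (excursion u)"
proof -
  note fm = continuous_map_measurable[OF f]
  have m[measurable]: "(\<lambda>\<omega>. f (\<lambda>t\<in>{a..b}. X t \<omega> - u * mean t)) \<in> borel_measurable M"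
    by (rule measurable_compose[OF path_maps(1) fm])
  have "uniform_measure M (excursion u) = density M (\<lambda>\<omega>. ennreal (indicator (excursion u) \<omega> / prob (excursion u)))"
    unfolding uniform_measure_def
    using pos by (intro density_cong) (auto simp: emeasure_eq_measure indicator_def divide_ennreal ennreal_1[symmetric] simp del: ennreal_1)
  moreover have "(\<integral>x. f x \<partial>cond_law M X mean a b u) = (\<integral>\<omega>. f (\<lambda>t\<in>{a..b}. X t \<omega> - u * mean t) \<partial>uniform_measure M (excursion u))"
    unfolding cond_law_eq by (rule integral_distr) (use path_maps(1) fm in auto)
  ultimately have "(\<integral>x. f x \<partial>cond_law M X mean a b u) =
      (\<integral>\<omega>. (indicator (excursion u) \<omega> / prob (excursion u)) *\<^sub>R f (\<lambda>t\<in>{a..b}. X t \<omega> - u * mean t) \<partial>M)"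
    by (simp add: integral_density del: real_scaleR_def)
  also have "\<dots> = (\<integral>\<omega>. (indicator (excursion u) \<omega> * f (\<lambda>t\<in>{a..b}. X t \<omega> - u * mean t)) / prob (excursion u) \<partial>M)"
    by simp
  finally show ?thesis unfolding excursion_mean_def by (simp only: integral_divide_zero)
qed

lemma tilted_law_integral:
  assumes f: "continuous_map (mtopology_of (C_space a b)) euclideanreal f"
  shows "(\<integral>x. f x \<partial>tilted_law M Z weight a b) = expectation (\<lambda>\<omega>. f (\<lambda>t\<in>{a..b}. Z t \<omega>) * weight \<omega>) / expectation weight"
proof -
  note fm = continuous_map_measurable[OF f]
  have m[measurable]: "(\<lambda>\<omega>. f (\<lambda>t\<in>{a..b}. Z t \<omega>)) \<in> borel_measurable M"
    by (rule measurable_compose[OF path_maps(2) fm])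
  have nn: "weight \<omega> / expectation weight \<ge> 0" for \<omega>
    using weight_bounds expectation_weight_pos by simp
  have "(\<integral>x. f x \<partial>tilted_law M Z weight a b) =
      (\<integral>\<omega>. f (\<lambda>t\<in>{a..b}. Z t \<omega>) \<partial>density M (\<lambda>\<omega>. ennreal (weight \<omega> / expectation weight)))"
    unfolding tilted_law_def by (rule integral_distr) (use path_maps(2) fm in auto)
  also have "\<dots> = (\<integral>\<omega>. (weight \<omega> / expectation weight) *\<^sub>R f (\<lambda>t\<in>{a..b}. Z t \<omega>) \<partial>M)"
    by (rule integral_density) (use nn in auto)
  also have "\<dots> = (\<integral>\<omega>. (f (\<lambda>t\<in>{a..b}. Z t \<omega>) * weight \<omega>) / expectation weight \<partial>M)"
    by (simp add: mult.commute)
  finally show ?thesis by (simp only: integral_divide_zero)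
qed

text \<open>Numerator and probability of the event are both of order \<open>rate u\<close> with the
  same constant \<open>\<kappa>\<close>, which cancels. Positivity of the expected weight makes the
  event eventually nonnull, so that the conditional laws are probability measures.\<close>

lemma weak_limit: "weakly_converges (C_space a b) (\<lambda>u. cond_law M X mean a b u) (tilted_law M Z weight a b) at_top"
proof -
  define \<kappa> where "\<kappa> = p0 / prod \<theta> S"
  have \<kappa>: "\<kappa> > 0" unfolding \<kappa>_def using p0 \<theta> by (intro divide_pos_pos prod_pos) auto
  have l1: "((\<lambda>u. prob (excursion u) / rate u) \<longlongrightarrow> \<kappa> * expectation weight) at_top"
    using bounded_limit[of "\<lambda>_. 1"] by (simp add: excursion_prob \<kappa>_def image_constant_conv)
  have lp: "\<kappa> * expectation weight > 0" using \<kappa> expectation_weight_pos by simp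
  have "\<forall>\<^sub>F u in at_top. prob (excursion u) / rate u > 0" by (rule order_tendstoD(1)[OF l1 lp])
  then have ev: "\<forall>\<^sub>F u in at_top. prob (excursion u) > 0 \<and> rate u > 0"
    using eventually_gt_at_top[of 0]
  proof eventually_elim
    case (elim u)
    have "rate u > 0" using elim by (simp add: rate_pos)
    then show ?case using elim by (simp add: zero_less_divide_iff)
  qed
  have "prob_space (tilted_law M Z weight a b)"
    unfolding tilted_law_def
  proof (rule prob_space.prob_space_distr)
    show "prob_space (density M (\<lambda>\<omega>. ennreal (weight \<omega> / expectation weight)))"
    proof (rule prob_spaceI)
      have "(\<integral>\<^sup>+\<omega>. ennreal (weight \<omega> / expectation weight) \<partial>M) = ennreal (expectation (\<lambda>\<omega>. weight \<omega> / expectation weight))"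
        using integrable_weight weight_bounds expectation_weight_pos by (intro nn_integral_eq_integral) auto
      also have "\<dots> = 1" using expectation_weight_pos by simp
      finally show "emeasure (density M (\<lambda>\<omega>. ennreal (weight \<omega> / expectation weight)))
        (space (density M (\<lambda>\<omega>. ennreal (weight \<omega> / expectation weight)))) = 1"
        by (simp add: emeasure_density nn_integral_set_ennreal[symmetric] cong: nn_integral_cong)
    qed
  qed (use path_maps(2) in simp)
  moreover have "\<forall>\<^sub>F u in at_top. prob_space (cond_law M X mean a b u) \<and> sets (cond_law M X mean a b u) = sets (metric_borel (C_space a b))"
    using ev
  proof eventually_elim
    case (elim u)
    have "prob_space (uniform_measure M (excursion u))"
      by (rule prob_space_uniform_measure) (use elim in \<open>auto simp: emeasure_eq_measure\<close>)
    then have "prob_space (cond_law M X mean a b u)"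
      unfolding cond_law_eq by (rule prob_space.prob_space_distr) (use path_maps(1) in simp)
    then show ?case by (simp add: cond_law_eq)
  qed
  moreover have "((\<lambda>u. \<integral>x. f x \<partial>cond_law M X mean a b u) \<longlongrightarrow> (\<integral>x. f x \<partial>tilted_law M Z weight a b)) at_top"
    if f: "continuous_map (mtopology_of (C_space a b)) euclideanreal f" "bounded (f ` mspace (C_space a b))" for f
  proof -
    have l2: "((\<lambda>u. excursion_mean f u / rate u) \<longlongrightarrow> \<kappa> * expectation (\<lambda>\<omega>. f (\<lambda>t\<in>{a..b}. Z t \<omega>) * weight \<omega>)) at_top"
      unfolding \<kappa>_def by (rule bounded_limit[OF f])
    have "((\<lambda>u. (excursion_mean f u / rate u) / (prob (excursion u) / rate u)) \<longlongrightarrow>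
       (\<kappa> * expectation (\<lambda>\<omega>. f (\<lambda>t\<in>{a..b}. Z t \<omega>) * weight \<omega>)) / (\<kappa> * expectation weight)) at_top"
      by (rule tendsto_divide[OF l2 l1]) (use \<kappa> expectation_weight_pos in simp)
    also have "(\<kappa> * expectation (\<lambda>\<omega>. f (\<lambda>t\<in>{a..b}. Z t \<omega>) * weight \<omega>)) / (\<kappa> * expectation weight) = (\<integral>x. f x \<partial>tilted_law M Z weight a b)"
      unfolding tilted_law_integral[OF f(1)] using \<kappa> by simp
    finally show ?thesis
    proof (rule Lim_transform_eventually)
      show "\<forall>\<^sub>F u in at_top. (excursion_mean f u / rate u) / (prob (excursion u) / rate u) = (\<integral>x. f x \<partial>cond_law M X mean a b u)"
        using ev
      proof eventually_elim
        case (elim u)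
        then show ?case using cond_law_integral[OF f(1), of u] by simp
      qed
    qed
  qed
  ultimately show ?thesis unfolding weakly_converges_def by (simp add: tilted_law_def)
qed

end

theorem theorem4p2:
  fixes M :: "'a measure" and X :: "real \<Rightarrow> 'a \<Rightarrow> real"
    and a b :: real and \<nu> :: "real measure" and S :: "real set" and \<mu> :: "real \<Rightarrow> real"
  assumes "prob_space M" and "a < b"
    and "centered_gaussian_process M X"
    and "\<forall>\<omega>\<in>space M. continuous_on UNIV (\<lambda>t. X t \<omega>)"
    and "assumption_a M X a b \<or> assumption_b M X"
    and "is_arg_min (energy (covfun M X)) (\<lambda>\<nu>'. \<nu>' \<in> borel_prob_measures {a..b}) \<nu>"
    and S: "S = measure_support \<nu>"
    and \<mu>: "\<mu> = cond_mean M X S"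
    and "\<forall>t\<in>S \<inter> {a<..<b}. (deriv ^^ 2) \<mu> t > 0"
  shows "weakly_converges (C_space a b)
           (\<lambda>u. cond_law M X \<mu> a b u)
           (tilted_law M (resid M X S) (W M X S a b) a b)
           at_top"
proof -
  interpret smooth_gaussian M X a b
    by (rule smooth_gaussianI) (use assms in auto)
  have \<nu>: "\<nu> \<in> borel_prob_measures {a..b}" using assms(6) by (simp add: is_arg_min_def)
  have Sab: "S \<subseteq> {a..b}" unfolding S by (rule borel_prob_measures_support(1)[OF \<nu>])
  \<comment> \<open>The sum that defines \<open>cond_mean\<close> is 0 for an infinite index set.
    Then \<open>\<mu>\<close> and its second derivative would be identically 0, against the
    convexity assumption at an interior point of \<open>S\<close>.\<close>
  have fin: "finite S"
  proof (rule ccontr)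
    assume inf: "infinite S"
    then have "infinite (S - {a, b})" by simp
    then obtain t where "t \<in> S - {a, b}" by (metis ex_in_conv finite.emptyI)
    then have t: "t \<in> S \<inter> {a<..<b}" using Sab by fastforce
    have "\<mu> = (\<lambda>_. 0)" unfolding \<mu> cond_mean_def[abs_def] using inf by simp
    then have "(deriv ^^ 2) \<mu> t = 0" by (simp add: numeral_2_eq_2)
    then show False using bspec[OF assms(9) t] by linarith
  qed
  define q where "q s = measure \<nu> {s}" for s
  define m where "m = (\<Sum>s\<in>S. \<Sum>t\<in>S. q s * q t * covfun M X s t)"
  have meas: "covfun M X s \<in> borel_measurable borel" for s
    by (rule borel_measurable_continuous_onI[OF entire_real_continuous[OF entire]])
  note opt = energy_minimizer_conditions[OF assms(6) _ covfun_sym meas, folded S, OF fin, folded q_def, folded m_def]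
  have "S \<noteq> {}" using opt(2) by auto
  then obtain s0 where s0: "s0 \<in> S" by blast
  \<comment> \<open>The minimal energy is the variance of a combination of the \<open>X s\<close>
    with positive coefficients, so it cannot vanish by nondegeneracy.\<close>
  have m: "m > 0"
  proof (rule ccontr)
    assume "\<not> m > 0"
    moreover have e: "expectation (\<lambda>\<omega>. (\<Sum>s\<in>S. q s * X s \<omega>)\<^sup>2) = m"
      unfolding m_def by (rule lincomb_second_moment[OF G fin])
    moreover have "expectation (\<lambda>\<omega>. (\<Sum>s\<in>S. q s * X s \<omega>)\<^sup>2) \<ge> 0" by simp
    ultimately have z: "expectation (\<lambda>\<omega>. (\<Sum>s\<in>S. q s * X s \<omega>)\<^sup>2) = 0" by linarith
    have "\<forall>s\<in>S. q s = 0" by (rule mp[OF spec[OF nd[OF fin, unfolded nondegenerate_on_def], of q] z])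
    then show False using opt(3)[OF s0] s0 by simp
  qed
  \<comment> \<open>The potential of the minimizer equals \<open>m\<close> on \<open>S\<close>.
    Division by \<open>m\<close> makes it 1 there, so that the scaled masses solve the normal
    equations defining \<open>theta\<close>.\<close>
  define \<theta> where "\<theta> s = q s / m" for s
  define mean where "mean = (\<lambda>t. \<Sum>s\<in>S. \<theta> s * covfun M X s t)"
  have mean_q: "mean t = (\<Sum>s\<in>S. q s * covfun M X s t) / m" for t
    by (simp add: mean_def \<theta>_def sum_divide_distrib)
  obtain \<alpha> p p0 where \<alpha>:
    "\<forall>s\<in>S. \<forall>s'\<in>S. \<alpha> s s' = of_bool (s = s')"
    "\<forall>t. \<forall>s\<in>S. expectation (\<lambda>x. resd X S \<alpha> t x * X s x) = 0"
    "p \<in> borel_measurable (Pi\<^sub>M S (\<lambda>_. lborel))" "\<forall>w. 0 \<le> p w \<and> p w \<le> p0" "p0 > 0"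
    "\<forall>w. ((\<lambda>e. p (\<lambda>s\<in>S. e * w s)) \<longlongrightarrow> p0) (at_right 0)"
    "disintegrates X S \<alpha> p"
    using gaussian_disintegration[OF G fin nd[OF fin]] by blast
  have \<alpha>sum: "\<mu> t = (\<Sum>r\<in>S. \<alpha> t r)" for t
    unfolding \<mu> cond_mean_def using \<alpha> by (intro sum.cong refl cond_coeff_eq[OF G fin nd[OF fin] _ \<alpha>(7,3)]) auto
  have mean_S: "mean t = 1" if "t \<in> S" for t
    unfolding mean_q opt(5)[OF that] using m by simp
  have \<mu>mean: "\<mu> = mean"
    unfolding fun_eq_iff \<alpha>sum mean_def
    by (intro allI sum_coeff[OF fin]) (use \<alpha>(2) mean_S in \<open>auto simp: mean_def\<close>)
  interpret conditioned_gaussian M X a b S \<theta> mean \<alpha> p p0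
  proof
    show "mean = (\<lambda>t. \<Sum>s\<in>S. \<theta> s * covfun M X s t)" by (rule mean_def)
    show "mean t \<ge> 1" if "t \<in> {a..b}" for t
      unfolding mean_q using opt(4)[OF that] m by simp
    show "\<theta> s > 0" if "s \<in> S" for s using opt(3)[OF that] m by (simp add: \<theta>_def)
    show "(deriv ^^ 2) mean s > 0" if "s \<in> S" "s \<in> {a<..<b}" for s
      using assms(9) that unfolding \<mu>mean by blast
  qed (use fin \<open>S \<noteq> {}\<close> Sab mean_S \<alpha> in auto)
  have "cond_law M X \<mu> a b u = cond_law M X mean a b u" for u by (simp only: \<mu>mean)
  then show ?thesis unfolding resid_eq W_eq_weight \<mu>mean using weak_limit by simp
qed

end
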